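(* Let $\mathcal R$ be a (monster) real closed valued field. Let $C,L,M$ be ordered valued subfields of $\mathcal R$ with $C$ maximal and $C\subseteq L\cap M$. Assume $\Gamma_L\cap\Gamma_M=\Gamma_C$ and that $k_L$ is linearly disjoint from $k_M$ over $k_C$. Suppose $\sigma$ and $\tau$ are automorphisms of $\mathcal R$ fixing $C\cup\Gamma_L\cup k_L$ pointwise with $\sigma(L)=L'$ and $\tau(M)=M'$. Then there is an automorphism of $\mathcal R$ which maps $N=C(L,M)$ to $N'=C(L',M')$ and restricts to $\sigma$ on $L$ and to $\tau$ on $M$. Furthermore, $\Gamma_N$ is the group generated by $\Gamma_L$ and $\Gamma_M$, and $k_N$ is the field generated by $k_L$ and $k_M$.
   Context: A real closed valued field is a real closed field with a nontrivial proper convex valuation ring $\mathcal V$; automorphisms are of the structure (ordering and valuation), acting also on the imaginary sorts $k$ (residue field) and $\Gamma$ (value group). For a subfield $K$: $\Gamma_K=v(K^\times)$, $k_K$ its residue field. A valued field is maximal if it has no proper immediate extension (equivalently, it is spherically complete). $C(L,M)$ is the field generated by $L$ and $M$ over $C$. *)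

theory Defs
  imports
    "HOL-Algebra.Algebra"
    "HOL-Algebra.Algebraic_Closure_Type"
    "HOL-Computational_Algebra.Polynomial"
begin

unbundle cardinal_syntax

section \<open>Valued fields\<close>

definition valuation_ring :: "('a, 'm) ring_scheme \<Rightarrow> 'a set \<Rightarrow> bool" where
  "valuation_ring F W \<longleftrightarrow> field F \<and> subring W F \<and>
     (\<forall>x\<in>carrier F - {\<zero>\<^bsub>F\<^esub>}. x \<in> W \<or> inv\<^bsub>F\<^esub> x \<in> W)"

definition val_units :: "('a, 'm) ring_scheme \<Rightarrow> 'a set \<Rightarrow> 'a set" where
  "val_units F W = {x \<in> W. x \<noteq> \<zero>\<^bsub>F\<^esub> \<and> inv\<^bsub>F\<^esub> x \<in> W}"

definition val_ideal :: "('a, 'm) ring_scheme \<Rightarrow> 'a set \<Rightarrow> 'a set" where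
  "val_ideal F W = W - val_units F W"

text \<open>The value group is the quotient of the multiplicative group of the field by the units of
  the valuation ring (written multiplicatively), and the valuation and residue maps are the
  quotient maps; so values and residues are subsets of the field.\<close>

definition value_group :: "('a, 'm) ring_scheme \<Rightarrow> 'a set \<Rightarrow> 'a set monoid" where
  "value_group F W = mult_of F Mod val_units F W"

definition residue_field :: "('a, 'm) ring_scheme \<Rightarrow> 'a set \<Rightarrow> 'a set ring" where
  "residue_field F W = (F\<lparr>carrier := W\<rparr>) Quot (val_ideal F W)"

definition val :: "('a, 'm) ring_scheme \<Rightarrow> 'a set \<Rightarrow> 'a \<Rightarrow> 'a set" where
  "val F W x = val_units F W #>\<^bsub>mult_of F\<^esub> x"

definition res :: "('a, 'm) ring_scheme \<Rightarrow> 'a set \<Rightarrow> 'a \<Rightarrow> 'a set" where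
  "res F W x = val_ideal F W +>\<^bsub>F\<lparr>carrier := W\<rparr>\<^esub> x"

text \<open>The value group and the residue field of a subfield \<open>K\<close>, as subsets of those of \<open>F\<close>.\<close>

definition value_group_on :: "('a, 'm) ring_scheme \<Rightarrow> 'a set \<Rightarrow> 'a set \<Rightarrow> 'a set set" where
  "value_group_on F W K = val F W ` (K - {\<zero>\<^bsub>F\<^esub>})"

definition residue_field_on :: "('a, 'm) ring_scheme \<Rightarrow> 'a set \<Rightarrow> 'a set \<Rightarrow> 'a set set" where
  "residue_field_on F W K = res F W ` (K \<inter> W)"

definition immediate_over :: "('a, 'm) ring_scheme \<Rightarrow> 'a set \<Rightarrow> 'a set \<Rightarrow> bool" where
  "immediate_over F W K \<longleftrightarrow>
     value_group_on F W K = carrier (value_group F W) \<and>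
     residue_field_on F W K = carrier (residue_field F W)"

text \<open>A valued field \<open>(F, V)\<close> is maximal if every immediate valued field extension
  \<open>e : (F, V) \<rightarrow> (S, W)\<close> is onto. Taking the elements of \<open>S\<close> from the type \<open>'a set\<close> loses no
  generality: an immediate extension of an infinite \<open>F\<close> has cardinality at most
  \<open>|k| ^ |\<Gamma>| \<le> |F| ^ |F| = 2 ^ |F|\<close> (Krull, Gravett), hence has an isomorphic copy there, while
  the valuation of a finite field is trivial, so that it has no proper immediate extension.\<close>

definition maximal_valued_field :: "'a ring \<Rightarrow> 'a set \<Rightarrow> bool" where
  "maximal_valued_field F V \<longleftrightarrow> valuation_ring F V \<and>
     (\<forall>(S :: 'a set ring) W e.
        valuation_ring S W \<and> e \<in> ring_hom F S \<and> e ` V = W \<inter> e ` carrier F \<and>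
        immediate_over S W (e ` carrier F) \<longrightarrow> e ` carrier F = carrier S)"

text \<open>Here \<open>A\<close>, \<open>B\<close>, \<open>D\<close> are subfields of the field \<open>F\<close>: \<open>A\<close> is linearly disjoint from \<open>B\<close>
  over \<open>D\<close>.\<close>

definition linearly_disjoint ::
    "('a, 'm) ring_scheme \<Rightarrow> 'a set \<Rightarrow> 'a set \<Rightarrow> 'a set \<Rightarrow> bool" where
  "linearly_disjoint F A B D \<longleftrightarrow>
     (\<forall>Us. set Us \<subseteq> A \<and> ring.independent F D Us \<longrightarrow> ring.independent F B Us)"


section \<open>Real closed valued fields\<close>

abbreviation RR :: "'a::linordered_field ring" where
  "RR \<equiv> ring_of_type_algebra"

definition real_closed :: "'a::linordered_field itself \<Rightarrow> bool" where
  "real_closed _ \<longleftrightarrow> (\<forall>x::'a. 0 \<le> x \<longrightarrow> (\<exists>y. x = y * y)) \<and>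
     (\<forall>p :: 'a poly. odd (degree p) \<longrightarrow> (\<exists>x. poly p x = 0))"

text \<open>As \<open>V\<close> is a valuation ring, \<open>V \<noteq> UNIV\<close> says both that it is a proper subring and that the
  valuation is nontrivial.\<close>

definition rc_valued_field :: "'a::linordered_field set \<Rightarrow> bool" where
  "rc_valued_field V \<longleftrightarrow> real_closed TYPE('a) \<and> valuation_ring RR V \<and> V \<noteq> UNIV \<and>
     (\<forall>x\<in>V. \<forall>y\<in>V. {x..y} \<subseteq> V)"

text \<open>An automorphism \<open>g\<close> acts on values and residues by taking images: \<open>g ` val RR V x\<close> is
  \<open>val RR V (g x)\<close>, and \<open>g ` res RR V x\<close> is \<open>res RR V (g x)\<close>.\<close>

definition ov_automorphism :: "'a::linordered_field set \<Rightarrow> ('a \<Rightarrow> 'a) \<Rightarrow> bool" where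
  "ov_automorphism V g \<longleftrightarrow> g \<in> ring_iso RR RR \<and> strict_mono g \<and> g ` V = V"


section \<open>Monster models\<close>

text \<open>First-order logic of ordered valued fields, with a unary predicate for the valuation
  ring and named variables.\<close>

datatype ov_term =
    TVar nat | TZero | TOne | TMinus ov_term
  | TAdd ov_term ov_term | TMult ov_term ov_term

datatype ov_formula =
    FEq ov_term ov_term | FLess ov_term ov_term | FVal ov_term
  | FNot ov_formula | FAnd ov_formula ov_formula | FEx nat ov_formula

primrec tm_val :: "(nat \<Rightarrow> 'a) \<Rightarrow> ov_term \<Rightarrow> 'a::linordered_field" where
  "tm_val s (TVar i) = s i"
| "tm_val s TZero = 0"
| "tm_val s TOne = 1"
| "tm_val s (TMinus t) = - tm_val s t"
| "tm_val s (TAdd t u) = tm_val s t + tm_val s u"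
| "tm_val s (TMult t u) = tm_val s t * tm_val s u"

primrec sat :: "'a::linordered_field set \<Rightarrow> (nat \<Rightarrow> 'a) \<Rightarrow> ov_formula \<Rightarrow> bool" where
  "sat V s (FEq t u) \<longleftrightarrow> tm_val s t = tm_val s u"
| "sat V s (FLess t u) \<longleftrightarrow> tm_val s t < tm_val s u"
| "sat V s (FVal t) \<longleftrightarrow> tm_val s t \<in> V"
| "sat V s (FNot p) \<longleftrightarrow> \<not> sat V s p"
| "sat V s (FAnd p q) \<longleftrightarrow> sat V s p \<and> sat V s q"
| "sat V s (FEx i p) \<longleftrightarrow> (\<exists>x. sat V (s(i := x)) p)"

definition partial_elementary :: "'a::linordered_field set \<Rightarrow> 'a set \<Rightarrow> ('a \<Rightarrow> 'a) \<Rightarrow> bool" where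
  "partial_elementary V A f \<longleftrightarrow>
     (\<forall>s p. range s \<subseteq> A \<longrightarrow> (sat V (f \<circ> s) p \<longleftrightarrow> sat V s p))"

text \<open>A formula with parameters in \<open>A\<close> and free variable \<open>0\<close> is a pair \<open>(p, s)\<close> of a formula
  and an assignment into \<open>A\<close>, whose value at \<open>0\<close> is overwritten. Types over the empty set are
  covered by \<open>A = {0}\<close>.\<close>

definition saturated :: "'a::linordered_field set \<Rightarrow> 'c rel \<Rightarrow> bool" where
  "saturated V \<kappa> \<longleftrightarrow>
     (\<forall>A :: 'a set. \<forall>P :: (ov_formula \<times> (nat \<Rightarrow> 'a)) set.
        |A| <o \<kappa> \<and> (\<forall>(p, s)\<in>P. range s \<subseteq> A) \<and>
        (\<forall>Q\<subseteq>P. finite Q \<longrightarrow> (\<exists>x. \<forall>(p, s)\<in>Q. sat V (s(0 := x)) p)) \<longrightarrow>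
        (\<exists>x. \<forall>(p, s)\<in>P. sat V (s(0 := x)) p))"

definition strongly_homogeneous :: "'a::linordered_field set \<Rightarrow> 'c rel \<Rightarrow> bool" where
  "strongly_homogeneous V \<kappa> \<longleftrightarrow>
     (\<forall>(A :: 'a set) f. |A| <o \<kappa> \<and> partial_elementary V A f \<longrightarrow>
        (\<exists>g. ov_automorphism V g \<and> (\<forall>a\<in>A. g a = f a)))"

text \<open>A monster model with respect to an uncountable cardinal \<open>\<kappa>\<close>; the small sets are those of
  cardinality less than \<open>\<kappa>\<close>.\<close>

definition monster_rcvf :: "'a::linordered_field set \<Rightarrow> 'c rel \<Rightarrow> bool" where
  "monster_rcvf V \<kappa> \<longleftrightarrow> rc_valued_field V \<and> Card_order \<kappa> \<and> natLeq <o \<kappa> \<and>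
     saturated V \<kappa> \<and> strongly_homogeneous V \<kappa>"

end

theory Submission
  imports Defs
begin

text \<open>After composing with the inverse of \<open>\<tau>\<close> it remains to see that the union of
  \<open>s = \<tau>\<^sup>-\<^sup>1 \<circ> \<sigma>\<close> on \<open>L\<close> and the identity on \<open>M\<close> is elementary. As \<open>C\<close> is maximal, elements have
  best approximations in it, so every finite-dimensional \<open>C\<close>-subspace of \<open>L\<close> has a basis \<open>b\<close> with
  \<open>v (\<Sum> c\<^sub>j b\<^sub>j) = min v (c\<^sub>j b\<^sub>j)\<close>. By the hypotheses on values and residues this persists for
  coefficients in \<open>M\<close>, so that the leading term of an element \<open>\<Sum> l\<^sub>i m\<^sub>i\<close> is \<open>l m \<Sum> u\<^sub>i w\<^sub>i\<close> with integral
  \<open>u\<^sub>i\<close> in \<open>L\<close>, \<open>w\<^sub>i\<close> in \<open>M\<close> and a unit sum. As \<open>s\<close> fixes the values and residues of \<open>L\<close>, the map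
  \<open>\<Sum> l\<^sub>i m\<^sub>i \<mapsto> \<Sum> s l\<^sub>i m\<^sub>i\<close> preserves signs and valuations; it extends to \<open>N\<close>, whose values and residues
  are visible in the leading terms. An embedding of small ordered valued fields is elementary by
  a back-and-forth argument: it extends to the relative algebraic closure, and to a further element
  by realizing its cut, which determines the order and the valuation. Strong homogeneity finishes
  the proof.\<close>

text \<open>Maximality of \<open>C\<close> speaks of valued fields without an ordering, and a limit
  that contradicts it may be a nonreal root of a polynomial over \<open>C\<close>. So the immediate
  extension is built in the algebraic closure, which is \<open>R + iR\<close> for the real closed
  field \<open>R\<close>; its valuation is read off from the squared norm, and it is then copied
  into the type over which maximality quantifies. In a space of several dimensions, the coordinates
  of ever better approximations need a limit before they can be rounded to \<open>C\<close>;
  saturation over the small field \<open>L\<close> supplies one. The cut of \<open>x\<close> decides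
  everything only over a domain that is real closed: there polynomials split into linear factors and
  sums of two squares, which cannot cancel, so the signs and values of all \<open>x - s\<close>
  suffice. No map on the compositum is known to be well defined in advance. Embeddings are therefore
  sets of pairs, and single-valuedness comes out of the preservation of signs. That
  \<open>\<sigma>\<close> and \<open>\<tau>\<close> both fix the values and residues of
  \<open>L\<close> is what makes \<open>s\<close> change elements of \<open>L\<close> only below
  their leading terms.\<close>

section \<open>Subfields of a field and polynomials over them\<close>

definition is_subfield :: "'b::field set \<Rightarrow> bool" where
  "is_subfield S \<longleftrightarrow> 0 \<in> S \<and> 1 \<in> S \<and> (\<forall>x\<in>S. \<forall>y\<in>S. x + y \<in> S \<and> x * y \<in> S) \<and>
     (\<forall>x\<in>S. - x \<in> S \<and> inverse x \<in> S)"

context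
  fixes S :: "'b::field set"
  assumes S: "is_subfield S"
begin

lemma is_subfield_0: "0 \<in> S" and is_subfield_1: "1 \<in> S"
  using S by (auto simp: is_subfield_def)

lemma is_subfield_add: "x \<in> S \<Longrightarrow> y \<in> S \<Longrightarrow> x + y \<in> S"
  and is_subfield_mult: "x \<in> S \<Longrightarrow> y \<in> S \<Longrightarrow> x * y \<in> S"
  and is_subfield_uminus: "x \<in> S \<Longrightarrow> - x \<in> S"
  and is_subfield_inverse: "x \<in> S \<Longrightarrow> inverse x \<in> S"
  using S by (auto simp: is_subfield_def)

lemma is_subfield_diff: "x \<in> S \<Longrightarrow> y \<in> S \<Longrightarrow> x - y \<in> S"
  using is_subfield_add[of x "- y"] is_subfield_uminus[of y] by simp

lemma is_subfield_divide: "x \<in> S \<Longrightarrow> y \<in> S \<Longrightarrow> x / y \<in> S"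
  by (simp add: divide_inverse is_subfield_mult is_subfield_inverse)

lemma is_subfield_of_nat: "of_nat n \<in> S"
  by (induction n) (auto intro: is_subfield_0 is_subfield_1 is_subfield_add)

lemma is_subfield_numeral: "numeral n \<in> S"
  using is_subfield_of_nat[of "numeral n"] by simp

lemma is_subfield_power: "x \<in> S \<Longrightarrow> x ^ n \<in> S"
  by (induction n) (auto intro: is_subfield_1 is_subfield_mult)

lemma is_subfield_sum: "(\<And>i. i \<in> I \<Longrightarrow> f i \<in> S) \<Longrightarrow> sum f I \<in> S"
  by (induction I rule: infinite_finite_induct) (auto intro: is_subfield_0 is_subfield_add)

lemmas is_subfield_intros =
  is_subfield_0 is_subfield_1 is_subfield_add is_subfield_mult is_subfield_uminus
  is_subfield_inverse is_subfield_diff is_subfield_divide is_subfield_of_nat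
  is_subfield_numeral is_subfield_power

end

definition polys_over :: "'b::zero set \<Rightarrow> 'b poly set" where
  "polys_over S = {p. \<forall>i. coeff p i \<in> S}"

lemma polys_over_coeff: "p \<in> polys_over S \<Longrightarrow> coeff p i \<in> S"
  by (simp add: polys_over_def)

context
  fixes S :: "'b::field set"
  assumes S: "is_subfield S"
begin

lemma polys_over_0: "0 \<in> polys_over S"
  by (simp add: polys_over_def is_subfield_0[OF S])

lemma polys_over_pCons: "a \<in> S \<Longrightarrow> p \<in> polys_over S \<Longrightarrow> pCons a p \<in> polys_over S"
  by (auto simp: polys_over_def coeff_pCons split: nat.split)

lemma polys_over_add: "p \<in> polys_over S \<Longrightarrow> q \<in> polys_over S \<Longrightarrow> p + q \<in> polys_over S"
  by (auto simp: polys_over_def intro: is_subfield_add[OF S])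

lemma polys_over_diff: "p \<in> polys_over S \<Longrightarrow> q \<in> polys_over S \<Longrightarrow> p - q \<in> polys_over S"
  by (auto simp: polys_over_def intro: is_subfield_diff[OF S])

lemma polys_over_smult: "c \<in> S \<Longrightarrow> p \<in> polys_over S \<Longrightarrow> smult c p \<in> polys_over S"
  by (auto simp: polys_over_def intro: is_subfield_mult[OF S])

lemma polys_over_mult: "p \<in> polys_over S \<Longrightarrow> q \<in> polys_over S \<Longrightarrow> p * q \<in> polys_over S"
  by (auto simp: polys_over_def coeff_mult intro!: is_subfield_sum[OF S] is_subfield_mult[OF S])

lemma polys_over_monom: "c \<in> S \<Longrightarrow> Polynomial.monom c n \<in> polys_over S"
  by (auto simp: polys_over_def is_subfield_0[OF S])

lemma polys_over_poly: "p \<in> polys_over S \<Longrightarrow> x \<in> S \<Longrightarrow> poly p x \<in> S"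
  by (auto simp: poly_altdef polys_over_def
      intro!: is_subfield_sum[OF S] is_subfield_mult[OF S] is_subfield_power[OF S])

lemma polys_over_pderiv: "p \<in> polys_over S \<Longrightarrow> pderiv p \<in> polys_over S"
  using is_subfield_of_nat[OF S] is_subfield_mult[OF S]
  by (auto simp: polys_over_def coeff_pderiv simp del: of_nat_Suc)

text \<open>Long division divides by nothing but the leading coefficient of \<open>d\<close>, so it
  stays inside \<open>S\<close>. Uniqueness of quotient and remainder then carries this over to
  \<open>div\<close> and \<open>mod\<close> of the big field.\<close>

lemma polys_over_division_ex:
  assumes d: "d \<in> polys_over S" "d \<noteq> 0" and "p \<in> polys_over S"
  shows "\<exists>q\<in>polys_over S. \<exists>r\<in>polys_over S. p = q * d + r \<and> (r = 0 \<or> degree r < degree d)"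
  using assms(3)
proof (induction "degree p" arbitrary: p rule: less_induct)
  case less
  show ?case
  proof (cases "p = 0 \<or> degree p < degree d")
    case True
    then show ?thesis using less.prems polys_over_0 by (intro bexI[of _ 0] bexI[of _ p]) auto
  next
    case False
    define m where "m = Polynomial.monom (coeff p (degree p) / coeff d (degree d)) (degree p - degree d)"
    have m: "m \<in> polys_over S"
      unfolding m_def using less.prems d
      by (intro polys_over_monom is_subfield_divide[OF S]) (auto simp: polys_over_def)
    have lc: "coeff p (degree p) \<noteq> 0" "coeff d (degree d) \<noteq> 0" using False d by auto
    have dm: "degree (m * d) = degree p"
      using False lc by (simp add: m_def degree_mult_eq degree_monom_eq d(2))
    have cm: "coeff (m * d) (degree p) = coeff p (degree p)"
    proof -
      have "coeff (m * d) (degree (m * d)) = coeff m (degree m) * coeff d (degree d)"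
        by (rule lead_coeff_mult)
      then show ?thesis using lc by (simp add: dm) (simp add: m_def degree_monom_eq)
    qed
    define p' where "p' = p - m * d"
    have p': "p' \<in> polys_over S"
      unfolding p'_def by (intro polys_over_diff polys_over_mult m d less.prems)
    have "p' = 0 \<or> degree p' < degree p"
    proof (rule disjCI)
      assume "\<not> degree p' < degree p"
      moreover have "degree p' \<le> degree p"
        unfolding p'_def using dm by (intro degree_diff_le) auto
      ultimately have "coeff p' (degree p') = 0" by (simp add: p'_def cm)
      then show "p' = 0" by simp
    qed
    then obtain q r where "q \<in> polys_over S" "r \<in> polys_over S" "p' = q * d + r"
      "r = 0 \<or> degree r < degree d"
    proof
      assume "p' = 0"
      then show ?thesis using that[of 0 0] polys_over_0 by auto
    next
      assume "degree p' < degree p"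
      from less.hyps[OF this p'] show ?thesis using that by blast
    qed
    moreover have "p = p' + m * d" by (simp add: p'_def)
    ultimately show ?thesis
      using m by (intro bexI[of _ "q + m"] bexI[of _ r]) (auto simp: algebra_simps intro: polys_over_add)
  qed
qed

lemma polys_over_div_mod:
  fixes p d :: "'b poly"
  assumes d: "d \<in> polys_over S" and "p \<in> polys_over S"
  shows "p div d \<in> polys_over S" "p mod d \<in> polys_over S"
proof -
  have "p div d \<in> polys_over S \<and> p mod d \<in> polys_over S"
  proof (cases "d = 0")
    case True then show ?thesis using assms polys_over_0 by simp
  next
    case False
    from polys_over_division_ex[OF d False assms(2)] obtain q r where
      qr: "q \<in> polys_over S" "r \<in> polys_over S" "p = q * d + r" "r = 0 \<or> degree r < degree d" by blast
    have "r mod d = r" "r div d = 0" using qr(4) by (auto simp: mod_poly_less div_poly_less)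
    then have "p div d = q" "p mod d = r"
      using False by (auto simp: qr(3) div_plus_div_distrib_dvd_left mod_mult_self3)
    then show ?thesis using qr by simp
  qed
  then show "p div d \<in> polys_over S" "p mod d \<in> polys_over S" by auto
qed

lemma polys_over_cofactor:
  fixes p d :: "'b poly"
  assumes "d \<in> polys_over S" "d * q \<in> polys_over S" "d \<noteq> 0"
  shows "q \<in> polys_over S"
  using polys_over_div_mod(1)[OF assms(1,2)] assms(3) by simp

end

subsection \<open>Power sums\<close>

text \<open>Logarithmic derivative: the factor of \<open>z i\<close> contributes
  \<open>- z i / (1 - z i X)\<close>, whose geometric series has the coefficients
  \<open>- z i ^ Suc k\<close>.\<close>

lemma fps_deriv_prod_linear:
  fixes z :: "'i \<Rightarrow> 'b::field_char_0"
  assumes "finite I"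
  shows "fps_deriv (\<Prod>i\<in>I. 1 - fps_const (z i) * fps_X) =
     - (\<Prod>i\<in>I. 1 - fps_const (z i) * fps_X) * Abs_fps (\<lambda>k. \<Sum>i\<in>I. z i ^ Suc k)"
  using assms
proof (induction I rule: finite_induct)
  case empty
  show ?case by (simp add: fps_eq_iff)
next
  case (insert a I)
  let ?F = "\<Prod>i\<in>I. 1 - fps_const (z i) * fps_X"
  let ?P = "Abs_fps (\<lambda>k. \<Sum>i\<in>I. z i ^ Suc k)"
  have geo: "(1 - fps_const (z a) * fps_X) * Abs_fps (\<lambda>k. z a ^ Suc k) = fps_const (z a)"
  proof (rule fps_ext)
    fix n
    let ?A = "Abs_fps (\<lambda>k. z a ^ Suc k)"
    have "(1 - fps_const (z a) * fps_X) * ?A = ?A - fps_const (z a) * (fps_X * ?A)"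
      by (simp add: left_diff_distrib mult.assoc)
    also have "\<dots> $ n = fps_const (z a) $ n"
      by (cases n) (simp_all add: fps_mult_left_const_nth fps_X_mult_nth)
    finally show "((1 - fps_const (z a) * fps_X) * ?A) $ n = fps_const (z a) $ n" .
  qed
  have split: "Abs_fps (\<lambda>k. \<Sum>i\<in>insert a I. z i ^ Suc k) = Abs_fps (\<lambda>k. z a ^ Suc k) + ?P"
    using insert by (simp add: fps_eq_iff)
  define u where "u = 1 - fps_const (z a) * fps_X"
  have du: "fps_deriv u = - fps_const (z a)" by (simp add: u_def)
  have "fps_deriv (\<Prod>i\<in>insert a I. 1 - fps_const (z i) * fps_X) = fps_deriv (u * ?F)"
    using insert by (simp add: u_def)
  also have "\<dots> = u * fps_deriv ?F - fps_const (z a) * ?F"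
    by (simp add: du fps_const_neg[symmetric] del: fps_const_neg)
  also have "\<dots> = u * fps_deriv ?F - u * Abs_fps (\<lambda>k. z a ^ Suc k) * ?F"
    using geo by (simp add: u_def)
  also have "\<dots> = - (u * ?F) * Abs_fps (\<lambda>k. \<Sum>i\<in>insert a I. z i ^ Suc k)"
    unfolding split insert.IH by (simp add: distrib_left mult_ac)
  also have "u * ?F = (\<Prod>i\<in>insert a I. 1 - fps_const (z i) * fps_X)"
    using insert by (simp add: u_def)
  finally show ?case .
qed

text \<open>The coefficients of the reversed polynomial and the power sums of the roots determine each
  other by Newton's identities, which are the coefficients of the logarithmic derivative above.\<close>

lemma prod_linear_over_iff:
  fixes z :: "'i \<Rightarrow> 'b::field_char_0"
  assumes S: "is_subfield S" and "finite I"
  shows "(\<Prod>i\<in>I. [:- z i, 1:]) \<in> polys_over S \<longleftrightarrow> (\<forall>k. (\<Sum>i\<in>I. z i ^ Suc k) \<in> S)"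
proof -
  define F where "F = (\<Prod>i\<in>I. 1 - fps_const (z i) * fps_X)"
  define P where "P = Abs_fps (\<lambda>k. \<Sum>i\<in>I. z i ^ Suc k)"
  define p where "p = (\<Prod>i\<in>I. [:- z i, 1:])"
  \<comment> \<open>Reversal turns the factor \<open>x - z\<close> into \<open>1 - z x\<close>,
    which is invertible as a power series.\<close>
  have reflect: "reflect_poly p = (\<Prod>i\<in>I. [:1, - z i:])"
    unfolding p_def using \<open>finite I\<close>
  proof (induction I rule: finite_induct)
    case (insert a I)
    have 1: "reflect_poly [:- z a, 1:] = [:1, - z a:]"
      by (cases "z a = 0") (auto simp: reflect_poly_def)
    then show ?case using insert by (simp add: reflect_poly_mult del: mult_pCons_left)
  qed simp
  have F: "F = fps_of_poly (reflect_poly p)"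
    unfolding reflect F_def fps_of_poly_prod
    by (intro prod.cong refl) (simp add: fps_of_poly_linear')
  have deg: "degree p = card I" unfolding p_def
    by (subst degree_prod_eq_sum_degree) auto
  have pS: "p \<in> polys_over S \<longleftrightarrow> (\<forall>n. F $ n \<in> S)"
  proof
    assume "p \<in> polys_over S"
    then show "\<forall>n. F $ n \<in> S"
      by (auto simp: F coeff_reflect_poly polys_over_def is_subfield_0[OF S])
  next
    assume *: "\<forall>n. F $ n \<in> S"
    show "p \<in> polys_over S" unfolding polys_over_def
    proof safe
      fix n
      show "coeff p n \<in> S"
      proof (cases "n \<le> degree p")
        case True
        then have "coeff p n = F $ (degree p - n)" by (simp add: F coeff_reflect_poly)
        then show ?thesis using * by simp
      qed (simp add: coeff_eq_0 is_subfield_0[OF S])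
    qed
  qed
  have F0: "F $ 0 = 1" by (simp add: F p_def lead_coeff_prod)
  have rec: "of_nat (Suc n) * F $ Suc n = - (\<Sum>k\<le>n. F $ (n - k) * P $ k)" for n
  proof -
    have "of_nat (Suc n) * F $ Suc n = fps_deriv F $ n" by (simp add: mult.commute)
    also have "\<dots> = - ((P * F) $ n)"
      using fps_deriv_prod_linear[OF \<open>finite I\<close>, of z] by (simp add: F_def P_def mult.commute)
    also have "(P * F) $ n = (\<Sum>k\<le>n. F $ (n - k) * P $ k)"
      unfolding fps_mult_nth atMost_atLeast0 by (simp add: mult.commute)
    finally show ?thesis .
  qed
  have "(\<forall>n. F $ n \<in> S) \<longleftrightarrow> (\<forall>k. P $ k \<in> S)"
  proof
    assume FS: "\<forall>n. F $ n \<in> S"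
    have "P $ n \<in> S" for n
    proof (induction n rule: less_induct)
      case (less n)
      have "(\<Sum>k\<le>n. F $ (n - k) * P $ k) = (\<Sum>k<n. F $ (n - k) * P $ k) + P $ n"
        by (simp add: lessThan_Suc_atMost[symmetric] F0)
      then have "P $ n = - (of_nat (Suc n) * F $ Suc n) - (\<Sum>k<n. F $ (n - k) * P $ k)"
        unfolding rec[of n] by simp
      also have "\<dots> \<in> S"
        using FS less by (intro is_subfield_diff[OF S] is_subfield_uminus[OF S] is_subfield_mult[OF S]
            is_subfield_of_nat[OF S] is_subfield_sum[OF S]) auto
      finally show ?case .
    qed
    then show "\<forall>k. P $ k \<in> S" ..
  next
    assume PS: "\<forall>k. P $ k \<in> S"
    have "F $ n \<in> S" for n
    proof (induction n rule: less_induct)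
      case (less n)
      show ?case
      proof (cases n)
        case 0 then show ?thesis by (simp add: F0 is_subfield_1[OF S])
      next
        case (Suc m)
        \<comment> \<open>Recovering the coefficients divides by \<open>Suc m\<close>, which
          characteristic zero allows; the power sums are recovered without division because
          \<open>F $ 0 = 1\<close>.\<close>
        have "F $ n = (- (\<Sum>k\<le>m. F $ (m - k) * P $ k)) / of_nat (Suc m)"
          using rec[of m] by (simp add: Suc field_simps del: of_nat_Suc)
        also have "\<dots> \<in> S"
          using PS less by (intro is_subfield_divide[OF S] is_subfield_uminus[OF S] is_subfield_mult[OF S]
            is_subfield_of_nat[OF S] is_subfield_sum[OF S]) (auto simp: Suc)
        finally show ?thesis .
      qed
    qed
    then show "\<forall>n. F $ n \<in> S" ..
  qed
  then show ?thesis using pS by (simp add: p_def P_def)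
qed

subsection \<open>Real closed subfields and their algebraic closures\<close>

text \<open>Relative to a subset, so that it applies both to the whole field
  (\<open>S = UNIV\<close>) and to the relatively algebraically closed domains of
  embeddings.\<close>

definition real_closed_in :: "'a::linordered_field set \<Rightarrow> bool" where
  "real_closed_in S \<longleftrightarrow> is_subfield S \<and> (\<forall>x\<in>S. 0 \<le> x \<longrightarrow> (\<exists>y\<in>S. x = y * y)) \<and>
     (\<forall>p\<in>polys_over S. odd (degree p) \<longrightarrow> (\<exists>x\<in>S. poly p x = 0))"

definition ac_i :: "'a::field alg_closure" where
  "ac_i = (SOME z. z * z = - 1)"

lemma ac_i_square: "ac_i * ac_i = (- 1 :: 'a::field alg_closure)"
proof -
  have "\<exists>z. z ^ 2 = (- 1 :: 'a alg_closure)" by (rule nth_root_exists) simp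
  then have "\<exists>z. z * z = (- 1 :: 'a alg_closure)" by (simp add: power2_eq_square)
  then show ?thesis unfolding ac_i_def by (rule someI_ex)
qed

definition cplx :: "'a::field \<Rightarrow> 'a \<Rightarrow> 'a alg_closure" where
  "cplx x y = to_ac x + ac_i * to_ac y"

lemma cplx_add: "cplx x y + cplx u v = cplx (x + u) (y + v)"
  and cplx_uminus: "- cplx x y = cplx (- x) (- y)"
  and cplx_of_real: "to_ac x = cplx x 0"
  by (auto simp: cplx_def algebra_simps)

lemma cplx_diff: "cplx x y - cplx u v = cplx (x - u) (y - v)"
  by (auto simp: cplx_def algebra_simps)

lemma cplx_mult: "cplx x y * cplx u v = cplx (x * u - y * v) (x * v + y * u)"
proof -
  have "cplx x y * cplx u v = to_ac x * to_ac u + (ac_i * ac_i) * (to_ac y * to_ac v)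
      + ac_i * (to_ac x * to_ac v + to_ac y * to_ac u)"
    unfolding cplx_def by (simp add: algebra_simps)
  then show ?thesis by (simp only: ac_i_square) (simp add: cplx_def)
qed

lemma cplx_eq_0_iff: "cplx x y = 0 \<longleftrightarrow> x = 0 \<and> y = (0 :: 'a::linordered_field)"
proof
  assume "cplx x y = 0"
  then have "cplx x y * cplx x (- y) = 0" by simp
  then have "to_ac (x * x + y * y) = 0" by (simp add: cplx_mult cplx_of_real mult.commute)
  then have "x * x + y * y = 0" by (simp only: to_ac_eq_0_iff)
  then show "x = 0 \<and> y = 0" by (simp add: sum_squares_eq_zero_iff)
qed (simp add: cplx_def)

lemma cplx_eq_iff: "cplx x y = cplx u v \<longleftrightarrow> x = u \<and> y = (v :: 'a::linordered_field)"
  using cplx_eq_0_iff[of "x - u" "y - v"] by (simp add: cplx_diff[symmetric])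

definition cplx_set :: "'a::field set \<Rightarrow> 'a alg_closure set" where
  "cplx_set S = {cplx x y | x y. x \<in> S \<and> y \<in> S}"

lemma map_poly_to_ac_mult: "map_poly to_ac (p * q) = map_poly to_ac p * map_poly to_ac q"
  by (rule poly_eqI) (simp add: coeff_map_poly coeff_mult to_ac_sum)

lemma poly_map_poly_to_ac: "poly (map_poly to_ac p) (to_ac x) = to_ac (poly p x)"
proof (induction p)
  case (pCons a p)
  have "map_poly to_ac (pCons a p) = pCons (to_ac a) (map_poly to_ac p)"
    by (rule poly_eqI) (simp add: coeff_map_poly coeff_pCons split: nat.split)
  then show ?case using pCons by simp
qed simp

lemma degree_map_poly_to_ac: "degree (map_poly to_ac p) = degree p"
  by (rule degree_map_poly) simp

lemma polys_over_range_to_ac: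
  assumes "p \<in> polys_over (to_ac ` S)"
  shows "\<exists>q\<in>polys_over S. p = map_poly to_ac q"
proof
  have "coeff p i \<in> to_ac ` S" for i using assms by (simp add: polys_over_def)
  then have "to_ac (of_ac (coeff p i)) = coeff p i" "of_ac (coeff p i) \<in> S" for i
    by (metis imageE of_ac_to_ac)+
  then show "p = map_poly to_ac (map_poly of_ac p)" "map_poly of_ac p \<in> polys_over S"
    by (auto simp: polys_over_def coeff_map_poly intro!: poly_eqI)
qed

lemma is_subfield_to_ac: "is_subfield S \<Longrightarrow> is_subfield (to_ac ` S)"
  unfolding is_subfield_def
  by (auto simp flip: to_ac_add to_ac_mult to_ac_minus to_ac_inverse)

lemma is_subfield_cplx_set:
  fixes S :: "'a::linordered_field set"
  assumes S: "is_subfield S"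
  shows "is_subfield (cplx_set S)"
  unfolding is_subfield_def
proof (intro conjI ballI)
  have "cplx 0 0 = (0 :: 'a alg_closure)" "cplx 1 0 = (1 :: 'a alg_closure)" by (auto simp: cplx_def)
  then show "0 \<in> cplx_set S" "1 \<in> cplx_set S"
    using is_subfield_0[OF S] is_subfield_1[OF S] unfolding cplx_set_def mem_Collect_eq by metis+
next
  fix z w assume "z \<in> cplx_set S" "w \<in> cplx_set S"
  then obtain x y u v where "z = cplx x y" "w = cplx u v" and *: "x \<in> S" "y \<in> S" "u \<in> S" "v \<in> S"
    by (auto simp: cplx_set_def)
  then have "z + w = cplx (x + u) (y + v)" "z * w = cplx (x * u - y * v) (x * v + y * u)"
    by (simp_all add: cplx_add cplx_mult)
  moreover have "x + u \<in> S" "y + v \<in> S" "x * u - y * v \<in> S" "x * v + y * u \<in> S"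
    using * by (auto intro: is_subfield_intros[OF S])
  ultimately show "z + w \<in> cplx_set S" "z * w \<in> cplx_set S"
    unfolding cplx_set_def by blast+
next
  fix z assume "z \<in> cplx_set S"
  then obtain x y where z: "z = cplx x y" "x \<in> S" "y \<in> S" by (auto simp: cplx_set_def)
  show "- z \<in> cplx_set S" unfolding cplx_set_def z(1)
    using is_subfield_uminus[OF S z(2)] is_subfield_uminus[OF S z(3)] cplx_uminus by blast
  show "inverse z \<in> cplx_set S"
  proof (cases "z = 0")
    case True
    then show ?thesis using \<open>z \<in> cplx_set S\<close> by simp
  next
    case False
    define n where "n = x * x + y * y"
    have "n \<noteq> 0" using False by (auto simp: n_def z cplx_eq_0_iff sum_squares_eq_zero_iff)
    have "x * (x / n) - y * (- y / n) = (x * x + y * y) / n" by (simp add: add_divide_distrib)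
    then have "z * cplx (x / n) (- y / n) = cplx (n / n) 0"
      unfolding z(1) cplx_mult n_def[symmetric] by (simp add: cplx_eq_iff)
    also have "\<dots> = 1" using \<open>n \<noteq> 0\<close> by (simp add: cplx_def)
    finally have "inverse z = cplx (x / n) (- y / n)" by (rule inverse_unique)
    moreover have "n \<in> S" unfolding n_def using z(2,3) by (intro is_subfield_intros[OF S])
    ultimately show ?thesis
      unfolding cplx_set_def
      using is_subfield_divide[OF S z(2)] is_subfield_divide[OF S is_subfield_uminus[OF S z(3)]] by blast
  qed
qed

context
  fixes S :: "'a::linordered_field set"
  assumes rc: "real_closed_in S"
begin

lemma real_closed_in_subfield: "is_subfield S"
  and real_closed_in_sqrt: "x \<in> S \<Longrightarrow> 0 \<le> x \<Longrightarrow> \<exists>y\<in>S. 0 \<le> y \<and> x = y * y"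
  and real_closed_in_odd: "p \<in> polys_over S \<Longrightarrow> odd (degree p) \<Longrightarrow> \<exists>x\<in>S. poly p x = 0"
proof -
  show S: "is_subfield S" using rc by (simp add: real_closed_in_def)
  show "\<exists>y\<in>S. 0 \<le> y \<and> x = y * y" if "x \<in> S" "0 \<le> x"
  proof -
    obtain y where "y \<in> S" "x = y * y" using rc \<open>x \<in> S\<close> \<open>0 \<le> x\<close> by (auto simp: real_closed_in_def)
    then show ?thesis
      using is_subfield_uminus[OF S, of y]
      by (cases "0 \<le> y") (auto intro: bexI[of _ y] bexI[of _ "- y"])
  qed
  show "p \<in> polys_over S \<Longrightarrow> odd (degree p) \<Longrightarrow> \<exists>x\<in>S. poly p x = 0"
    using rc by (simp add: real_closed_in_def)
qed

text \<open>The classical formula: with \<open>r = |z|\<close>, the square root has real part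
  \<open>u\<close> and imaginary part \<open>v\<close> or \<open>- v\<close>, where
  \<open>u * u = (r + x) / 2\<close> and \<open>v * v = (r - x) / 2\<close>; the sign is chosen so
  that the cross term gives \<open>y\<close>.\<close>

lemma cplx_set_sqrt:
  assumes "z \<in> cplx_set S"
  shows "\<exists>w\<in>cplx_set S. z = w * w"
proof -
  note SI = is_subfield_intros[OF real_closed_in_subfield]
  obtain x y where z: "z = cplx x y" "x \<in> S" "y \<in> S" using assms by (auto simp: cplx_set_def)
  obtain r where r: "r \<in> S" "0 \<le> r" "x * x + y * y = r * r"
    using real_closed_in_sqrt[of "x * x + y * y"] z(2,3) by (auto intro: SI)
  have "x * x \<le> r * r" unfolding r(3)[symmetric] by simp
  then have "\<bar>x\<bar> \<le> r"
    using abs_le_square_iff[of x r] r(2) by (simp add: power2_eq_square)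
  then have "0 \<le> (r + x) / 2" "0 \<le> (r - x) / 2" by auto
  moreover have "(r + x) / 2 \<in> S" "(r - x) / 2 \<in> S" using z(2,3) r(1) by (auto intro: SI)
  ultimately obtain u v where u: "u \<in> S" "0 \<le> u" "(r + x) / 2 = u * u"
    and v: "v \<in> S" "0 \<le> v" "(r - x) / 2 = v * v"
    using real_closed_in_sqrt by metis
  have uv: "u * u - v * v = x" unfolding u(3)[symmetric] v(3)[symmetric] by (simp add: field_simps)
  have "(2 * u * v) * (2 * u * v) = 4 * ((u * u) * (v * v))" by simp
  also have "\<dots> = r * r - x * x"
    unfolding u(3)[symmetric] v(3)[symmetric] by (simp add: field_simps)
  also have "\<dots> = y * y" using r(3) by (simp add: algebra_simps)
  finally have "2 * u * v = y \<or> 2 * u * v = - y" by (simp only: square_eq_iff)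
  then show ?thesis
  proof
    assume "2 * u * v = y"
    then have "z = cplx u v * cplx u v" using uv by (simp add: cplx_mult z cplx_eq_iff)
    then show ?thesis using u v by (auto simp: cplx_set_def)
  next
    assume "2 * u * v = - y"
    then have "z = cplx u (- v) * cplx u (- v)" using uv by (simp add: cplx_mult z cplx_eq_iff)
    then show ?thesis using u(1) SI(5)[OF v(1)] by (auto simp: cplx_set_def)
  qed
qed

end

text \<open>The roots are listed with multiplicity, and Newton's identities put their power sums
  into \<open>T\<close>. In this form symmetric expressions in the roots can be handled without
  elementary symmetric functions.\<close>

lemma poly_roots_power_sums:
  fixes p :: "'b::{alg_closed_field, field_char_0} poly"
  assumes T: "is_subfield T" and p: "p \<in> polys_over T" "p \<noteq> 0"
  obtains r where "p = smult (lead_coeff p) (\<Prod>i<degree p. [:- r i, 1:])"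
    and "\<And>a. (\<Sum>i<degree p. r i ^ a) \<in> T"
proof -
  define n where "n = degree p"
  from alg_closed_imp_factorization[OF p(2)] obtain A where
    A: "size A = n" "p = smult (lead_coeff p) (\<Prod>x\<in>#A. [:- x, 1:])" by (auto simp: n_def)
  obtain rs where rs: "A = mset rs" by (metis ex_mset)
  define r where "r = (\<lambda>i. rs ! i)"
  have prs: "(\<Prod>x\<in>#A. [:- x, 1:]) = (\<Prod>i<n. [:- r i, 1:])"
    using A(1) unfolding rs r_def
    by (simp add: prod_mset_prod_list prod.list_conv_set_nth lessThan_atLeast0
        flip: mset_map)
  have "(\<Prod>i<n. [:- r i, 1:]) = smult (inverse (lead_coeff p)) p"
    by (subst (2) A(2)) (simp add: prs p(2))
  also have "\<dots> \<in> polys_over T"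
    using p(1) by (intro polys_over_smult[OF T] is_subfield_inverse[OF T]) (auto simp: polys_over_def)
  finally have pw1: "(\<Sum>i<n. r i ^ Suc a) \<in> T" for a
    using prod_linear_over_iff[OF T, of "{..<n}" r] by simp
  \<comment> \<open>The exponent \<open>0\<close>, which Newton's identities do not cover, gives the
    number \<open>n\<close>.\<close>
  have "(\<Sum>i<n. r i ^ a) \<in> T" for a
    using pw1 is_subfield_of_nat[OF T, of n] by (cases a) auto
  then show thesis using that[of r] A(2) by (simp add: prs n_def)
qed

text \<open>Laplace's induction on the 2-adic valuation of the degree: if \<open>p\<close> has the roots
  \<open>r i\<close>, the polynomial with the roots \<open>r i + r j + t * r i * r j\<close> for \<open>i < j\<close> has a root in
  \<open>S + i S\<close>, and for two values of \<open>t\<close> this happens for the same pair \<open>i\<close>, \<open>j\<close>.\<close>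

lemma real_closed_in_root:
  fixes S :: "'a::linordered_field set"
  assumes rc: "real_closed_in S"
  shows "p \<in> polys_over (to_ac ` S) \<Longrightarrow> degree p = 2 ^ k * m \<Longrightarrow> odd m \<Longrightarrow>
    \<exists>z\<in>cplx_set S. poly p z = 0"
proof (induction k arbitrary: p m)
  case 0
  obtain q where q: "q \<in> polys_over S" "p = map_poly to_ac q"
    using polys_over_range_to_ac[OF 0(1)] by blast
  then have "odd (degree q)" using 0 by (simp add: degree_map_poly_to_ac)
  then obtain x where "x \<in> S" "poly q x = 0" using real_closed_in_odd[OF rc q(1)] by blast
  then have "poly p (cplx x 0) = 0" by (simp add: q poly_map_poly_to_ac flip: cplx_of_real)
  then show ?case
    using \<open>x \<in> S\<close> is_subfield_0[OF real_closed_in_subfield[OF rc]] by (auto simp: cplx_set_def)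
next
  case (Suc k)
  define T where "T = to_ac ` S"
  have T: "is_subfield T"
    unfolding T_def by (intro is_subfield_to_ac real_closed_in_subfield rc)
  note TI = is_subfield_intros[OF T]
  have Z: "is_subfield (cplx_set S)" by (intro is_subfield_cplx_set real_closed_in_subfield rc)
  note ZI = is_subfield_intros[OF Z]
  define n where "n = degree p"
  have n: "n = 2 ^ Suc k * m" "m > 0" using Suc by (auto simp: n_def intro: Nat.gr0I)
  then have "n > 0" by simp
  then have p0: "p \<noteq> 0" by (auto simp: n_def)
  obtain r where A: "p = smult (lead_coeff p) (\<Prod>i<n. [:- r i, 1:])"
    and pw: "\<And>a. (\<Sum>i<n. r i ^ a) \<in> T"
    using poly_roots_power_sums[OF T Suc.prems(1)[folded T_def] p0] unfolding n_def by blast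
  have root: "poly p (r i) = 0" if "i < n" for i
    using that by (subst A) (auto simp: poly_prod)
  define s where "s = (\<lambda>t i j. r i + r j + of_nat t * (r i * r j))"
  \<comment> \<open>With the extra monomials in \<open>r i\<close> and \<open>r j\<close> the claim
    becomes inductive: one factor \<open>s t i j\<close> is expanded and only raises their
    exponents.\<close>
  have full: "(\<Sum>i<n. \<Sum>j<n. s t i j ^ e * (r i ^ a * r j ^ b)) \<in> T" for t e a b
  proof (induction e arbitrary: a b)
    case 0
    have "(\<Sum>i<n. \<Sum>j<n. r i ^ a * r j ^ b) = (\<Sum>i<n. r i ^ a) * (\<Sum>j<n. r j ^ b)"
      by (simp add: sum_product)
    then show ?case using TI(4)[OF pw pw] by simp
  next
    case (Suc e)
    have "(\<Sum>i<n. \<Sum>j<n. s t i j ^ Suc e * (r i ^ a * r j ^ b)) =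
        (\<Sum>i<n. \<Sum>j<n. s t i j ^ e * (r i ^ Suc a * r j ^ b))
      + (\<Sum>i<n. \<Sum>j<n. s t i j ^ e * (r i ^ a * r j ^ Suc b))
      + of_nat t * (\<Sum>i<n. \<Sum>j<n. s t i j ^ e * (r i ^ Suc a * r j ^ Suc b))"
      unfolding sum_distrib_left sum.distrib[symmetric]
      by (intro sum.cong refl) (simp add: s_def algebra_simps)
    then show ?case
      by (simp only:) (intro is_subfield_add[OF T] is_subfield_mult[OF T] TI(9,10) Suc)
  qed
  have diag: "(\<Sum>i<n. s t i i ^ e * r i ^ a) \<in> T" for t e a
  proof (induction e arbitrary: a)
    case (Suc e)
    have "(\<Sum>i<n. s t i i ^ Suc e * r i ^ a) =
       2 * (\<Sum>i<n. s t i i ^ e * r i ^ Suc a) + of_nat t * (\<Sum>i<n. s t i i ^ e * r i ^ Suc (Suc a))"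
      unfolding sum_distrib_left sum.distrib[symmetric]
      by (intro sum.cong refl) (simp add: s_def algebra_simps)
    then show ?case
      by (simp only:) (intro is_subfield_add[OF T] is_subfield_mult[OF T] TI(9,10) Suc)
  qed (use pw in simp)
  define I where "I = (SIGMA j:{..<n}. {..<j})"
  have fI: "finite I" by (auto simp: I_def)
  \<comment> \<open>The sum over pairs of distinct indices, taken once each, is half of the full
    double sum without its diagonal.\<close>
  have half: "2 * (\<Sum>(j, i)\<in>I. f i j) = (\<Sum>i<n. \<Sum>j<n. f i j) - (\<Sum>i<n. f i i)"
    if "\<And>i j. f i j = f j i" for f :: "nat \<Rightarrow> nat \<Rightarrow> 'a alg_closure"
  proof -
    have "2 * (\<Sum>j<N. \<Sum>i<j. f i j) = (\<Sum>i<N. \<Sum>j<N. f i j) - (\<Sum>i<N. f i i)" for N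
    proof (induction N)
      case (Suc N)
      have "(\<Sum>i<N. f N i) = (\<Sum>i<N. f i N)" by (intro sum.cong refl that)
      then show ?case using Suc by (simp add: sum.distrib algebra_simps)
    qed simp
    then show ?thesis by (simp add: I_def sum.Sigma)
  qed
  have "card I = (\<Sum>j<n. j)" by (simp add: I_def)
  moreover have "2 * (\<Sum>j<N. j) = N * (N - 1)" for N :: nat
    proof (induction N)
      case (Suc N)
      then show ?case by (cases N) (auto simp: algebra_simps)
    qed simp
  ultimately have cI: "2 * card I = n * (n - 1)" by simp
  have q: "(\<Prod>x\<in>I. [:- (case x of (j, i) \<Rightarrow> s t i j), 1:]) \<in> polys_over T" for t
  proof (subst prod_linear_over_iff[OF T fI], intro allI)
    fix e
    have sym: "s t i j = s t j i" for i j by (simp add: s_def algebra_simps)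
    have "2 * (\<Sum>(j, i)\<in>I. s t i j ^ Suc e) =
      (\<Sum>i<n. \<Sum>j<n. s t i j ^ Suc e) - (\<Sum>i<n. s t i i ^ Suc e)"
      by (rule half) (metis sym)
    also have "\<dots> \<in> T" using TI(7)[OF full[of t "Suc e" 0 0] diag[of t "Suc e" 0]] by simp
    finally have "2 * (\<Sum>(j, i)\<in>I. s t i j ^ Suc e) / 2 \<in> T" by (rule TI(8)[OF _ TI(10)])
    then show "(\<Sum>x\<in>I. (case x of (j, i) \<Rightarrow> s t i j) ^ Suc e) \<in> T"
      by (simp add: case_prod_unfold)
  qed
  have "\<exists>x\<in>I. (case x of (j, i) \<Rightarrow> s t i j) \<in> cplx_set S" for t
  proof -
    \<comment> \<open>The number of pairs is \<open>n * (n - 1) / 2\<close>. As \<open>n\<close> is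
      even, \<open>n - 1\<close> is odd, so exactly one factor \<open>2\<close> is lost and the
      induction hypothesis for \<open>k\<close> applies.\<close>
    have "2 * card I = 2 * (2 ^ k * (m * (n - 1)))" using cI n(1) by simp
    then have "degree (\<Prod>x\<in>I. [:- (case x of (j, i) \<Rightarrow> s t i j), 1:]) = 2 ^ k * (m * (n - 1))"
      by (subst degree_prod_eq_sum_degree) auto
    moreover have "odd (m * (n - 1))" using Suc.prems(3) n \<open>n > 0\<close> by simp
    ultimately obtain z where "z \<in> cplx_set S" "poly (\<Prod>x\<in>I. [:- (case x of (j, i) \<Rightarrow> s t i j), 1:]) z = 0"
      using Suc.IH q unfolding T_def by blast
    then obtain x where "x \<in> I" "z = (case x of (j, i) \<Rightarrow> s t i j)" using fI by (auto simp: poly_prod)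
    then show ?thesis using \<open>z \<in> cplx_set S\<close> by blast
  qed
  then obtain x where "x \<in> I" and inf: "infinite {t::nat. (case x of (j, i) \<Rightarrow> s t i j) \<in> cplx_set S}"
    using pigeonhole_infinite_rel[of "UNIV :: nat set" I "\<lambda>t x. (case x of (j, i) \<Rightarrow> s t i j) \<in> cplx_set S"] fI
    by auto
  obtain i j where x: "x = (j, i)" by (cases x)
  have ij: "i < n" using \<open>x \<in> I\<close> by (auto simp: I_def x)
  have "infinite {t. s t i j \<in> cplx_set S}" using inf by (simp add: x)
  then obtain t1 where t1: "s t1 i j \<in> cplx_set S" using not_finite_existsD by blast
  have "infinite ({t. s t i j \<in> cplx_set S} - {t1})" using inf by (simp add: x)
  then obtain t2 where t2: "s t2 i j \<in> cplx_set S" "t2 \<noteq> t1"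
    by (metis (no_types, lifting) Diff_iff equals0I finite.emptyI insertCI mem_Collect_eq)
  \<comment> \<open>The difference of the two values is a multiple of the product of the roots. This
    yields the product, then the sum, and by the quadratic formula the roots themselves.\<close>
  have "s t2 i j - s t1 i j = (of_nat t2 - of_nat t1) * (r i * r j)"
    by (simp add: s_def algebra_simps)
  then have "r i * r j = (s t2 i j - s t1 i j) / (of_nat t2 - of_nat t1)"
    using t2(2) by simp
  then have pr: "r i * r j \<in> cplx_set S"
    using t1 t2 by (auto intro!: ZI)
  have "r i + r j = s t1 i j - of_nat t1 * (r i * r j)" by (simp add: s_def)
  then have sm: "r i + r j \<in> cplx_set S" using t1 pr by (auto intro!: ZI)
  have "(r i - r j) * (r i - r j) = (r i + r j) * (r i + r j) - 4 * (r i * r j)"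
    by (simp add: algebra_simps)
  also have "\<dots> \<in> cplx_set S" by (intro ZI(7)[OF ZI(4) ZI(4)] sm pr ZI(10))
  finally obtain w where w: "w \<in> cplx_set S" "(r i - r j) * (r i - r j) = w * w"
    using cplx_set_sqrt[OF rc] by blast
  have "r i - r j \<in> cplx_set S"
    using w ZI(5)[of w] by (auto simp: square_eq_iff)
  then have "((r i + r j) + (r i - r j)) / 2 \<in> cplx_set S" using sm by (intro ZI(8)[OF ZI(3)] ZI(10))
  then have "r i \<in> cplx_set S" by simp
  then show ?case using root[OF ij] by blast
qed

lemma poly_map_to_ac_quadratic:
  "poly (map_poly to_ac [:s * s + t * t, - 2 * s, 1:]) z = (z - to_ac s) * (z - to_ac s) + to_ac (t * t)"
proof -
  have "map_poly to_ac [:s * s + t * t, - 2 * s, 1:] = [:to_ac (s * s + t * t), to_ac (- 2 * s), 1:]"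
    by (rule poly_eqI) (simp add: coeff_map_poly coeff_pCons split: nat.split)
  then show ?thesis by (simp add: algebra_simps)
qed

lemma poly_map_to_ac_linear: "poly (map_poly to_ac [:a, b:]) z = to_ac a + z * to_ac b"
proof -
  have "map_poly to_ac [:a, b:] = [:to_ac a, to_ac b:]"
    by (rule poly_eqI) (simp add: coeff_map_poly coeff_pCons split: nat.split)
  then show ?thesis by simp
qed

lemma map_poly_to_ac_add: "map_poly to_ac (p + q) = map_poly to_ac p + map_poly to_ac q"
  by (rule poly_eqI) (simp add: coeff_map_poly)

lemma nat_power2_odd_decomp: "n > 0 \<Longrightarrow> \<exists>k m. n = 2 ^ k * m \<and> odd (m::nat)"
proof (induction n rule: less_induct)
  case (less n)
  show ?case
  proof (cases "odd n")
    case True then show ?thesis by (intro exI[of _ 0] exI[of _ n]) simp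
  next
    case False
    then obtain n' where n': "n = 2 * n'" by auto
    then have "n' < n" "n' > 0" using less.prems by auto
    then obtain k m where "n' = 2 ^ k * m" "odd m" using less.IH by blast
    then show ?thesis using n' by (intro exI[of _ "Suc k"] exI[of _ m]) simp
  qed
qed

lemma quadratic_pos: "t \<noteq> 0 \<Longrightarrow> 0 < (x - s) * (x - s) + t * (t :: 'a::linordered_field)"
  by (simp add: add_nonneg_pos not_square_less_zero order_less_le)

lemma poly_quadratic: "poly [:s * s + t * t, - 2 * s, 1:] x = (x - s) * (x - s) + t * (t :: 'a::linordered_field)"
  by (simp add: algebra_simps)

context
  fixes S :: "'a::linordered_field set"
  assumes rc: "real_closed_in S"
begin

text \<open>A root \<open>s + i t\<close> exists in \<open>S + i S\<close>. If \<open>t\<close> is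
  nonzero, the remainder modulo the quadratic polynomial with the roots \<open>s + i t\<close> and
  \<open>s - i t\<close> is linear over \<open>S\<close> and vanishes at a nonreal point, hence is
  zero.\<close>

lemma real_closed_in_factor:
  assumes p: "p \<in> polys_over S" "degree p > 0"
  obtains s q where "s \<in> S" "q \<in> polys_over S" "p = [:- s, 1:] * q"
    | s t q where "s \<in> S" "t \<in> S" "t \<noteq> 0" "q \<in> polys_over S" "p = [:s * s + t * t, - 2 * s, 1:] * q"
proof -
  note S = real_closed_in_subfield[OF rc]
  obtain k m where km: "degree p = 2 ^ k * m" "odd m" using nat_power2_odd_decomp p(2) by blast
  have "map_poly to_ac p \<in> polys_over (to_ac ` S)"
    using p(1) by (auto simp: polys_over_def coeff_map_poly)
  then obtain z where "z \<in> cplx_set S" and z: "poly (map_poly to_ac p) z = 0"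
    using real_closed_in_root[OF rc _ _ km(2), of "map_poly to_ac p" k] km(1)
    by (auto simp: degree_map_poly_to_ac)
  then obtain s t where st: "z = cplx s t" "s \<in> S" "t \<in> S" by (auto simp: cplx_set_def)
  show thesis
  proof (cases "t = 0")
    case True
    then have "poly p s = 0" using z st(1) by (simp add: poly_map_poly_to_ac flip: cplx_of_real)
    then obtain q where q: "p = [:- s, 1:] * q" by (auto simp: poly_eq_0_iff_dvd elim: dvdE)
    have "q \<in> polys_over S"
    proof (rule polys_over_cofactor[OF S])
      show "[:- s, 1:] \<in> polys_over S"
        using st by (intro polys_over_pCons[OF S] polys_over_0[OF S] is_subfield_intros[OF S])
    qed (use p q in auto)
    then show thesis using that(1) q st by blast
  next
    case False
    define d where "d = [:s * s + t * t, - 2 * s, 1:]"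
    have dS: "d \<in> polys_over S"
      unfolding d_def using st
      by (intro polys_over_pCons[OF S] polys_over_0[OF S] is_subfield_intros[OF S])
         (auto intro: is_subfield_intros[OF S])
    have dz: "poly (map_poly to_ac d) z = 0"
    proof -
      have "z - to_ac s = cplx 0 t" by (simp add: st cplx_def)
      then show ?thesis
        by (simp only: d_def poly_map_to_ac_quadratic cplx_mult) (simp add: cplx_def)
    qed
    define r where "r = p mod d"
    have "degree d = 2" by (simp add: d_def)
    moreover have "r = 0 \<or> degree r < degree d"
      unfolding r_def by (rule degree_mod_less) (simp add: d_def)
    ultimately have "degree r < 2" by auto
    then obtain a b where r: "r = [:a, b:]"
    proof -
      have "r = [:coeff r 0, coeff r 1:]"
        using \<open>degree r < 2\<close> by (intro poly_eqI) (auto simp: coeff_pCons coeff_eq_0 split: nat.split)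
      then show thesis using that by blast
    qed
    have "p = d * (p div d) + r" by (simp add: r_def)
    then have "poly (map_poly to_ac p) z = poly (map_poly to_ac r) z"
      by (metis dz map_poly_to_ac_add map_poly_to_ac_mult poly_add poly_mult mult_zero_left add_0)
    then have "to_ac a + z * to_ac b = 0" using z by (simp only: r poly_map_to_ac_linear)
    moreover have "to_ac a + z * to_ac b = cplx (a + s * b) (t * b)"
      by (simp add: st cplx_def algebra_simps)
    ultimately have "r = 0" using False by (auto simp: cplx_eq_0_iff r)
    then have q: "p = d * (p div d)" by (metis \<open>p = d * (p div d) + r\<close> add.right_neutral)
    have "p div d \<in> polys_over S" by (rule polys_over_div_mod[OF S dS p(1)])
    then show thesis using that(2)[of s t "p div d"] q st False unfolding d_def by blast
  qed
qed

text \<open>Splitting off factors finds every root, not just one. For \<open>S = UNIV\<close> it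
  follows that the algebraic closure consists of the elements \<open>cplx x y\<close>.\<close>

lemma real_closed_in_all_roots:
  assumes "p \<in> polys_over S" "p \<noteq> 0" "poly (map_poly to_ac p) z = 0"
  shows "z \<in> cplx_set S"
  using assms
proof (induction "degree p" arbitrary: p rule: less_induct)
  case less
  note S = real_closed_in_subfield[OF rc]
  have "degree p > 0"
  proof (rule ccontr)
    assume "\<not> degree p > 0"
    then obtain c where "p = [:c:]" by (auto elim: degree_eq_zeroE)
    then show False using less by (simp add: map_poly_pCons)
  qed
  from less.prems(1) this show ?case
  proof (cases rule: real_closed_in_factor)
    case (1 s q)
    have "q \<noteq> 0" using 1 less by auto
    then have "degree q < degree p" unfolding 1(3) by (subst degree_mult_eq) auto
    moreover have "poly (map_poly to_ac [:- s, 1:]) z = 0 \<or> poly (map_poly to_ac q) z = 0"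
      using less.prems(3) unfolding 1(3) map_poly_to_ac_mult by simp
    ultimately show ?thesis
    proof (elim disjE)
      assume "poly (map_poly to_ac [:- s, 1:]) z = 0"
      then have "z = cplx s 0" by (simp add: poly_map_to_ac_linear flip: cplx_of_real)
      then show ?thesis using 1 is_subfield_0[OF S] by (auto simp: cplx_set_def)
    qed (use less.hyps[of q] 1 \<open>q \<noteq> 0\<close> in auto)
  next
    case (2 s t q)
    have "q \<noteq> 0" using 2 less by auto
    then have "degree q < degree p" unfolding 2(5) by (subst degree_mult_eq) auto
    moreover have "poly (map_poly to_ac [:s * s + t * t, - 2 * s, 1:]) z = 0 \<or> poly (map_poly to_ac q) z = 0"
      using less.prems(3) unfolding 2(5) map_poly_to_ac_mult by simp
    ultimately show ?thesis
    proof (elim disjE)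
      assume "poly (map_poly to_ac [:s * s + t * t, - 2 * s, 1:]) z = 0"
      then have "(z - to_ac s) * (z - to_ac s) = - to_ac (t * t)"
        by (simp only: poly_map_to_ac_quadratic add_eq_0_iff2)
      also have "\<dots> = cplx 0 t * cplx 0 t" by (simp only: cplx_mult) (simp add: cplx_def)
      finally have "z - to_ac s = cplx 0 t \<or> z - to_ac s = - cplx 0 t" by (simp only: square_eq_iff)
      then have "z = cplx s t \<or> z = cplx s (- t)"
        by (auto simp: cplx_def algebra_simps)
      then show ?thesis using 2 is_subfield_uminus[OF S, of t] by (auto simp: cplx_set_def)
    qed (use less.hyps[of q] 2 \<open>q \<noteq> 0\<close> in auto)
  qed
qed

end

section \<open>Intermediate values, Rolle's theorem and monotonicity for polynomials\<close>

context
  assumes rcU: "real_closed_in (UNIV :: 'a::linordered_field set)"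
begin

lemma alg_closure_cplx: obtains x y :: 'a where "z = cplx x y"
proof -
  obtain p :: "'a poly" where "p \<noteq> 0" "poly (map_poly to_ac p) z = 0" by (rule alg_closure_algebraic)
  then have "z \<in> cplx_set UNIV"
    by (intro real_closed_in_all_roots[OF rcU]) (auto simp: polys_over_def)
  then show thesis using that by (auto simp: cplx_set_def)
qed

text \<open>Induction along the factorization: definite quadratic factors are positive, and a linear
  factor with its root outside the interval has one sign on it.\<close>

lemma poly_no_root_same_sign:
  fixes p :: "'a poly"
  assumes "a \<le> b" "\<And>x. a \<le> x \<Longrightarrow> x \<le> b \<Longrightarrow> poly p x \<noteq> 0"
  shows "0 < poly p a * poly p b"
  using assms(2)
proof (induction "degree p" arbitrary: p rule: less_induct)
  case less
  have "p \<noteq> 0" using less.prems[of a] assms(1) by auto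
  show ?case
  proof (cases "degree p > 0")
    case False
    then obtain c where "p = [:c:]" by (auto elim: degree_eq_zeroE)
    then show ?thesis using less.prems[of a] assms(1) by (simp add: not_square_less_zero order_less_le)
  next
    case True
    have "p \<in> polys_over UNIV" by (simp add: polys_over_def)
    from rcU this True show ?thesis
    proof (cases rule: real_closed_in_factor)
      case (1 s q)
      have "q \<noteq> 0" using 1 \<open>p \<noteq> 0\<close> by auto
      then have "degree q < degree p" unfolding 1(3) by (subst degree_mult_eq) auto
      then have IH: "0 < poly q a * poly q b"
        using less.prems by (intro less.hyps) (auto simp: 1(3))
      have "s < a \<or> b < s" using less.prems[of s] by (force simp: 1(3))
      then have "0 < (a - s) * (b - s)" using assms(1) by (auto intro: mult_pos_pos mult_neg_neg)
      then have "0 < ((a - s) * (b - s)) * (poly q a * poly q b)" using IH by simp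
      then show ?thesis by (simp add: 1(3) algebra_simps)
    next
      case (2 s t q)
      have "q \<noteq> 0" using 2 \<open>p \<noteq> 0\<close> by auto
      then have "degree q < degree p" unfolding 2(5) by (subst degree_mult_eq) auto
      then have IH: "0 < poly q a * poly q b"
      proof (rule less.hyps)
        show "poly q x \<noteq> 0" if "a \<le> x" "x \<le> b" for x
          using less.prems[OF that] unfolding 2(5) poly_mult by auto
      qed
      have "0 < ((a - s) * (a - s) + t * t) * ((b - s) * (b - s) + t * t)"
        using 2(3) by (intro mult_pos_pos quadratic_pos)
      then have "0 < (((a - s) * (a - s) + t * t) * ((b - s) * (b - s) + t * t)) * (poly q a * poly q b)"
        using IH by simp
      moreover have "poly p x = ((x - s) * (x - s) + t * t) * poly q x" for x
        unfolding 2(5) poly_mult poly_quadratic ..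
      ultimately show ?thesis by (simp only: mult_ac)
    qed
  qed
qed

lemma poly_rc_IVT:
  fixes p :: "'a poly"
  assumes "a < b" "poly p a * poly p b < 0"
  obtains x where "a < x" "x < b" "poly p x = 0"
proof -
  obtain x where "a \<le> x" "x \<le> b" "poly p x = 0"
    using poly_no_root_same_sign[of a b p] assms by fastforce
  moreover have "x \<noteq> a" "x \<noteq> b" using assms(2) \<open>poly p x = 0\<close> by auto
  ultimately show thesis using that[of x] by simp
qed

text \<open>Passing to the first root \<open>c\<close> after \<open>a\<close>, one can write
  \<open>p = (x - a)^m (x - c)^n q\<close>, where \<open>q\<close> has no root between
  \<open>a\<close> and \<open>c\<close> and hence a constant sign there. The intermediate value
  property then applies to a factor of the derivative.\<close>

lemma poly_rc_Rolle:
  fixes p :: "'a poly"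
  assumes "a < b" "poly p a = 0" "poly p b = 0" "p \<noteq> 0"
  obtains x where "a < x" "x < b" "poly (pderiv p) x = 0"
proof -
  define B where "B = {x. a < x \<and> x \<le> b \<and> poly p x = 0}"
  have "finite B" unfolding B_def by (rule finite_subset[OF _ poly_roots_finite[OF assms(4)]]) auto
  have "B \<noteq> {}" using assms by (auto simp: B_def)
  define c where "c = Min B"
  have c: "a < c" "c \<le> b" "poly p c = 0"
    using Min_in[OF \<open>finite B\<close> \<open>B \<noteq> {}\<close>] by (auto simp: c_def B_def)
  have min: "poly p x \<noteq> 0" if "a < x" "x < c" for x
  proof
    assume "poly p x = 0"
    then have "x \<in> B" using that c by (auto simp: B_def)
    then show False using Min_le[OF \<open>finite B\<close>, of x] that by (simp add: c_def)
  qed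
  obtain m q1 where q1: "p = [:- a, 1:] ^ m * q1" "poly q1 a \<noteq> 0"
    using order_decomp[OF assms(4), of a] by (auto simp: poly_eq_0_iff_dvd)
  have "q1 \<noteq> 0" using q1(2) by auto
  then obtain n q where q: "q1 = [:- c, 1:] ^ n * q" "poly q c \<noteq> 0"
    using order_decomp[of q1 c] by (auto simp: poly_eq_0_iff_dvd)
  have "m \<noteq> 0" using assms(2) q1 by (cases m) auto
  then obtain m' where m: "m = Suc m'" by (cases m) auto
  have "n \<noteq> 0"
  proof
    assume "n = 0"
    then have "poly q1 c = poly q c" by (simp add: q)
    then have "poly p c \<noteq> 0" using q(2) c(1) by (simp add: q1(1))
    then show False using c by simp
  qed
  then obtain n' where n: "n = Suc n'" by (cases n) auto
  have p: "p = [:- a, 1:] ^ m * [:- c, 1:] ^ n * q" using q1 q by (simp add: mult.assoc)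
  \<comment> \<open>\<open>g\<close> is what remains of \<open>pderiv p\<close> once
    \<open>(x - a) ^ m'\<close> and \<open>(x - c) ^ n'\<close> are removed. At \<open>a\<close> and
    at \<open>c\<close> a single summand survives, with opposite signs.\<close>
  define g where "g = smult (of_nat m) ([:- c, 1:] * q) + smult (of_nat n) ([:- a, 1:] * q) + [:- a, 1:] * [:- c, 1:] * pderiv q"
  have dp: "poly (pderiv p) x = (x - a) ^ m' * (x - c) ^ n' * poly g x" for x
    unfolding p m n g_def
    by (simp only: pderiv_mult pderiv_power_Suc) (simp add: pderiv_pCons algebra_simps del: of_nat_Suc)
  have qa: "poly q a \<noteq> 0" using q1(2) q(1) by auto
  have q0: "poly q x \<noteq> 0" if "a \<le> x" "x \<le> c" for x
  proof (cases "x = a \<or> x = c")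
    case True then show ?thesis using qa q(2) by auto
  next
    case False
    then have "poly p x \<noteq> 0" using min that by auto
    then show ?thesis by (auto simp: p)
  qed
  have pos: "0 < poly q a * poly q c" using c q0 by (intro poly_no_root_same_sign) auto
  have "poly g a * poly g c = (of_nat m * (a - c)) * (of_nat n * (c - a)) * (poly q a * poly q c)"
    by (simp add: g_def algebra_simps)
  also have "\<dots> < 0"
  proof (rule mult_neg_pos[OF _ pos])
    show "(of_nat m * (a - c)) * (of_nat n * (c - a)) < 0"
      using c(1) m n by (intro mult_neg_pos mult_pos_neg mult_pos_pos) (auto simp del: of_nat_Suc)
  qed
  finally obtain x where "a < x" "x < c" "poly g x = 0" using poly_rc_IVT[OF c(1)] by blast
  then show thesis using that[of x] c dp[of x] by simp
qed

lemma poly_rc_MVT: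
  fixes p :: "'a poly"
  assumes "a < b"
  obtains x where "a < x" "x < b" "poly p b - poly p a = (b - a) * poly (pderiv p) x"
proof -
  define l where "l = (poly p b - poly p a) / (b - a)"
  define r where "r = p - [:poly p a - a * l, l:]"
  have l: "(b - a) * l = poly p b - poly p a" using assms by (simp add: l_def)
  have dr: "pderiv r = pderiv p - [:l:]" by (simp add: r_def pderiv_diff pderiv_pCons)
  show thesis
  proof (cases "r = 0")
    \<comment> \<open>If \<open>p\<close> equals its secant, every interior point works; Rolle's
      theorem needs a nonzero polynomial.\<close>
    case True
    then have "pderiv p = [:l:]" using dr by simp
    then show thesis using that[of "(a + b) / 2"] assms l by simp
  next
    case False
    have "poly r a = 0" by (simp add: r_def)
    have "poly r b = poly p b - poly p a - (b - a) * l" by (simp add: r_def algebra_simps)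
    then have "poly r b = 0" using l by simp
    from poly_rc_Rolle[OF assms \<open>poly r a = 0\<close> this False] obtain x where
      "a < x" "x < b" "poly (pderiv r) x = 0" by blast
    then show thesis using that[of x] dr l by simp
  qed
qed

text \<open>Strict monotonicity as a product of two increments, so that increasing and decreasing
  polynomials need not be distinguished.\<close>

lemma poly_rc_monotone:
  fixes p :: "'a poly"
  assumes "\<And>x. a < x \<Longrightarrow> x < b \<Longrightarrow> poly (pderiv p) x \<noteq> 0"
    and "a \<le> u" "u < v" "v \<le> w" "w < t" "t \<le> b"
  shows "0 < (poly p v - poly p u) * (poly p t - poly p w)"
proof -
  obtain x where x: "u < x" "x < v" "poly p v - poly p u = (v - u) * poly (pderiv p) x"
    by (rule poly_rc_MVT[OF \<open>u < v\<close>])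
  obtain y where y: "w < y" "y < t" "poly p t - poly p w = (t - w) * poly (pderiv p) y"
    by (rule poly_rc_MVT[OF \<open>w < t\<close>])
  have "0 < poly (pderiv p) x * poly (pderiv p) y"
    using assms x y by (intro poly_no_root_same_sign) auto
  moreover have "0 < (v - u) * (t - w)" using assms by simp
  ultimately have "0 < ((v - u) * (t - w)) * (poly (pderiv p) x * poly (pderiv p) y)" by simp
  then show ?thesis unfolding x y by (simp add: mult_ac)
qed

end

subsection \<open>Convex valuations\<close>

text \<open>\<open>V = UNIV\<close> is allowed on purpose: the trivial valuation is used in
  \<open>alg_over_bound\<close>.\<close>

locale convex_valuation =
  fixes V :: "'a::linordered_field set"
  assumes V_1: "1 \<in> V" and V_add: "x \<in> V \<Longrightarrow> y \<in> V \<Longrightarrow> x + y \<in> V"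
    and V_mult: "x \<in> V \<Longrightarrow> y \<in> V \<Longrightarrow> x * y \<in> V" and V_uminus: "x \<in> V \<Longrightarrow> - x \<in> V"
    and V_convex: "0 \<le> x \<Longrightarrow> x \<le> y \<Longrightarrow> y \<in> V \<Longrightarrow> x \<in> V"
begin

text \<open>\<open>x \<preceq> y\<close> stands for \<open>v x \<ge> v y\<close>, and \<open>x \<lless> y\<close> for \<open>v x > v y\<close>.\<close>

definition vle :: "'a \<Rightarrow> 'a \<Rightarrow> bool" (infix "\<preceq>" 50) where
  "x \<preceq> y \<longleftrightarrow> (\<exists>u\<in>V. x = u * y)"

definition vlt :: "'a \<Rightarrow> 'a \<Rightarrow> bool" (infix "\<lless>" 50) where
  "x \<lless> y \<longleftrightarrow> \<not> y \<preceq> x"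

lemma V_0: "0 \<in> V"
  using V_add[OF V_1 V_uminus[OF V_1]] by simp

lemma V_abs_iff: "\<bar>x\<bar> \<in> V \<longleftrightarrow> x \<in> V"
  using V_uminus[of x] V_uminus[of "- x"] unfolding abs_if minus_minus by (cases "x < 0") (simp_all, blast)

lemma vle_1_iff: "x \<preceq> 1 \<longleftrightarrow> x \<in> V"
  by (auto simp: vle_def)

lemma vle_refl [simp]: "x \<preceq> x"
  unfolding vle_def by (intro bexI[OF _ V_1]) simp

lemma vle_zero [simp]: "0 \<preceq> x"
  unfolding vle_def by (intro bexI[OF _ V_0]) simp

lemma vle_zero_iff [simp]: "x \<preceq> 0 \<longleftrightarrow> x = 0"
  by (auto simp: vle_def intro: V_1)

lemma vle_trans: "x \<preceq> y \<Longrightarrow> y \<preceq> z \<Longrightarrow> x \<preceq> z"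
proof -
  assume "x \<preceq> y" "y \<preceq> z"
  then obtain a b where ab: "a \<in> V" "x = a * y" "b \<in> V" "y = b * z" by (auto simp: vle_def)
  then have "x = (a * b) * z" by (simp add: mult.assoc)
  then show "x \<preceq> z" unfolding vle_def using V_mult[OF ab(1,3)] by blast
qed

text \<open>Convexity puts every quotient of absolute value at most \<open>1\<close> into
  \<open>V\<close>. So \<open>\<preceq>\<close> is coarser than the order of absolute values, and it
  is total because that order is.\<close>

lemma vle_if_abs_le: "\<bar>x\<bar> \<le> \<bar>y\<bar> \<Longrightarrow> x \<preceq> y"
proof (cases "y = 0")
  case False
  assume "\<bar>x\<bar> \<le> \<bar>y\<bar>"
  then have "\<bar>x / y\<bar> \<le> 1" using False by (simp add: abs_divide)
  then have "\<bar>x / y\<bar> \<in> V" using V_convex[OF abs_ge_zero _ V_1] by blast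
  then have "x / y \<in> V" by (simp only: V_abs_iff)
  then show "x \<preceq> y" unfolding vle_def using False by (intro bexI[of _ "x / y"]) simp_all
qed auto

lemma vlt_imp_abs_less: "x \<lless> y \<Longrightarrow> \<bar>x\<bar> < \<bar>y\<bar>"
  using vle_if_abs_le[of y x] by (meson vlt_def not_le)

lemma vle_total: "x \<preceq> y \<or> y \<preceq> x"
  using vle_if_abs_le[of x y] vle_if_abs_le[of y x] by linarith

lemma not_vlt: "\<not> x \<lless> y \<longleftrightarrow> y \<preceq> x"
  by (auto simp: vlt_def)

lemma vlt_imp_vle: "x \<lless> y \<Longrightarrow> x \<preceq> y"
  using vle_total by (auto simp: vlt_def)

lemma vlt_irrefl [simp]: "\<not> x \<lless> x" by (simp add: vlt_def)

lemma vle_vlt_trans: "x \<preceq> y \<Longrightarrow> y \<lless> z \<Longrightarrow> x \<lless> z"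
  and vlt_vle_trans: "x \<lless> y \<Longrightarrow> y \<preceq> z \<Longrightarrow> x \<lless> z"
  unfolding vlt_def using vle_trans by blast+

lemma vlt_trans: "x \<lless> y \<Longrightarrow> y \<lless> z \<Longrightarrow> x \<lless> z"
  using vle_vlt_trans vlt_imp_vle by blast

lemma vlt_zero_iff [simp]: "0 \<lless> x \<longleftrightarrow> x \<noteq> 0" and not_vlt_zero [simp]: "\<not> x \<lless> 0"
  by (auto simp: vlt_def)

lemma vle_uminus [simp]: "- x \<preceq> y \<longleftrightarrow> x \<preceq> y" "x \<preceq> - y \<longleftrightarrow> x \<preceq> y"
proof -
  have *: "- x \<preceq> y" if "x \<preceq> y" for x y
    by (rule vle_trans[OF _ that], rule vle_if_abs_le) simp
  have **: "x \<preceq> - y" if "x \<preceq> y" for x y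
    by (rule vle_trans[OF that], rule vle_if_abs_le) simp
  show "- x \<preceq> y \<longleftrightarrow> x \<preceq> y" using *[of x y] *[of "- x" y] by auto
  show "x \<preceq> - y \<longleftrightarrow> x \<preceq> y" using **[of x y] **[of x "- y"] by auto
qed

lemma vlt_uminus [simp]: "- x \<lless> y \<longleftrightarrow> x \<lless> y" "x \<lless> - y \<longleftrightarrow> x \<lless> y"
  by (auto simp: vlt_def)

lemma vle_abs [simp]: "\<bar>x\<bar> \<preceq> y \<longleftrightarrow> x \<preceq> y" "x \<preceq> \<bar>y\<bar> \<longleftrightarrow> x \<preceq> y"
  by (auto simp: abs_if)

lemma vlt_abs [simp]: "\<bar>x\<bar> \<lless> y \<longleftrightarrow> x \<lless> y" "x \<lless> \<bar>y\<bar> \<longleftrightarrow> x \<lless> y"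
  by (auto simp: vlt_def)

lemma vle_add: "x \<preceq> z \<Longrightarrow> y \<preceq> z \<Longrightarrow> x + y \<preceq> z"
proof -
  assume "x \<preceq> z" "y \<preceq> z"
  then obtain a b where ab: "a \<in> V" "x = a * z" "b \<in> V" "y = b * z" by (auto simp: vle_def)
  then have "x + y = (a + b) * z" by (simp add: distrib_right)
  then show "x + y \<preceq> z" unfolding vle_def using V_add[OF ab(1,3)] by blast
qed

lemma vle_diff: "x \<preceq> z \<Longrightarrow> y \<preceq> z \<Longrightarrow> x - y \<preceq> z"
  using vle_add[of x z "- y"] by simp

lemma V_of_nat: "of_nat n \<in> V"
  by (induction n) (auto intro: V_0 V_1 V_add)

lemma V_numeral: "numeral n \<in> V"
  using V_of_nat[of "numeral n"] by simp

lemma vlt_add: 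
  assumes "x \<lless> z" "y \<lless> z" shows "x + y \<lless> z"
proof -
  have "x + y \<preceq> x \<or> x + y \<preceq> y"
    using vle_total[of x y] by (auto intro: vle_add)
  then show ?thesis using assms vle_vlt_trans by blast
qed

lemma vlt_diff: "x \<lless> z \<Longrightarrow> y \<lless> z \<Longrightarrow> x - y \<lless> z"
  using vlt_add[of x z "- y"] by simp

lemma vle_sum: "(\<And>i. i \<in> I \<Longrightarrow> f i \<preceq> z) \<Longrightarrow> sum f I \<preceq> z"
  by (induction I rule: infinite_finite_induct) (auto intro: vle_add)

lemma vlt_sum: "z \<noteq> 0 \<Longrightarrow> (\<And>i. i \<in> I \<Longrightarrow> f i \<lless> z) \<Longrightarrow> sum f I \<lless> z"
  by (induction I rule: infinite_finite_induct) (auto intro: vlt_add)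

lemma vle_mult: "x \<preceq> y \<Longrightarrow> u \<preceq> w \<Longrightarrow> x * u \<preceq> y * w"
proof -
  assume "x \<preceq> y" "u \<preceq> w"
  then obtain a b where ab: "a \<in> V" "x = a * y" "b \<in> V" "u = b * w" by (auto simp: vle_def)
  then have "x * u = (a * b) * (y * w)" by (simp add: mult_ac)
  then show "x * u \<preceq> y * w" unfolding vle_def using V_mult[OF ab(1,3)] by blast
qed

lemma vle_mult_cancel: "z \<noteq> 0 \<Longrightarrow> x * z \<preceq> y * z \<longleftrightarrow> x \<preceq> y"
  by (auto simp: vle_def mult.assoc[symmetric])

lemma vle_mult_cancel_left: "z \<noteq> 0 \<Longrightarrow> z * x \<preceq> z * y \<longleftrightarrow> x \<preceq> y"
  using vle_mult_cancel[of z x y] by (simp add: mult.commute)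

lemma vlt_mult_cancel: "z \<noteq> 0 \<Longrightarrow> x * z \<lless> y * z \<longleftrightarrow> x \<lless> y"
  by (simp add: vlt_def vle_mult_cancel)

lemma vlt_mult_cancel_left: "z \<noteq> 0 \<Longrightarrow> z * x \<lless> z * y \<longleftrightarrow> x \<lless> y"
  by (simp add: vlt_def vle_mult_cancel_left)

lemma vlt_vle_mult: "x \<lless> y \<Longrightarrow> u \<preceq> w \<Longrightarrow> w \<noteq> 0 \<Longrightarrow> x * u \<lless> y * w"
  using vle_vlt_trans[OF vle_mult[OF vle_refl[of x], of u w]] vlt_mult_cancel by blast

lemma vle_vlt_mult: "x \<preceq> y \<Longrightarrow> u \<lless> w \<Longrightarrow> y \<noteq> 0 \<Longrightarrow> x * u \<lless> y * w"
  using vlt_vle_mult[of u w x y] by (simp add: mult.commute)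

lemma vlt_mult: "x \<lless> y \<Longrightarrow> u \<lless> w \<Longrightarrow> x * u \<lless> y * w"
  using vlt_vle_mult[of x y u w] vlt_imp_vle by (metis not_vlt_zero)

lemma vle_divide_iff: "z \<noteq> 0 \<Longrightarrow> x / z \<preceq> y \<longleftrightarrow> x \<preceq> y * z"
  using vle_mult_cancel[of z "x / z" y] by simp

lemma vle_divide_iff': "z \<noteq> 0 \<Longrightarrow> x \<preceq> y / z \<longleftrightarrow> x * z \<preceq> y"
  using vle_mult_cancel[of z x "y / z"] by simp

lemma vlt_divide_iff: "z \<noteq> 0 \<Longrightarrow> x / z \<lless> y \<longleftrightarrow> x \<lless> y * z"
  by (simp add: vlt_def vle_divide_iff')

lemma vle_power: "x \<preceq> y \<Longrightarrow> x ^ n \<preceq> y ^ n"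
  by (induction n) (auto intro: vle_mult)

lemma vlt_power: "x \<lless> y \<Longrightarrow> n > 0 \<Longrightarrow> x ^ n \<lless> y ^ n"
proof (induction n)
  case (Suc n)
  then show ?case by (cases n) (auto intro: vlt_mult)
qed simp

lemma vle_square_iff: "x * x \<preceq> y * y \<longleftrightarrow> x \<preceq> y"
  using vle_mult[of x y x y] vlt_mult[of y x y x] by (auto simp: vlt_def)

lemma vlt_square_iff: "x * x \<lless> y * y \<longleftrightarrow> x \<lless> y"
  by (simp add: vlt_def vle_square_iff)

lemma vle_add_absorb: "x \<lless> y \<Longrightarrow> y \<preceq> x + y"
  using vlt_diff[of "x + y" y x] by (auto simp: vlt_def)

lemma sign_add_absorb: "x \<lless> y \<Longrightarrow> 0 < x + y \<longleftrightarrow> 0 < y"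
  using vlt_imp_abs_less[of x y] by (auto simp: abs_if split: if_splits)

definition veq :: "'a \<Rightarrow> 'a \<Rightarrow> bool" where
  "veq x y \<longleftrightarrow> x \<preceq> y \<and> y \<preceq> x"

lemma veq_refl [simp]: "veq x x"
  and veq_sym: "veq x y \<Longrightarrow> veq y x"
  and veq_trans: "veq x y \<Longrightarrow> veq y z \<Longrightarrow> veq x z"
  and veq_mult: "veq x y \<Longrightarrow> veq u w \<Longrightarrow> veq (x * u) (y * w)"
  by (auto simp: veq_def intro: vle_trans vle_mult)

lemma veq_zero_iff [simp]: "veq x 0 \<longleftrightarrow> x = 0" "veq 0 x \<longleftrightarrow> x = 0"
  by (auto simp: veq_def)

lemma veq_mult_cancel: "z \<noteq> 0 \<Longrightarrow> veq (x * z) (y * z) \<longleftrightarrow> veq x y"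
  by (simp add: veq_def vle_mult_cancel)

lemma veq_divide: "veq x y \<Longrightarrow> veq u w \<Longrightarrow> veq (x / u) (y / w)"
proof (cases "u = 0")
  case False
  assume *: "veq x y" "veq u w"
  then have "w \<noteq> 0" using False by auto
  have "veq (x * w) (y * u)" by (intro veq_mult *(1) veq_sym[OF *(2)])
  moreover have "(x / u) * (u * w) = x * w" "(y / w) * (u * w) = y * u"
    using False \<open>w \<noteq> 0\<close> by simp_all
  ultimately have "veq ((x / u) * (u * w)) ((y / w) * (u * w))" by simp
  then show "veq (x / u) (y / w)" using False \<open>w \<noteq> 0\<close> by (subst (asm) veq_mult_cancel) auto
qed auto

lemma veq_vle_cong: "veq x x' \<Longrightarrow> veq y y' \<Longrightarrow> x \<preceq> y \<longleftrightarrow> x' \<preceq> y'"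
  unfolding veq_def by (blast intro: vle_trans)

lemma veq_vlt_cong: "veq x x' \<Longrightarrow> veq y y' \<Longrightarrow> x \<lless> y \<longleftrightarrow> x' \<lless> y'"
  using veq_vle_cong[of y y' x x'] by (simp add: vlt_def)

lemma veq_add_absorb: "x \<lless> y \<Longrightarrow> veq (x + y) y"
  unfolding veq_def using vle_add_absorb vlt_imp_vle by (auto intro: vle_add)

lemma veq_uminus [simp]: "veq (- x) y \<longleftrightarrow> veq x y" "veq x (- y) \<longleftrightarrow> veq x y"
  by (auto simp: veq_def)

lemma veq_abs [simp]: "veq \<bar>x\<bar> y \<longleftrightarrow> veq x y" "veq x \<bar>y\<bar> \<longleftrightarrow> veq x y"
  by (auto simp: veq_def)

text \<open>Nonnegative summands cannot cancel: each is bounded by the sum.\<close>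

lemma vle_add_pos:
  assumes "0 \<le> x" "0 \<le> y" shows "x + y \<preceq> z \<longleftrightarrow> x \<preceq> z \<and> y \<preceq> z"
proof -
  have "x \<preceq> x + y" "y \<preceq> x + y" using assms by (auto intro: vle_if_abs_le)
  then show ?thesis using vle_add vle_trans by blast
qed

end

subsection \<open>Graphs of partial embeddings\<close>

text \<open>Partial maps as sets of pairs: inverting, extending and taking unions of chains are then
  set operations. Being single-valued and injective is not demanded; both follow from the
  preservation of signs in \<open>order_graph\<close>.\<close>

definition subring_graph :: "('a::linordered_field \<times> 'a) set \<Rightarrow> bool" where
  "subring_graph D \<longleftrightarrow> (0, 0) \<in> D \<and> (1, 1) \<in> D \<and> (\<forall>x y. (x, y) \<in> D \<longrightarrow> (- x, - y) \<in> D) \<and>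
     (\<forall>x y x' y'. (x, y) \<in> D \<longrightarrow> (x', y') \<in> D \<longrightarrow> (x + x', y + y') \<in> D \<and> (x * x', y * y') \<in> D)"

definition order_graph :: "('a::linordered_field \<times> 'a) set \<Rightarrow> bool" where
  "order_graph D \<longleftrightarrow> subring_graph D \<and> (\<forall>x y. (x, y) \<in> D \<longrightarrow> (0 < x \<longleftrightarrow> 0 < y))"

definition field_graph :: "('a::linordered_field \<times> 'a) set \<Rightarrow> bool" where
  "field_graph G \<longleftrightarrow> order_graph G \<and> (\<forall>x y. (x, y) \<in> G \<longrightarrow> (inverse x, inverse y) \<in> G)"

definition frac_graph :: "('a::linordered_field \<times> 'a) set \<Rightarrow> ('a \<times> 'a) set" where
  "frac_graph D = {(x / x', y / y') | x y x' y'. (x, y) \<in> D \<and> (x', y') \<in> D \<and> x' \<noteq> 0}"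

context
  fixes D :: "('a::linordered_field \<times> 'a) set"
  assumes D: "subring_graph D"
begin

lemma subring_graph_0: "(0, 0) \<in> D" and subring_graph_1: "(1, 1) \<in> D"
  using D by (auto simp: subring_graph_def)

lemma subring_graph_uminus: "(x, y) \<in> D \<Longrightarrow> (- x, - y) \<in> D"
  and subring_graph_add: "(x, y) \<in> D \<Longrightarrow> (x', y') \<in> D \<Longrightarrow> (x + x', y + y') \<in> D"
  and subring_graph_mult: "(x, y) \<in> D \<Longrightarrow> (x', y') \<in> D \<Longrightarrow> (x * x', y * y') \<in> D"
  using D unfolding subring_graph_def by blast+

lemma subring_graph_diff: "(x, y) \<in> D \<Longrightarrow> (x', y') \<in> D \<Longrightarrow> (x - x', y - y') \<in> D"
  using subring_graph_add[OF _ subring_graph_uminus, of x y x' y'] by simp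

lemma subring_graph_power: "(x, y) \<in> D \<Longrightarrow> (x ^ n, y ^ n) \<in> D"
  by (induction n) (auto intro: subring_graph_1 subring_graph_mult)

lemma subring_graph_of_nat: "(of_nat n, of_nat n) \<in> D"
  by (induction n) (auto intro: subring_graph_0 subring_graph_1 subring_graph_add)

lemma subring_graph_sum: "(\<And>i. i \<in> I \<Longrightarrow> (f i, g i) \<in> D) \<Longrightarrow> (sum f I, sum g I) \<in> D"
  by (induction I rule: infinite_finite_induct) (auto intro: subring_graph_0 subring_graph_add)

end

context
  fixes D :: "('a::linordered_field \<times> 'a) set"
  assumes D: "order_graph D"
begin

lemma order_graph_subring: "subring_graph D"
  using D by (simp add: order_graph_def)

lemma order_graph_pos: "(x, y) \<in> D \<Longrightarrow> 0 < x \<longleftrightarrow> 0 < y"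
  using D by (auto simp: order_graph_def)

lemma order_graph_neg: "(x, y) \<in> D \<Longrightarrow> x < 0 \<longleftrightarrow> y < 0"
  using order_graph_pos[OF subring_graph_uminus[OF order_graph_subring]] by simp

lemma order_graph_zero: "(x, y) \<in> D \<Longrightarrow> x = 0 \<longleftrightarrow> y = 0"
  unfolding order_eq_iff not_less[symmetric] using order_graph_pos[of x y] order_graph_neg[of x y] by simp

lemma order_graph_less: "(x, y) \<in> D \<Longrightarrow> (x', y') \<in> D \<Longrightarrow> x < x' \<longleftrightarrow> y < y'"
  using order_graph_pos[OF subring_graph_diff[OF order_graph_subring], of x' y' x y] by simp

lemma order_graph_eq: "(x, y) \<in> D \<Longrightarrow> (x', y') \<in> D \<Longrightarrow> x = x' \<longleftrightarrow> y = y'"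
  using order_graph_zero[OF subring_graph_diff[OF order_graph_subring], of x y x' y'] by simp

lemma order_graph_abs: "(x, y) \<in> D \<Longrightarrow> (\<bar>x\<bar>, \<bar>y\<bar>) \<in> D"
  using order_graph_neg[of x y] subring_graph_uminus[OF order_graph_subring] by (auto simp: abs_if)

lemma frac_graphI:
  "(x, y) \<in> D \<Longrightarrow> (x', y') \<in> D \<Longrightarrow> x' \<noteq> 0 \<Longrightarrow> (x / x', y / y') \<in> frac_graph D"
  by (auto simp: frac_graph_def)

lemma frac_graph_incl: "D \<subseteq> frac_graph D"
  using frac_graphI[OF _ subring_graph_1[OF order_graph_subring]] by auto

lemma field_graph_frac: "field_graph (frac_graph D)"
proof -
  note S = order_graph_subring
  have pos: "0 < x \<longleftrightarrow> 0 < y" if "(x, y) \<in> frac_graph D" for x y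
  proof -
    obtain a b c d where *: "x = a / b" "y = c / d" "(a, c) \<in> D" "(b, d) \<in> D"
      using \<open>(x, y) \<in> frac_graph D\<close> by (auto simp: frac_graph_def)
    then show ?thesis
      using order_graph_pos order_graph_neg by (simp add: zero_less_divide_iff)
  qed
  have inv: "(inverse x, inverse y) \<in> frac_graph D" if "(x, y) \<in> frac_graph D" for x y
  proof -
    obtain a b c d where *: "x = a / b" "y = c / d" "(a, c) \<in> D" "(b, d) \<in> D"
      using \<open>(x, y) \<in> frac_graph D\<close> by (auto simp: frac_graph_def)
    show ?thesis
    proof (cases "a = 0")
      case True
      then have "c = 0" using order_graph_zero * by blast
      then show ?thesis using True * frac_graph_incl subring_graph_0[OF S] by auto
    next
      case False
      then show ?thesis using frac_graphI[OF *(4,3)] * by simp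
    qed
  qed
  have mult: "(x * x', y * y') \<in> frac_graph D" and add: "(x + x', y + y') \<in> frac_graph D"
    if xy: "(x, y) \<in> frac_graph D" "(x', y') \<in> frac_graph D" for x y x' y'
  proof -
    obtain a b c d a' b' c' d' where
      *: "x = a / b" "y = c / d" "(a, c) \<in> D" "(b, d) \<in> D" "b \<noteq> 0"
        "x' = a' / b'" "y' = c' / d'" "(a', c') \<in> D" "(b', d') \<in> D" "b' \<noteq> 0"
      using xy by (auto simp: frac_graph_def)
    then have "d \<noteq> 0" "d' \<noteq> 0" using order_graph_zero by blast+
    have "x * x' = (a * a') / (b * b')" "y * y' = (c * c') / (d * d')"
      "x + x' = (a * b' + a' * b) / (b * b')" "y + y' = (c * d' + c' * d) / (d * d')"
      using * \<open>d \<noteq> 0\<close> \<open>d' \<noteq> 0\<close> by (simp_all add: add_frac_eq)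
    moreover have "(a * a', c * c') \<in> D" "(b * b', d * d') \<in> D" "(a * b' + a' * b, c * d' + c' * d) \<in> D"
      using * by (auto intro!: subring_graph_add[OF S] subring_graph_mult[OF S])
    moreover have "b * b' \<noteq> 0" using * by simp
    ultimately show "(x * x', y * y') \<in> frac_graph D" "(x + x', y + y') \<in> frac_graph D"
      by (auto intro!: frac_graphI)
  qed
  have uminus: "(- x, - y) \<in> frac_graph D" if "(x, y) \<in> frac_graph D" for x y
    using mult[OF subsetD[OF frac_graph_incl] that, of "- 1" "- 1"]
      subring_graph_uminus[OF S subring_graph_1[OF S]] by simp
  have z: "(0, 0) \<in> frac_graph D" "(1, 1) \<in> frac_graph D"
    using frac_graph_incl subring_graph_0[OF S] subring_graph_1[OF S] by auto
  show ?thesis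
    unfolding field_graph_def order_graph_def subring_graph_def
    by (intro conjI allI impI; (rule add mult, assumption, assumption | rule pos inv uminus, assumption | rule z))
qed

end

context
  fixes G :: "('a::linordered_field \<times> 'a) set"
  assumes G: "field_graph G"
begin

lemma field_graph_order: "order_graph G"
  using G by (simp add: field_graph_def)

lemma field_graph_subring: "subring_graph G"
  by (rule order_graph_subring[OF field_graph_order])

lemma field_graph_inverse: "(x, y) \<in> G \<Longrightarrow> (inverse x, inverse y) \<in> G"
  using G by (auto simp: field_graph_def)

lemma field_graph_divide: "(x, y) \<in> G \<Longrightarrow> (x', y') \<in> G \<Longrightarrow> (x / x', y / y') \<in> G"
  unfolding divide_inverse by (intro subring_graph_mult[OF field_graph_subring] field_graph_inverse)

lemma is_subfield_Domain: "is_subfield (Domain G)"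
  unfolding is_subfield_def
proof (intro conjI ballI)
  show "0 \<in> Domain G" "1 \<in> Domain G"
    using subring_graph_0[OF field_graph_subring] subring_graph_1[OF field_graph_subring] by auto
next
  fix x y assume "x \<in> Domain G" "y \<in> Domain G"
  then show "x + y \<in> Domain G" "x * y \<in> Domain G"
    using subring_graph_add[OF field_graph_subring] subring_graph_mult[OF field_graph_subring] by blast+
next
  fix x assume "x \<in> Domain G"
  then show "- x \<in> Domain G" "inverse x \<in> Domain G"
    using subring_graph_uminus[OF field_graph_subring] field_graph_inverse by blast+
qed

lemma field_graph_converse: "field_graph (G\<inverse>)"
  using G unfolding field_graph_def order_graph_def subring_graph_def by auto

end

definition poly_graph :: "('a::linordered_field \<times> 'a) set \<Rightarrow> ('a poly \<times> 'a poly) set" where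
  "poly_graph G = {(p, p'). \<forall>i. (coeff p i, coeff p' i) \<in> G}"

context
  fixes G :: "('a::linordered_field \<times> 'a) set"
  assumes G: "field_graph G"
begin

lemma poly_graph_0: "(0, 0) \<in> poly_graph G"
  by (simp add: poly_graph_def subring_graph_0[OF field_graph_subring[OF G]])

lemma poly_graph_pCons: "(a, a') \<in> G \<Longrightarrow> (p, p') \<in> poly_graph G \<Longrightarrow> (pCons a p, pCons a' p') \<in> poly_graph G"
  by (auto simp: poly_graph_def coeff_pCons split: nat.split)

lemma poly_graph_add: "(p, p') \<in> poly_graph G \<Longrightarrow> (q, q') \<in> poly_graph G \<Longrightarrow> (p + q, p' + q') \<in> poly_graph G"
  by (auto simp: poly_graph_def intro: subring_graph_add[OF field_graph_subring[OF G]])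

lemma poly_graph_uminus: "(p, p') \<in> poly_graph G \<Longrightarrow> (- p, - p') \<in> poly_graph G"
  by (auto simp: poly_graph_def intro: subring_graph_uminus[OF field_graph_subring[OF G]])

lemma poly_graph_mult: "(p, p') \<in> poly_graph G \<Longrightarrow> (q, q') \<in> poly_graph G \<Longrightarrow> (p * q, p' * q') \<in> poly_graph G"
  by (auto simp: poly_graph_def coeff_mult intro!: subring_graph_sum[OF field_graph_subring[OF G]]
      subring_graph_mult[OF field_graph_subring[OF G]])

lemma poly_graph_pderiv: "(p, p') \<in> poly_graph G \<Longrightarrow> (pderiv p, pderiv p') \<in> poly_graph G"
  by (auto simp: poly_graph_def coeff_pderiv simp del: of_nat_Suc intro!: subring_graph_of_nat[OF field_graph_subring[OF G]]
      subring_graph_mult[OF field_graph_subring[OF G]])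

lemma poly_graph_domain: "(p, p') \<in> poly_graph G \<Longrightarrow> p \<in> polys_over (Domain G)"
  by (auto simp: poly_graph_def polys_over_def)

lemma poly_graph_eq: "(p, p') \<in> poly_graph G \<Longrightarrow> (q, q') \<in> poly_graph G \<Longrightarrow> p = q \<longleftrightarrow> p' = q'"
  using order_graph_eq[OF field_graph_order[OF G]] unfolding poly_graph_def poly_eq_iff by blast

lemma poly_graph_degree:
  assumes "(p, p') \<in> poly_graph G" shows "degree p' = degree p"
proof -
  have "coeff p i = 0 \<longleftrightarrow> coeff p' i = 0" for i
    using assms order_graph_zero[OF field_graph_order[OF G]] by (auto simp: poly_graph_def)
  then show ?thesis by (simp add: degree_def)
qed

lemma poly_graph_zero_iff: "(p, p') \<in> poly_graph G \<Longrightarrow> p = 0 \<longleftrightarrow> p' = 0"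
  using poly_graph_eq[OF _ poly_graph_0] .

lemma poly_graph_poly:
  assumes "(p, p') \<in> poly_graph G" "(x, x') \<in> G" shows "(poly p x, poly p' x') \<in> G"
  unfolding poly_altdef poly_graph_degree[OF assms(1)] using assms
  by (auto simp: poly_graph_def intro!: subring_graph_sum[OF field_graph_subring[OF G]]
      subring_graph_mult[OF field_graph_subring[OF G]] subring_graph_power[OF field_graph_subring[OF G]])

lemma poly_graph_total:
  assumes "p \<in> polys_over (Domain G)" obtains p' where "(p, p') \<in> poly_graph G"
proof -
  define f where "f = (\<lambda>x. SOME y. (x, y) \<in> G)"
  have f: "(x, f x) \<in> G" if "x \<in> Domain G" for x
    using that unfolding f_def by (auto intro: someI)
  have "f 0 = 0"
    using f[of 0] subring_graph_0[OF field_graph_subring[OF G]]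
      order_graph_eq[OF field_graph_order[OF G], of 0 0 0 "f 0"] by auto
  then have "(p, map_poly f p) \<in> poly_graph G"
    using assms f by (auto simp: poly_graph_def polys_over_def coeff_map_poly)
  then show thesis by (rule that)
qed

lemma poly_graph_const: "(a, a') \<in> G \<Longrightarrow> ([:a:], [:a':]) \<in> poly_graph G"
  by (intro poly_graph_pCons poly_graph_0)

text \<open>The graph carries a division equation to a division equation with the same degrees, and
  uniqueness identifies its quotient and remainder.\<close>

lemma poly_graph_div_mod:
  assumes p: "(p, p') \<in> poly_graph G" and d: "(d, d') \<in> poly_graph G" and "d \<noteq> 0"
  shows "(p div d, p' div d') \<in> poly_graph G" "(p mod d, p' mod d') \<in> poly_graph G"
proof -
  note K = is_subfield_Domain[OF G]
  have "p div d \<in> polys_over (Domain G)" "p mod d \<in> polys_over (Domain G)"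
    using polys_over_div_mod[OF K poly_graph_domain[OF d] poly_graph_domain[OF p]] by auto
  then obtain q r where q: "(p div d, q) \<in> poly_graph G" and r: "(p mod d, r) \<in> poly_graph G"
    by (meson poly_graph_total)
  have "(p div d * d + p mod d, q * d' + r) \<in> poly_graph G"
    by (intro poly_graph_add poly_graph_mult q r d)
  then have p': "p' = q * d' + r" using poly_graph_eq[OF p, of p "q * d' + r"] by simp
  have "d' \<noteq> 0" using poly_graph_zero_iff[OF d] \<open>d \<noteq> 0\<close> by simp
  moreover have "r = 0 \<or> degree r < degree d'"
    using degree_mod_less[OF \<open>d \<noteq> 0\<close>, of p] poly_graph_zero_iff[OF r] poly_graph_degree[OF r]
      poly_graph_degree[OF d] by auto
  ultimately have "p' div d' = q" "p' mod d' = r"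
    by (auto simp: p' mod_poly_less div_poly_less div_plus_div_distrib_dvd_left)
  then show "(p div d, p' div d') \<in> poly_graph G" "(p mod d, p' mod d') \<in> poly_graph G"
    using q r by auto
qed

text \<open>The only candidate for an extension sending \<open>x\<close> to \<open>y\<close>. It
  need not be single-valued until it is shown to preserve signs.\<close>

definition adjoin_graph :: "'a \<Rightarrow> 'a \<Rightarrow> ('a \<times> 'a) set" where
  "adjoin_graph x y = {(poly p x, poly p' y) | p p'. (p, p') \<in> poly_graph G}"

lemma adjoin_graph_incl: "G \<subseteq> adjoin_graph x y"
proof safe
  fix a b assume "(a, b) \<in> G"
  then have "([:a:], [:b:]) \<in> poly_graph G" by (rule poly_graph_const)
  then show "(a, b) \<in> adjoin_graph x y" unfolding adjoin_graph_def by force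
qed

lemma adjoin_graph_mem: "(x, y) \<in> adjoin_graph x y"
proof -
  have "([:0, 1:], [:0, 1:]) \<in> poly_graph G"
    using subring_graph_0[OF field_graph_subring[OF G]] subring_graph_1[OF field_graph_subring[OF G]]
    by (intro poly_graph_pCons poly_graph_0)
  then show ?thesis unfolding adjoin_graph_def by force
qed

lemma subring_graph_adjoin: "subring_graph (adjoin_graph x y)"
  unfolding subring_graph_def
proof safe
  show "(0, 0) \<in> adjoin_graph x y" "(1, 1) \<in> adjoin_graph x y"
    using adjoin_graph_incl subring_graph_0[OF field_graph_subring[OF G]]
      subring_graph_1[OF field_graph_subring[OF G]] by auto
next
  fix a b assume "(a, b) \<in> adjoin_graph x y"
  then obtain p p' where "(p, p') \<in> poly_graph G" "a = poly p x" "b = poly p' y"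
    by (auto simp: adjoin_graph_def)
  then show "(- a, - b) \<in> adjoin_graph x y"
    unfolding adjoin_graph_def using poly_graph_uminus by (force simp flip: poly_minus)
next
  fix a b c d assume "(a, b) \<in> adjoin_graph x y" "(c, d) \<in> adjoin_graph x y"
  then obtain p p' q q' where "(p, p') \<in> poly_graph G" "a = poly p x" "b = poly p' y"
    "(q, q') \<in> poly_graph G" "c = poly q x" "d = poly q' y"
    by (auto simp: adjoin_graph_def)
  then show "(a + c, b + d) \<in> adjoin_graph x y" "(a * c, b * d) \<in> adjoin_graph x y"
    unfolding adjoin_graph_def using poly_graph_add poly_graph_mult
    by (force simp flip: poly_add, force simp flip: poly_mult)
qed

end

subsection \<open>Algebraic elements\<close>

definition alg_over :: "'a::field set \<Rightarrow> 'a \<Rightarrow> bool" where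
  "alg_over K x \<longleftrightarrow> (\<exists>p\<in>polys_over K. p \<noteq> 0 \<and> poly p x = 0)"

lemma alg_overI: "p \<in> polys_over K \<Longrightarrow> p \<noteq> 0 \<Longrightarrow> poly p x = 0 \<Longrightarrow> alg_over K x"
  by (auto simp: alg_over_def)

context
  fixes K :: "'a::linordered_field set"
  assumes K: "is_subfield K"
begin

text \<open>By Newton's identities, a finite family whose power sums lie in \<open>K\<close>
  consists of the roots of a polynomial over \<open>K\<close>. This criterion and its converse
  \<open>alg_over_conjugates\<close> replace linear algebra in the closure properties of algebraic
  elements.\<close>

lemma alg_over_if_power_sums:
  assumes "finite I" "\<And>k. (\<Sum>i\<in>I. z i ^ Suc k) \<in> to_ac ` K" "i \<in> I" "z i = to_ac x"
  shows "alg_over K x"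
proof -
  note T = is_subfield_to_ac[OF K]
  have "(\<Prod>i\<in>I. [:- z i, 1:]) \<in> polys_over (to_ac ` K)"
    using prod_linear_over_iff[OF T assms(1), of z] assms(2) by blast
  then obtain q where q: "q \<in> polys_over K" "(\<Prod>i\<in>I. [:- z i, 1:]) = map_poly to_ac q"
    using polys_over_range_to_ac by blast
  have "(\<Prod>i\<in>I. [:- z i, 1:]) \<noteq> 0" using assms(1) by (simp add: prod_zero_iff)
  then have "q \<noteq> 0" using q(2) by auto
  have "to_ac (poly q x) = poly (\<Prod>i\<in>I. [:- z i, 1:]) (to_ac x)"
    by (simp add: q(2) poly_map_poly_to_ac)
  also have "\<dots> = 0" using assms(1,3) by (auto simp: poly_prod assms(4)[symmetric])
  finally have "poly q x = 0" by simp
  then show ?thesis using q \<open>q \<noteq> 0\<close> by (intro alg_overI)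
qed

lemma alg_over_conjugates:
  assumes "alg_over K x"
  shows "\<exists>(n::nat) r. (\<exists>i<n. r i = to_ac x) \<and> (\<forall>a. (\<Sum>i<n. r i ^ a) \<in> to_ac ` K)"
proof -
  note T = is_subfield_to_ac[OF K]
  obtain p where p: "p \<in> polys_over K" "p \<noteq> 0" "poly p x = 0" using assms by (auto simp: alg_over_def)
  define P where "P = map_poly to_ac p"
  have "P \<in> polys_over (to_ac ` K)" using p by (auto simp: P_def polys_over_def coeff_map_poly)
  moreover have "P \<noteq> 0" using p(2) by (auto simp: P_def poly_eq_iff coeff_map_poly)
  ultimately obtain r where r: "P = smult (lead_coeff P) (\<Prod>i<degree P. [:- r i, 1:])"
    "\<And>a. (\<Sum>i<degree P. r i ^ a) \<in> to_ac ` K"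
    using poly_roots_power_sums[OF T] by blast
  have "poly P (to_ac x) = 0" using p by (simp add: P_def poly_map_poly_to_ac)
  then have "lead_coeff P * (\<Prod>i<degree P. to_ac x - r i) = 0"
    by (subst (asm) r(1)) (simp add: poly_prod)
  then obtain i where "i < degree P" "r i = to_ac x" using \<open>P \<noteq> 0\<close> by auto
  then show ?thesis using r(2) by blast
qed

text \<open>For the family of all products of a conjugate of \<open>x\<close> and a conjugate of
  \<open>y\<close>, each power sum is the product of two power sums.\<close>

lemma alg_over_mult:
  assumes "alg_over K x" "alg_over K y" shows "alg_over K (x * y)"
proof -
  note T = is_subfield_to_ac[OF K]
  obtain n r i where r: "i < (n::nat)" "r i = to_ac x" "\<And>a. (\<Sum>i<n. r i ^ a) \<in> to_ac ` K"
    using alg_over_conjugates[OF assms(1)] by blast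
  obtain m s j where s: "j < (m::nat)" "s j = to_ac y" "\<And>a. (\<Sum>j<m. s j ^ a) \<in> to_ac ` K"
    using alg_over_conjugates[OF assms(2)] by blast
  show ?thesis
  proof (rule alg_over_if_power_sums)
    show "finite ({..<n} \<times> {..<m})" by simp
    show "(i, j) \<in> {..<n} \<times> {..<m}" using r s by simp
    show "(case (i, j) of (i, j) \<Rightarrow> r i * s j) = to_ac (x * y)" using r s by simp
    fix k
    have "(\<Sum>x\<in>{..<n} \<times> {..<m}. (case x of (i, j) \<Rightarrow> r i * s j) ^ Suc k)
        = (\<Sum>i<n. \<Sum>j<m. r i ^ Suc k * s j ^ Suc k)"
      by (simp add: sum.cartesian_product case_prod_unfold power_mult_distrib mult_ac)
    also have "\<dots> = (\<Sum>i<n. r i ^ Suc k) * (\<Sum>j<m. s j ^ Suc k)"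
      by (simp add: sum_product)
    also have "\<dots> \<in> to_ac ` K" by (intro is_subfield_mult[OF T] r s)
    finally show "(\<Sum>x\<in>{..<n} \<times> {..<m}. (case x of (i, j) \<Rightarrow> r i * s j) ^ Suc k) \<in> to_ac ` K" .
  qed
qed

lemma alg_over_inverse:
  assumes "alg_over K x" shows "alg_over K (inverse x)"
proof (cases "x = 0")
  case True then show ?thesis using assms by simp
next
  case False
  obtain p where p: "p \<in> polys_over K" "p \<noteq> 0" "poly p x = 0" using assms by (auto simp: alg_over_def)
  show ?thesis
  proof (rule alg_overI)
    show "reflect_poly p \<in> polys_over K"
      using p(1) is_subfield_0[OF K] by (auto simp: polys_over_def coeff_reflect_poly)
    show "poly (reflect_poly p) (inverse x) = 0"
      using False p by (subst poly_reflect_poly_nz) auto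
  qed (use p in simp)
qed

text \<open>If \<open>q\<close> is applied to all conjugates of \<open>x\<close>, the new power sums
  are combinations over \<open>K\<close> of the old ones.\<close>

lemma alg_over_poly:
  assumes "alg_over K x" "q \<in> polys_over K" shows "alg_over K (poly q x)"
proof -
  note T = is_subfield_to_ac[OF K]
  obtain n r i where r: "i < (n::nat)" "r i = to_ac x" "\<And>a. (\<Sum>i<n. r i ^ a) \<in> to_ac ` K"
    using alg_over_conjugates[OF assms(1)] by blast
  define Q where "Q = map_poly to_ac q"
  have Q: "Q \<in> polys_over (to_ac ` K)" using assms(2) by (auto simp: Q_def polys_over_def coeff_map_poly)
  have pow: "Q ^ k \<in> polys_over (to_ac ` K)" for k
    by (induction k) (auto simp: one_pCons intro: Q polys_over_mult[OF T] polys_over_pCons[OF T] polys_over_0[OF T] is_subfield_1[OF T])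
  show ?thesis
  proof (rule alg_over_if_power_sums)
    show "finite {..<n}" by simp
    show "i \<in> {..<n}" using r by simp
    show "poly Q (r i) = to_ac (poly q x)" by (simp add: r Q_def poly_map_poly_to_ac)
    fix k
    have "(\<Sum>i<n. poly Q (r i) ^ Suc k) = (\<Sum>i<n. poly (Q ^ Suc k) (r i))" by (simp add: poly_power)
    also have "\<dots> = (\<Sum>j\<le>degree (Q ^ Suc k). coeff (Q ^ Suc k) j * (\<Sum>i<n. r i ^ j))"
      unfolding poly_altdef sum_distrib_left by (rule sum.swap)
    also have "\<dots> \<in> to_ac ` K"
      by (intro is_subfield_sum[OF T] is_subfield_mult[OF T] r polys_over_coeff[OF pow])
    finally show "(\<Sum>i<n. poly Q (r i) ^ Suc k) \<in> to_ac ` K" .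
  qed
qed

end

context convex_valuation
begin

lemma vle_maximal:
  assumes "finite A" "A \<noteq> {}" obtains m where "m \<in> A" "\<And>k. k \<in> A \<Longrightarrow> f k \<preceq> f m"
proof -
  have "\<exists>m\<in>A. \<forall>k\<in>A. f k \<preceq> f m"
    using assms
  proof (induction rule: finite_ne_induct)
    case (insert a A)
    then obtain m where m: "m \<in> A" "\<forall>k\<in>A. f k \<preceq> f m" by blast
    show ?case
    proof (cases "f a \<preceq> f m")
      case True then show ?thesis using m by auto
    next
      case False
      then have "f m \<preceq> f a" using vle_total by blast
      then show ?thesis using m vle_trans by (intro bexI[of _ a]) auto
    qed
  qed simp
  then show thesis using that by blast
qed

text \<open>The elements of \<open>V\<close> algebraic over \<open>K\<close> lie in the convex hull of \<open>K \<inter> V\<close>: normalize the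
  equation so that all coefficients are in \<open>V\<close> and the last unit coefficient is \<open>1\<close>.\<close>

lemma alg_over_V_bound:
  assumes K: "is_subfield K" and x: "alg_over K x" "x \<in> V"
  shows "\<exists>c\<in>K \<inter> V. \<bar>x\<bar> \<le> c"
proof -
  note KI = is_subfield_intros[OF K]
  obtain p where p: "p \<in> polys_over K" "p \<noteq> 0" "poly p x = 0" using x by (auto simp: alg_over_def)
  define N where "N = degree p"
  define M where "M = {i\<in>{..N}. \<forall>k\<le>N. coeff p k \<preceq> coeff p i}"
  have "finite M" by (simp add: M_def)
  have "M \<noteq> {}"
    using vle_maximal[of "{..N}" "coeff p"] by (auto simp: M_def)
  define m where "m = Max M"
  have m: "m \<le> N" "\<And>k. k \<le> N \<Longrightarrow> coeff p k \<preceq> coeff p m"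
    using Max_in[OF \<open>finite M\<close> \<open>M \<noteq> {}\<close>] by (auto simp: m_def M_def)
  have gt: "coeff p i \<lless> coeff p m" if "m < i" "i \<le> N" for i
  proof (rule ccontr)
    assume "\<not> coeff p i \<lless> coeff p m"
    then have "coeff p m \<preceq> coeff p i" by (simp add: not_vlt)
    then have "i \<in> M" using m that vle_trans by (auto simp: M_def)
    then show False using Max_ge[OF \<open>finite M\<close>, of i] that by (simp add: m_def)
  qed
  have "coeff p m \<noteq> 0"
    using m(2)[of N] p(2) by (auto simp: N_def)
  define b where "b = (\<lambda>i. coeff p i / coeff p m)"
  have bK: "b i \<in> K" for i using p(1) by (auto simp: b_def polys_over_def intro: KI)
  have bm: "b m = 1" using \<open>coeff p m \<noteq> 0\<close> by (simp add: b_def)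
  have bV: "b i \<in> V" if "i \<le> N" for i
    using m(2)[OF that] \<open>coeff p m \<noteq> 0\<close> by (simp add: b_def vle_divide_iff flip: vle_1_iff)
  have blt: "b i \<lless> 1" if "m < i" "i \<le> N" for i
    using gt[OF that] \<open>coeff p m \<noteq> 0\<close> by (simp add: b_def vlt_divide_iff)
  define s where "s = (\<Sum>i<m. b i * x ^ i)"
  define e where "e = (\<Sum>i\<in>{m<..N}. b i * x ^ i)"
  have "(\<Sum>i\<le>N. b i * x ^ i) = poly p x / coeff p m"
    by (simp add: poly_altdef N_def b_def sum_divide_distrib)
  then have "(\<Sum>i\<le>N. b i * x ^ i) = 0" using p by simp
  moreover have "{..N} = insert m ({..<m} \<union> {m<..N})" using m by auto
  then have "(\<Sum>i\<le>N. b i * x ^ i) = x ^ m + (s + e)"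
    unfolding s_def e_def by (simp add: bm) (subst sum.union_disjoint, auto)
  ultimately have eq: "x ^ m = - s - e" by (simp add: algebra_simps eq_neg_iff_add_eq_0)
  have xp: "x ^ i \<preceq> 1" for i using vle_power[of x 1 i] x by (simp add: vle_1_iff)
  have "e \<lless> 1"
    unfolding e_def
  proof (rule vlt_sum)
    fix i assume "i \<in> {m<..N}"
    then show "b i * x ^ i \<lless> 1" using vlt_vle_mult[OF blt xp, of i i] by simp
  qed simp
  have m0: "m \<noteq> 0"
  proof
    assume "m = 0"
    then have "1 = - e" using eq by (simp add: s_def)
    then show False using \<open>e \<lless> 1\<close> by (metis vlt_irrefl vlt_uminus(1))
  qed
  have e1: "\<bar>e\<bar> \<le> 1" using vlt_imp_abs_less[OF \<open>e \<lless> 1\<close>] by simp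
  \<comment> \<open>Cauchy's root bound; the summand \<open>1\<close> absorbs the tail
    \<open>e\<close>, which lies in the maximal ideal and so has absolute value at most
    \<open>1\<close>.\<close>
  define c where "c = (\<Sum>i<m. \<bar>b i\<bar>) + 1"
  have absK: "\<bar>y\<bar> \<in> K" if "y \<in> K" for y using that KI(5) by (auto simp: abs_if)
  have cK: "c \<in> K" unfolding c_def by (intro KI is_subfield_sum[OF K] absK bK)
  have "(\<Sum>i<m. \<bar>b i\<bar>) \<preceq> 1"
    using bV m by (intro vle_sum) (simp add: vle_1_iff V_abs_iff)
  then have cV: "c \<in> V" unfolding c_def by (intro V_add V_1) (simp add: vle_1_iff)
  have c1: "1 \<le> c" unfolding c_def by (simp add: sum_nonneg)
  have "\<bar>x\<bar> \<le> c"
  proof (rule ccontr)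
    assume "\<not> \<bar>x\<bar> \<le> c"
    then have xc: "c < \<bar>x\<bar>" "1 \<le> \<bar>x\<bar>" using c1 by auto
    have "\<bar>s\<bar> \<le> (\<Sum>i<m. \<bar>b i\<bar> * \<bar>x\<bar> ^ (m - 1))"
      unfolding s_def
    proof (rule order_trans[OF sum_abs], rule sum_mono)
      fix i assume "i \<in> {..<m}"
      then have "\<bar>x\<bar> ^ i \<le> \<bar>x\<bar> ^ (m - 1)" using xc by (intro power_increasing) auto
      then show "\<bar>b i * x ^ i\<bar> \<le> \<bar>b i\<bar> * \<bar>x\<bar> ^ (m - 1)"
        by (simp add: abs_mult power_abs mult_left_mono)
    qed
    moreover have "1 \<le> \<bar>x\<bar> ^ (m - 1)" using xc by simp
    moreover have "\<bar>x\<bar> ^ m \<le> \<bar>s\<bar> + \<bar>e\<bar>" unfolding power_abs[symmetric] eq by simp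
    ultimately have "\<bar>x\<bar> ^ m \<le> (\<Sum>i<m. \<bar>b i\<bar> * \<bar>x\<bar> ^ (m - 1)) + \<bar>x\<bar> ^ (m - 1)" using e1 by linarith
    also have "\<dots> = c * \<bar>x\<bar> ^ (m - 1)" by (simp add: c_def sum_distrib_right distrib_right)
    also have "\<dots> < \<bar>x\<bar> * \<bar>x\<bar> ^ (m - 1)" using xc by (intro mult_strict_right_mono) auto
    also have "\<dots> = \<bar>x\<bar> ^ m" using m0 by (cases m) auto
    finally show False by simp
  qed
  then show ?thesis using cK cV by blast
qed

end

text \<open>The previous bound for the trivial valuation.\<close>

lemma alg_over_bound:
  assumes "is_subfield K" "alg_over K x"
  shows "\<exists>c\<in>K. \<bar>x\<bar> \<le> (c :: 'a::linordered_field)"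
proof -
  interpret convex_valuation "UNIV :: 'a set" by unfold_locales auto
  show ?thesis using alg_over_V_bound[OF assms] by auto
qed

subsection \<open>Extending embeddings to algebraic elements\<close>

definition rel_alg_closed :: "'a::field set \<Rightarrow> bool" where
  "rel_alg_closed T \<longleftrightarrow> is_subfield T \<and> (\<forall>x. alg_over T x \<longrightarrow> x \<in> T)"

lemma poly_no_root_pos_iff:
  fixes p :: "'a::linordered_field poly"
  assumes "real_closed_in (UNIV :: 'a set)" "\<And>z. a < z \<Longrightarrow> z < b \<Longrightarrow> poly p z \<noteq> 0"
    and "a < s" "s < b" "a < t" "t < b"
  shows "0 < poly p s \<longleftrightarrow> 0 < poly p t"
proof -
  have *: "0 < poly p s \<longleftrightarrow> 0 < poly p t" if "s \<le> t" "a < s" "t < b" for s t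
  proof -
    have "0 < poly p s * poly p t"
      using assms(2) that by (intro poly_no_root_same_sign[OF assms(1)]) auto
    then show ?thesis by (auto simp: zero_less_mult_iff)
  qed
  show ?thesis
  proof (cases "s \<le> t")
    case True then show ?thesis using assms(3,6) by (rule *)
  next
    case False then show ?thesis using *[OF _ assms(5,4)] by simp
  qed
qed

context
  fixes G :: "('a::linordered_field \<times> 'a) set" and n :: nat
  assumes G: "field_graph G"
    and rcU: "real_closed_in (UNIV :: 'a set)"
    and low: "\<And>p x. p \<in> polys_over (Domain G) \<Longrightarrow> p \<noteq> 0 \<Longrightarrow> degree p < n \<Longrightarrow> poly p x = 0 \<Longrightarrow> x \<in> Domain G"
begin

text \<open>The critical points of \<open>g\<close> lie in the domain by \<open>low\<close>, and by
  induction their images cut the target interval into pieces on which \<open>g'\<close> is monotone.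
  A root of \<open>g'\<close> inside a piece would make \<open>g'\<close> change sign between its
  end points; the embedding preserves these signs, so \<open>g\<close> would have a root as
  well.\<close>

lemma poly_graph_no_root:
  assumes "(g, g') \<in> poly_graph G" "g \<noteq> 0" "degree g < n" "(a, a') \<in> G" "(b, b') \<in> G"
    and "\<And>x. a < x \<Longrightarrow> x < b \<Longrightarrow> poly g x \<noteq> 0" "a' < y" "y < b'"
  shows "poly g' y \<noteq> 0"
  using assms
proof (induction "degree g" arbitrary: g g' a a' b b' y rule: less_induct)
  case less
  note O = field_graph_order[OF G]
  note PG = poly_graph_poly[OF G less.prems(1)]
  have "g' \<noteq> 0" using poly_graph_zero_iff[OF G less.prems(1)] less.prems(2) by simp
  show ?case
  proof (cases "degree g = 0")
    case True
    then have "degree g' = 0" using poly_graph_degree[OF G less.prems(1)] by simp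
    then obtain c where "g' = [:c:]" by (auto elim: degree_eq_zeroE)
    then show ?thesis using \<open>g' \<noteq> 0\<close> by auto
  next
    case False
    define h where "h = pderiv g"
    define h' where "h' = pderiv g'"
    have h: "(h, h') \<in> poly_graph G" unfolding h_def h'_def by (rule poly_graph_pderiv[OF G less.prems(1)])
    have "h \<noteq> 0" using False by (simp add: h_def pderiv_eq_0_iff)
    have dh: "degree h < degree g" using False by (simp add: h_def degree_pderiv)
    show ?thesis
    proof
      assume gy: "poly g' y = 0"
      define R where "R = {(r, r')\<in>G. a < r \<and> r < b \<and> poly h r = 0}"
      have "fst ` R \<subseteq> {r. poly h r = 0}" by (auto simp: R_def)
      moreover have "inj_on fst R"
        using order_graph_eq[OF O] by (auto simp: inj_on_def R_def)
      ultimately have finR: "finite R"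
        using poly_roots_finite[OF \<open>h \<noteq> 0\<close>] by (meson finite_imageD finite_subset)
      have roots: "\<exists>r'. (r, r') \<in> R" if "a < r" "r < b" "poly h r = 0" for r
        using low[OF poly_graph_domain[OF G h] \<open>h \<noteq> 0\<close> _ that(3)] dh less.prems(3) that
        by (auto simp: R_def)
      have ne: "r' \<noteq> y" if "(r, r') \<in> R" for r r'
      proof
        assume "r' = y"
        then have "(poly g r, 0) \<in> G" using PG[of r y] that gy by (simp add: R_def)
        then have "poly g r = 0" using order_graph_zero[OF O] by blast
        then show False using less.prems(6) that by (auto simp: R_def)
      qed
      \<comment> \<open>The nearest images of critical points on either side of \<open>y\<close>,
        with the end points of the interval as defaults. No critical point has the image
        \<open>y\<close> itself, since \<open>g\<close> would vanish there.\<close>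
      define L where "L = insert (a, a') {(r, r')\<in>R. r' < y}"
      define U where "U = insert (b, b') {(r, r')\<in>R. y < r'}"
      have finL: "finite L" and finU: "finite U"
        using finR by (auto simp: L_def U_def intro: finite_subset[OF _ finR])
      define d where "d = Max (fst ` L)"
      define e where "e = Min (fst ` U)"
      have "d \<in> fst ` L" unfolding d_def using finL by (intro Max_in) (auto simp: L_def)
      then obtain d' where d': "(d, d') \<in> L" by auto
      have "e \<in> fst ` U" unfolding e_def using finU by (intro Min_in) (auto simp: U_def)
      then obtain e' where e': "(e, e') \<in> U" by auto
      have dG: "(d, d') \<in> G" "a \<le> d" "d' < y" and eG: "(e, e') \<in> G" "e \<le> b" "y < e'"
        using d' e' less.prems by (auto simp: L_def U_def R_def)
      have "d < e" using order_graph_less[OF O dG(1) eG(1)] dG eG by auto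
      have noroot: "poly h x \<noteq> 0" if "d < x" "x < e" for x
      proof
        assume "poly h x = 0"
        moreover have "a < x" "x < b" using that dG(2) eG(2) by auto
        ultimately obtain x' where x': "(x, x') \<in> R" using roots by blast
        show False
        proof (cases "x' < y")
          case True
          then have "x \<in> fst ` L" using x' by (force simp: L_def)
          then have "x \<le> d" unfolding d_def using finL by (intro Max_ge) auto
          then show False using that by simp
        next
          case False
          then have "x \<in> fst ` U" using x' ne[OF x'] by (force simp: U_def)
          then have "e \<le> x" unfolding e_def using finU by (intro Min_le) auto
          then show False using that by simp
        qed
      qed
      have noroot': "poly h' z \<noteq> 0" if "d' < z" "z < e'" for z
        using less.hyps[OF dh h \<open>h \<noteq> 0\<close> _ dG(1) eG(1) noroot that] dh less.prems(3) by simp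
      have "0 < (poly g' y - poly g' d') * (poly g' e' - poly g' y)"
        using noroot' dG(3) eG(3)
        by (intro poly_rc_monotone[OF rcU, of d' e']) (auto simp: h'_def)
      then have neg: "poly g' d' * poly g' e' < 0" using gy by simp
      have "(poly g d * poly g e, poly g' d' * poly g' e') \<in> G"
        by (intro subring_graph_mult[OF field_graph_subring[OF G]] PG dG eG)
      then have "poly g d * poly g e < 0" using order_graph_neg[OF O] neg by blast
      then obtain x where "d < x" "x < e" "poly g x = 0"
        using poly_rc_IVT[OF rcU \<open>d < e\<close>] by blast
      then show False using less.prems(6)[of x] dG eG by auto
    qed
  qed
qed

text \<open>All roots of \<open>p\<close> lie in the domain and so differ from \<open>x\<close>.
  Where there is no root on one side, the bound for the algebraic element \<open>x\<close> provides
  an end point.\<close>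

lemma roots_gap:
  assumes p: "p \<in> polys_over (Domain G)" "p \<noteq> 0" "degree p < n" and x: "x \<notin> Domain G" "alg_over (Domain G) x"
  obtains a b where "a \<in> Domain G" "b \<in> Domain G" "a < x" "x < b" "\<And>z. a < z \<Longrightarrow> z < b \<Longrightarrow> poly p z \<noteq> 0"
proof -
  note K = is_subfield_Domain[OF G]
  obtain c where c: "c \<in> Domain G" "\<bar>x\<bar> \<le> c" using alg_over_bound[OF K x(2)] by blast
  define R where "R = {r. poly p r = 0}"
  have finR: "finite R" unfolding R_def by (rule poly_roots_finite[OF p(2)])
  have R: "R \<subseteq> Domain G" using low[OF p] by (auto simp: R_def)
  have cx: "- c - 1 < x" "x < c + 1" using c by auto
  have cG: "- c - 1 \<in> Domain G" "c + 1 \<in> Domain G" using c by (auto intro: is_subfield_intros[OF K])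
  define A where "A = insert (- c - 1) {r\<in>R. r < x}"
  define B where "B = insert (c + 1) {r\<in>R. x < r}"
  have fin: "finite A" "A \<noteq> {}" "finite B" "B \<noteq> {}" using finR by (auto simp: A_def B_def)
  show thesis
  proof (rule that)
    show "Max A \<in> Domain G" "Max A < x" using Max_in[OF fin(1,2)] R cG cx by (auto simp: A_def)
    show "Min B \<in> Domain G" "x < Min B" using Min_in[OF fin(3,4)] R cG cx by (auto simp: B_def)
    fix z assume z: "Max A < z" "z < Min B"
    show "poly p z \<noteq> 0"
    proof
      assume "poly p z = 0"
      then have "z \<in> R" by (simp add: R_def)
      then consider "z \<in> A" | "z \<in> B" | "z = x"
        by (cases z x rule: linorder_cases) (auto simp: A_def B_def)
      then show False
        using Max_ge[OF fin(1)] Min_le[OF fin(3)] z R x(1) \<open>z \<in> R\<close> by cases (auto simp: not_le[symmetric])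
    qed
  qed
qed

text \<open>Around \<open>x\<close> the polynomial \<open>p\<close> is strictly monotone on an
  interval of the domain, and so is \<open>p'\<close> on the image interval; its root there is
  \<open>y\<close>, which fills the image of the cut of \<open>x\<close>. Polynomials of degree
  below \<open>n\<close> have their roots in the domain, so their signs at \<open>x\<close> can be
  read off from the cut.\<close>

lemma adjoin_algebraic:
  assumes p: "p \<in> polys_over (Domain G)" "p \<noteq> 0" "degree p = n" "poly p x = 0" and x: "x \<notin> Domain G"
  shows "\<exists>y. order_graph (adjoin_graph G x y)"
proof -
  note O = field_graph_order[OF G]
  note K = is_subfield_Domain[OF G]
  have alg: "alg_over (Domain G) x" using p by (intro alg_overI)
  obtain p' where p': "(p, p') \<in> poly_graph G" using poly_graph_total[OF G p(1)] by blast
  have "n > 0" using p by (auto intro!: Nat.gr0I elim!: degree_eq_zeroE)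
  \<comment> \<open>A root of \<open>p\<close> in the domain could be divided out, leaving a
    polynomial of smaller degree that still vanishes at \<open>x\<close>, against
    \<open>low\<close>.\<close>
  have nz: "poly p a \<noteq> 0" if "a \<in> Domain G" for a
  proof
    assume "poly p a = 0"
    then obtain q where q: "p = [:- a, 1:] * q" by (auto simp: poly_eq_0_iff_dvd elim: dvdE)
    have "q \<in> polys_over (Domain G)"
      by (rule polys_over_cofactor[OF K, of "[:- a, 1:]"])
         (use that p q in \<open>auto intro!: polys_over_pCons[OF K] polys_over_0[OF K] is_subfield_intros[OF K]\<close>)
    moreover have "q \<noteq> 0" using p q by auto
    moreover have "degree q < n" using \<open>q \<noteq> 0\<close> unfolding p(3)[symmetric] q by (subst degree_mult_eq) auto
    moreover have "poly q x = 0" using p(4) x that by (auto simp: q)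
    ultimately show False using low x by blast
  qed
  define h where "h = pderiv p"
  have hK: "h \<in> polys_over (Domain G)" unfolding h_def by (rule polys_over_pderiv[OF K p(1)])
  have hG: "(h, pderiv p') \<in> poly_graph G" unfolding h_def by (rule poly_graph_pderiv[OF G p'])
  have h0: "h \<noteq> 0" "degree h < n" using \<open>n > 0\<close> p(3) by (auto simp: h_def pderiv_eq_0_iff degree_pderiv)
  obtain a b where ab: "a \<in> Domain G" "b \<in> Domain G" "a < x" "x < b"
    and hr: "\<And>z. a < z \<Longrightarrow> z < b \<Longrightarrow> poly h z \<noteq> 0"
    using roots_gap[OF hK h0 x alg] by blast
  obtain a' b' where ab': "(a, a') \<in> G" "(b, b') \<in> G" using ab by auto
  have hr': "poly (pderiv p') z \<noteq> 0" if "a' < z" "z < b'" for z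
    by (rule poly_graph_no_root[OF hG h0 ab' hr that])
  have mono: "0 < (poly p v - poly p u) * (poly p t - poly p w)"
    if "a \<le> u" "u < v" "v \<le> w" "w < t" "t \<le> b" for u v w t
    using hr by (intro poly_rc_monotone[OF rcU _ that]) (auto simp: h_def)
  have mono': "0 < (poly p' v - poly p' u) * (poly p' t - poly p' w)"
    if "a' \<le> u" "u < v" "v \<le> w" "w < t" "t \<le> b'" for u v w t
    using hr' by (intro poly_rc_monotone[OF rcU _ that]) auto
  have "0 < (poly p x - poly p a) * (poly p b - poly p x)" using ab by (intro mono) auto
  then have "poly p a * poly p b < 0" using p(4) by simp
  moreover have "(poly p a * poly p b, poly p' a' * poly p' b') \<in> G"
    by (intro subring_graph_mult[OF field_graph_subring[OF G]] poly_graph_poly[OF G p'] ab')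
  ultimately have "poly p' a' * poly p' b' < 0" using order_graph_neg[OF O] by blast
  moreover have "a' < b'" using order_graph_less[OF O ab'] ab by simp
  ultimately obtain y where y: "a' < y" "y < b'" "poly p' y = 0" using poly_rc_IVT[OF rcU] by blast
  have cut: "c < x \<longleftrightarrow> c' < y" if c: "(c, c') \<in> G" for c c'
  proof (cases "a < c \<and> c < b")
    case False
    then show ?thesis
      using order_graph_less[OF O ab'(1) c] order_graph_less[OF O c ab'(2)] ab y by auto
  next
    case True
    then have c': "a' < c'" "c' < b'"
      using order_graph_less[OF O ab'(1) c] order_graph_less[OF O c ab'(2)] by auto
    have "c \<noteq> x" using x c by auto
    have "c' \<noteq> y"
    proof
      assume "c' = y"
      then have "(poly p c, 0) \<in> G" using poly_graph_poly[OF G p' c] y by simp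
      then have "poly p c = 0" using order_graph_zero[OF O] by blast
      then show False using nz c by blast
    qed
    \<comment> \<open>Since \<open>p\<close> changes its sign exactly at \<open>x\<close> within the
      interval, the side on which \<open>c\<close> lies is seen from the sign of \<open>p\<close> at
      \<open>c\<close>, which the embedding preserves.\<close>
    have 1: "c < x \<longleftrightarrow> 0 < poly p a * poly p c"
    proof
      assume "c < x"
      then have "0 < (poly p x - poly p c) * (poly p b - poly p x)" 
        "0 < (poly p x - poly p a) * (poly p b - poly p x)" using ab True by (intro mono; auto)+
      then show "0 < poly p a * poly p c" using p(4) by (auto simp: zero_less_mult_iff mult_less_0_iff)
    next
      assume *: "0 < poly p a * poly p c"
      show "c < x"
      proof (rule ccontr)
        assume "\<not> c < x"
        then have "x < c" using \<open>c \<noteq> x\<close> by simp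
        then have "0 < (poly p x - poly p a) * (poly p c - poly p x)" using ab True by (intro mono) auto
        then show False using p(4) * by simp
      qed
    qed
    have 2: "c' < y \<longleftrightarrow> 0 < poly p' a' * poly p' c'"
    proof
      assume "c' < y"
      then have "0 < (poly p' y - poly p' c') * (poly p' b' - poly p' y)" 
        "0 < (poly p' y - poly p' a') * (poly p' b' - poly p' y)" using y c' by (intro mono'; auto)+
      then show "0 < poly p' a' * poly p' c'" using y(3) by (auto simp: zero_less_mult_iff mult_less_0_iff)
    next
      assume *: "0 < poly p' a' * poly p' c'"
      show "c' < y"
      proof (rule ccontr)
        assume "\<not> c' < y"
        then have "y < c'" using \<open>c' \<noteq> y\<close> by simp
        then have "0 < (poly p' y - poly p' a') * (poly p' c' - poly p' y)" using y c' by (intro mono') auto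
        then show False using y(3) * by simp
      qed
    qed
    have "(poly p a * poly p c, poly p' a' * poly p' c') \<in> G"
      by (intro subring_graph_mult[OF field_graph_subring[OF G]] poly_graph_poly[OF G p'] ab' c)
    then show ?thesis using order_graph_pos[OF O] unfolding 1 2 by blast
  qed
  have pos: "0 < poly q x \<longleftrightarrow> 0 < poly q' y" if q: "(q, q') \<in> poly_graph G" for q q'
  proof -
    define r where "r = q mod p"
    define r' where "r' = q' mod p'"
    have r: "(r, r') \<in> poly_graph G"
      unfolding r_def r'_def by (rule poly_graph_div_mod[OF G q p' p(2)])
    have "poly q x = poly (q div p * p + r) x" by (simp only: r_def div_mult_mod_eq)
    then have qx: "poly q x = poly r x" using p(4) by simp
    have "poly q' y = poly (q' div p' * p' + r') y" by (simp only: r'_def div_mult_mod_eq)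
    then have qy: "poly q' y = poly r' y" using y(3) by simp
    show ?thesis
    proof (cases "r = 0")
      case True
      then have "r' = 0" using poly_graph_zero_iff[OF G r] by simp
      then show ?thesis using True qx qy by simp
    next
      case False
      then have dr: "degree r < n" using degree_mod_less[OF p(2), of q] p(3) by (simp add: r_def)
      note rK = poly_graph_domain[OF G r]
      obtain u v where uv: "u \<in> Domain G" "v \<in> Domain G" "u < x" "x < v"
        and rr: "\<And>z. u < z \<Longrightarrow> z < v \<Longrightarrow> poly r z \<noteq> 0"
        using roots_gap[OF rK False dr x alg] by blast
      obtain u' v' where uv': "(u, u') \<in> G" "(v, v') \<in> G" using uv by auto
      have uy: "u' < y" "y < v'"
      proof -
        show "u' < y" using cut[OF uv'(1)] uv by simp
        have "y \<noteq> v'"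
        proof
          assume "y = v'"
          then have "(poly p v, 0) \<in> G" using poly_graph_poly[OF G p' uv'(2)] y by simp
          then have "poly p v = 0" using order_graph_zero[OF O] by blast
          then show False using nz uv(2) by blast
        qed
        then show "y < v'" using cut[OF uv'(2)] uv by auto
      qed
      \<comment> \<open>A test point of the domain inside the gap: \<open>r\<close> has the same
        sign at \<open>c\<close> and at \<open>x\<close>, \<open>r'\<close> at \<open>c'\<close> and
        at \<open>y\<close>, and the embedding relates \<open>c\<close> to
        \<open>c'\<close>.\<close>
      define c where "c = (u + v) / 2"
      have c: "(c, (u' + v') / 2) \<in> G"
        unfolding c_def
        using field_graph_divide[OF G subring_graph_add[OF field_graph_subring[OF G] uv']
            subring_graph_of_nat[OF field_graph_subring[OF G], of 2]] by simp
      define c' where "c' = (u' + v') / 2"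
      have cuv: "u < c" "c < v" "u' < c'" "c' < v'" using uv uy by (auto simp: c_def c'_def)
      have rr': "poly r' z \<noteq> 0" if "u' < z" "z < v'" for z
        by (rule poly_graph_no_root[OF r False dr uv' rr that])
      have "0 < poly r x \<longleftrightarrow> 0 < poly r c"
        by (rule poly_no_root_pos_iff[OF rcU rr uv(3,4) cuv(1,2)])
      also have "\<dots> \<longleftrightarrow> 0 < poly r' c'"
        using poly_graph_poly[OF G r c] order_graph_pos[OF O] by (simp add: c'_def)
      also have "\<dots> \<longleftrightarrow> 0 < poly r' y"
        by (rule poly_no_root_pos_iff[OF rcU rr' cuv(3,4) uy])
      finally show ?thesis using qx qy by simp
    qed
  qed
  have "order_graph (adjoin_graph G x y)"
    unfolding order_graph_def using subring_graph_adjoin[OF G] pos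
    by (auto simp: adjoin_graph_def[OF G])
  then show ?thesis ..
qed

end

section \<open>Valuations under algebraic extensions\<close>

context convex_valuation
begin

definition val_graph :: "('a \<times> 'a) set \<Rightarrow> bool" where
  "val_graph G \<longleftrightarrow> field_graph G \<and> (\<forall>x y. (x, y) \<in> G \<longrightarrow> (x \<in> V \<longleftrightarrow> y \<in> V))"

lemma val_graph_field: "val_graph G \<Longrightarrow> field_graph G"
  by (simp add: val_graph_def)

lemma val_graph_V: "val_graph G \<Longrightarrow> (x, y) \<in> G \<Longrightarrow> x \<in> V \<longleftrightarrow> y \<in> V"
  by (auto simp: val_graph_def)

lemma val_graph_converse: "val_graph G \<Longrightarrow> val_graph (G\<inverse>)"
  using field_graph_converse by (auto simp: val_graph_def)

lemma val_graph_vle: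
  assumes G: "val_graph G" "(x, y) \<in> G" "(x', y') \<in> G"
  shows "x \<preceq> x' \<longleftrightarrow> y \<preceq> y'"
proof (cases "x' = 0")
  note z = order_graph_zero[OF field_graph_order[OF val_graph_field[OF G(1)]]]
  case True
  then show ?thesis using z[OF G(2)] z[OF G(3)] by simp
next
  note z = order_graph_zero[OF field_graph_order[OF val_graph_field[OF G(1)]]]
  case False
  then have "y' \<noteq> 0" using z[OF G(3)] by simp
  have "(x / x', y / y') \<in> G" by (intro field_graph_divide[OF val_graph_field] G)
  then have "x / x' \<preceq> 1 \<longleftrightarrow> y / y' \<preceq> 1" using val_graph_V[OF G(1)] by (simp add: vle_1_iff)
  then show ?thesis using False \<open>y' \<noteq> 0\<close> by (simp add: vle_divide_iff)
qed

lemma val_graph_fracI: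
  assumes D: "order_graph D" "\<And>x y x' y'. (x, y) \<in> D \<Longrightarrow> (x', y') \<in> D \<Longrightarrow> x \<preceq> x' \<longleftrightarrow> y \<preceq> y'"
  shows "val_graph (frac_graph D)"
  unfolding val_graph_def
proof (intro conjI allI impI)
  show "field_graph (frac_graph D)" by (rule field_graph_frac[OF D(1)])
  fix x y assume "(x, y) \<in> frac_graph D"
  then obtain a b c d where *: "x = a / b" "y = c / d" "(a, c) \<in> D" "(b, d) \<in> D" "b \<noteq> 0"
    by (auto simp: frac_graph_def)
  then have "d \<noteq> 0" using order_graph_zero[OF D(1)] by blast
  then show "x \<in> V \<longleftrightarrow> y \<in> V"
    using D(2)[OF *(3,4)] * by (simp add: vle_divide_iff flip: vle_1_iff)
qed

text \<open>An element of \<open>V\<close> algebraic over the domain is bounded by an element of the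
  domain in \<open>V\<close>. Order preservation bounds its image by an element of \<open>V\<close>,
  and convexity finishes. The other direction is the same argument for the converse graph.\<close>

lemma val_graph_algebraic:
  assumes G: "val_graph G" and H: "field_graph H" "G \<subseteq> H"
    and alg: "\<And>x. x \<in> Domain H \<Longrightarrow> alg_over (Domain G) x"
  shows "val_graph H"
proof -
  have *: "y \<in> V"
    if G: "val_graph G" and H: "field_graph H" "G \<subseteq> H"
      and x: "alg_over (Domain G) x" and xy: "(x, y) \<in> H" and xV: "x \<in> V"
    for G H x y
  proof -
    obtain c where c: "c \<in> Domain G" "c \<in> V" "\<bar>x\<bar> \<le> c"
      using alg_over_V_bound[OF is_subfield_Domain[OF val_graph_field[OF G]] x xV] by blast
    then obtain c' where c': "(c, c') \<in> G" by auto
    note O = field_graph_order[OF H(1)]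
    have "\<not> c' < \<bar>y\<bar>"
      using order_graph_less[OF O _ order_graph_abs[OF O xy], of c c'] c c' H by auto
    moreover have "c' \<in> V" using val_graph_V[OF G c'] c by simp
    ultimately have "\<bar>y\<bar> \<in> V" using V_convex[of "\<bar>y\<bar>" c'] by simp
    then show ?thesis by (simp only: V_abs_iff)
  qed
  have "x \<in> V \<longleftrightarrow> y \<in> V" if xy: "(x, y) \<in> H" for x y
  proof
    have algx: "alg_over (Domain G) x" using alg xy by auto
    show "x \<in> V \<Longrightarrow> y \<in> V" using *[OF G H algx xy] .
    obtain p where p: "p \<in> polys_over (Domain G)" "p \<noteq> 0" "poly p x = 0"
      using algx by (auto simp: alg_over_def)
    obtain p' where p': "(p, p') \<in> poly_graph G" using poly_graph_total[OF val_graph_field[OF G] p(1)] by blast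
    then have "(p, p') \<in> poly_graph H" using H(2) by (auto simp: poly_graph_def)
    from poly_graph_poly[OF H(1) this xy] have "(0, poly p' y) \<in> H" using p by simp
    then have "poly p' y = 0" using order_graph_zero[OF field_graph_order[OF H(1)]] by blast
    moreover have "p' \<noteq> 0" using poly_graph_zero_iff[OF val_graph_field[OF G] p'] p by simp
    moreover have "p' \<in> polys_over (Domain (G\<inverse>))" using p' by (auto simp: polys_over_def poly_graph_def)
    ultimately have "alg_over (Domain (G\<inverse>)) y" by (intro alg_overI)
    then show "y \<in> V \<Longrightarrow> x \<in> V"
      using *[OF val_graph_converse[OF G] field_graph_converse[OF H(1)], of y x] H(2) xy by auto
  qed
  then show ?thesis using H(1) by (auto simp: val_graph_def)
qed

lemma chain_Un:
  assumes chain: "subset.chain A C" "C \<noteq> {}" and A: "\<And>G. G \<in> A \<Longrightarrow> val_graph G"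
  shows "val_graph (\<Union>C)"
proof -
  have CA: "C \<subseteq> A" using chain by (auto simp: subset.chain_def)
  have pair: "\<exists>G\<in>C. u \<in> G \<and> w \<in> G" if "u \<in> \<Union>C" "w \<in> \<Union>C" for u w :: "'a \<times> 'a"
    using that chain unfolding subset.chain_def by blast
  have f: "val_graph G" if "G \<in> C" for G using that CA A by blast
  note fg = val_graph_field[OF f]
  note sg = field_graph_subring[OF fg]
  show ?thesis
    unfolding val_graph_def field_graph_def order_graph_def subring_graph_def
  proof (intro conjI allI impI)
    obtain G where "G \<in> C" using chain by blast
    then show "(0, 0) \<in> \<Union>C" "(1, 1) \<in> \<Union>C" using subring_graph_0[OF sg] subring_graph_1[OF sg] by blast+
  next
    fix x y assume "(x, y) \<in> \<Union>C"
    then obtain G where G: "G \<in> C" "(x, y) \<in> G" by blast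
    show "(- x, - y) \<in> \<Union>C" using subring_graph_uminus[OF sg] G by blast
    show "(inverse x, inverse y) \<in> \<Union>C" using field_graph_inverse[OF fg] G by blast
    show "0 < x \<longleftrightarrow> 0 < y" using order_graph_pos[OF field_graph_order[OF fg[OF G(1)]] G(2)] .
    show "x \<in> V \<longleftrightarrow> y \<in> V" using val_graph_V[OF f[OF G(1)] G(2)] .
  next
    fix x y x' y' assume "(x, y) \<in> \<Union>C" "(x', y') \<in> \<Union>C"
    then obtain G where G: "G \<in> C" "(x, y) \<in> G" "(x', y') \<in> G" using pair by blast
    show "(x + x', y + y') \<in> \<Union>C" using subring_graph_add[OF sg[OF G(1)] G(2,3)] G by blast
    show "(x * x', y * y') \<in> \<Union>C" using subring_graph_mult[OF sg[OF G(1)] G(2,3)] G by blast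
  qed
qed

text \<open>Zorn's lemma among the extensions inside the prescribed \<open>T\<close>, which keeps
  the cardinality of the domain under control.\<close>

lemma extend_rel_alg_closed:
  assumes rcU: "real_closed_in (UNIV :: 'a set)"
    and G0: "val_graph G0" and T: "rel_alg_closed T" "Domain G0 \<subseteq> T"
  obtains G where "val_graph G" "G0 \<subseteq> G" "Domain G \<subseteq> T" "rel_alg_closed (Domain G)"
proof -
  define A where "A = {G. val_graph G \<and> G0 \<subseteq> G \<and> Domain G \<subseteq> T}"
  have "\<exists>M\<in>A. \<forall>H\<in>A. M \<subseteq> H \<longrightarrow> H = M"
  proof (rule subset_Zorn_nonempty)
    show "A \<noteq> {}" using G0 T by (auto simp: A_def)
    fix C assume C: "C \<noteq> {}" "subset.chain A C"
    then have CA: "C \<subseteq> A" by (auto simp: subset.chain_def)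
    have "val_graph (\<Union>C)" by (rule chain_Un[OF C(2,1)]) (simp add: A_def)
    moreover have "G0 \<subseteq> \<Union>C" using C(1) CA by (auto simp: A_def)
    moreover have "Domain (\<Union>C) \<subseteq> T" using CA by (auto simp: A_def)
    ultimately show "\<Union>C \<in> A" by (simp add: A_def)
  qed
  then obtain M where M: "M \<in> A" and max: "\<And>H. H \<in> A \<Longrightarrow> M \<subseteq> H \<Longrightarrow> H = M" by blast
  have vM: "val_graph M" using M by (simp add: A_def)
  note fM = val_graph_field[OF vM]
  note K = is_subfield_Domain[OF fM]
  have "rel_alg_closed (Domain M)"
  proof (rule ccontr)
    assume "\<not> rel_alg_closed (Domain M)"
    then obtain x0 where x0: "x0 \<notin> Domain M" "alg_over (Domain M) x0"
      using K by (auto simp: rel_alg_closed_def)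
    \<comment> \<open>Among the algebraic elements outside the domain, one with an annihilating
      polynomial of least degree is taken; this provides the assumption \<open>low\<close> of
      \<open>adjoin_algebraic\<close>.\<close>
    define P where "P = (\<lambda>k. \<exists>p x. p \<in> polys_over (Domain M) \<and> p \<noteq> 0 \<and> degree p = k \<and> poly p x = 0 \<and> x \<notin> Domain M)"
    define n where "n = (LEAST k. P k)"
    have "\<exists>k. P k" using x0 by (auto simp: P_def alg_over_def)
    then have "P n" unfolding n_def by (rule LeastI_ex)
    then obtain p x where p: "p \<in> polys_over (Domain M)" "p \<noteq> 0" "degree p = n" "poly p x = 0" "x \<notin> Domain M"
      by (auto simp: P_def)
    have low: "z \<in> Domain M"
      if "q \<in> polys_over (Domain M)" "q \<noteq> 0" "degree q < n" "poly q z = 0" for q z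
    proof (rule ccontr)
      assume "z \<notin> Domain M"
      then have "P (degree q)" using that unfolding P_def by blast
      then show False using not_less_Least that(3) unfolding n_def by blast
    qed
    have "\<exists>y. order_graph (adjoin_graph M x y)"
      by (rule adjoin_algebraic[OF fM rcU _ p]) (rule low)
    then obtain y where y: "order_graph (adjoin_graph M x y)" ..
    define H where "H = frac_graph (adjoin_graph M x y)"
    have fH: "field_graph H" unfolding H_def by (rule field_graph_frac[OF y])
    have sub: "adjoin_graph M x y \<subseteq> H" unfolding H_def by (rule frac_graph_incl[OF y])
    have MH: "M \<subseteq> H" using adjoin_graph_incl[OF fM] sub by blast
    have xH: "(x, y) \<in> H" using adjoin_graph_mem[OF fM] sub by blast
    have algx: "alg_over (Domain M) x" using p by (intro alg_overI)
    have alg: "alg_over (Domain M) z" if "z \<in> Domain H" for z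
    proof -
      obtain q q' r r' where *: "z = poly q x / poly r x" "(q, q') \<in> poly_graph M" "(r, r') \<in> poly_graph M"
        using \<open>z \<in> Domain H\<close> by (auto simp: H_def frac_graph_def adjoin_graph_def[OF fM])
      show ?thesis unfolding *(1) divide_inverse
        using * poly_graph_domain[OF fM]
        by (intro alg_over_mult[OF K] alg_over_inverse[OF K] alg_over_poly[OF K algx]) auto
    qed
    have "val_graph H" by (rule val_graph_algebraic[OF vM fH MH alg])
    moreover have "Domain H \<subseteq> T"
    proof
      fix z assume "z \<in> Domain H"
      then have "alg_over (Domain M) z" by (rule alg)
      then have "alg_over T z" using M by (auto simp: alg_over_def polys_over_def A_def) blast
      then show "z \<in> T" using T by (simp add: rel_alg_closed_def)
    qed
    ultimately have "H \<in> A" using M MH by (auto simp: A_def)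
    then have "H = M" using max MH by blast
    then show False using xH p by auto
  qed
  then show thesis using that[of M] M by (simp add: A_def)
qed

end

subsection \<open>Adjoining a transcendental element\<close>

lemma polys_over_monom_diff:
  assumes "is_subfield K" "a \<in> K"
  shows "Polynomial.monom 1 n - [:a:] \<in> polys_over K"
  using assms by (intro polys_over_diff polys_over_monom polys_over_pCons polys_over_0 is_subfield_1)

lemma square_pos: "a \<noteq> 0 \<Longrightarrow> 0 < a * (a :: 'a::linordered_field)"
  by (auto simp: zero_less_mult_iff linorder_neq_iff)

lemma rel_alg_closed_root:
  assumes K: "rel_alg_closed K" and "y ^ n = a" "a \<in> K" "n > 0"
  shows "(y :: 'a::field) \<in> K"
proof -
  have S: "is_subfield K" using K by (simp add: rel_alg_closed_def)
  have "coeff (Polynomial.monom 1 n - [:a:]) n = 1"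
    using \<open>n > 0\<close> by (cases n) simp_all
  then have "Polynomial.monom 1 n - [:a:] \<noteq> 0" by (metis coeff_0 zero_neq_one)
  then have "alg_over K y"
    using assms(2) by (intro alg_overI[OF polys_over_monom_diff[OF S assms(3), of n]]) (auto simp: poly_monom)
  then show ?thesis using K by (simp add: rel_alg_closed_def)
qed

lemma rel_alg_closed_real_closed:
  fixes K :: "'a::linordered_field set"
  assumes rcU: "real_closed_in (UNIV :: 'a set)" and K: "rel_alg_closed K"
  shows "real_closed_in K"
  unfolding real_closed_in_def
proof (intro conjI ballI impI)
  show "is_subfield K" using K by (simp add: rel_alg_closed_def)
  fix x assume "x \<in> K" "0 \<le> x"
  then obtain y where "x = y * y" using rcU by (auto simp: real_closed_in_def)
  then show "\<exists>y\<in>K. x = y * y"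
    using rel_alg_closed_root[OF K, of y 2 x] \<open>x \<in> K\<close> by (auto simp: power2_eq_square)
next
  fix p assume p: "p \<in> polys_over K" "odd (degree p)"
  then obtain x where x: "poly p x = 0" using rcU by (auto simp: real_closed_in_def polys_over_def)
  have "p \<noteq> 0" using p(2) by auto
  then have "alg_over K x" using p x by (intro alg_overI)
  then show "\<exists>x\<in>K. poly p x = 0" using K x by (auto simp: rel_alg_closed_def)
qed

lemma rc_nth_root:
  assumes rcU: "real_closed_in (UNIV :: 'a::linordered_field set)" and "0 \<le> (a :: 'a)" "n > 0"
  shows "\<exists>y\<ge>0. y ^ n = a"
proof (cases "a = 0")
  case True then show ?thesis using \<open>n > 0\<close> by (intro exI[of _ 0]) simp
next
  case False
  then have "0 < a" using assms by simp
  define p where "p = Polynomial.monom 1 n - [:a:]"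
  have p: "poly p x = x ^ n - a" for x by (simp add: p_def poly_monom)
  \<comment> \<open>The right end point is \<open>a + 1\<close> and not \<open>a\<close>, since
    \<open>a ^ n\<close> is smaller than \<open>a\<close> when \<open>a < 1\<close> and
    \<open>n > 1\<close>.\<close>
  have "a < a + 1" by simp
  also have "\<dots> \<le> (a + 1) ^ n" using \<open>0 < a\<close> \<open>n > 0\<close> by (intro self_le_power) auto
  finally have "0 < poly p (a + 1)" by (simp add: p)
  moreover have "poly p 0 < 0" using \<open>0 < a\<close> \<open>n > 0\<close> by (simp add: p power_0_left)
  ultimately have "poly p 0 * poly p (a + 1) < 0" by (simp add: mult_neg_pos)
  moreover have "0 < a + 1" using \<open>0 < a\<close> by simp
  ultimately obtain y where "0 < y" "poly p y = 0" using poly_rc_IVT[OF rcU] by blast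
  then show ?thesis by (intro exI[of _ y]) (simp add: p)
qed

context convex_valuation
begin

text \<open>Same sign and same value, for nonzero elements: what a leading term has to record. It is
  multiplicative and insensitive to summands of larger value.\<close>

definition vsim :: "'a \<Rightarrow> 'a \<Rightarrow> bool" where
  "vsim x y \<longleftrightarrow> 0 < x * y \<and> veq x y"

lemma vsim_refl: "x \<noteq> 0 \<Longrightarrow> vsim x x"
  by (auto simp: vsim_def zero_less_mult_iff)

lemma vsim_mult: "vsim a b \<Longrightarrow> vsim c d \<Longrightarrow> vsim (a * c) (b * d)"
proof -
  assume *: "vsim a b" "vsim c d"
  then have "0 < (a * b) * (c * d)" by (simp add: vsim_def)
  then show ?thesis using * by (simp add: vsim_def veq_mult mult_ac)
qed

lemma vsim_pos_iff: "vsim a b \<Longrightarrow> 0 < a \<longleftrightarrow> 0 < b"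
  by (auto simp: vsim_def zero_less_mult_iff)

lemma vsim_add: "b \<lless> a \<Longrightarrow> vsim (a + b) a"
proof -
  assume ba: "b \<lless> a"
  then have "0 < (a + b) * a"
    using sign_add_absorb[OF ba] sign_add_absorb[of "- b" "- a"]
    by (cases "0 < a") (auto simp: zero_less_mult_iff add.commute not_less le_less)
  then show ?thesis using veq_add_absorb[OF ba] by (simp add: vsim_def add.commute)
qed

text \<open>This and the next lemma treat the definite factors \<open>(x - s)^2 + t^2\<close>:
  squares do not cancel, so the dominating one is a leading term.\<close>

lemma vsim_sum_squares:
  assumes "vsim (a * a) b" "t * t \<preceq> b"
  shows "vsim (a * a + t * t) b"
proof -
  have ab: "0 < (a * a) * b" using assms(1) by (simp only: vsim_def)
  then have "0 < a * a" by (intro square_pos) auto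
  then have "0 < b" using ab zero_less_mult_pos by blast
  have "0 < (a * a + t * t) * b" 
    by (rule mult_pos_pos[OF add_pos_nonneg[OF \<open>0 < a * a\<close> zero_le_square] \<open>0 < b\<close>])
  moreover have "b \<preceq> a * a + t * t"
    using assms(1) vle_add_pos[of "a * a" "t * t" "a * a + t * t"] vle_trans
    by (auto simp: vsim_def veq_def)
  moreover have "a * a + t * t \<preceq> b" using assms by (intro vle_add) (auto simp: vsim_def veq_def)
  ultimately show ?thesis by (simp add: vsim_def veq_def)
qed

lemma vsim_sum_squares':
  assumes "veq (a * a) b" "b \<preceq> t * t" "t \<noteq> 0"
  shows "vsim (a * a + t * t) (t * t)"
proof -
  have "0 < t * t" by (rule square_pos[OF assms(3)])
  then have "0 < (a * a + t * t) * (t * t)" by (intro mult_pos_pos[OF add_nonneg_pos[OF zero_le_square]])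
  moreover have "a * a \<preceq> t * t" using assms vle_trans by (auto simp: veq_def)
  then have "a * a + t * t \<preceq> t * t" by (intro vle_add) auto
  moreover have "t * t \<preceq> a * a + t * t"
    using vle_add_pos[of "a * a" "t * t" "a * a + t * t"] by simp
  ultimately show ?thesis by (simp add: vsim_def veq_def)
qed

text \<open>Besides the order, a cut records how the values of all \<open>x - s\<close> compare with
  the values of the domain. \<open>F\<close> need not be a field, so that finite parts of a graph
  are covered as well.\<close>

definition same_cut :: "('a \<times> 'a) set \<Rightarrow> 'a \<Rightarrow> 'a \<Rightarrow> bool" where
  "same_cut F x y \<longleftrightarrow> (\<forall>s s' c c'. (s, s') \<in> F \<longrightarrow> (c, c') \<in> F \<longrightarrow>
     (x < s \<longleftrightarrow> y < s') \<and> (x - s \<preceq> c \<longleftrightarrow> y - s' \<preceq> c') \<and> (c \<preceq> x - s \<longleftrightarrow> c' \<preceq> y - s'))"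

lemma same_cutD:
  assumes "same_cut F x y" "(s, s') \<in> F"
  shows "x < s \<longleftrightarrow> y < s'"
    and "(c, c') \<in> F \<Longrightarrow> x - s \<preceq> c \<longleftrightarrow> y - s' \<preceq> c'"
    and "(c, c') \<in> F \<Longrightarrow> c \<preceq> x - s \<longleftrightarrow> c' \<preceq> y - s'"
  using assms unfolding same_cut_def by blast+

context
  fixes G x
  assumes rcU: "real_closed_in (UNIV :: 'a set)" and G: "val_graph G"
    and K: "rel_alg_closed (Domain G)" and x: "x \<notin> Domain G"
begin

lemmas G_field = val_graph_field[OF G]
lemmas G_order = field_graph_order[OF G_field]
lemmas G_subring = field_graph_subring[OF G_field]

context
  fixes y
  assumes cut: "same_cut G x y"
begin

lemma cut_less: "(s, s') \<in> G \<Longrightarrow> x < s \<longleftrightarrow> y < s'"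
  and cut_vle: "(s, s') \<in> G \<Longrightarrow> (c, c') \<in> G \<Longrightarrow> x - s \<preceq> c \<longleftrightarrow> y - s' \<preceq> c'"
  and cut_vle': "(s, s') \<in> G \<Longrightarrow> (c, c') \<in> G \<Longrightarrow> c \<preceq> x - s \<longleftrightarrow> c' \<preceq> y - s'"
  using same_cutD[OF cut] by blast+

lemma cut_neq: "(s, s') \<in> G \<Longrightarrow> y \<noteq> s'"
  using cut_vle[OF _ subring_graph_0[OF G_subring], of s s'] x by auto

lemma cut_greater: "(s, s') \<in> G \<Longrightarrow> 0 < x - s \<longleftrightarrow> 0 < y - s'"
  using cut_less[of s s'] cut_neq[of s s'] x by (auto simp: not_less le_less)

text \<open>If the values of all \<open>x - s\<close> are in the value group of the domain, take \<open>w = w' = 1\<close>; otherwise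
  take \<open>w = \<bar>x - s\<bar>\<close> with a value outside of it.\<close>

context
  fixes w w'
  assumes w: "0 < w" "0 < w'"
    and compare: "\<And>k k' l l' n m. (k, k') \<in> G \<Longrightarrow> (l, l') \<in> G \<Longrightarrow>
      k * w ^ n \<preceq> l * w ^ m \<longleftrightarrow> k' * w' ^ n \<preceq> l' * w' ^ m"
    and linear: "\<And>s s'. (s, s') \<in> G \<Longrightarrow>
      \<exists>k k' n. (k, k') \<in> G \<and> vsim (x - s) (k * w ^ n) \<and> vsim (y - s') (k' * w' ^ n)"
begin

text \<open>Over the real closed domain \<open>p\<close> is a product of linear factors and sums of
  two squares. The former have leading terms by \<open>linear\<close>, the latter by the lemmas on
  sums of squares, and leading terms multiply.\<close>

lemma poly_normal_form:
  assumes "(p, p') \<in> poly_graph G" "p \<noteq> 0"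
  shows "\<exists>k k' n. (k, k') \<in> G \<and> vsim (poly p x) (k * w ^ n) \<and> vsim (poly p' y) (k' * w' ^ n)"
  using assms
proof (induction "degree p" arbitrary: p p' rule: less_induct)
  case less
  note pK = poly_graph_domain[OF G_field less.prems(1)]
  have step: ?case
    if d: "(d, d') \<in> poly_graph G" and q: "q \<in> polys_over (Domain G)" "p = d * q" "degree d > 0"
      and nf: "(k1, k1') \<in> G" "vsim (poly d x) (k1 * w ^ n1)" "vsim (poly d' y) (k1' * w' ^ n1)"
    for d d' q k1 k1' n1
  proof -
    have "q \<noteq> 0" "d \<noteq> 0" using q less.prems by auto
    then have "degree q < degree p" unfolding q(2) using q(3) by (subst degree_mult_eq) auto
    obtain q' where q': "(q, q') \<in> poly_graph G" using poly_graph_total[OF G_field q(1)] by blast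
    have p': "p' = d' * q'"
      using poly_graph_eq[OF G_field less.prems(1) poly_graph_mult[OF G_field d q']] q(2) by simp
    obtain k k' n where nf2: "(k, k') \<in> G" "vsim (poly q x) (k * w ^ n)" "vsim (poly q' y) (k' * w' ^ n)"
      using less.hyps[OF \<open>degree q < degree p\<close> q' \<open>q \<noteq> 0\<close>] by blast
    have "vsim (poly p x) ((k1 * k) * w ^ (n1 + n))"
      using vsim_mult[OF nf(2) nf2(2)] by (simp add: q(2) power_add mult_ac)
    moreover have "vsim (poly p' y) ((k1' * k') * w' ^ (n1 + n))"
      using vsim_mult[OF nf(3) nf2(3)] by (simp add: p' power_add mult_ac)
    ultimately show ?thesis using subring_graph_mult[OF G_subring nf(1) nf2(1)] by blast
  qed
  show ?case
  proof (cases "degree p > 0")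
    case False
    then obtain c where c: "p = [:c:]" by (auto elim: degree_eq_zeroE)
    have "degree p' = 0" using poly_graph_degree[OF G_field less.prems(1)] False by simp
    then obtain c' where c': "p' = [:c':]" by (auto elim: degree_eq_zeroE)
    have "(c, c') \<in> G" using less.prems(1) by (auto simp: poly_graph_def c c' dest: spec[of _ 0])
    moreover have "c \<noteq> 0" using less.prems(2) by (simp add: c)
    moreover have "c' \<noteq> 0" using order_graph_zero[OF G_order \<open>(c, c') \<in> G\<close>] \<open>c \<noteq> 0\<close> by simp
    ultimately show ?thesis
      by (intro exI[of _ c] exI[of _ c'] exI[of _ 0]) (simp add: c c' vsim_refl)
  next
    case True
    from rel_alg_closed_real_closed[OF rcU K] pK True show ?thesis
    proof (cases rule: real_closed_in_factor)
      case (1 s q)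
      then obtain s' where s': "(s, s') \<in> G" by auto
      obtain k k' n where nf: "(k, k') \<in> G" "vsim (x - s) (k * w ^ n)" "vsim (y - s') (k' * w' ^ n)"
        using linear[OF s'] by blast
      have "([:- s, 1:], [:- s', 1:]) \<in> poly_graph G"
        by (intro poly_graph_pCons[OF G_field] poly_graph_0[OF G_field]
            subring_graph_uminus[OF G_subring] subring_graph_1[OF G_subring] s')
      from step[OF this 1(2,3) _ nf(1)] nf(2,3) show ?thesis by simp
    next
      case (2 s t q)
      then obtain s' t' where s': "(s, s') \<in> G" and t': "(t, t') \<in> G" by auto
      define d where "d = [:s * s + t * t, - 2 * s, 1:]"
      define d' where "d' = [:s' * s' + t' * t', - 2 * s', 1:]"
      have d: "(d, d') \<in> poly_graph G"
        unfolding d_def d'_def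
        using subring_graph_of_nat[OF G_subring, of 2]
        by (intro poly_graph_pCons[OF G_field] poly_graph_0[OF G_field] subring_graph_add[OF G_subring]
            subring_graph_mult[OF G_subring] subring_graph_uminus[OF G_subring] subring_graph_1[OF G_subring] s' t')
           simp
      have dx: "poly d x = (x - s) * (x - s) + t * t" "poly d' y = (y - s') * (y - s') + t' * t'"
        by (simp_all only: d_def d'_def poly_quadratic)
      obtain k k' n where nf: "(k, k') \<in> G" "vsim (x - s) (k * w ^ n)" "vsim (y - s') (k' * w' ^ n)"
        using linear[OF s'] by blast
      have nf2: "vsim ((x - s) * (x - s)) ((k * k) * w ^ (n + n))"
        "vsim ((y - s') * (y - s')) ((k' * k') * w' ^ (n + n))"
        using vsim_mult[OF nf(2) nf(2)] vsim_mult[OF nf(3) nf(3)] by (simp_all add: power_add mult_ac)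
      note kk = subring_graph_mult[OF G_subring nf(1) nf(1)]
      note tt = subring_graph_mult[OF G_subring t' t']
      have "t' \<noteq> 0" using order_graph_zero[OF G_order t'] 2(3) by simp
      have deg: "degree d > 0" by (simp add: d_def)
      show ?thesis
      \<comment> \<open>Which of the two squares dominates is decided in the same way on both sides,
        by \<open>compare\<close>.\<close>
      proof (cases "t * t \<preceq> (k * k) * w ^ (n + n)")
        case True
        then have "t' * t' \<preceq> (k' * k') * w' ^ (n + n)" using compare[OF tt kk, of 0 "n + n"] by simp
        from step[OF d 2(4) 2(5)[folded d_def] deg kk, unfolded dx, OF vsim_sum_squares[OF nf2(1) True]
            vsim_sum_squares[OF nf2(2) this]]
        show ?thesis .
      next
        case False
        then have "\<not> t' * t' \<preceq> (k' * k') * w' ^ (n + n)" using compare[OF tt kk, of 0 "n + n"] by simp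
        then have le: "(k * k) * w ^ (n + n) \<preceq> t * t" "(k' * k') * w' ^ (n + n) \<preceq> t' * t'"
          using False vle_total by blast+
        have "vsim (poly d x) ((t * t) * w ^ 0)" "vsim (poly d' y) ((t' * t') * w' ^ 0)"
          unfolding dx power_0 mult_1_right
          using vsim_sum_squares'[OF _ le(1) 2(3)] vsim_sum_squares'[OF _ le(2) \<open>t' \<noteq> 0\<close>] nf2
          by (simp_all only: vsim_def)
        from step[OF d 2(4) 2(5)[folded d_def] deg tt this] show ?thesis .
      qed
    qed
  qed
qed

lemma val_graph_adjoin: "val_graph (frac_graph (adjoin_graph G x y))"
proof (rule val_graph_fracI)
  have pos: "0 < poly p x \<longleftrightarrow> 0 < poly p' y" if p: "(p, p') \<in> poly_graph G" for p p'
  proof (cases "p = 0")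
    case True
    then show ?thesis using poly_graph_zero_iff[OF G_field p] by simp
  next
    case False
    obtain k k' n where nf: "(k, k') \<in> G" "vsim (poly p x) (k * w ^ n)" "vsim (poly p' y) (k' * w' ^ n)"
      using poly_normal_form[OF p False] by blast
    then show ?thesis
      using vsim_pos_iff[OF nf(2)] vsim_pos_iff[OF nf(3)] w order_graph_pos[OF G_order nf(1)]
      by (simp add: zero_less_mult_iff not_less[symmetric])
  qed
  then show "order_graph (adjoin_graph G x y)"
    unfolding order_graph_def using subring_graph_adjoin[OF G_field]
    by (auto simp: adjoin_graph_def[OF G_field])
  have nf: "\<exists>k k' n. (k, k') \<in> G \<and> veq (poly p x) (k * w ^ n) \<and> veq (poly p' y) (k' * w' ^ n)"
    if p: "(p, p') \<in> poly_graph G" for p p'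
  proof (cases "p = 0")
    case True
    then show ?thesis using poly_graph_zero_iff[OF G_field p] subring_graph_0[OF G_subring]
      by (intro exI[of _ 0]) simp
  next
    case False
    then show ?thesis using poly_normal_form[OF p False] unfolding vsim_def by blast
  qed
  fix a b a' b' assume "(a, b) \<in> adjoin_graph G x y" "(a', b') \<in> adjoin_graph G x y"
  then obtain p p' q q' where *: "(p, p') \<in> poly_graph G" "a = poly p x" "b = poly p' y"
    "(q, q') \<in> poly_graph G" "a' = poly q x" "b' = poly q' y"
    unfolding adjoin_graph_def[OF G_field] by blast
  obtain k k' n where 1: "(k, k') \<in> G" "veq a (k * w ^ n)" "veq b (k' * w' ^ n)"
    using nf[OF *(1)] * by blast
  obtain l l' m where 2: "(l, l') \<in> G" "veq a' (l * w ^ m)" "veq b' (l' * w' ^ m)"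
    using nf[OF *(4)] * by blast
  show "a \<preceq> a' \<longleftrightarrow> b \<preceq> b'"
    unfolding veq_vle_cong[OF 1(2) 2(2)] veq_vle_cong[OF 1(3) 2(3)] by (rule compare[OF 1(1) 2(1)])
qed

end

end

end

end

section \<open>From equal cuts to embeddings\<close>

context convex_valuation
begin

lemma vle_double_iff: "2 * x \<preceq> y \<longleftrightarrow> x \<preceq> y" "y \<preceq> 2 * x \<longleftrightarrow> y \<preceq> x"
proof -
  have "x \<preceq> 2 * x" by (rule vle_if_abs_le) simp
  moreover have "2 * x \<preceq> x" using V_numeral by (auto simp: vle_def)
  ultimately show "2 * x \<preceq> y \<longleftrightarrow> x \<preceq> y" "y \<preceq> 2 * x \<longleftrightarrow> y \<preceq> x" using vle_trans by blast+
qed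

lemma vsim_neg_iff: "vsim a b \<Longrightarrow> a < 0 \<longleftrightarrow> b < 0"
  by (auto simp: vsim_def zero_less_mult_iff)

text \<open>Either all values of \<open>x - s\<close> occur in the domain, or some
  \<open>x - s0\<close> has a new value. In the second case roots of elements of the domain stay in
  it, so comparisons of powers of \<open>w\<close> reduce to comparisons of
  \<open>w\<close>.\<close>

lemma val_graph_if_same_cut:
  assumes rcU: "real_closed_in (UNIV :: 'a set)" and G: "val_graph G"
    and K: "rel_alg_closed (Domain G)" and x: "x \<notin> Domain G" and cut: "same_cut G x y"
  shows "val_graph (frac_graph (adjoin_graph G x y))"
proof (cases "\<forall>s\<in>Domain G. \<exists>e\<in>Domain G. veq (x - s) e")
  note sub = field_graph_subring[OF val_graph_field[OF G]]
  note ord = field_graph_order[OF val_graph_field[OF G]]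
  case True
  show ?thesis
  proof (rule val_graph_adjoin[OF rcU G K x cut, of 1 1])
    show "(0 :: 'a) < 1" "(0 :: 'a) < 1" by auto
    show "k * 1 ^ n \<preceq> l * 1 ^ m \<longleftrightarrow> k' * 1 ^ n \<preceq> l' * 1 ^ m" if "(k, k') \<in> G" "(l, l') \<in> G" for k k' l l' n m
      using val_graph_vle[OF G that] by simp
    fix s s' assume s: "(s, s') \<in> G"
    then obtain e e' where e: "(e, e') \<in> G" "veq (x - s) e" using True by blast
    then have e': "veq (y - s') e'"
      using cut_vle[OF rcU G K x cut s e(1)] cut_vle'[OF rcU G K x cut s e(1)] by (simp add: veq_def)
    have "x - s \<noteq> 0" "y - s' \<noteq> 0" using x s cut_neq[OF rcU G K x cut s] by auto
    then have "e \<noteq> 0" "e' \<noteq> 0" using e e' by auto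
    note gr = cut_greater[OF rcU G K x cut s]
    \<comment> \<open>\<open>e\<close> determines only the value. The sign of \<open>x - s\<close>
      is attached to it, and by \<open>cut_greater\<close> the same sign fits on the other
      side.\<close>
    define f where "f = (if 0 < x - s then \<bar>e\<bar> else - \<bar>e\<bar>)"
    define f' where "f' = (if 0 < x - s then \<bar>e'\<bar> else - \<bar>e'\<bar>)"
    have "(f, f') \<in> G"
      unfolding f_def f'_def using order_graph_abs[OF ord e(1)] subring_graph_uminus[OF sub order_graph_abs[OF ord e(1)]]
      by simp
    moreover have "veq (x - s) f" "veq (y - s') f'" using e e' by (auto simp: f_def f'_def)
    moreover have "0 < (x - s) * f"
      using \<open>e \<noteq> 0\<close> \<open>x - s \<noteq> 0\<close> by (simp add: f_def zero_less_mult_iff)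
    moreover have "0 < (y - s') * f'"
      using \<open>e' \<noteq> 0\<close> \<open>y - s' \<noteq> 0\<close> gr by (simp add: f'_def zero_less_mult_iff)
    ultimately show "\<exists>k k' n. (k, k') \<in> G \<and> vsim (x - s) (k * 1 ^ n) \<and> vsim (y - s') (k' * 1 ^ n)"
      by (intro exI[of _ f] exI[of _ f'] exI[of _ 0]) (simp add: vsim_def)
  qed
next
  note sub = field_graph_subring[OF val_graph_field[OF G]]
  note ord = field_graph_order[OF val_graph_field[OF G]]
  case False
  then obtain s0 s0' where s0: "(s0, s0') \<in> G" and nv: "\<And>e. e \<in> Domain G \<Longrightarrow> \<not> veq (x - s0) e" by blast
  have x0: "x - s0 \<noteq> 0" "y - s0' \<noteq> 0" using x s0 cut_neq[OF rcU G K x cut s0] by auto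
  define w where "w = \<bar>x - s0\<bar>"
  define w' where "w' = \<bar>y - s0'\<bar>"
  have w: "0 < w" "0 < w'" using x0 by (auto simp: w_def w'_def)
  have we: "w \<preceq> e \<longleftrightarrow> w' \<preceq> e'" "e \<preceq> w \<longleftrightarrow> e' \<preceq> w'" if "(e, e') \<in> G" for e e'
    using cut_vle[OF rcU G K x cut s0 that] cut_vle'[OF rcU G K x cut s0 that] by (simp_all add: w_def w'_def)
  \<comment> \<open>The \<open>j\<close>-th root of \<open>\<bar>a\<bar>\<close> lies in the domain,
    so comparing \<open>w ^ j\<close> with \<open>a\<close> amounts to comparing \<open>w\<close>
    with that root.\<close>
  have wpow: "(w ^ j \<preceq> a \<longleftrightarrow> w' ^ j \<preceq> a') \<and> (a \<preceq> w ^ j \<longleftrightarrow> a' \<preceq> w' ^ j)" if a: "(a, a') \<in> G" for a a' j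
  proof (cases "j = 0")
    case True
    then show ?thesis using val_graph_vle[OF G a subring_graph_1[OF sub]] val_graph_vle[OF G subring_graph_1[OF sub] a]
      by simp
  next
    case False
    then obtain e where e: "e \<ge> 0" "e ^ j = \<bar>a\<bar>" using rc_nth_root[OF rcU, of "\<bar>a\<bar>" j] by auto
    note aa = order_graph_abs[OF ord a]
    have "e \<in> Domain G" using rel_alg_closed_root[OF K e(2)] aa False by auto
    then obtain e' where e': "(e, e') \<in> G" by auto
    have "e' ^ j = \<bar>a'\<bar>"
      using order_graph_eq[OF ord aa subring_graph_power[OF sub e', of j]] e(2) by simp
    moreover have "w ^ j \<preceq> e ^ j \<longleftrightarrow> w \<preceq> e" "e ^ j \<preceq> w ^ j \<longleftrightarrow> e \<preceq> w" for w e
      using vle_power[of w e j] vlt_power[of e w j] vle_power[of e w j] vlt_power[of w e j] False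
      by (auto simp: vlt_def)
    ultimately show ?thesis using we[OF e'] e(2)[symmetric]
      by (metis vle_abs(1) vle_abs(2))
  qed
  have compare: "k * w ^ n \<preceq> l * w ^ m \<longleftrightarrow> k' * w' ^ n \<preceq> l' * w' ^ m"
    if kl: "(k, k') \<in> G" "(l, l') \<in> G" for k k' l l' n m
  proof (cases "k = 0 \<or> l = 0")
    case True
    have "k = 0 \<longleftrightarrow> k' = 0" "l = 0 \<longleftrightarrow> l' = 0" using order_graph_zero[OF ord] kl by blast+
    then show ?thesis using True w by auto
  next
    case False
    have "k' \<noteq> 0" "l' \<noteq> 0" using order_graph_zero[OF ord] kl False by blast+
    show ?thesis
    proof (cases "m \<le> n")
      case True
      define j where "j = n - m"
      have n: "n = j + m" using True by (simp add: j_def)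
      have "k * w ^ n \<preceq> l * w ^ m \<longleftrightarrow> w ^ j \<preceq> l / k"
        if "k \<noteq> 0" "0 < w" for k l w
      proof -
        have "k * w ^ n \<preceq> l * w ^ m \<longleftrightarrow> (k * w ^ j) * w ^ m \<preceq> l * w ^ m"
          by (simp add: n power_add mult.assoc)
        also have "\<dots> \<longleftrightarrow> w ^ j * k \<preceq> l" using that by (subst vle_mult_cancel) (simp_all add: mult.commute)
        finally show ?thesis using that by (simp add: vle_divide_iff')
      qed
      then show ?thesis
        using wpow[OF field_graph_divide[OF val_graph_field[OF G] kl(2,1)], of j] False \<open>k' \<noteq> 0\<close> w by simp
    next
      case False
      define j where "j = m - n"
      have m: "m = j + n" using False by (simp add: j_def)
      have "k * w ^ n \<preceq> l * w ^ m \<longleftrightarrow> k / l \<preceq> w ^ j"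
        if "l \<noteq> 0" "0 < w" for k l w
      proof -
        have "k * w ^ n \<preceq> l * w ^ m \<longleftrightarrow> k * w ^ n \<preceq> (l * w ^ j) * w ^ n"
          by (simp add: m power_add mult.assoc)
        also have "\<dots> \<longleftrightarrow> k \<preceq> w ^ j * l" using that by (subst vle_mult_cancel) (simp_all add: mult.commute)
        finally show ?thesis using that by (simp add: vle_divide_iff)
      qed
      then show ?thesis
        using wpow[OF field_graph_divide[OF val_graph_field[OF G] kl], of j] \<open>\<not> (k = 0 \<or> l = 0)\<close> \<open>l' \<noteq> 0\<close> w
        by simp
    qed
  qed
  show ?thesis
  proof (rule val_graph_adjoin[OF rcU G K x cut w compare])
    fix s s' assume s: "(s, s') \<in> G"
    define d where "d = s0 - s"
    define d' where "d' = s0' - s'"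
    have d: "(d, d') \<in> G" unfolding d_def d'_def by (rule subring_graph_diff[OF sub s0 s])
    have xs: "x - s = (x - s0) + d" "y - s' = (y - s0') + d'" by (simp_all add: d_def d'_def)
    \<comment> \<open>The values of \<open>w\<close> and \<open>d\<close> are different, so one of
      the two summands dominates in \<open>x - s = (x - s0) + d\<close>.\<close>
    have "\<not> veq w d" using nv[of d] d by (auto simp: w_def)
    show "\<exists>k k' n. (k, k') \<in> G \<and> vsim (x - s) (k * w ^ n) \<and> vsim (y - s') (k' * w' ^ n)"
    proof (cases "w \<preceq> d")
      case True
      then have "w \<lless> d" using \<open>\<not> veq w d\<close> by (auto simp: veq_def vlt_def)
      then have "w' \<lless> d'" using we[OF d] by (auto simp: vlt_def)
      have "vsim (x - s) d" "vsim (y - s') d'"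
        unfolding xs using vsim_add[of "x - s0" d] vsim_add[of "y - s0'" d'] \<open>w \<lless> d\<close> \<open>w' \<lless> d'\<close>
        by (simp_all add: w_def w'_def add.commute)
      then show ?thesis using d by (intro exI[of _ d] exI[of _ d'] exI[of _ 0]) simp
    next
      case False
      then have "\<not> w' \<preceq> d'" using we[OF d] by simp
      define g where "g = (if 0 < x - s0 then 1 else - 1 :: 'a)"
      have "vsim (x - s) (x - s0)" "vsim (y - s') (y - s0')"
        unfolding xs using False \<open>\<not> w' \<preceq> d'\<close> by (auto intro!: vsim_add simp: vlt_def w_def w'_def)
      moreover have "x - s0 = g * w ^ 1" "y - s0' = g * w' ^ 1"
        using cut_greater[OF rcU G K x cut s0] by (auto simp: g_def w_def w'_def)
      moreover have "(g, g) \<in> G"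
        using subring_graph_1[OF sub] subring_graph_uminus[OF sub subring_graph_1[OF sub]] by (simp add: g_def)
      ultimately show ?thesis by metis
    qed
  qed auto
qed

subsection \<open>Finite satisfiability of a cut\<close>

text \<open>The square root of \<open>Max A * Min B\<close> has the mean value of the two. If one
  side is empty, an element outside \<open>V\<close> shifts the value beyond the other side.\<close>

lemma vlt_interpolate:
  assumes rcU: "real_closed_in (UNIV :: 'a set)" and nontriv: "V \<noteq> UNIV"
    and fin: "finite A" "finite B" and pos: "\<And>a. a \<in> A \<Longrightarrow> 0 < a" "\<And>b. b \<in> B \<Longrightarrow> 0 < b"
    and AB: "\<And>a b. a \<in> A \<Longrightarrow> b \<in> B \<Longrightarrow> a \<lless> b"
  obtains z where "0 < z" "\<And>a. a \<in> A \<Longrightarrow> a \<lless> z" "\<And>b. b \<in> B \<Longrightarrow> z \<lless> b"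
proof -
  obtain u where "u \<notin> V" using nontriv by blast
  then have u: "1 \<lless> \<bar>u\<bar>" "0 < \<bar>u\<bar>" using V_0 by (auto simp: vlt_def vle_1_iff V_abs_iff)
  have A: "a \<lless> z" if "a \<in> A" "Max A \<lless> z" for a z
  proof -
    have "a \<le> Max A" "0 < a" using that fin pos(1) by auto
    then have "a \<preceq> Max A" by (intro vle_if_abs_le) linarith
    then show ?thesis using that vle_vlt_trans by blast
  qed
  have B: "z \<lless> b" if "b \<in> B" "z \<lless> Min B" for b z
  proof -
    have "B \<noteq> {}" using that by auto
    then have "0 < Min B" using fin pos(2) by simp
    moreover have "Min B \<le> b" using that fin by simp
    ultimately have "Min B \<preceq> b" by (intro vle_if_abs_le) linarith
    then show ?thesis using that vlt_vle_trans by blast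
  qed
  have mA: "0 < Max A" "Max A \<in> A" if "A \<noteq> {}" using that fin pos by auto
  have mB: "0 < Min B" "Min B \<in> B" if "B \<noteq> {}" using that fin pos by auto
  consider "A = {}" "B = {}" | "A = {}" "B \<noteq> {}" | "A \<noteq> {}" "B = {}" | "A \<noteq> {}" "B \<noteq> {}" by blast
  then show thesis
  proof cases
    case 1 then show thesis using that[of 1] by simp
  next
    case 2
    have "Min B / \<bar>u\<bar> \<lless> Min B"
      using mB[OF 2(2)] u vlt_mult_cancel_left[of "Min B" 1 "\<bar>u\<bar>"] by (simp add: vlt_divide_iff)
    then show thesis using that[of "Min B / \<bar>u\<bar>"] 2 B mB[OF 2(2)] u by simp
  next
    case 3
    have "Max A \<lless> Max A * \<bar>u\<bar>"
      using mA[OF 3(1)] u vlt_mult_cancel_left[of "Max A" 1 "\<bar>u\<bar>"] by simp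
    then show thesis using that[of "Max A * \<bar>u\<bar>"] 3 A mA[OF 3(1)] u by simp
  next
    case 4
    note m = mA[OF 4(1)] mB[OF 4(2)]
    have "0 < Max A * Min B" using m by simp
    then obtain z where z: "0 \<le> z" "Max A * Min B = z * z"
      using real_closed_in_sqrt[OF rcU, of "Max A * Min B"] by auto
    then have "0 < z" using \<open>0 < Max A * Min B\<close> by (cases "z = 0") auto
    have ab: "Max A \<lless> Min B" using AB m by blast
    have "Max A * Max A \<lless> z * z" "z * z \<lless> Min B * Min B"
      unfolding z(2)[symmetric] using ab m by (simp_all add: vlt_mult_cancel vlt_mult_cancel_left)
    then have "Max A \<lless> z" "z \<lless> Min B" by (simp_all add: vlt_square_iff)
    then show thesis using that[of z] A B \<open>0 < z\<close> by blast
  qed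
qed

lemma vsim_shift:
  assumes "x' - x \<preceq> e" "e \<lless> x - s" shows "vsim (x - s) (x' - s)"
proof -
  have "vsim ((x - s) + (x' - x)) (x - s)" using vle_vlt_trans[OF assms] by (rule vsim_add)
  then show ?thesis by (auto simp: vsim_def veq_def mult.commute)
qed

text \<open>If no \<open>x - s\<close> has a new value, a point of \<open>K\<close> close to \<open>x\<close> has the same finite cut: the midpoint
  of the neighbours of \<open>x\<close> among the \<open>s\<close> closest to \<open>x\<close>.\<close>

lemma finite_cut_realized_inside:
  assumes K: "is_subfield K" and x: "x \<notin> K" and S: "finite S" "S \<subseteq> K"
    and val: "\<And>s. s \<in> S \<Longrightarrow> \<exists>e\<in>K. veq (x - s) e"
  obtains x' where "x' \<in> K" "\<And>s. s \<in> S \<Longrightarrow> vsim (x - s) (x' - s)"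
proof (cases "S = {}")
  case True then show thesis using that[of 0] is_subfield_0[OF K] by simp
next
  case False
  note KI = is_subfield_intros[OF K]
  obtain s1 where s1: "s1 \<in> S" "\<And>s. s \<in> S \<Longrightarrow> inverse (x - s) \<preceq> inverse (x - s1)"
    using vle_maximal[OF S(1) False, of "\<lambda>s. inverse (x - s)"] by blast
  have xs: "x - s \<noteq> 0" if "s \<in> S" for s using that S x by auto
  have min: "x - s1 \<preceq> x - s" if "s \<in> S" for s
    using s1(2)[OF that] xs[OF that] xs[OF s1(1)]
    by (simp add: inverse_eq_divide vle_divide_iff) (simp add: vle_divide_iff' mult.commute)
  obtain e0 where e0: "e0 \<in> K" "veq (x - s1) e0" using val[OF s1(1)] by blast
  define e where "e = \<bar>e0\<bar>"
  have "e0 \<noteq> 0" using e0(2) xs[OF s1(1)] by auto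
  then have e: "e \<in> K" "veq (x - s1) e" "0 < e"
    using e0 KI(5)[of e0] by (auto simp: e_def abs_if)
  have emin: "e \<preceq> x - s" if "s \<in> S" for s using min[OF that] e(2) vle_trans by (auto simp: veq_def)
  \<comment> \<open>Only these closest points are sensitive to moving \<open>x\<close> by an element
    of size \<open>e\<close>; for all others \<open>vsim_shift\<close> applies.\<close>
  define S1 where "S1 = {s\<in>S. x - s \<preceq> e}"
  have S1: "finite S1" "s1 \<in> S1" "S1 \<subseteq> S" using S s1 e by (auto simp: S1_def veq_def)
  note result = that
  have main: thesis
    if x': "x' \<in> K" "x' - x \<preceq> e" and near: "\<And>s. s \<in> S1 \<Longrightarrow> 0 < (x - s) * (x' - s) \<and> e \<preceq> x' - s" for x'
  proof (rule result[OF x'(1)])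
    fix s assume s: "s \<in> S"
    show "vsim (x - s) (x' - s)"
    proof (cases "s \<in> S1")
      case True
      then have "x - s \<preceq> e" by (simp add: S1_def)
      then have "(x' - x) + (x - s) \<preceq> e" using x' by (intro vle_add)
      then have "x' - s \<preceq> e" by simp
      then show ?thesis
        using near[OF True] \<open>x - s \<preceq> e\<close> emin[OF s] vle_trans unfolding vsim_def veq_def by blast
    next
      case False
      then show ?thesis using s x' by (intro vsim_shift[of x' x e]) (auto simp: S1_def vlt_def)
    qed
  qed
  define L where "L = {s\<in>S1. s < x}"
  define U where "U = {s\<in>S1. x < s}"
  have fin: "finite L" "finite U" using S1 by (auto simp: L_def U_def)
  have LU: "s \<in> L \<or> s \<in> U" if "s \<in> S1" for s
    using that xs[of s] S1 by (cases s x rule: linorder_cases) (auto simp: L_def U_def)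
  have a: "Max L \<in> L" "Max L \<in> S1" "Max L < x" if "L \<noteq> {}"
    using Max_in[OF fin(1) that] by (auto simp: L_def)
  have b: "Min U \<in> U" "Min U \<in> S1" "x < Min U" if "U \<noteq> {}"
    using Min_in[OF fin(2) that] by (auto simp: U_def)
  have L: "s \<le> Max L" "s < x" if "s \<in> L" for s using that fin by (auto simp: L_def)
  have U: "Min U \<le> s" "x < s" if "s \<in> U" for s using that fin by (auto simp: U_def)
  have SK: "s \<in> K" if "s \<in> S1" for s using that S1 S by blast
  have far: "e \<preceq> x - s" "x - s \<preceq> e" if "s \<in> S1" for s using that emin[of s] S1 by (auto simp: S1_def)
  consider "L \<noteq> {}" "U = {}" | "L = {}" "U \<noteq> {}" | "L \<noteq> {}" "U \<noteq> {}" using LU[OF S1(2)] by blast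
  then show thesis
  proof cases
    case 1
    note a = a[OF 1(1)]
    \<comment> \<open>Without a neighbour above, the new point is put at distance \<open>e\<close>
      above \<open>Max L\<close>: its differences with the points of \<open>L\<close> are positive
      and not smaller than \<open>e\<close>.\<close>
    show thesis
    proof (rule main[of "Max L + e"])
      show "Max L + e \<in> K" using SK a e by (intro KI)
      have "e - (x - Max L) \<preceq> e" by (rule vle_diff[OF vle_refl far(2)[OF a(2)]])
      then show "Max L + e - x \<preceq> e" by (simp add: algebra_simps)
      fix s assume "s \<in> S1"
      then have s: "s \<in> L" using LU 1 by blast
      have "e \<le> Max L + e - s" using L[OF s] by simp
      then have "e \<preceq> Max L + e - s" using e(3) by (intro vle_if_abs_le) auto
      moreover have "0 < x - s" "0 < Max L + e - s" using L[OF s] e(3) by (auto intro: add_nonneg_pos)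
      ultimately show "0 < (x - s) * (Max L + e - s) \<and> e \<preceq> Max L + e - s" by simp
    qed
  next
    case 2
    note b = b[OF 2(2)]
    show thesis
    proof (rule main[of "Min U - e"])
      show "Min U - e \<in> K" using SK b e by (intro KI)
      have "- (x - Min U) - e \<preceq> e" by (rule vle_diff[OF vle_uminus(1)[THEN iffD2, OF far(2)[OF b(2)]] vle_refl])
      then show "Min U - e - x \<preceq> e" by (simp add: algebra_simps)
      fix s assume "s \<in> S1"
      then have s: "s \<in> U" using LU 2 by blast
      have le: "Min U - e - s \<le> - e" using U[OF s] by simp
      then have "e \<preceq> Min U - e - s" using e(3) by (intro vle_if_abs_le) auto
      moreover have "x - s < 0" "Min U - e - s < 0" using U[OF s] e(3) le by auto
      ultimately show "0 < (x - s) * (Min U - e - s) \<and> e \<preceq> Min U - e - s" by (simp add: mult_neg_neg)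
    qed
  next
    case 3
    note a = a[OF 3(1)] and b = b[OF 3(2)]
    define m where "m = (Max L + Min U) / 2"
    have m2: "2 * m = Max L + Min U" by (simp add: m_def)
    show thesis
    proof (rule main[of m])
      show "m \<in> K" unfolding m_def using SK a b by (intro KI) auto
      have "- (x - Max L) - (x - Min U) \<preceq> e" by (rule vle_diff[OF vle_uminus(1)[THEN iffD2, OF far(2)[OF a(2)]] far(2)[OF b(2)]])
      also have "- (x - Max L) - (x - Min U) = 2 * (m - x)"
        unfolding right_diff_distrib m2 by (simp add: algebra_simps)
      finally show "m - x \<preceq> e" by (simp only: vle_double_iff)
      fix s assume "s \<in> S1"
      then consider "s \<in> L" | "s \<in> U" using LU by blast
      then show "0 < (x - s) * (m - s) \<and> e \<preceq> m - s"
      proof cases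
        case 1
        have h: "x - Max L \<le> 2 * (m - s)" "0 < x - Max L" using L[OF 1] a b m2 by (auto simp: algebra_simps)
        then have "x - Max L \<preceq> 2 * (m - s)" by (intro vle_if_abs_le) auto
        then have "e \<preceq> m - s" using far(1)[OF a(2)] vle_trans vle_double_iff by blast
        moreover have "0 < m - s" using h by simp
        ultimately show ?thesis using L[OF 1] by simp
      next
        case 2
        have h: "Min U - x \<le> 2 * (s - m)" "0 < Min U - x" using U[OF 2] a b m2 by (auto simp: algebra_simps)
        then have "Min U - x \<preceq> 2 * (s - m)" by (intro vle_if_abs_le) auto
        then have "Min U - x \<preceq> s - m" by (simp only: vle_double_iff)
        then have "- (x - Min U) \<preceq> s - m" by simp
        then have "x - Min U \<preceq> s - m" by (simp only: vle_uminus)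
        then have "e \<preceq> s - m" using far(1)[OF b(2)] vle_trans by blast
        then have "e \<preceq> - (m - s)" by simp
        then have "e \<preceq> m - s" by (simp only: vle_uminus)
        moreover have "m - s < 0" using h by simp
        ultimately show ?thesis using U[OF 2] by (simp add: mult_neg_neg)
      qed
    qed
  qed
qed

text \<open>If all \<open>x - s\<close> have values of the domain, a point of the domain has the
  same finite cut and its image is a solution. Otherwise some \<open>x - s0\<close> has a new value,
  and any value in the corresponding gap will do.\<close>

lemma finite_cut_realized:
  assumes rcU: "real_closed_in (UNIV :: 'a set)" and nontriv: "V \<noteq> UNIV"
    and G: "val_graph G" and x: "x \<notin> Domain G" and F: "finite F" "F \<subseteq> G"
  shows "\<exists>y. same_cut F x y"
proof (cases "\<forall>s\<in>Domain F. \<exists>e\<in>Domain G. veq (x - s) e")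
  note ord = field_graph_order[OF val_graph_field[OF G]]
  note sub = field_graph_subring[OF val_graph_field[OF G]]
  case True
  have fin: "finite (Domain F)" "Domain F \<subseteq> Domain G" using F by (auto simp: finite_Domain)
  obtain x' where x': "x' \<in> Domain G" "\<And>s. s \<in> Domain F \<Longrightarrow> vsim (x - s) (x' - s)"
    using finite_cut_realized_inside[OF is_subfield_Domain[OF val_graph_field[OF G]] x fin] True by blast
  then obtain y where y: "(x', y) \<in> G" by auto
  have "same_cut F x y"
    unfolding same_cut_def
  proof (intro allI impI)
    fix s s' c c' assume "(s, s') \<in> F" "(c, c') \<in> F"
    then have s: "(s, s') \<in> G" "s \<in> Domain F" and c: "(c, c') \<in> G" using F by auto
    note sim = x'(2)[OF s(2)]
    have d: "(x' - s, y - s') \<in> G" by (rule subring_graph_diff[OF sub y s(1)])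
    have "x < s \<longleftrightarrow> x' < s" using sim by (auto simp: vsim_def zero_less_mult_iff)
    also have "\<dots> \<longleftrightarrow> y < s'" by (rule order_graph_less[OF ord y s(1)])
    finally have 1: "x < s \<longleftrightarrow> y < s'" .
    have v: "veq (x - s) (x' - s)" using sim by (simp add: vsim_def)
    have 2: "x - s \<preceq> c \<longleftrightarrow> y - s' \<preceq> c'"
      unfolding veq_vle_cong[OF v veq_refl[of c]] by (rule val_graph_vle[OF G d c])
    have 3: "c \<preceq> x - s \<longleftrightarrow> c' \<preceq> y - s'"
      unfolding veq_vle_cong[OF veq_refl[of c] v] by (rule val_graph_vle[OF G c d])
    show "(x < s \<longleftrightarrow> y < s') \<and> (x - s \<preceq> c \<longleftrightarrow> y - s' \<preceq> c') \<and> (c \<preceq> x - s \<longleftrightarrow> c' \<preceq> y - s')"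
      using 1 2 3 by blast
  qed
  then show ?thesis ..
next
  note ord = field_graph_order[OF val_graph_field[OF G]]
  note sub = field_graph_subring[OF val_graph_field[OF G]]
  case False
  then obtain s0 s0' where s0: "(s0, s0') \<in> F" and nv: "\<And>e. e \<in> Domain G \<Longrightarrow> \<not> veq (x - s0) e" by blast
  have s0G: "(s0, s0') \<in> G" using s0 F by blast
  define w where "w = \<bar>x - s0\<bar>"
  have "x - s0 \<noteq> 0" using x s0G by auto
  then have "0 < w" by (simp add: w_def)
  have nvw: "\<not> veq w e" if "e \<in> Domain G" for e using nv[OF that] by (simp add: w_def)
  \<comment> \<open>All elements with which \<open>w\<close> has to be compared: the bounds
    \<open>c\<close> and the differences \<open>s0 - s\<close>, the latter because
    \<open>x - s = (x - s0) + (s0 - s)\<close>.\<close>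
  define E where "E = (\<lambda>(c, c'). (\<bar>c\<bar>, \<bar>c'\<bar>)) ` F \<union> (\<lambda>(s, s'). (\<bar>s0 - s\<bar>, \<bar>s0' - s'\<bar>)) ` F"
  have finE: "finite E" using F by (simp add: E_def)
  have EG: "E \<subseteq> G"
    unfolding E_def using F order_graph_abs[OF ord] subring_graph_diff[OF sub s0G] by auto
  \<comment> \<open>The images of the elements below and above \<open>w\<close> in value. Zero is
    left out of \<open>A\<close>, since interpolation takes positive elements.\<close>
  define A where "A = {e'. \<exists>e. (e, e') \<in> E \<and> e \<lless> w \<and> e \<noteq> 0}"
  define B where "B = {e'. \<exists>e. (e, e') \<in> E \<and> w \<lless> e}"
  have "A \<subseteq> snd ` E" "B \<subseteq> snd ` E" by (force simp: A_def B_def)+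
  then have finAB: "finite A" "finite B" using finE finite_subset by blast+
  have E0: "0 \<le> e" "e = 0 \<longleftrightarrow> e' = 0" "0 < e \<longleftrightarrow> 0 < e'" if "(e, e') \<in> E" for e e'
  proof -
    have "(e, e') \<in> G" using that EG by blast
    then show "e = 0 \<longleftrightarrow> e' = 0" "0 < e \<longleftrightarrow> 0 < e'"
      using order_graph_zero[OF ord] order_graph_pos[OF ord] by blast+
    show "0 \<le> e" using that by (auto simp: E_def)
  qed
  have Apos: "0 < e'" if e': "e' \<in> A" for e'
  proof -
    obtain e where e: "(e, e') \<in> E" "e \<noteq> 0" using e' by (auto simp: A_def)
    then show ?thesis using E0[OF e(1)] by (simp add: le_less)
  qed
  have Bpos: "0 < e'" if e': "e' \<in> B" for e'
  proof -
    obtain e where e: "(e, e') \<in> E" "w \<lless> e" using e' by (auto simp: B_def)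
    then have "e \<noteq> 0" by auto
    then show ?thesis using E0[OF e(1)] by (simp add: le_less)
  qed
  have AB: "e' \<lless> f'" if ef': "e' \<in> A" "f' \<in> B" for e' f'
  proof -
    obtain e f where ef: "(e, e') \<in> E" "e \<lless> w" "(f, f') \<in> E" "w \<lless> f" using ef' by (auto simp: A_def B_def)
    then have "e \<lless> f" using vlt_trans by blast
    moreover have "(e, e') \<in> G" "(f, f') \<in> G" using ef EG by auto
    ultimately show ?thesis using val_graph_vle[OF G, of f f' e e'] by (simp add: vlt_def)
  qed
  obtain z where z: "0 < z" "\<And>a. a \<in> A \<Longrightarrow> a \<lless> z" "\<And>b. b \<in> B \<Longrightarrow> z \<lless> b"
    using vlt_interpolate[OF rcU nontriv finAB Apos Bpos AB] by blast
  have ze: "(w \<preceq> e \<longleftrightarrow> z \<preceq> e') \<and> (e \<preceq> w \<longleftrightarrow> e' \<preceq> z)" if e: "(e, e') \<in> E" for e e'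
  proof (cases "w \<lless> e")
    case True
    then have "z \<lless> e'" using z(3) e by (auto simp: B_def)
    then show ?thesis using True vlt_imp_vle by (auto simp: vlt_def)
  next
    case False
    moreover have "\<not> veq w e" using nvw e EG by auto
    ultimately have ew: "e \<lless> w" by (auto simp: vlt_def veq_def)
    show ?thesis
    proof (cases "e = 0")
      case True
      then show ?thesis using E0[OF e] \<open>0 < w\<close> z(1) by simp
    next
      case False
      then have "e' \<lless> z" using z(2) e ew by (auto simp: A_def)
      then show ?thesis using ew vlt_imp_vle by (auto simp: vlt_def)
    qed
  qed
  define g where "g = (if 0 < x - s0 then 1 else - 1 :: 'a)"
  have g: "x - s0 = g * w" "g = 1 \<or> g = - 1" by (auto simp: g_def w_def)
  \<comment> \<open>The mirror image of \<open>x = s0 + g * w\<close>, where the sign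
    \<open>g\<close> puts \<open>y\<close> on the same side of \<open>s0'\<close>.\<close>
  define y where "y = s0' + g * z"
  have "same_cut F x y"
    unfolding same_cut_def
  proof (intro allI impI)
    fix s s' c c' assume s: "(s, s') \<in> F" and c: "(c, c') \<in> F"
    have sG: "(s, s') \<in> G" and cG: "(c, c') \<in> G" using s c F by auto
    define d where "d = s0 - s"
    define d' where "d' = s0' - s'"
    have d: "(d, d') \<in> G" unfolding d_def d'_def by (rule subring_graph_diff[OF sub s0G sG])
    have xs: "x - s = g * w + d" "y - s' = g * z + d'" using g by (simp_all add: d_def d'_def y_def algebra_simps)
    have dE: "(\<bar>d\<bar>, \<bar>d'\<bar>) \<in> E"
      unfolding E_def d_def d'_def by (rule UnI2, rule image_eqI[OF _ s]) simp
    have cE: "(\<bar>c\<bar>, \<bar>c'\<bar>) \<in> E"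
      unfolding E_def by (rule UnI1, rule image_eqI[OF _ c]) simp
    have wd: "w \<preceq> d \<longleftrightarrow> z \<preceq> d'" using ze[OF dE] by simp
    have gw: "veq (g * w) w" "veq (g * z) z" using g(2) by auto
    show "(x < s \<longleftrightarrow> y < s') \<and> (x - s \<preceq> c \<longleftrightarrow> y - s' \<preceq> c') \<and> (c \<preceq> x - s \<longleftrightarrow> c' \<preceq> y - s')"
    proof (cases "w \<preceq> d")
      case True
      moreover have "\<not> veq w d" using nvw d by auto
      ultimately have "w \<lless> d" by (auto simp: veq_def vlt_def)
      moreover have "z \<lless> d'"
      proof -
        have "\<not> \<bar>d\<bar> \<preceq> w" using \<open>w \<lless> d\<close> by (simp add: vlt_def)
        then show ?thesis using ze[OF dE] by (simp add: vlt_def)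
      qed
      ultimately have "g * w \<lless> d" "g * z \<lless> d'" using g(2) by auto
      then have sim: "vsim (x - s) d" "vsim (y - s') d'"
        unfolding xs using vsim_add[of "g * w" d] vsim_add[of "g * z" d'] by (simp_all add: add.commute)
      have "x < s \<longleftrightarrow> d < 0" "y < s' \<longleftrightarrow> d' < 0"
        using vsim_neg_iff[OF sim(1)] vsim_neg_iff[OF sim(2)] by simp_all
      then have 1: "x < s \<longleftrightarrow> y < s'" using order_graph_neg[OF ord d] by simp
      have v: "veq (x - s) d" "veq (y - s') d'" using sim by (auto simp: vsim_def)
      have 2: "x - s \<preceq> c \<longleftrightarrow> y - s' \<preceq> c'"
        unfolding veq_vle_cong[OF v(1) veq_refl[of c]] veq_vle_cong[OF v(2) veq_refl[of c']]
        by (rule val_graph_vle[OF G d cG])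
      have 3: "c \<preceq> x - s \<longleftrightarrow> c' \<preceq> y - s'"
        unfolding veq_vle_cong[OF veq_refl[of c] v(1)] veq_vle_cong[OF veq_refl[of c'] v(2)]
        by (rule val_graph_vle[OF G cG d])
      show ?thesis using 1 2 3 by blast
    next
      case False
      then have "d \<lless> g * w" "d' \<lless> g * z" using wd g(2) by (auto simp: vlt_def)
      then have sim: "vsim (x - s) (g * w)" "vsim (y - s') (g * z)"
        unfolding xs by (auto intro: vsim_add)
      have "x < s \<longleftrightarrow> g * w < 0" "y < s' \<longleftrightarrow> g * z < 0"
        using vsim_neg_iff[OF sim(1)] vsim_neg_iff[OF sim(2)] by simp_all
      then have 1: "x < s \<longleftrightarrow> y < s'" using g(2) \<open>0 < w\<close> z(1) by auto
      have v: "veq (x - s) w" "veq (y - s') z" using sim gw veq_trans by (auto simp: vsim_def)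
      have 2: "x - s \<preceq> c \<longleftrightarrow> y - s' \<preceq> c'"
        unfolding veq_vle_cong[OF v(1) veq_refl[of c]] veq_vle_cong[OF v(2) veq_refl[of c']]
        using ze[OF cE] by simp
      have 3: "c \<preceq> x - s \<longleftrightarrow> c' \<preceq> y - s'"
        unfolding veq_vle_cong[OF veq_refl[of c] v(1)] veq_vle_cong[OF veq_refl[of c'] v(2)]
        using ze[OF cE] by simp
      show ?thesis using 1 2 3 by blast
    qed
  qed
  then show ?thesis ..
qed

end

subsection \<open>Small algebraically closed subsets\<close>

context
  fixes \<kappa> :: "'c rel"
  assumes kappa: "Card_order \<kappa>" "natLeq <o \<kappa>"
begin

lemma kappa_infinite: "infinite (Field \<kappa>)"
proof -
  have "|UNIV :: nat set| \<le>o |Field \<kappa>|"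
    using card_of_nat card_of_Field_ordIso[OF kappa(1)] kappa(2)
    by (meson ordIso_ordLeq_trans ordLeq_ordIso_trans ordIso_symmetric ordLess_imp_ordLeq)
  then show ?thesis by (simp add: infinite_iff_card_of_nat)
qed

text \<open>Countably many operations are applied in \<open>\<omega>\<close> rounds. The summand
  \<open>UNIV :: nat set\<close> makes the bound \<open>B\<close> infinite even for finite
  \<open>A\<close>; \<open>B\<close> stays below \<open>\<kappa>\<close> because
  \<open>\<kappa>\<close> is uncountable.\<close>

lemma small_closure:
  fixes F :: "nat \<Rightarrow> 'x \<Rightarrow> 'x \<Rightarrow> 'x"
  assumes A: "|A| <o \<kappa>"
  obtains S where "A \<subseteq> S" "c \<in> S" "|S| <o \<kappa>" "\<And>k x y. x \<in> S \<Longrightarrow> y \<in> S \<Longrightarrow> F k x y \<in> S"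
proof -
  define B where "B = A <+> (UNIV :: nat set)"
  have natB: "|UNIV :: nat set| \<le>o |B|" unfolding B_def by (rule card_of_Plus2)
  then have infB: "infinite B" by (simp add: infinite_iff_card_of_nat)
  have "|UNIV :: nat set| <o \<kappa>" using card_of_nat kappa(2) ordIso_ordLess_trans by blast
  then have B: "|B| <o \<kappa>"
    unfolding B_def by (intro card_of_Plus_ordLess_infinite_Field kappa_infinite kappa A)
  define T where "T = rec_nat (insert c A) (\<lambda>_ T. T \<union> (\<lambda>(k, x, y). F k x y) ` (UNIV \<times> T \<times> T))"
  have T0: "T 0 = insert c A" by (simp add: T_def)
  have TS: "T (Suc n) = T n \<union> (\<lambda>(k, x, y). F k x y) ` (UNIV \<times> T n \<times> T n)" for n by (simp add: T_def)
  have card: "|T n| \<le>o |B|" for n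
  proof (induction n)
    case 0
    have "T 0 \<subseteq> case_sum id (\<lambda>_. c) ` B"
    proof
      fix z assume "z \<in> T 0"
      then consider "z = c" | "z \<in> A" by (auto simp: T0)
      then show "z \<in> case_sum id (\<lambda>_. c) ` B"
        by cases (auto simp: B_def intro: image_eqI[of _ _ "Inr 0"] image_eqI[of _ _ "Inl z"])
    qed
    then show ?case using card_of_mono1 card_of_image ordLeq_transitive by blast
  next
    case (Suc n)
    have fB: "infinite (Field |B| )" "Card_order |B|" using infB by (simp_all add: Field_card_of card_of_Card_order)
    have "|(UNIV :: nat set) \<times> T n \<times> T n| \<le>o |B|"
      by (intro card_of_Times_ordLeq_infinite_Field fB Suc natB)
    then have "|(\<lambda>(k, x, y). F k x y) ` ((UNIV :: nat set) \<times> T n \<times> T n)| \<le>o |B|"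
      using card_of_image ordLeq_transitive by blast
    then have le: "\<forall>i\<in>(UNIV :: bool set). |if i then T n else (\<lambda>(k, x, y). F k x y) ` (UNIV \<times> T n \<times> T n)| \<le>o |B|"
      using Suc by simp
    have "|UNIV :: bool set| \<le>o |B|"
      using infB by (meson finite finite_ordLess_infinite2 ordLess_imp_ordLeq)
    then have "|\<Union>i\<in>(UNIV :: bool set). if i then T n else (\<lambda>(k, x, y). F k x y) ` (UNIV \<times> T n \<times> T n)| \<le>o |B|"
      by (rule card_of_UNION_ordLeq_infinite[OF infB _ le])
    moreover have "T (Suc n) = (\<Union>i\<in>(UNIV :: bool set). if i then T n else (\<lambda>(k, x, y). F k x y) ` (UNIV \<times> T n \<times> T n))"
      unfolding TS UNIV_bool by auto
    ultimately show ?case by simp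
  qed
  have mono: "T n \<subseteq> T m" if "n \<le> m" for n m
    using that by (rule lift_Suc_mono_le[rotated]) (auto simp: TS)
  show thesis
  proof
    show "A \<subseteq> (\<Union>n. T n)" "c \<in> (\<Union>n. T n)" using T0 by auto
    have "|\<Union>n. T n| \<le>o |B|" using card by (intro card_of_UNION_ordLeq_infinite[OF infB natB]) auto
    then show "|\<Union>n. T n| <o \<kappa>" using B ordLeq_ordLess_trans by blast
    fix k x y assume "x \<in> (\<Union>n. T n)" "y \<in> (\<Union>n. T n)"
    then obtain n m where "x \<in> T n" "y \<in> T m" by auto
    then have "x \<in> T (max n m)" "y \<in> T (max n m)" using mono[of n "max n m"] mono[of m "max n m"] by auto
    then have "F k x y \<in> T (Suc (max n m))" unfolding TS by force
    then show "F k x y \<in> (\<Union>n. T n)" by blast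
  qed
qed

text \<open>Roots are reached from coefficients by way of polynomials, so the closure is formed in
  the two-sorted type \<open>'a + 'a poly\<close>.\<close>

lemma small_rel_alg_closed:
  fixes A :: "'a::linordered_field set"
  assumes A: "|A| <o \<kappa>"
  obtains T where "A \<subseteq> T" "rel_alg_closed T" "|T| <o \<kappa>"
proof -
  \<comment> \<open>On two elements, \<open>k mod 6\<close> selects an arithmetic operation or a
    starting value; an element and a polynomial give \<open>pCons\<close>; a polynomial in first
    place gives its \<open>k\<close>-th root. An index beyond the roots yields an arbitrary element,
    which is harmless in a closure.\<close>
  define F :: "nat \<Rightarrow> 'a + 'a poly \<Rightarrow> 'a + 'a poly \<Rightarrow> 'a + 'a poly" where
    "F = (\<lambda>k u v. case u of
        Inl a \<Rightarrow> (case v of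
           Inl b \<Rightarrow> [Inl 1, Inl (a + b), Inl (a * b), Inl (- a), Inl (inverse a), Inr 0] ! (k mod 6)
         | Inr p \<Rightarrow> Inr (pCons a p))
      | Inr p \<Rightarrow> Inl (sorted_list_of_set {x. poly p x = 0} ! k))"
  have "|Inl ` A| <o \<kappa>" using A card_of_image ordLeq_ordLess_trans by blast
  then obtain S where S: "Inl ` A \<subseteq> S" "Inl 0 \<in> S" "|S| <o \<kappa>"
    and cl: "\<And>k u v. u \<in> S \<Longrightarrow> v \<in> S \<Longrightarrow> F k u v \<in> S"
    using small_closure[of "Inl ` A" "Inl 0" F] by blast
  define T where "T = {a. Inl a \<in> S}"
  have cl1: "Inl 1 \<in> S" "Inr 0 \<in> S" using cl[OF S(2) S(2), of 0] cl[OF S(2) S(2), of 5] by (auto simp: F_def)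
  have cl2: "Inl (a + b) \<in> S" "Inl (a * b) \<in> S" "Inl (- a) \<in> S" "Inl (inverse a) \<in> S"
    if "Inl a \<in> S" "Inl b \<in> S" for a b
  proof -
    have "F 1 (Inl a) (Inl b) = Inl (a + b)" "F 2 (Inl a) (Inl b) = Inl (a * b)"
      "F 3 (Inl a) (Inl b) = Inl (- a)" "F 4 (Inl a) (Inl b) = Inl (inverse a)"
      by (simp_all add: F_def)
    then show "Inl (a + b) \<in> S" "Inl (a * b) \<in> S" "Inl (- a) \<in> S" "Inl (inverse a) \<in> S"
      using cl[OF that] by metis+
  qed
  have sub: "is_subfield T"
    unfolding is_subfield_def T_def
    by (intro conjI ballI CollectI S(2) cl1(1) cl2; (erule CollectD | rule S(2)))
  have poly: "Inr p \<in> S" if "p \<in> polys_over T" for p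
    using that
  proof (induction p)
    case 0 then show ?case using cl1 by simp
  next
    case (pCons a p)
    have co: "coeff (pCons a p) i \<in> T" for i using pCons.prems by (rule polys_over_coeff)
    have "a \<in> T" using co[of 0] by simp
    moreover have "p \<in> polys_over T" using co[of "Suc i" for i] by (auto simp: polys_over_def)
    ultimately show ?case using cl[of "Inl a" "Inr p" 0] pCons.IH by (simp add: F_def T_def)
  qed
  have root: "x \<in> T" if p: "p \<in> polys_over T" "p \<noteq> 0" "poly p x = 0" for p x
  proof -
    define R where "R = {x. poly p x = 0}"
    have "finite R" unfolding R_def by (rule poly_roots_finite[OF p(2)])
    then have "x \<in> set (sorted_list_of_set R)" using p(3) by (simp add: R_def)
    then obtain k where "sorted_list_of_set R ! k = x" by (auto simp: in_set_conv_nth)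
    moreover have "F k (Inr p) (Inl 0) \<in> S" by (intro cl poly p S)
    ultimately show ?thesis by (simp add: F_def R_def T_def)
  qed
  show thesis
  proof
    show "A \<subseteq> T" using S by (auto simp: T_def)
    show "rel_alg_closed T" using sub root by (auto simp: rel_alg_closed_def alg_over_def)
    have "T \<subseteq> (\<lambda>u. case u of Inl a \<Rightarrow> a | Inr p \<Rightarrow> 0) ` S" by (force simp: T_def)
    then have "|T| \<le>o |S|" using card_of_mono1 card_of_image ordLeq_transitive by blast
    then show "|T| <o \<kappa>" using S(3) ordLeq_ordLess_trans by blast
  qed
qed

lemma small_Un: "|A| <o \<kappa> \<Longrightarrow> |B| <o \<kappa> \<Longrightarrow> |A \<union> B| <o \<kappa>"
  by (intro card_of_Un_ordLess_infinite_Field kappa_infinite kappa)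

lemma small_mono: "A \<subseteq> B \<Longrightarrow> |B| <o \<kappa> \<Longrightarrow> |A| <o \<kappa>"
  using card_of_mono1 ordLeq_ordLess_trans by blast

lemma small_finite: "finite A \<Longrightarrow> |A| <o \<kappa>"
  using kappa_infinite card_of_Field_ordIso[OF kappa(1)] finite_ordLess_infinite2 ordLess_ordIso_trans by blast

lemma small_Range:
  assumes "field_graph G" "|Domain G| <o \<kappa>" shows "|Range G| <o \<kappa>"
proof -
  have "Range G \<subseteq> (\<lambda>x. SOME y. (x, y) \<in> G) ` Domain G"
  proof
    fix y assume "y \<in> Range G"
    then obtain x where xy: "(x, y) \<in> G" by auto
    then have "(x, SOME y. (x, y) \<in> G) \<in> G" by (rule someI)
    then have "(SOME y. (x, y) \<in> G) = y" using order_graph_eq[OF field_graph_order[OF assms(1)] _ xy] by blast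
    then show "y \<in> (\<lambda>x. SOME y. (x, y) \<in> G) ` Domain G" using xy by force
  qed
  then show ?thesis using assms(2) card_of_mono1 card_of_image ordLeq_transitive ordLeq_ordLess_trans by meson
qed

end

subsection \<open>Small embeddings are elementary\<close>

definition vle_formula :: "ov_term \<Rightarrow> ov_term \<Rightarrow> ov_formula" where
  "vle_formula t u = FEx 3 (FAnd (FVal (TVar 3)) (FEq t (TMult (TVar 3) u)))"

text \<open>The three clauses of \<open>same_cut\<close>: variable \<open>0\<close> stands for the
  new element, \<open>1\<close> for \<open>s\<close> and \<open>2\<close> for \<open>c\<close>;
  variable \<open>3\<close> is bound inside \<open>vle_formula\<close>.\<close>

definition cut_formula :: "nat \<Rightarrow> ov_formula" where
  "cut_formula j = (if j = 0 then FLess (TVar 0) (TVar 1)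
     else if j = 1 then vle_formula (TAdd (TVar 0) (TMinus (TVar 1))) (TVar 2)
     else vle_formula (TVar 2) (TAdd (TVar 0) (TMinus (TVar 1))))"

lemma saturatedD:
  assumes "saturated V \<kappa>" "|A| <o \<kappa>" "\<forall>(p, s)\<in>P. range s \<subseteq> A"
    and "\<And>Q. Q \<subseteq> P \<Longrightarrow> finite Q \<Longrightarrow> \<exists>x. \<forall>(p, s)\<in>Q. sat V (s(0 := x)) p"
  shows "\<exists>x. \<forall>(p, s)\<in>P. sat V (s(0 := x)) p"
  using assms(1)[unfolded saturated_def, THEN spec[of _ A], THEN spec[of _ P]] assms(2-4) by blast

context convex_valuation
begin

lemma sat_cut_formula:
  "sat V ((\<lambda>i. if i = Suc 0 then s else c)(0 := y)) (cut_formula j) \<longleftrightarrow>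
     (if j = 0 then y < s else if j = Suc 0 then y - s \<preceq> c else c \<preceq> y - s)"
  by (auto simp: cut_formula_def vle_formula_def vle_def)

context
  fixes \<kappa> :: "'c rel"
  assumes kappa: "Card_order \<kappa>" "natLeq <o \<kappa>" and satur: "saturated V \<kappa>"
    and rcU: "real_closed_in (UNIV :: 'a set)" and nontriv: "V \<noteq> UNIV"
begin

text \<open>The cut is a type over \<open>Range G\<close>: each cut formula, or its negation,
  according to its truth at \<open>x\<close>, with the parameters replaced by their images. It is
  finitely satisfiable by \<open>finite_cut_realized\<close>, and \<open>Range G\<close> is
  small.\<close>

lemma cut_realized:
  assumes G: "val_graph G" and small: "|Domain G| <o \<kappa>" and x: "x \<notin> Domain G"
  shows "\<exists>y. same_cut G x y"
proof -
  define C where "C = (\<lambda>(j::nat) y s c. if j = 0 then y < s else if j = 1 then y - s \<preceq> c else c \<preceq> y - s)"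
  define \<pi> where "\<pi> = (\<lambda>((s, s' :: 'a), (c, c'), j). (if C j x s c then cut_formula j else FNot (cut_formula j),
      (\<lambda>i. if i = Suc 0 then s' else c')))"
  define P where "P = \<pi> ` (G \<times> G \<times> {0, 1, 2})"
  have sat_pi: "(case \<pi> ((s, s'), (c, c'), j) of (p, a) \<Rightarrow> sat V (a(0 := y)) p) \<longleftrightarrow>
      (C j x s c \<longleftrightarrow> C j y s' c')" for s s' c c' j y
    unfolding \<pi>_def C_def by (simp add: sat_cut_formula)
  have fin: "\<exists>y. \<forall>(p, a)\<in>Q. sat V (a(0 := y)) p" if Q: "Q \<subseteq> P" "finite Q" for Q
  proof -
    obtain Q0 where Q0: "Q0 \<subseteq> G \<times> G \<times> {0, 1, 2}" "finite Q0" "Q = \<pi> ` Q0"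
      using finite_subset_image[OF Q(2) Q(1)[unfolded P_def]] by blast
    define F where "F = fst ` Q0 \<union> (\<lambda>q. fst (snd q)) ` Q0"
    have "finite F" "F \<subseteq> G" using Q0 by (auto simp: F_def)
    then obtain y where y: "same_cut F x y" using finite_cut_realized[OF rcU nontriv G x] by blast
    have *: "case \<pi> q of (p, a) \<Rightarrow> sat V (a(0 := y)) p" if "q \<in> Q0" for q
    proof -
      obtain s s' c c' j where q: "q = ((s, s'), (c, c'), j)" by (metis prod.exhaust)
      have "(s, s') \<in> F" "(c, c') \<in> F" using that unfolding F_def q by force+
      then have "C j x s c \<longleftrightarrow> C j y s' c'"
        using same_cutD[OF y] unfolding C_def by (cases "j = 0"; cases "j = 1") simp_all
      then show ?thesis unfolding q sat_pi .
    qed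
    have "case z of (p, a) \<Rightarrow> sat V (a(0 := y)) p" if "z \<in> Q" for z
    proof -
      obtain q where "z = \<pi> q" "q \<in> Q0" using \<open>z \<in> Q\<close> unfolding Q0(3) by (rule imageE)
      then show ?thesis using * by simp
    qed
    then show ?thesis by (intro exI[of _ y] ballI)
  qed
  have "\<forall>(p, a)\<in>P. range a \<subseteq> Range G" by (auto simp: P_def \<pi>_def)
  moreover have "|Range G| <o \<kappa>" by (rule small_Range[OF kappa val_graph_field[OF G] small])
  ultimately obtain y where y: "\<forall>(p, a)\<in>P. sat V (a(0 := y)) p"
    using saturatedD[OF satur _ _ fin] by meson
  have "C j x s c \<longleftrightarrow> C j y s' c'" if "(s, s') \<in> G" "(c, c') \<in> G" "j \<in> {0, 1, 2}" for s s' c c' j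
  proof -
    have "\<pi> ((s, s'), (c, c'), j) \<in> P" unfolding P_def using that by blast
    with y have "case \<pi> ((s, s'), (c, c'), j) of (p, a) \<Rightarrow> sat V (a(0 := y)) p" by (rule bspec)
    then show ?thesis unfolding sat_pi .
  qed
  from this[of _ _ _ _ 0] this[of _ _ _ _ 1] this[of _ _ _ _ 2] have "same_cut G x y"
    unfolding same_cut_def C_def by simp
  then show ?thesis ..
qed

text \<open>A cut determines an embedding only over a relatively algebraically closed domain, so the
  domain is closed first, inside a small field. The fractions added afterwards lie in a second small
  field \<open>T'\<close>.\<close>

lemma extend_val_graph:
  assumes G: "val_graph G" and small: "|Domain G| <o \<kappa>"
  obtains H where "val_graph H" "G \<subseteq> H" "|Domain H| <o \<kappa>" "x \<in> Domain H"
proof -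
  obtain T where T: "Domain G \<subseteq> T" "rel_alg_closed T" "|T| <o \<kappa>"
    using small_rel_alg_closed[OF kappa small] by blast
  obtain H where H: "val_graph H" "G \<subseteq> H" "Domain H \<subseteq> T" "rel_alg_closed (Domain H)"
    using extend_rel_alg_closed[OF rcU G T(2,1)] by blast
  have smallH: "|Domain H| <o \<kappa>" by (rule small_mono[OF kappa H(3) T(3)])
  show thesis
  proof (cases "x \<in> Domain H")
    case True then show thesis using that H smallH by blast
  next
    case False
    obtain y where y: "same_cut H x y" using cut_realized[OF H(1) smallH False] by blast
    define E where "E = frac_graph (adjoin_graph H x y)"
    have E: "val_graph E" unfolding E_def by (rule val_graph_if_same_cut[OF rcU H(1,4) False y])
    have "adjoin_graph H x y \<subseteq> E"
    proof
      fix q assume "q \<in> adjoin_graph H x y"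
      then show "q \<in> E"
        using subring_graph_1[OF subring_graph_adjoin[OF val_graph_field[OF H(1)]], of x y]
        unfolding E_def frac_graph_def by (cases q) force
    qed
    then have HE: "H \<subseteq> E" "(x, y) \<in> E"
      using adjoin_graph_incl[OF val_graph_field[OF H(1)]] adjoin_graph_mem[OF val_graph_field[OF H(1)]] by blast+
    have "|Domain H \<union> {x}| <o \<kappa>" by (intro small_Un[OF kappa] smallH small_finite[OF kappa]) simp
    then obtain T' where T': "Domain H \<union> {x} \<subseteq> T'" "rel_alg_closed T'" "|T'| <o \<kappa>"
      using small_rel_alg_closed[OF kappa] by blast
    have S: "is_subfield T'" using T' by (simp add: rel_alg_closed_def)
    have po: "poly p x \<in> T'" if "(p, p') \<in> poly_graph H" for p p'
      using polys_over_poly[OF S, of p x] T'(1) poly_graph_domain[OF val_graph_field[OF H(1)] that]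
      by (auto simp: polys_over_def)
    have "Domain E \<subseteq> T'"
      unfolding E_def frac_graph_def adjoin_graph_def[OF val_graph_field[OF H(1)]]
      using po is_subfield_divide[OF S] by blast
    then have "|Domain E| <o \<kappa>" using T' small_mono[OF kappa] by blast
    then show thesis using that E HE H(2) by blast
  qed
qed

lemma tm_val_graph:
  assumes G: "val_graph G" and s: "\<And>i. (s i, s' i) \<in> G"
  shows "(tm_val s t, tm_val s' t) \<in> G"
proof -
  note S = field_graph_subring[OF val_graph_field[OF G]]
  show ?thesis
    by (induction t) (auto intro: s subring_graph_0[OF S] subring_graph_1[OF S] subring_graph_add[OF S]
        subring_graph_mult[OF S] subring_graph_uminus[OF S])
qed

text \<open>Back and forth as an induction on formulas with arbitrary \<open>G\<close>: a witness on
  the left is added to the domain of \<open>G\<close>, a witness on the right to that of its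
  converse.\<close>

lemma sat_val_graph:
  assumes "val_graph G" "|Domain G| <o \<kappa>" "\<And>i. (s i, s' i) \<in> G"
  shows "sat V s' p \<longleftrightarrow> sat V s p"
  using assms
proof (induction p arbitrary: G s s')
  case (FEq t u)
  show ?case using order_graph_eq[OF field_graph_order[OF val_graph_field[OF FEq(1)]]
        tm_val_graph[OF FEq(1,3)] tm_val_graph[OF FEq(1,3)]] by simp
next
  case (FLess t u)
  show ?case using order_graph_less[OF field_graph_order[OF val_graph_field[OF FLess(1)]]
        tm_val_graph[OF FLess(1,3)] tm_val_graph[OF FLess(1,3)]] by simp
next
  case (FVal t)
  show ?case using val_graph_V[OF FVal(1) tm_val_graph[OF FVal(1,3)]] by simp
next
  case (FNot p)
  show ?case using FNot.IH[OF FNot.prems] by simp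
next
  case (FAnd p q)
  show ?case using FAnd.IH(1)[OF FAnd.prems] FAnd.IH(2)[OF FAnd.prems] by simp
next
  case (FEx i p)
  have up: "\<exists>y. sat V (s'(i := y)) p" if "sat V (s(i := x)) p" for x
  proof -
    obtain H where H: "val_graph H" "G \<subseteq> H" "|Domain H| <o \<kappa>" "x \<in> Domain H"
      by (rule extend_val_graph[OF FEx.prems(1,2)])
    then obtain y where y: "(x, y) \<in> H" by auto
    have "((s(i := x)) j, (s'(i := y)) j) \<in> H" for j using y H(2) FEx.prems(3) by auto
    from FEx.IH[OF H(1,3), of "s(i := x)" "s'(i := y)", OF this] that show ?thesis by blast
  qed
  have down: "\<exists>x. sat V (s(i := x)) p" if "sat V (s'(i := y)) p" for y
  proof -
    have "|Domain (G\<inverse>)| <o \<kappa>" using small_Range[OF kappa val_graph_field[OF FEx.prems(1)] FEx.prems(2)] by simp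
    then obtain H where H: "val_graph H" "G\<inverse> \<subseteq> H" "|Domain H| <o \<kappa>" "y \<in> Domain H"
      by (rule extend_val_graph[OF val_graph_converse[OF FEx.prems(1)]])
    then obtain x where x: "(y, x) \<in> H" by auto
    have "((s(i := x)) j, (s'(i := y)) j) \<in> H\<inverse>" for j using x H(2) FEx.prems(3) by auto
    moreover have "|Domain (H\<inverse>)| <o \<kappa>" using small_Range[OF kappa val_graph_field[OF H(1)] H(3)] by simp
    ultimately show ?thesis using FEx.IH[OF val_graph_converse[OF H(1)], of "s(i := x)" "s'(i := y)"] that by blast
  qed
  show ?case using up down by auto
qed

lemma val_graph_partial_elementary:
  assumes "val_graph G" "|Domain G| <o \<kappa>" "\<And>a. a \<in> A \<Longrightarrow> (a, f a) \<in> G"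
  shows "partial_elementary V A f"
  unfolding partial_elementary_def
proof (intro allI impI)
  fix s :: "nat \<Rightarrow> 'a" and p assume "range s \<subseteq> A"
  then have "(s i, (f \<circ> s) i) \<in> G" for i using assms(3) by auto
  then show "sat V (f \<circ> s) p \<longleftrightarrow> sat V s p" by (rule sat_val_graph[OF assms(1,2)])
qed

end

end

subsection \<open>Immediate extensions\<close>

text \<open>The squared absolute value of \<open>x + i y\<close>. Compared by
  \<open>\<preceq>\<close>, it represents the extension of the valuation to the algebraic closure;
  squaring doubles the values and avoids a square root.\<close>

definition nrm2 :: "'a::linordered_field alg_closure \<Rightarrow> 'a" where
  "nrm2 z = (THE n. \<exists>x y. z = cplx x y \<and> n = x * x + y * y)"

lemma nrm2_cplx: "nrm2 (cplx x y) = x * x + y * y"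
  unfolding nrm2_def by (rule the_equality) (auto simp: cplx_eq_iff)

lemma nrm2_to_ac: "nrm2 (to_ac x) = x * x"
  unfolding cplx_of_real nrm2_cplx by simp

context convex_valuation
begin

context
  assumes rcU: "real_closed_in (UNIV :: 'a set)"
begin

lemma nrm2_mult: "nrm2 (z * w) = nrm2 z * nrm2 (w :: 'a alg_closure)"
proof -
  obtain x y where z: "z = cplx x y" by (rule alg_closure_cplx[OF rcU])
  obtain u v where w: "w = cplx u v" by (rule alg_closure_cplx[OF rcU])
  show ?thesis unfolding z w cplx_mult nrm2_cplx by (simp add: algebra_simps)
qed

lemma nrm2_nonneg: "0 \<le> nrm2 (z :: 'a alg_closure)"
proof -
  obtain x y where z: "z = cplx x y" by (rule alg_closure_cplx[OF rcU])
  show ?thesis unfolding z nrm2_cplx by simp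
qed

lemma nrm2_eq_0_iff: "nrm2 z = 0 \<longleftrightarrow> z = (0 :: 'a alg_closure)"
proof -
  obtain x y where z: "z = cplx x y" by (rule alg_closure_cplx[OF rcU])
  show ?thesis unfolding z nrm2_cplx cplx_eq_0_iff by (simp add: sum_squares_eq_zero_iff)
qed

lemma nrm2_uminus: "nrm2 (- z) = nrm2 (z :: 'a alg_closure)"
proof -
  obtain x y where z: "z = cplx x y" by (rule alg_closure_cplx[OF rcU])
  show ?thesis unfolding z cplx_uminus nrm2_cplx by simp
qed

lemma nrm2_minus_commute: "nrm2 (z - w) = nrm2 (w - z :: 'a alg_closure)"
  using nrm2_uminus[of "z - w"] by simp

lemma nrm2_1: "nrm2 (1 :: 'a alg_closure) = 1"
  using nrm2_to_ac[of "1 :: 'a"] by simp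

lemma nrm2_inverse: "nrm2 (inverse z) = inverse (nrm2 (z :: 'a alg_closure))"
proof (cases "z = 0")
  case True
  then show ?thesis using nrm2_eq_0_iff[of 0] by simp
next
  case False
  then have "nrm2 z * nrm2 (inverse z) = 1" by (simp add: nrm2_mult[symmetric] nrm2_1)
  then show ?thesis by (rule inverse_unique[symmetric])
qed

lemma nrm2_divide: "nrm2 (z / w) = nrm2 z / nrm2 (w :: 'a alg_closure)"
  by (simp add: divide_inverse nrm2_mult nrm2_inverse)

text \<open>The ultrametric inequality follows from
  \<open>|z + w|^2 \<le> 2 (|z|^2 + |w|^2)\<close>, since the factor \<open>2\<close> is a
  unit.\<close>

lemma nrm2_add: "nrm2 (z + w) \<preceq> nrm2 z \<or> nrm2 (z + w) \<preceq> nrm2 (w :: 'a alg_closure)"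
proof -
  obtain x y where z: "z = cplx x y" by (rule alg_closure_cplx[OF rcU])
  obtain u v where w: "w = cplx u v" by (rule alg_closure_cplx[OF rcU])
  have "0 \<le> (x - u) * (x - u) + (y - v) * (y - v)" by simp
  then have le: "nrm2 (z + w) \<le> 2 * (nrm2 z + nrm2 w)"
    unfolding z w cplx_add nrm2_cplx by (simp add: algebra_simps)
  have "nrm2 (z + w) \<preceq> 2 * (nrm2 z + nrm2 w)"
    using le nrm2_nonneg[of "z + w"] by (intro vle_if_abs_le) auto
  then have *: "nrm2 (z + w) \<preceq> nrm2 z + nrm2 w" by (simp only: vle_double_iff)
  from vle_total[of "nrm2 z" "nrm2 w"] show ?thesis
  proof
    assume "nrm2 z \<preceq> nrm2 w"
    then have "nrm2 z + nrm2 w \<preceq> nrm2 w" by (intro vle_add) auto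
    then show ?thesis using * vle_trans by blast
  next
    assume "nrm2 w \<preceq> nrm2 z"
    then have "nrm2 z + nrm2 w \<preceq> nrm2 z" by (intro vle_add) auto
    then show ?thesis using * vle_trans by blast
  qed
qed

lemma nrm2_vle_add: "nrm2 z \<preceq> u \<Longrightarrow> nrm2 (w :: 'a alg_closure) \<preceq> u \<Longrightarrow> nrm2 (z + w) \<preceq> u"
  using nrm2_add[of z w] vle_trans by blast

lemma nrm2_vlt_add: "nrm2 z \<lless> u \<Longrightarrow> nrm2 (w :: 'a alg_closure) \<lless> u \<Longrightarrow> nrm2 (z + w) \<lless> u"
  using nrm2_add[of z w] vle_vlt_trans by blast

text \<open>The 1-units. They form a multiplicative group, and two elements have the same leading
  term if their quotient belongs to it.\<close>

definition unit1 :: "'a alg_closure \<Rightarrow> bool" where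
  "unit1 u \<longleftrightarrow> nrm2 (u - 1) \<lless> 1"

lemma unit1_veq: assumes "unit1 u" shows "veq (nrm2 u) 1"
proof -
  have u: "nrm2 (u - 1) \<lless> 1" using assms by (simp add: unit1_def)
  have "nrm2 ((u - 1) + 1) \<preceq> 1" using vlt_imp_vle[OF u] by (intro nrm2_vle_add) (auto simp: nrm2_1)
  moreover have "1 \<preceq> nrm2 u"
    using nrm2_vlt_add[of "- (u - 1)" 1 u] u nrm2_uminus[of "u - 1"] by (auto simp: vlt_def nrm2_1)
  ultimately show ?thesis by (simp add: veq_def)
qed

lemma unit1_nonzero: "unit1 u \<Longrightarrow> u \<noteq> 0"
  using unit1_veq[of u] nrm2_eq_0_iff[of u] by auto

lemma unit1_1: "unit1 1"
  using nrm2_eq_0_iff[of 0] by (simp add: unit1_def)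

lemma unit1_mult: assumes "unit1 u" "unit1 v" shows "unit1 (u * v)"
proof -
  have "nrm2 ((u - 1) * v) \<lless> 1"
    using vlt_vle_mult[of "nrm2 (u - 1)" 1 "nrm2 v" 1] assms unit1_veq[OF assms(2)]
    by (simp add: nrm2_mult unit1_def veq_def)
  then have "nrm2 ((u - 1) * v + (v - 1)) \<lless> 1" using assms(2) by (intro nrm2_vlt_add) (auto simp: unit1_def)
  then show ?thesis by (simp add: unit1_def algebra_simps)
qed

lemma unit1_inverse: assumes "unit1 u" shows "unit1 (inverse u)"
proof -
  have "inverse u - 1 = (- (u - 1)) * inverse u" using unit1_nonzero[OF assms] by (simp add: algebra_simps)
  then have "nrm2 (inverse u - 1) = nrm2 (u - 1) / nrm2 u"
    by (metis nrm2_mult nrm2_uminus nrm2_inverse divide_inverse)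
  also have "\<dots> \<lless> 1"
  proof -
    have "nrm2 u \<noteq> 0" using unit1_nonzero[OF assms] nrm2_eq_0_iff by blast
    moreover have "nrm2 (u - 1) \<lless> nrm2 u"
      using assms unit1_veq[OF assms] vlt_vle_trans by (auto simp: unit1_def veq_def)
    ultimately show ?thesis by (simp add: vlt_divide_iff)
  qed
  finally show ?thesis by (simp add: unit1_def)
qed

text \<open>\<open>maximal_in_closure C\<close> says that \<open>C\<close> has no proper immediate extension inside the algebraic
  closure: the extension \<open>F\<close> is immediate iff every \<open>z \<noteq> 0\<close> in \<open>F\<close> is of the form \<open>c * (1 + \<epsilon>)\<close>
  with \<open>c\<close> in \<open>C\<close> and \<open>\<epsilon>\<close> in the maximal ideal.\<close>

definition maximal_in_closure :: "'a set \<Rightarrow> bool" where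
  "maximal_in_closure C \<longleftrightarrow> (\<forall>F. is_subfield F \<longrightarrow> to_ac ` C \<subseteq> F \<longrightarrow>
     (\<forall>z\<in>F - {0}. \<exists>c\<in>C - {0}. unit1 (z / to_ac c)) \<longrightarrow> F = to_ac ` C)"

context
  fixes C and a :: 'a
  assumes C: "is_subfield C" and noncl: "\<And>c. c \<in> C \<Longrightarrow> \<exists>c'\<in>C. a - c' \<lless> a - c"
begin

text \<open>Pseudo-limits in the sense of Ostrowski and Kaplansky of the elements of
  \<open>C\<close> approaching \<open>a\<close>: the points closer to \<open>a\<close> than all of
  \<open>C\<close>. One of them is \<open>a\<close>; no element of \<open>C\<close> is.\<close>

definition pseudo_limit :: "'a alg_closure \<Rightarrow> bool" where
  "pseudo_limit z \<longleftrightarrow> (\<forall>c\<in>C. nrm2 (z - to_ac a) \<lless> (a - c) * (a - c))"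

lemma pseudo_limit_self: "pseudo_limit (to_ac a)"
proof -
  have "(a - c) * (a - c) \<noteq> 0" if "c \<in> C" for c using noncl[OF that] by auto
  then show ?thesis using nrm2_eq_0_iff[of 0] by (simp add: pseudo_limit_def)
qed

text \<open>A point \<open>z\<close> that is no pseudo-limit stays at least as far from
  \<open>a\<close> as some \<open>c0\<close>. Once \<open>c\<close> is closer to \<open>a\<close>
  than that, the distance from \<open>b\<close> to \<open>c\<close> is negligible against the
  distance from \<open>c\<close> to \<open>z\<close>.\<close>

lemma pseudo_limit_ratio_linear:
  assumes b: "pseudo_limit b" and z: "\<not> pseudo_limit z"
  obtains c1 where "c1 \<in> C" "\<And>c. c \<in> C \<Longrightarrow> a - c \<preceq> a - c1 \<Longrightarrow> to_ac c \<noteq> z \<and> unit1 ((b - z) / (to_ac c - z))"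
proof -
  obtain c0 where c0: "c0 \<in> C" "(a - c0) * (a - c0) \<preceq> nrm2 (z - to_ac a)"
    using z by (auto simp: pseudo_limit_def vlt_def)
  obtain c1 where c1: "c1 \<in> C" "a - c1 \<lless> a - c0" using noncl[OF c0(1)] by blast
  show thesis
  proof (rule that[OF c1(1)])
    fix c assume c: "c \<in> C" "a - c \<preceq> a - c1"
    have lt: "(a - c) * (a - c) \<lless> (a - c0) * (a - c0)"
      unfolding vlt_square_iff using vle_vlt_trans[OF c(2) c1(2)] .
    have ac: "nrm2 (to_ac c - to_ac a) = (a - c) * (a - c)"
      using nrm2_to_ac[of "c - a"] by (simp add: algebra_simps)
    have "nrm2 ((z - to_ac c) + (to_ac c - to_ac a)) \<preceq> nrm2 (z - to_ac c)
      \<or> nrm2 ((z - to_ac c) + (to_ac c - to_ac a)) \<preceq> nrm2 (to_ac c - to_ac a)" by (rule nrm2_add)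
    moreover have "(z - to_ac c) + (to_ac c - to_ac a) = z - to_ac a" by simp
    ultimately have "nrm2 (z - to_ac a) \<preceq> nrm2 (to_ac c - z) \<or> nrm2 (z - to_ac a) \<preceq> (a - c) * (a - c)"
      by (simp only: ac nrm2_minus_commute[of z "to_ac c"])
    moreover have "\<not> nrm2 (z - to_ac a) \<preceq> (a - c) * (a - c)"
      using lt c0(2) vle_trans by (auto simp: vlt_def)
    ultimately have cz: "(a - c) * (a - c) \<lless> nrm2 (to_ac c - z)"
      using lt c0(2) vlt_vle_trans by blast
    have "nrm2 (b - to_ac a) \<preceq> (a - c) * (a - c)"
      using b c(1) vlt_imp_vle by (auto simp: pseudo_limit_def)
    then have "nrm2 ((b - to_ac a) + (to_ac a - to_ac c)) \<preceq> (a - c) * (a - c)"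
      by (intro nrm2_vle_add) (auto simp: ac nrm2_minus_commute[of "to_ac a"])
    then have "nrm2 (b - to_ac c) \<preceq> (a - c) * (a - c)" by simp
    then have bc: "nrm2 (b - to_ac c) \<lless> nrm2 (to_ac c - z)" using cz vle_vlt_trans by blast
    have ne: "to_ac c \<noteq> z"
      using cz nrm2_eq_0_iff[of 0] by auto
    then have "(b - z) / (to_ac c - z) - 1 = (b - to_ac c) / (to_ac c - z)"
      by (simp add: field_simps)
    moreover have "nrm2 (to_ac c - z) \<noteq> 0" using ne nrm2_eq_0_iff[of "to_ac c - z"] by simp
    ultimately have "unit1 ((b - z) / (to_ac c - z))"
      using bc by (simp add: unit1_def nrm2_divide vlt_divide_iff)
    then show "to_ac c \<noteq> z \<and> unit1 ((b - z) / (to_ac c - z))" using ne by simp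
  qed
qed

lemma closer:
  assumes "c1 \<in> C" "c2 \<in> C"
  obtains c where "c \<in> C" "a - c \<preceq> a - c1" "a - c \<preceq> a - c2"
  using assms vle_total[of "a - c1" "a - c2"] vle_refl by blast

text \<open>Linear factors over the algebraic closure reduce this to the previous lemma; the
  finitely many conditions on \<open>c\<close> are combined by \<open>closer\<close>. Hence
  \<open>poly q b\<close> has the same leading term as a value of \<open>q\<close> on
  \<open>C\<close>.\<close>

lemma pseudo_limit_ratio:
  assumes b: "pseudo_limit b"
  shows "q \<noteq> 0 \<Longrightarrow> (\<And>z. poly q z = 0 \<Longrightarrow> \<not> pseudo_limit z) \<Longrightarrow>
    \<exists>c1\<in>C. \<forall>c\<in>C. a - c \<preceq> a - c1 \<longrightarrow> poly q (to_ac c) \<noteq> 0 \<and> unit1 (poly q b / poly q (to_ac c))"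
proof (induction "degree q" arbitrary: q rule: less_induct)
  case less
  show ?case
  proof (cases "degree q = 0")
    case True
    then obtain k where "q = [:k:]" by (auto elim: degree_eq_zeroE)
    then show ?thesis using less.prems(1) is_subfield_0[OF C] unit1_1 by auto
  next
    case False
    then obtain z where z: "poly q z = 0" using alg_closed_imp_poly_has_root[of q] by auto
    then obtain r where r: "q = [:- z, 1:] * r" by (auto simp: poly_eq_0_iff_dvd elim: dvdE)
    have "r \<noteq> 0" using less.prems r by auto
    then have "degree r < degree q" unfolding r by (subst degree_mult_eq) auto
    moreover have "\<not> pseudo_limit y" if "poly r y = 0" for y using less.prems(2)[of y] that by (simp add: r)
    ultimately obtain c1 where c1: "c1 \<in> C"
      "\<And>c. c \<in> C \<Longrightarrow> a - c \<preceq> a - c1 \<Longrightarrow> poly r (to_ac c) \<noteq> 0 \<and> unit1 (poly r b / poly r (to_ac c))"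
      using less.hyps[of r] \<open>r \<noteq> 0\<close> by blast
    obtain c2 where c2: "c2 \<in> C"
      "\<And>c. c \<in> C \<Longrightarrow> a - c \<preceq> a - c2 \<Longrightarrow> to_ac c \<noteq> z \<and> unit1 ((b - z) / (to_ac c - z))"
      using pseudo_limit_ratio_linear[OF b less.prems(2)[OF z]] by blast
    obtain c3 where c3: "c3 \<in> C" "a - c3 \<preceq> a - c1" "a - c3 \<preceq> a - c2" using closer[OF c1(1) c2(1)] by blast
    have "poly q (to_ac c) \<noteq> 0 \<and> unit1 (poly q b / poly q (to_ac c))" if "c \<in> C" "a - c \<preceq> a - c3" for c
    proof -
      have *: "poly r (to_ac c) \<noteq> 0 \<and> unit1 (poly r b / poly r (to_ac c))"
        using c1(2) that c3(2) vle_trans by blast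
      have **: "to_ac c \<noteq> z \<and> unit1 ((b - z) / (to_ac c - z))"
        using c2(2) that c3(3) vle_trans by blast
      have "poly q y = (y - z) * poly r y" for y by (simp add: r algebra_simps)
      then have "poly q (to_ac c) \<noteq> 0"
        "poly q b / poly q (to_ac c) = ((b - z) / (to_ac c - z)) * (poly r b / poly r (to_ac c))"
        using * ** by simp_all
      then show ?thesis
        using unit1_mult[OF **[THEN conjunct2] *[THEN conjunct2]] by (simp only: simp_thms)
    qed
    then show ?thesis using c3(1) by blast
  qed
qed

text \<open>Kaplansky's dichotomy. If no nonzero polynomial over \<open>C\<close> vanishes at a
  pseudo-limit, \<open>a\<close> itself serves. Otherwise \<open>b\<close> is a root of such a
  polynomial of least degree, and reduction modulo it leaves polynomials of smaller degree, whose
  roots are not pseudo-limits.\<close>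

lemma immediate_extension:
  obtains b where "pseudo_limit b"
    "\<And>q. q \<in> polys_over (to_ac ` C) \<Longrightarrow> poly q b \<noteq> 0 \<Longrightarrow>
      \<exists>q'\<in>polys_over (to_ac ` C). poly q' b = poly q b \<and> q' \<noteq> 0 \<and> (\<forall>z. poly q' z = 0 \<longrightarrow> \<not> pseudo_limit z)"
proof -
  define T where "T = to_ac ` C"
  have T: "is_subfield T" unfolding T_def by (rule is_subfield_to_ac[OF C])
  define P where "P = (\<lambda>n. \<exists>p z. p \<in> polys_over T \<and> p \<noteq> 0 \<and> degree p = n \<and> poly p z = 0 \<and> pseudo_limit z)"
  show thesis
  proof (cases "\<exists>n. P n")
    case False
    show thesis
    proof (rule that[OF pseudo_limit_self], fold T_def)
      fix q assume q: "q \<in> polys_over T" "poly q (to_ac a) \<noteq> 0"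
      then have "q \<noteq> 0" by auto
      moreover have "\<not> pseudo_limit z" if "poly q z = 0" for z
        using False q(1) \<open>q \<noteq> 0\<close> that unfolding P_def by blast
      ultimately show "\<exists>q'\<in>polys_over T. poly q' (to_ac a) = poly q (to_ac a) \<and> q' \<noteq> 0 \<and>
          (\<forall>z. poly q' z = 0 \<longrightarrow> \<not> pseudo_limit z)"
        using q(1) by blast
    qed
  next
    case True
    define n where "n = (LEAST n. P n)"
    have "P n" unfolding n_def using True by (rule LeastI_ex)
    then obtain p b where p: "p \<in> polys_over T" "p \<noteq> 0" "degree p = n" "poly p b = 0" "pseudo_limit b"
      by (auto simp: P_def)
    show thesis
    proof (rule that[OF p(5)], fold T_def)
      fix q assume q: "q \<in> polys_over T" "poly q b \<noteq> 0"
      define r where "r = q mod p"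
      have rT: "r \<in> polys_over T" unfolding r_def by (rule polys_over_div_mod[OF T p(1) q(1)])
      have "poly q b = poly (q div p * p + r) b" by (simp only: r_def div_mult_mod_eq)
      then have rb: "poly r b = poly q b" using p(4) by simp
      then have "r \<noteq> 0" using q(2) by auto
      then have "degree r < n" using degree_mod_less[OF p(2), of q] p(3) by (simp add: r_def)
      then have "\<not> P (degree r)" unfolding n_def by (rule not_less_Least)
      then have "\<not> pseudo_limit z" if "poly r z = 0" for z using rT \<open>r \<noteq> 0\<close> that unfolding P_def by blast
      then show "\<exists>q'\<in>polys_over T. poly q' b = poly q b \<and> q' \<noteq> 0 \<and> (\<forall>z. poly q' z = 0 \<longrightarrow> \<not> pseudo_limit z)"
        using rT rb \<open>r \<noteq> 0\<close> by blast
    qed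
  qed
qed

text \<open>The field \<open>F\<close> generated by \<open>b\<close> over \<open>C\<close> is
  immediate, because quotients of values at \<open>b\<close> agree up to 1-units with quotients of
  values on \<open>C\<close>. Maximality would put \<open>b\<close> into \<open>C\<close>, where
  there is no pseudo-limit.\<close>

lemma not_maximal: "\<not> maximal_in_closure C"
proof
  assume max: "maximal_in_closure C"
  define T where "T = to_ac ` C"
  have T: "is_subfield T" unfolding T_def by (rule is_subfield_to_ac[OF C])
  obtain b where b: "pseudo_limit b" and rep: "\<And>q. q \<in> polys_over T \<Longrightarrow> poly q b \<noteq> 0 \<Longrightarrow>
      \<exists>q'\<in>polys_over T. poly q' b = poly q b \<and> q' \<noteq> 0 \<and> (\<forall>z. poly q' z = 0 \<longrightarrow> \<not> pseudo_limit z)"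
    using immediate_extension unfolding T_def by blast
  define F where "F = {poly q b / poly r b | q r. q \<in> polys_over T \<and> r \<in> polys_over T \<and> poly r b \<noteq> 0}"
  have FI: "poly q b / poly r b \<in> F" if "q \<in> polys_over T" "r \<in> polys_over T" "poly r b \<noteq> 0" for q r
    unfolding F_def using that by blast
  have FE: "\<exists>q r. z = poly q b / poly r b \<and> q \<in> polys_over T \<and> r \<in> polys_over T \<and> poly r b \<noteq> 0"
    if "z \<in> F" for z using that unfolding F_def by blast
  have cst: "[:t:] \<in> polys_over T" if "t \<in> T" for t
    using that by (intro polys_over_pCons[OF T] polys_over_0[OF T])
  have one: "1 \<in> polys_over T" using cst[OF is_subfield_1[OF T]] by (simp add: one_pCons)
  have TF: "T \<subseteq> F"
  proof
    fix t assume "t \<in> T"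
    then show "t \<in> F" using FI[OF cst[of t] one] by simp
  qed
  have bF: "b \<in> F"
  proof -
    have "[:0, 1:] \<in> polys_over T"
      by (intro polys_over_pCons[OF T] polys_over_0[OF T] is_subfield_0[OF T] is_subfield_1[OF T])
    then show ?thesis using FI[OF _ one, of "[:0, 1:]"] by simp
  qed
  have "is_subfield F"
    unfolding is_subfield_def
  proof (intro conjI ballI)
    show "0 \<in> F" "1 \<in> F" using TF is_subfield_0[OF T] is_subfield_1[OF T] by blast+
  next
    fix x y assume "x \<in> F" "y \<in> F"
    then obtain q r q' r' where *: "x = poly q b / poly r b" "q \<in> polys_over T" "r \<in> polys_over T" "poly r b \<noteq> 0"
      "y = poly q' b / poly r' b" "q' \<in> polys_over T" "r' \<in> polys_over T" "poly r' b \<noteq> 0"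
      using FE[of x] FE[of y] by blast
    have eq: "x + y = poly (q * r' + q' * r) b / poly (r * r') b" "x * y = poly (q * q') b / poly (r * r') b"
      using * by (simp_all add: add_frac_eq)
    have "q * r' + q' * r \<in> polys_over T" "q * q' \<in> polys_over T" "r * r' \<in> polys_over T" "poly (r * r') b \<noteq> 0"
      using * by (auto intro: polys_over_add[OF T] polys_over_mult[OF T])
    then show "x + y \<in> F" "x * y \<in> F" unfolding eq by (blast intro: FI)+
  next
    fix x assume "x \<in> F"
    then obtain q r where *: "x = poly q b / poly r b" "q \<in> polys_over T" "r \<in> polys_over T" "poly r b \<noteq> 0"
      using FE[of x] by blast
    have "- x = poly (0 - q) b / poly r b" using * by simp
    then show "- x \<in> F" using * by (simp only:) (intro FI polys_over_diff[OF T] polys_over_0[OF T])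
    show "inverse x \<in> F"
    proof (cases "poly q b = 0")
      case True
      then show ?thesis using TF is_subfield_0[OF T] * by auto
    next
      case False
      then show ?thesis using FI[OF *(3,2)] * by simp
    qed
  qed
  moreover have "\<exists>c\<in>C - {0}. unit1 (z / to_ac c)" if z: "z \<in> F - {0}" for z
  proof -
    obtain q0 r0 where *: "z = poly q0 b / poly r0 b" "q0 \<in> polys_over T" "r0 \<in> polys_over T" "poly r0 b \<noteq> 0"
      using FE[of z] z by blast
    then have "poly q0 b \<noteq> 0" using z by auto
    then obtain q where q: "q \<in> polys_over T" "poly q b = poly q0 b" "q \<noteq> 0" "\<And>z. poly q z = 0 \<Longrightarrow> \<not> pseudo_limit z"
      using rep[OF *(2)] by blast
    obtain r where r: "r \<in> polys_over T" "poly r b = poly r0 b" "r \<noteq> 0" "\<And>z. poly r z = 0 \<Longrightarrow> \<not> pseudo_limit z"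
      using rep[OF *(3,4)] by blast
    obtain c1 where c1: "c1 \<in> C" "\<And>c. c \<in> C \<Longrightarrow> a - c \<preceq> a - c1 \<Longrightarrow>
        poly q (to_ac c) \<noteq> 0 \<and> unit1 (poly q b / poly q (to_ac c))"
      using pseudo_limit_ratio[OF b q(3,4)] by blast
    obtain c2 where c2: "c2 \<in> C" "\<And>c. c \<in> C \<Longrightarrow> a - c \<preceq> a - c2 \<Longrightarrow>
        poly r (to_ac c) \<noteq> 0 \<and> unit1 (poly r b / poly r (to_ac c))"
      using pseudo_limit_ratio[OF b r(3,4)] by blast
    obtain c where c: "c \<in> C" "a - c \<preceq> a - c1" "a - c \<preceq> a - c2" using closer[OF c1(1) c2(1)] by blast
    have qc: "poly q (to_ac c) \<noteq> 0" "unit1 (poly q b / poly q (to_ac c))" using c1(2) c by auto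
    have rc: "poly r (to_ac c) \<noteq> 0" "unit1 (poly r b / poly r (to_ac c))" using c2(2) c by auto
    have "poly q (to_ac c) / poly r (to_ac c) \<in> T"
      using c(1) q(1) r(1) by (intro is_subfield_divide[OF T] polys_over_poly[OF T]) (auto simp: T_def)
    then obtain d where d: "d \<in> C" "to_ac d = poly q (to_ac c) / poly r (to_ac c)" by (auto simp: T_def)
    then have "d \<noteq> 0" using qc(1) rc(1) by auto
    have "z / to_ac d = (poly q b / poly q (to_ac c)) * inverse (poly r b / poly r (to_ac c))"
      using qc(1) rc(1) by (simp add: d(2) * q(2) r(2))
    then have "unit1 (z / to_ac d)" using unit1_mult[OF qc(2) unit1_inverse[OF rc(2)]] by simp
    then show ?thesis using d \<open>d \<noteq> 0\<close> by blast
  qed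
  ultimately have "F = T" using max TF unfolding maximal_in_closure_def T_def by blast
  then obtain c where c: "c \<in> C" "b = to_ac c" using bF by (auto simp: T_def)
  have "nrm2 (b - to_ac a) = (a - c) * (a - c)"
    using nrm2_to_ac[of "c - a"] c(2) by (simp add: algebra_simps)
  then show False using b c(1) by (auto simp: pseudo_limit_def)
qed

end

lemma best_approximation:
  assumes "is_subfield C" "maximal_in_closure C"
  obtains c where "c \<in> C" "\<And>c'. c' \<in> C \<Longrightarrow> a - c \<preceq> a - c'"
  using not_maximal[OF assms(1), of a] assms(2) unfolding vlt_def by blast

end

end

subsection \<open>Separated bases\<close>

text \<open>The image of the tensor product of \<open>L\<close> and \<open>M\<close> under the pair
  of maps \<open>l m \<mapsto> l m\<close> and \<open>l m \<mapsto> \<sigma> l m\<close>. It is a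
  relation because the second map is not yet known to factor through the first.\<close>

inductive_set tens :: "'a::field set \<Rightarrow> 'a set \<Rightarrow> ('a \<Rightarrow> 'a) \<Rightarrow> ('a \<times> 'a) set"
  for L M \<sigma> where
  tens_mult: "l \<in> L \<Longrightarrow> m \<in> M \<Longrightarrow> (l * m, \<sigma> l * m) \<in> tens L M \<sigma>"
| tens_add: "(x, y) \<in> tens L M \<sigma> \<Longrightarrow> (x', y') \<in> tens L M \<sigma> \<Longrightarrow> (x + x', y + y') \<in> tens L M \<sigma>"

context convex_valuation
begin

text \<open>No cancellation: the value of a combination is the minimum of the values of its terms.
  Only one inequality is demanded, the other holds for every sum.\<close>

definition separated :: "'a set \<Rightarrow> nat \<Rightarrow> (nat \<Rightarrow> 'a) \<Rightarrow> bool" where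
  "separated C k b \<longleftrightarrow> (\<forall>i<k. b i \<noteq> 0) \<and>
     (\<forall>c. (\<forall>i<k. c i \<in> C) \<longrightarrow> (\<forall>i<k. c i * b i \<preceq> (\<Sum>j<k. c j * b j)))"

definition span_over :: "'a set \<Rightarrow> nat \<Rightarrow> (nat \<Rightarrow> 'a) \<Rightarrow> 'a set" where
  "span_over C k b = {(\<Sum>j<k. c j * b j) | c. \<forall>i<k. c i \<in> C}"

lemma span_overI: "(\<And>i. i < k \<Longrightarrow> c i \<in> C) \<Longrightarrow> (\<Sum>j<k. c j * b j) \<in> span_over C k b"
  by (auto simp: span_over_def)

lemma separatedD: "separated C k b \<Longrightarrow> (\<And>i. i < k \<Longrightarrow> c i \<in> C) \<Longrightarrow> i < k \<Longrightarrow> c i * b i \<preceq> (\<Sum>j<k. c j * b j)"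
  and separated_nonzero: "separated C k b \<Longrightarrow> i < k \<Longrightarrow> b i \<noteq> 0"
  by (auto simp: separated_def)

lemma vle_minimal:
  assumes "finite A" "A \<noteq> {}" "\<And>k. k \<in> A \<Longrightarrow> f k \<noteq> 0"
  obtains m where "m \<in> A" "\<And>k. k \<in> A \<Longrightarrow> f m \<preceq> f k"
proof -
  obtain m where m: "m \<in> A" "\<And>k. k \<in> A \<Longrightarrow> inverse (f k) \<preceq> inverse (f m)"
    using vle_maximal[OF assms(1,2), of "\<lambda>k. inverse (f k)"] by blast
  have "f m \<preceq> f k" if "k \<in> A" for k
  proof -
    have "inverse (f k) * (f k * f m) \<preceq> inverse (f m) * (f k * f m)"
      using m(2)[OF that] by (intro vle_mult) auto
    moreover have "inverse (f k) * (f k * f m) = f m" "inverse (f m) * (f k * f m) = f k"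
      using assms(3)[OF that] assms(3)[OF m(1)] by (simp_all add: mult.left_commute)
    ultimately show ?thesis by simp
  qed
  then show thesis using m(1) that by blast
qed

lemma vsim_sym: "vsim a b \<Longrightarrow> vsim b a"
  by (simp add: vsim_def veq_sym mult.commute)

lemma vsim_trans: "vsim a b \<Longrightarrow> vsim b c \<Longrightarrow> vsim a c"
  unfolding vsim_def zero_less_mult_iff using veq_trans by (meson less_asym)

end

locale maximal_subfield = convex_valuation V for V :: "'a::linordered_field set" +
  fixes \<kappa> :: "'c rel" and C L :: "'a set"
  assumes rcU: "real_closed_in (UNIV :: 'a set)" and satur: "saturated V \<kappa>"
    and C: "is_subfield C" and L: "is_subfield L" and CL: "C \<subseteq> L" and small: "|L| <o \<kappa>"
    and max: "maximal_in_closure C"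
begin

lemma sum_in_L: "(\<And>i. i < k \<Longrightarrow> c i \<in> C) \<Longrightarrow> (\<And>i. i < k \<Longrightarrow> b i \<in> L) \<Longrightarrow> (\<Sum>j<k. c j * b j) \<in> L"
  using CL by (intro is_subfield_sum[OF L] is_subfield_mult[OF L]) auto

text \<open>The approximations of \<open>a\<close> by the elements of the span are approximated coordinatewise by
  some \<open>x\<close>, by saturation; the best approximation of \<open>x\<close> in \<open>C\<close> is then the coordinate of a best
  approximation of \<open>a\<close>.\<close>

lemma coordinate_limit:
  assumes sep: "separated C k b" and bL: "\<And>i. i < k \<Longrightarrow> b i \<in> L" and a: "a \<in> L" "a \<notin> span_over C k b"
    and j: "j < k"
  obtains x where "\<And>c. (\<And>i. i < k \<Longrightarrow> c i \<in> C) \<Longrightarrow> (x - c j) * b j \<preceq> a - (\<Sum>i<k. c i * b i)"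
proof -
  define W where "W = {c. \<forall>i<k. c i \<in> C}"
  define s where "s = (\<lambda>c. \<Sum>i<k. c i * b i)"
  have nz: "a - s c \<noteq> 0" if "c \<in> W" for c
  proof
    assume "a - s c = 0"
    then have "a = s c" by simp
    moreover have "s c \<in> span_over C k b" unfolding s_def using that by (intro span_overI) (simp add: W_def)
    ultimately show False using a(2) by simp
  qed
  \<comment> \<open>Division by the nonzero \<open>a - s c\<close> turns the inequality into
    membership in \<open>V\<close>, with the parameters \<open>c j\<close> and
    \<open>b j / (a - s c)\<close> from the small field \<open>L\<close>.\<close>
  define f where "f = FVal (TMult (TAdd (TVar 0) (TMinus (TVar 1))) (TVar 2))"
  define asg where "asg = (\<lambda>c (i::nat). if i = Suc 0 then c j else b j / (a - s c))"
  define P where "P = (\<lambda>c. (f, asg c)) ` W"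
  have sat_f: "sat V ((asg c)(0 := x)) f \<longleftrightarrow> (x - c j) * b j \<preceq> a - s c" if "c \<in> W" for c x
  proof -
    have "sat V ((asg c)(0 := x)) f \<longleftrightarrow> (x - c j) * (b j / (a - s c)) \<preceq> 1"
      by (simp add: f_def asg_def vle_1_iff)
    also have "\<dots> \<longleftrightarrow> (x - c j) * b j \<preceq> a - s c" using vle_divide_iff[OF nz[OF that], of "(x - c j) * b j" 1] by simp
    finally show ?thesis .
  qed
  have "\<exists>x. \<forall>(p, s)\<in>P. sat V (s(0 := x)) p"
  proof (rule saturatedD[OF satur small])
    have "range (asg c) \<subseteq> L" if "c \<in> W" for c
    proof -
      have "s c \<in> L" unfolding s_def using that bL by (intro sum_in_L) (auto simp: W_def)
      then have "b j / (a - s c) \<in> L" using bL[OF j] a(1) by (intro is_subfield_divide[OF L] is_subfield_diff[OF L])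
      moreover have "c j \<in> L" using that j CL by (auto simp: W_def)
      ultimately show ?thesis by (auto simp: asg_def)
    qed
    then show "\<forall>(p, s)\<in>P. range s \<subseteq> L" by (auto simp: P_def)
  next
    fix Q assume "Q \<subseteq> P" "finite Q"
    then obtain W0 where W0: "W0 \<subseteq> W" "finite W0" "Q = (\<lambda>c. (f, asg c)) ` W0"
      unfolding P_def by (meson finite_subset_image)
    show "\<exists>x. \<forall>(p, s)\<in>Q. sat V (s(0 := x)) p"
    proof (cases "W0 = {}")
      case True then show ?thesis by (simp add: W0)
    next
      case False
      have "a - s c \<noteq> 0" if "c \<in> W0" for c using nz W0(1) that by blast
      \<comment> \<open>The best of finitely many approximations meets all their conditions: by
        separatedness the difference of two coordinates is controlled by the difference of the
        combinations.\<close>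
      then obtain c0 where c0: "c0 \<in> W0" "\<And>c. c \<in> W0 \<Longrightarrow> a - s c0 \<preceq> a - s c"
        using vle_minimal[OF W0(2) False, of "\<lambda>c. a - s c"] by blast
      have "sat V ((asg c)(0 := c0 j)) f" if c: "c \<in> W0" for c
      proof -
        have cW: "c \<in> W" "c0 \<in> W" using c c0 W0 by auto
        have "(c0 j - c j) * b j \<preceq> (\<Sum>i<k. (c0 i - c i) * b i)"
          using separatedD[OF sep _ j, of "\<lambda>i. c0 i - c i"] cW is_subfield_diff[OF C] by (simp add: W_def)
        also have "(\<Sum>i<k. (c0 i - c i) * b i) = s c0 - s c"
          by (simp add: s_def sum_subtractf left_diff_distrib)
        finally have "(c0 j - c j) * b j \<preceq> s c0 - s c" .
        moreover have "(a - s c) - (a - s c0) \<preceq> a - s c" using c0(2)[OF c] by (rule vle_diff[OF vle_refl])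
        then have "s c0 - s c \<preceq> a - s c" by simp
        ultimately show ?thesis using sat_f[OF cW(1)] vle_trans by blast
      qed
      then show ?thesis unfolding W0(3) by (intro exI[of _ "c0 j"]) auto
    qed
  qed
  then obtain x where x: "\<forall>(p, s)\<in>P. sat V (s(0 := x)) p" by blast
  show thesis
  proof (rule that[of x])
    fix c assume "\<And>i. i < k \<Longrightarrow> c i \<in> C"
    then have c: "c \<in> W" by (simp add: W_def)
    then have "(f, asg c) \<in> P" by (simp add: P_def)
    then have "sat V ((asg c)(0 := x)) f" using x by blast
    then show "(x - c j) * b j \<preceq> a - (\<Sum>i<k. c i * b i)" using sat_f[OF c] by (simp add: s_def)
  qed
qed

lemma best_approximation_span:
  assumes sep: "separated C k b" and bL: "\<And>i. i < k \<Longrightarrow> b i \<in> L" and a: "a \<in> L" "a \<notin> span_over C k b"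
  obtains w where "w \<in> span_over C k b" "\<And>w'. w' \<in> span_over C k b \<Longrightarrow> a - w \<preceq> a - w'"
proof -
  have "\<exists>d. d \<in> C \<and> (\<forall>c. (\<forall>i<k. c i \<in> C) \<longrightarrow> (d - c j) * b j \<preceq> a - (\<Sum>i<k. c i * b i))"
    if j: "j < k" for j
  proof -
    obtain x where x: "\<And>c. (\<And>i. i < k \<Longrightarrow> c i \<in> C) \<Longrightarrow> (x - c j) * b j \<preceq> a - (\<Sum>i<k. c i * b i)"
      using coordinate_limit[OF sep bL a j] by blast
    obtain d where d: "d \<in> C" "\<And>c. c \<in> C \<Longrightarrow> x - d \<preceq> x - c"
      using best_approximation[OF rcU C max] by blast
    have "(d - c j) * b j \<preceq> a - (\<Sum>i<k. c i * b i)" if c: "\<forall>i<k. c i \<in> C" for c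
    proof -
      \<comment> \<open>Rounding \<open>x\<close> to \<open>d\<close> in \<open>C\<close> keeps the
        inequality, since \<open>x - d\<close> is no larger than \<open>x - c j\<close>.\<close>
      have "(x - c j) - (x - d) \<preceq> x - c j" using d(2)[of "c j"] c j by (intro vle_diff[OF vle_refl]) auto
      then have "(d - c j) * b j \<preceq> (x - c j) * b j" by (intro vle_mult) auto
      then show ?thesis using x[of c] c vle_trans by blast
    qed
    then show ?thesis using d(1) by blast
  qed
  then obtain d where d: "\<And>j. j < k \<Longrightarrow> d j \<in> C"
    "\<And>j c. j < k \<Longrightarrow> (\<forall>i<k. c i \<in> C) \<Longrightarrow> (d j - c j) * b j \<preceq> a - (\<Sum>i<k. c i * b i)"
    by metis
  define w where "w = (\<Sum>i<k. d i * b i)"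
  show thesis
  proof (rule that)
    show "w \<in> span_over C k b" unfolding w_def by (rule span_overI[OF d(1)])
    fix w' assume "w' \<in> span_over C k b"
    then obtain c where c: "\<And>i. i < k \<Longrightarrow> c i \<in> C" "w' = (\<Sum>j<k. c j * b j)"
      unfolding span_over_def by blast
    have "(\<Sum>j<k. (d j - c j) * b j) \<preceq> a - w'"
      unfolding c(2) using d(2) c(1) by (intro vle_sum) auto
    also have "(\<Sum>j<k. (d j - c j) * b j) = w - w'"
      by (simp add: w_def c(2) sum_subtractf left_diff_distrib)
    finally have "(a - w') - (w - w') \<preceq> a - w'" by (rule vle_diff[OF vle_refl])
    then show "a - w \<preceq> a - w'" by simp
  qed
qed

text \<open>A Gram-Schmidt step. The best approximation \<open>w\<close> plays the projection: in
  \<open>y + c (a - w)\<close> with nonzero \<open>c\<close>, the part \<open>y\<close> cannot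
  cancel \<open>c (a - w)\<close>, as \<open>w - y / c\<close> would approximate \<open>a\<close>
  better than \<open>w\<close>.\<close>

lemma separated_extend:
  assumes sep: "separated C k b" and w: "w \<in> span_over C k b" "\<And>w'. w' \<in> span_over C k b \<Longrightarrow> a - w \<preceq> a - w'"
    and a: "a \<notin> span_over C k b"
  shows "separated C (Suc k) (b(k := a - w))"
proof -
  define b' where "b' = b(k := a - w)"
  have nz: "a - w \<noteq> 0" using w(1) a by auto
  have sum: "(\<Sum>j<k. c j * b' j) = (\<Sum>j<k. c j * b j)" for c by (intro sum.cong) (auto simp: b'_def)
  have "c i * b' i \<preceq> (\<Sum>j<Suc k. c j * b' j)" if c: "\<forall>i<Suc k. c i \<in> C" and i: "i < Suc k" for c i
  proof -
    define y where "y = (\<Sum>j<k. c j * b j)"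
    define x where "x = y + c k * (a - w)"
    have x: "(\<Sum>j<Suc k. c j * b' j) = x" by (simp add: sum x_def y_def b'_def)
    have k: "c k * (a - w) \<preceq> x"
    proof (cases "c k = 0")
      case False
      obtain e where e: "\<And>i. i < k \<Longrightarrow> e i \<in> C" "w = (\<Sum>j<k. e j * b j)" using w(1) unfolding span_over_def by blast
      have "(\<Sum>j<k. (e j - c j / c k) * b j) \<in> span_over C k b"
        using e(1) c by (intro span_overI is_subfield_diff[OF C] is_subfield_divide[OF C]) auto
      also have "(\<Sum>j<k. (e j - c j / c k) * b j) = w - y / c k"
        by (simp add: e(2) y_def sum_subtractf left_diff_distrib sum_divide_distrib)
      finally have "a - w \<preceq> a - (w - y / c k)" by (rule w(2))
      then have "c k * (a - w) \<preceq> c k * (a - (w - y / c k))" by (intro vle_mult) auto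
      also have "c k * (a - (w - y / c k)) = x" using False by (simp add: x_def algebra_simps)
      finally show ?thesis .
    qed simp
    show ?thesis
    proof (cases "i = k")
      case True then show ?thesis using k unfolding x by (simp add: b'_def)
    next
      case False
      then have "i < k" using i by simp
      have "x - c k * (a - w) \<preceq> x" using k by (rule vle_diff[OF vle_refl])
      then have "y \<preceq> x" by (simp add: x_def)
      moreover have "c i * b i \<preceq> y" unfolding y_def using c by (intro separatedD[OF sep _ \<open>i < k\<close>]) auto
      ultimately have "c i * b i \<preceq> x" using vle_trans by blast
      then show ?thesis unfolding x using False by (simp add: b'_def)
    qed
  qed
  moreover have "b' i \<noteq> 0" if "i < Suc k" for i
    using separated_nonzero[OF sep, of i] nz that by (auto simp: b'_def less_Suc_eq)
  ultimately show ?thesis unfolding separated_def b'_def[symmetric] by blast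
qed

lemma separated_basis:
  fixes n :: nat
  assumes "\<And>i. i < n \<Longrightarrow> l i \<in> L"
  obtains k b where "separated C k b" "\<And>i. i < k \<Longrightarrow> b i \<in> L" "\<And>i. i < n \<Longrightarrow> l i \<in> span_over C k b"
proof -
  have "\<exists>k b. separated C k b \<and> (\<forall>i<k. b i \<in> L) \<and> (\<forall>i<n. l i \<in> span_over C k b)"
    using assms
  proof (induction n)
    case 0
    have "separated C 0 (\<lambda>_. 0)" by (simp add: separated_def)
    then show ?case by (intro exI[of _ 0]) auto
  next
    case (Suc n)
    then obtain k b where kb: "separated C k b" "\<forall>i<k. b i \<in> L" "\<forall>i<n. l i \<in> span_over C k b" by auto
    show ?case
    proof (cases "l n \<in> span_over C k b")
      case True
      then show ?thesis using kb by (intro exI[of _ k] exI[of _ b]) (auto simp: less_Suc_eq)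
    next
      case False
      have ln: "l n \<in> L" using Suc.prems by simp
      obtain w where w: "w \<in> span_over C k b" "\<And>w'. w' \<in> span_over C k b \<Longrightarrow> l n - w \<preceq> l n - w'"
        using best_approximation_span[OF kb(1) _ ln False] kb(2) by blast
      define b' where "b' = b(k := l n - w)"
      have sep: "separated C (Suc k) b'" unfolding b'_def by (rule separated_extend[OF kb(1) w False])
      obtain e where e: "\<And>i. i < k \<Longrightarrow> e i \<in> C" "w = (\<Sum>j<k. e j * b j)" using w(1) unfolding span_over_def by blast
      have "w \<in> L" unfolding e(2) using e(1) kb(2) by (intro sum_in_L) auto
      then have bL: "\<forall>i<Suc k. b' i \<in> L"
        using kb(2) is_subfield_diff[OF L ln] by (auto simp: b'_def less_Suc_eq)
      have ext: "v + t * (l n - w) \<in> span_over C (Suc k) b'" if v: "v \<in> span_over C k b" and t: "t \<in> C" for v t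
      proof -
        obtain c where c: "\<And>i. i < k \<Longrightarrow> c i \<in> C" "v = (\<Sum>j<k. c j * b j)" using v unfolding span_over_def by blast
        have "(\<Sum>j<Suc k. (c(k := t)) j * b' j) \<in> span_over C (Suc k) b'"
          using c(1) t by (intro span_overI) (auto simp: less_Suc_eq)
        also have "(\<Sum>j<Suc k. (c(k := t)) j * b' j) = v + t * (l n - w)"
          by (simp add: c(2) b'_def)
        finally show ?thesis .
      qed
      have "l n \<in> span_over C (Suc k) b'" using ext[OF w(1) is_subfield_1[OF C]] by simp
      moreover have "l i \<in> span_over C (Suc k) b'" if "i < n" for i
        using ext[of "l i" 0] kb(3) that is_subfield_0[OF C] by simp
      ultimately show ?thesis using sep bL by (intro exI[of _ "Suc k"] exI[of _ b']) (auto simp: less_Suc_eq)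
    qed
  qed
  then show thesis using that by blast
qed

end

section \<open>Sums of products from \<open>L\<close> and \<open>M\<close>\<close>

text \<open>\<open>VG\<close> and \<open>LD\<close> express the hypotheses on value groups and
  residue fields through representatives, a residue being zero iff its representative is
  \<open>\<lless> 1\<close>. The premise of \<open>LD\<close> on \<open>e\<close> is independence
  over the residue field of \<open>C\<close>, and its last two lines are independence over that of
  \<open>M\<close>. The map here is the composition of the inverse of \<open>\<tau>\<close> with
  \<open>\<sigma>\<close>.\<close>

locale disjoint_pair = maximal_subfield V \<kappa> C L
  for V :: "'a::linordered_field set" and \<kappa> :: "'c rel" and C L :: "'a set" +
  fixes M :: "'a set" and \<sigma> :: "'a \<Rightarrow> 'a"
  assumes M: "is_subfield M" and CM: "C \<subseteq> M"
    and VG: "\<And>l m. l \<in> L - {0} \<Longrightarrow> m \<in> M - {0} \<Longrightarrow> veq l m \<Longrightarrow> \<exists>c\<in>C - {0}. veq l c"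
    and LD: "\<And>(J::nat set) u w. finite J \<Longrightarrow> u ` J \<subseteq> L \<inter> V \<Longrightarrow> w ` J \<subseteq> M \<inter> V \<Longrightarrow>
      (\<And>e. e ` J \<subseteq> C \<inter> V \<Longrightarrow> (\<Sum>i\<in>J. e i * u i) \<lless> 1 \<Longrightarrow> \<forall>i\<in>J. e i \<lless> 1) \<Longrightarrow>
      (\<Sum>i\<in>J. w i * u i) \<lless> 1 \<Longrightarrow> \<forall>i\<in>J. w i \<lless> 1"
    and hom: "\<And>x y. \<sigma> (x + y) = \<sigma> x + \<sigma> y" "\<And>x y. \<sigma> (x * y) = \<sigma> x * \<sigma> y"
    and \<sigma>C: "\<And>c. c \<in> C \<Longrightarrow> \<sigma> c = c"
    and \<sigma>pos: "\<And>x. 0 < x \<Longrightarrow> 0 < \<sigma> x"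
    and \<sigma>val: "\<And>l. l \<in> L \<Longrightarrow> veq (\<sigma> l) l"
    and \<sigma>res: "\<And>l. l \<in> L \<Longrightarrow> l \<in> V \<Longrightarrow> \<sigma> l - l \<lless> 1"
begin

lemma \<sigma>_0: "\<sigma> 0 = 0" and \<sigma>_1: "\<sigma> 1 = 1"
  using \<sigma>C is_subfield_0[OF C] is_subfield_1[OF C] by auto

lemma \<sigma>_uminus: "\<sigma> (- x) = - \<sigma> x"
proof -
  have "\<sigma> (- x) + \<sigma> x = 0" using hom(1)[of "- x" x] by (simp add: \<sigma>_0)
  then show ?thesis by (simp only: eq_neg_iff_add_eq_0)
qed

lemma \<sigma>_sum: "\<sigma> (sum f I) = (\<Sum>i\<in>I. \<sigma> (f i))"
  by (induction I rule: infinite_finite_induct) (auto simp: \<sigma>_0 hom)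

lemma \<sigma>_nonzero: "x \<noteq> 0 \<Longrightarrow> \<sigma> x \<noteq> 0"
  using \<sigma>pos[of x] \<sigma>pos[of "- x"] by (cases x "0 :: 'a" rule: linorder_cases) (auto simp: \<sigma>_uminus)

lemma \<sigma>_divide: "\<sigma> (x / y) = \<sigma> x / \<sigma> y"
proof (cases "y = 0")
  case True then show ?thesis by (simp add: \<sigma>_0)
next
  case False
  then have "\<sigma> (x / y) * \<sigma> y = \<sigma> x" by (simp add: hom(2)[symmetric])
  then show ?thesis using \<sigma>_nonzero[OF False] by (simp add: eq_divide_eq)
qed

lemma \<sigma>_vsim: assumes "l \<in> L" "l \<noteq> 0" shows "vsim (\<sigma> l) l"
proof -
  have "0 < \<sigma> l * l"
    using \<sigma>pos[of l] \<sigma>pos[of "- l"] assms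
    by (cases l "0 :: 'a" rule: linorder_cases) (auto simp: \<sigma>_uminus mult_neg_neg)
  then show ?thesis using \<sigma>val[OF assms(1)] by (simp add: vsim_def)
qed

text \<open>Only the terms of dominant value matter. Up to factors from \<open>C\<close> they are
  \<open>b j0 * m j0\<close> times products of units; separatedness makes the residues of the units
  from \<open>L\<close> independent over the residue field of \<open>C\<close>, and linear
  disjointness keeps the sum of the products from vanishing.\<close>

lemma leading_term_basis:
  assumes sep: "separated C k b" and bL: "\<And>j. j < k \<Longrightarrow> b j \<in> L" and mM: "\<And>j. j < k \<Longrightarrow> m j \<in> M"
    and nz: "\<exists>j<k. m j \<noteq> 0"
  obtains l0 m0 J u w where "l0 \<in> L - {0}" "m0 \<in> M - {0}" "finite (J :: nat set)" "u ` J \<subseteq> L \<inter> V" "w ` J \<subseteq> M \<inter> V"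
    "\<not> (\<Sum>i\<in>J. u i * w i) \<lless> 1" "(\<Sum>j<k. b j * m j) / (l0 * m0) - (\<Sum>i\<in>J. u i * w i) \<lless> 1"
    "(\<Sum>j<k. \<sigma> (b j) * m j) / (\<sigma> l0 * m0) - (\<Sum>i\<in>J. u i * w i) \<lless> 1"
proof -
  have bnz: "b j \<noteq> 0" if "j < k" for j by (rule separated_nonzero[OF sep that])
  have "{..<k} \<noteq> {}" using nz by auto
  then obtain j0 where j0: "j0 < k" "\<And>j. j < k \<Longrightarrow> b j * m j \<preceq> b j0 * m j0"
    using vle_maximal[of "{..<k}" "\<lambda>j. b j * m j"] by auto
  obtain j1 where "j1 < k" "m j1 \<noteq> 0" using nz by blast
  then have "b j0 * m j0 \<noteq> 0" using j0(2)[of j1] bnz[of j1] by auto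
  then have nz0: "b j0 \<noteq> 0" "m j0 \<noteq> 0" by auto
  define p where "p = b j0 * m j0"
  have p0: "p \<noteq> 0" using nz0 by (simp add: p_def)
  define J where "J = {j. j < k \<and> veq (b j * m j) p}"
  have J: "finite J" "j0 \<in> J" using j0 by (auto simp: J_def p_def)
  have Jk: "j < k" if "j \<in> J" for j using that by (simp add: J_def)
  have mnz: "m j \<noteq> 0" if "j \<in> J" for j using that p0 by (auto simp: J_def)
  have "\<exists>c\<in>C - {0}. veq (b j / b j0) c" if j: "j \<in> J" for j
  proof (rule VG)
    show "b j / b j0 \<in> L - {0}" using bL[OF Jk[OF j]] bL[OF j0(1)] bnz[OF Jk[OF j]] nz0
      by (auto intro: is_subfield_divide[OF L])
    show "m j0 / m j \<in> M - {0}" using mM[OF Jk[OF j]] mM[OF j0(1)] mnz[OF j] nz0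
      by (auto intro: is_subfield_divide[OF M])
    have "veq ((b j * m j) / (b j0 * m j)) (p / (b j0 * m j))"
      using j by (intro veq_divide) (auto simp: J_def)
    then show "veq (b j / b j0) (m j0 / m j)" using mnz[OF j] nz0 by (simp add: p_def)
  qed
  then obtain c where c: "\<And>j. j \<in> J \<Longrightarrow> c j \<in> C - {0}" "\<And>j. j \<in> J \<Longrightarrow> veq (b j / b j0) (c j)" by metis
  \<comment> \<open>\<open>b j / b j0\<close> and \<open>m j0 / m j\<close> have the same value,
    which is that of some \<open>c j\<close> in \<open>C\<close> by \<open>VG\<close>. Moving
    \<open>c j\<close> from one factor to the other makes both units and leaves their product
    unchanged.\<close>
  define u where "u = (\<lambda>j. b j / (b j0 * c j))"
  define w where "w = (\<lambda>j. m j * c j / m j0)"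
  have uw: "u j * w j = b j * m j / p" if "j \<in> J" for j
    using c(1)[OF that] by (simp add: u_def w_def p_def)
  have u1: "veq (u j) 1" if "j \<in> J" for j
    using veq_divide[OF c(2)[OF that] veq_refl[of "c j"]] c(1)[OF that] by (simp add: u_def)
  have uw1: "veq (u j * w j) 1" if "j \<in> J" for j
  proof -
    have "veq (b j * m j / p) (p / p)" using that by (intro veq_divide) (auto simp: J_def)
    then show ?thesis using p0 by (simp add: uw[OF that])
  qed
  have w1: "veq (w j) 1" if "j \<in> J" for j
  proof -
    have "u j \<noteq> 0" using u1[OF that] by auto
    then show ?thesis using veq_divide[OF uw1[OF that] u1[OF that]] by simp
  qed
  have cL: "c j \<in> L" "c j \<in> M" if "j \<in> J" for j using c(1)[OF that] CL CM by auto
  have uL: "u ` J \<subseteq> L \<inter> V"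
  proof safe
    fix j assume j: "j \<in> J"
    show "u j \<in> L" unfolding u_def using bL Jk[OF j] j0(1) cL[OF j]
      by (intro is_subfield_divide[OF L] is_subfield_mult[OF L]) auto
    show "u j \<in> V" using u1[OF j] by (simp add: veq_def vle_1_iff)
  qed
  have wM: "w ` J \<subseteq> M \<inter> V"
  proof safe
    fix j assume j: "j \<in> J"
    show "w j \<in> M" unfolding w_def using mM Jk[OF j] j0(1) cL[OF j]
      by (intro is_subfield_divide[OF M] is_subfield_mult[OF M]) auto
    show "w j \<in> V" using w1[OF j] by (simp add: veq_def vle_1_iff)
  qed
  have indep: "\<forall>i\<in>J. e i \<lless> 1" if e: "e ` J \<subseteq> C \<inter> V" and lt: "(\<Sum>i\<in>J. e i * u i) \<lless> 1" for e
  proof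
    fix i assume i: "i \<in> J"
    \<comment> \<open>Multiplied by \<open>b j0\<close>, a relation among the \<open>u j\<close>
      becomes a combination of the \<open>b j\<close> with the coefficients \<open>e j / c j\<close>
      in \<open>C\<close>, to which separatedness applies.\<close>
    define d where "d = (\<lambda>j. if j \<in> J then e j / c j else 0)"
    have dC: "d j \<in> C" for j
      using e c(1) is_subfield_0[OF C] by (auto simp: d_def intro!: is_subfield_divide[OF C])
    have "d i * b i \<preceq> (\<Sum>j<k. d j * b j)" by (rule separatedD[OF sep dC Jk[OF i]])
    also have "(\<Sum>j<k. d j * b j) = (\<Sum>j\<in>J. d j * b j)"
      by (rule sum.mono_neutral_right) (auto simp: J_def d_def)
    also have "\<dots> = (\<Sum>j\<in>J. e j * u j) * b j0"
      unfolding sum_distrib_right using nz0 c(1) by (intro sum.cong) (auto simp: d_def u_def)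
    finally have "d i * b i / b j0 \<preceq> (\<Sum>j\<in>J. e j * u j)" using nz0 by (simp add: vle_divide_iff)
    also have "d i * b i / b j0 = e i * u i" using i by (simp add: d_def u_def)
    finally have "e i * u i \<lless> 1" using lt vle_vlt_trans by blast
    then show "e i \<lless> 1"
      using veq_vlt_cong[OF veq_mult[OF veq_refl[of "e i"] u1[OF i]] veq_refl[of 1]] by simp
  qed
  define s where "s = (\<Sum>i\<in>J. u i * w i)"
  have s1: "\<not> s \<lless> 1"
  proof
    assume "s \<lless> 1"
    then have "(\<Sum>i\<in>J. w i * u i) \<lless> 1" by (simp add: s_def mult.commute)
    from LD[OF J(1) uL wM indep this] have "w j0 \<lless> 1" using J(2) by blast
    then show False using w1[OF J(2)] by (auto simp: veq_def vlt_def)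
  qed
  have split: "(\<Sum>j<k. f j) = (\<Sum>j\<in>J. f j) + (\<Sum>j\<in>{..<k} - J. f j)" for f :: "nat \<Rightarrow> 'a"
    using sum.subset_diff[of J "{..<k}" f] by (auto simp: J_def add.commute)
  have rest: "b j * m j / p \<lless> 1" if "j \<in> {..<k} - J" for j
    using that j0(2)[of j] p0 by (auto simp: J_def veq_def vlt_def vle_divide_iff vle_divide_iff' p_def[symmetric])
  have "(\<Sum>j<k. b j * m j) / p = (\<Sum>j<k. b j * m j / p)" by (simp add: sum_divide_distrib)
  also have "\<dots> = s + (\<Sum>j\<in>{..<k} - J. b j * m j / p)" unfolding split s_def using uw by simp
  finally have "(\<Sum>j<k. b j * m j) / p - s = (\<Sum>j\<in>{..<k} - J. b j * m j / p)" by simp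
  then have 1: "(\<Sum>j<k. b j * m j) / p - s \<lless> 1" using vlt_sum[of 1 "{..<k} - J"] rest by simp
  define q where "q = \<sigma> (b j0) * m j0"
  have q0: "q \<noteq> 0" using nz0 \<sigma>_nonzero by (simp add: q_def)
  have qp: "veq q p" unfolding q_def p_def using \<sigma>val[OF bL[OF j0(1)]] by (intro veq_mult) auto
  have \<sigma>uw: "\<sigma> (b j) * m j / q = \<sigma> (u j) * w j" if "j \<in> J" for j
    using c(1)[OF that] \<sigma>C[of "c j"] by (simp add: u_def w_def q_def \<sigma>_divide hom(2))
  have "(\<Sum>j<k. \<sigma> (b j) * m j) / q = (\<Sum>j<k. \<sigma> (b j) * m j / q)" by (simp add: sum_divide_distrib)
  also have "\<dots> = (\<Sum>j\<in>J. \<sigma> (u j) * w j) + (\<Sum>j\<in>{..<k} - J. \<sigma> (b j) * m j / q)"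
    unfolding split using \<sigma>uw by simp
  \<comment> \<open>The image has the same leading sum \<open>s\<close>: by
    \<open>\<sigma>res\<close> each \<open>u j\<close> changes by an element of the maximal ideal
    only, and by \<open>\<sigma>val\<close> the remaining terms stay small.\<close>
  finally have "(\<Sum>j<k. \<sigma> (b j) * m j) / q - s =
      (\<Sum>j\<in>J. (\<sigma> (u j) - u j) * w j) + (\<Sum>j\<in>{..<k} - J. \<sigma> (b j) * m j / q)"
    by (simp add: s_def sum_subtractf left_diff_distrib)
  also have "\<dots> \<lless> 1"
  proof (intro vlt_add vlt_sum)
    fix j assume j: "j \<in> J"
    have "\<sigma> (u j) - u j \<lless> 1" using uL j by (intro \<sigma>res) auto
    then show "(\<sigma> (u j) - u j) * w j \<lless> 1"
      using vlt_vle_mult[of "\<sigma> (u j) - u j" 1 "w j" 1] w1[OF j] by (simp add: veq_def)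
  next
    fix j assume j: "j \<in> {..<k} - J"
    have "veq (\<sigma> (b j) * m j / q) (b j * m j / p)"
      using \<sigma>val[of "b j"] bL j qp by (intro veq_divide veq_mult) auto
    then show "\<sigma> (b j) * m j / q \<lless> 1" using rest[OF j] veq_vlt_cong[OF _ veq_refl] by blast
  qed auto
  finally have 2: "(\<Sum>j<k. \<sigma> (b j) * m j) / q - s \<lless> 1" .
  show thesis
    by (rule that[of "b j0" "m j0" J u w])
       (use bL mM j0 nz0 J uL wM s1 1 2 in \<open>auto simp: s_def p_def q_def\<close>)
qed

text \<open>The \<open>l i\<close> are expanded in a separated basis of their span and the sum is
  regrouped, with coefficients \<open>m' j\<close> in \<open>M\<close>. As \<open>\<sigma>\<close>
  fixes \<open>C\<close>, the same regrouping works for the image.\<close>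

lemma leading_term:
  fixes n :: nat
  assumes lL: "\<And>i. i < n \<Longrightarrow> l i \<in> L" and mM: "\<And>i. i < n \<Longrightarrow> m i \<in> M"
    and x: "x = (\<Sum>i<n. l i * m i)" and y: "y = (\<Sum>i<n. \<sigma> (l i) * m i)"
  shows "(x = 0 \<and> y = 0) \<or> (\<exists>l0\<in>L - {0}. \<exists>m0\<in>M - {0}. \<exists>(J :: nat set) u w. finite J \<and> u ` J \<subseteq> L \<inter> V \<and>
     w ` J \<subseteq> M \<inter> V \<and> \<not> (\<Sum>i\<in>J. u i * w i) \<lless> 1 \<and> x / (l0 * m0) - (\<Sum>i\<in>J. u i * w i) \<lless> 1 \<and>
     y / (\<sigma> l0 * m0) - (\<Sum>i\<in>J. u i * w i) \<lless> 1)"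
proof -
  obtain k b where kb: "separated C k b" "\<And>i. i < k \<Longrightarrow> b i \<in> L" "\<And>i. i < n \<Longrightarrow> l i \<in> span_over C k b"
    using separated_basis[of n l] lL by blast
  have "\<exists>c. (\<forall>j<k. c j \<in> C) \<and> l i = (\<Sum>j<k. c j * b j)" if "i < n" for i
    using kb(3)[OF that] by (auto simp: span_over_def)
  then obtain c where c: "\<And>i j. i < n \<Longrightarrow> j < k \<Longrightarrow> c i j \<in> C" "\<And>i. i < n \<Longrightarrow> l i = (\<Sum>j<k. c i j * b j)"
    by metis
  define m' where "m' = (\<lambda>j. \<Sum>i<n. c i j * m i)"
  have m'M: "m' j \<in> M" if "j < k" for j
    unfolding m'_def using c(1) that mM CM by (intro is_subfield_sum[OF M] is_subfield_mult[OF M]) auto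
  have swap: "(\<Sum>i<n. (\<Sum>j<k. c i j * f j) * m i) = (\<Sum>j<k. f j * m' j)" for f :: "nat \<Rightarrow> 'a"
    unfolding m'_def sum_distrib_left sum_distrib_right
    by (subst sum.swap) (simp add: mult_ac)
  have x': "x = (\<Sum>j<k. b j * m' j)" unfolding x swap[symmetric] using c(2) by simp
  have "\<sigma> (l i) = (\<Sum>j<k. c i j * \<sigma> (b j))" if "i < n" for i
    unfolding c(2)[OF that] \<sigma>_sum using \<sigma>C[OF c(1)[OF that]] by (intro sum.cong) (auto simp: hom(2))
  then have y': "y = (\<Sum>j<k. \<sigma> (b j) * m' j)" unfolding y swap[symmetric] by simp
  show ?thesis
  proof (cases "\<exists>j<k. m' j \<noteq> 0")
    case False
    then show ?thesis by (simp add: x' y')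
  next
    case True
    show ?thesis
      by (rule leading_term_basis[OF kb(1,2) m'M True], assumption, assumption)
         (unfold x' y', blast)
  qed
qed


lemma tens_sum:
  assumes "(x, y) \<in> tens L M \<sigma>"
  shows "\<exists>(n::nat) l m. (\<forall>i<n. l i \<in> L \<and> m i \<in> M) \<and> x = (\<Sum>i<n. l i * m i) \<and> y = (\<Sum>i<n. \<sigma> (l i) * m i)"
  using assms
proof (induction rule: tens.induct)
  case (tens_mult l m)
  then show ?case by (intro exI[of _ "Suc 0"] exI[of _ "\<lambda>_. l"] exI[of _ "\<lambda>_. m"]) simp
next
  case (tens_add x y x' y')
  then obtain n l m n' l' m' where
    *: "\<forall>i<(n::nat). l i \<in> L \<and> m i \<in> M" "x = (\<Sum>i<n. l i * m i)" "y = (\<Sum>i<n. \<sigma> (l i) * m i)"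
      "\<forall>i<(n'::nat). l' i \<in> L \<and> m' i \<in> M" "x' = (\<Sum>i<n'. l' i * m' i)" "y' = (\<Sum>i<n'. \<sigma> (l' i) * m' i)"
    by blast
  define l'' where "l'' = (\<lambda>i. if i < n then l i else l' (i - n))"
  define m'' where "m'' = (\<lambda>i. if i < n then m i else m' (i - n))"
  have sum: "(\<Sum>i<n + n'. f (l'' i) * m'' i) = (\<Sum>i<n. f (l i) * m i) + (\<Sum>i<n'. f (l' i) * m' i)" for f
  proof -
    have "(\<Sum>i<n + n'. f (l'' i) * m'' i) = (\<Sum>i<n. f (l'' i) * m'' i) + (\<Sum>i<n'. f (l'' (i + n)) * m'' (i + n))"
      by (induction n') (simp_all add: add.assoc add.commute)
    then show ?thesis by (simp add: l''_def m''_def)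
  qed
  show ?case
    by (intro exI[of _ "n + n'"] exI[of _ l''] exI[of _ m''])
       (use * sum[of "\<lambda>x. x"] sum[of \<sigma>] in \<open>auto simp: l''_def m''_def\<close>)
qed

lemma tens_left: "l \<in> L \<Longrightarrow> (l, \<sigma> l) \<in> tens L M \<sigma>"
  using tens_mult[of l L 1 M \<sigma>] is_subfield_1[OF M] by simp

lemma tens_right: "m \<in> M \<Longrightarrow> (m, m) \<in> tens L M \<sigma>"
  using tens_mult[of 1 L m M \<sigma>] is_subfield_1[OF L] by (simp add: \<sigma>_1)

lemma subring_graph_tens: "subring_graph (tens L M \<sigma>)"
proof -
  have uminus: "(- x, - y) \<in> tens L M \<sigma>" if "(x, y) \<in> tens L M \<sigma>" for x y
    using that
  proof (induction rule: tens.induct)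
    case (tens_mult l m)
    then show ?case using tens.tens_mult[of l L "- m" M \<sigma>] is_subfield_uminus[OF M] by simp
  next
    case (tens_add x y x' y')
    then show ?case using tens.tens_add[OF tens_add.IH] by simp
  qed
  have mult1: "((l * m) * x, (\<sigma> l * m) * y) \<in> tens L M \<sigma>" if "(x, y) \<in> tens L M \<sigma>" "l \<in> L" "m \<in> M" for l m x y
    using that
  proof (induction rule: tens.induct)
    case (tens_mult l' m')
    then show ?case
      using tens.tens_mult[of "l * l'" L "m * m'" M \<sigma>] is_subfield_mult[OF L] is_subfield_mult[OF M]
      by (simp add: hom(2) mult_ac)
  next
    case (tens_add x y x' y')
    then show ?case using tens.tens_add[OF tens_add.IH] by (simp add: distrib_left)
  qed
  have mult: "(x * x', y * y') \<in> tens L M \<sigma>" if "(x, y) \<in> tens L M \<sigma>" "(x', y') \<in> tens L M \<sigma>" for x y x' y'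
    using that
  proof (induction rule: tens.induct)
    case (tens_mult l m)
    then show ?case using mult1 by blast
  next
    case (tens_add x1 y1 x2 y2)
    have "(x1 * x' + x2 * x', y1 * y' + y2 * y') \<in> tens L M \<sigma>"
      using tens_add by (intro tens.tens_add) auto
    then show ?case by (simp add: distrib_right)
  qed
  have "(0, 0) \<in> tens L M \<sigma>" "(1, 1) \<in> tens L M \<sigma>"
    using tens_right is_subfield_0[OF M] is_subfield_1[OF M] by auto
  then show ?thesis unfolding subring_graph_def by (intro conjI allI impI uminus tens.tens_add mult)
qed

text \<open>After division by \<open>l * m\<close> and \<open>\<sigma> l * m\<close>, the two
  components share the leading term given by one and the same unit sum, and the two divisors agree
  in sign and value.\<close>

lemma tens_normal_form:
  assumes "(x, y) \<in> tens L M \<sigma>" "\<not> (x = 0 \<and> y = 0)"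
  obtains l m J u w where "l \<in> L - {0}" "m \<in> M - {0}" "finite (J :: nat set)" "u ` J \<subseteq> L \<inter> V" "w ` J \<subseteq> M \<inter> V"
    "veq (\<Sum>i\<in>J. u i * w i) 1" "x / (l * m) - (\<Sum>i\<in>J. u i * w i) \<lless> 1"
    "vsim (x / (l * m)) (\<Sum>i\<in>J. u i * w i)" "vsim x y"
proof -
  obtain n :: nat and l m where *: "\<forall>i<n. l i \<in> L \<and> m i \<in> M" "x = (\<Sum>i<n. l i * m i)" "y = (\<Sum>i<n. \<sigma> (l i) * m i)"
    using tens_sum[OF assms(1)] by blast
  obtain l0 m0 and J :: "nat set" and u w where
    lm: "l0 \<in> L - {0}" "m0 \<in> M - {0}" and J: "finite J" "u ` J \<subseteq> L \<inter> V" "w ` J \<subseteq> M \<inter> V"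
    and s: "\<not> (\<Sum>i\<in>J. u i * w i) \<lless> 1" "x / (l0 * m0) - (\<Sum>i\<in>J. u i * w i) \<lless> 1"
      "y / (\<sigma> l0 * m0) - (\<Sum>i\<in>J. u i * w i) \<lless> 1"
    using leading_term[of n l m x y] * assms(2) by blast
  define s where "s = (\<Sum>i\<in>J. u i * w i)"
  have "s \<preceq> 1" unfolding s_def
    using J vle_mult[of _ 1 _ 1] by (intro vle_sum) (auto simp: vle_1_iff image_subset_iff intro!: V_mult)
  moreover have "1 \<preceq> s" using s(1) by (simp add: s_def vlt_def)
  ultimately have s1: "veq s 1" by (simp add: veq_def)
  have near: "vsim z s" if "z - s \<lless> 1" for z
    using vsim_add[of "z - s" s] vlt_vle_trans[OF that \<open>1 \<preceq> s\<close>] by simp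
  have "vsim (x / (l0 * m0)) s" "vsim (y / (\<sigma> l0 * m0)) s" using s(2,3) unfolding s_def[symmetric] by (auto intro: near)
  then have "vsim (x / (l0 * m0)) (y / (\<sigma> l0 * m0))" using vsim_sym vsim_trans by blast
  moreover have "vsim (l0 * m0) (\<sigma> l0 * m0)"
    using lm \<sigma>_vsim[of l0] by (intro vsim_mult vsim_refl) (auto intro: vsim_sym)
  ultimately have "vsim (x / (l0 * m0) * (l0 * m0)) (y / (\<sigma> l0 * m0) * (\<sigma> l0 * m0))" by (rule vsim_mult)
  then have "vsim x y" using lm \<sigma>_nonzero by simp
  then show thesis using that[OF lm J] s1 s(2) \<open>vsim (x / (l0 * m0)) s\<close> by (simp add: s_def)
qed

lemma tens_vsim: "(x, y) \<in> tens L M \<sigma> \<Longrightarrow> (x = 0 \<and> y = 0) \<or> vsim x y"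
  using tens_normal_form by blast

lemma order_graph_tens: "order_graph (tens L M \<sigma>)"
  unfolding order_graph_def
proof (intro conjI allI impI subring_graph_tens)
  fix x y assume "(x, y) \<in> tens L M \<sigma>"
  from tens_vsim[OF this] show "0 < x \<longleftrightarrow> 0 < y" by (auto simp: vsim_pos_iff)
qed

lemma val_graph_tens: "val_graph (frac_graph (tens L M \<sigma>))"
proof (rule val_graph_fracI[OF order_graph_tens])
  have veq: "veq x y" if "(x, y) \<in> tens L M \<sigma>" for x y
    using tens_vsim[OF that] by (auto simp: vsim_def)
  show "x \<preceq> x' \<longleftrightarrow> y \<preceq> y'" if "(x, y) \<in> tens L M \<sigma>" "(x', y') \<in> tens L M \<sigma>" for x y x' y'
    using veq_vle_cong[OF veq[OF that(1)] veq[OF that(2)]] .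
qed

lemma tens_subset:
  assumes T: "is_subfield T" "L \<subseteq> T" "M \<subseteq> T"
  shows "Domain (frac_graph (tens L M \<sigma>)) \<subseteq> T"
proof -
  have "x \<in> T" if "(x, y) \<in> tens L M \<sigma>" for x y
    using that by (induction rule: tens.induct) (use T in \<open>auto intro: is_subfield_add is_subfield_mult\<close>)
  then show ?thesis using is_subfield_divide[OF T(1)] unfolding frac_graph_def by blast
qed

text \<open>The quotient of two normal forms. The unit sum of the denominator is kept as a factor on
  the left, so that the relation needs no division by sums.\<close>

lemma tens_element:
  assumes "n \<in> Domain (frac_graph (tens L M \<sigma>))" "n \<noteq> 0"
  obtains l m J u w J' u' w' where "l \<in> L - {0}" "m \<in> M - {0}" "veq n (l * m)"
    "finite (J :: nat set)" "u ` J \<subseteq> L \<inter> V" "w ` J \<subseteq> M \<inter> V" "veq (\<Sum>i\<in>J. u i * w i) 1"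
    "finite (J' :: nat set)" "u' ` J' \<subseteq> L \<inter> V" "w' ` J' \<subseteq> M \<inter> V" "veq (\<Sum>i\<in>J'. u' i * w' i) 1"
    "n / (l * m) * (\<Sum>i\<in>J'. u' i * w' i) - (\<Sum>i\<in>J. u i * w i) \<lless> 1"
proof -
  obtain x y x' y' where *: "n = x / x'" "(x, y) \<in> tens L M \<sigma>" "(x', y') \<in> tens L M \<sigma>" "x' \<noteq> 0"
    using assms(1) unfolding frac_graph_def by blast
  then have nz: "\<not> (x = 0 \<and> y = 0)" "\<not> (x' = 0 \<and> y' = 0)" using assms(2) by auto
  obtain l m J u w where
    1: "l \<in> L - {0}" "m \<in> M - {0}" "finite (J :: nat set)" "u ` J \<subseteq> L \<inter> V" "w ` J \<subseteq> M \<inter> V"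
    "veq (\<Sum>i\<in>J. u i * w i) 1" "x / (l * m) - (\<Sum>i\<in>J. u i * w i) \<lless> 1"
    "vsim (x / (l * m)) (\<Sum>i\<in>J. u i * w i)"
    by (rule tens_normal_form[OF *(2) nz(1)])
  obtain l' m' J' u' w' where
    2: "l' \<in> L - {0}" "m' \<in> M - {0}" "finite (J' :: nat set)" "u' ` J' \<subseteq> L \<inter> V" "w' ` J' \<subseteq> M \<inter> V"
    "veq (\<Sum>i\<in>J'. u' i * w' i) 1" "x' / (l' * m') - (\<Sum>i\<in>J'. u' i * w' i) \<lless> 1"
    "vsim (x' / (l' * m')) (\<Sum>i\<in>J'. u' i * w' i)"
    by (rule tens_normal_form[OF *(3) nz(2)])
  define s where "s = (\<Sum>i\<in>J. u i * w i)"
  define s' where "s' = (\<Sum>i\<in>J'. u' i * w' i)"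
  define a where "a = x / (l * m)"
  define b where "b = x' / (l' * m')"
  have s: "veq s 1" "veq s' 1" "a - s \<lless> 1" "b - s' \<lless> 1" "veq a s" "veq b s'"
    using 1(6-8) 2(6-8) by (auto simp: s_def s'_def a_def b_def vsim_def)
  have ab: "veq a 1" "veq b 1" using s veq_trans by blast+
  then have b0: "b \<noteq> 0" by auto
  define r where "r = n / ((l / l') * (m / m'))"
  have rab: "r = a / b" using 1(1,2) 2(1,2) *(4) by (simp add: r_def a_def b_def *(1))
  have r1: "veq r 1" unfolding rab using veq_divide[OF ab] by simp
  have "r * b = a" using b0 by (simp add: rab)
  then have "r * s' - s = (a - s) - r * (b - s')" by (simp add: right_diff_distrib)
  also have "\<dots> \<lless> 1"
  proof (rule vlt_diff[OF s(3)])
    show "r * (b - s') \<lless> 1" using vle_vlt_mult[of r 1 "b - s'" 1] r1 s(4) by (simp add: veq_def)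
  qed
  finally have fin: "r * s' - s \<lless> 1" .
  have lm: "l / l' \<in> L - {0}" "m / m' \<in> M - {0}"
    using 1(1,2) 2(1,2) is_subfield_divide[OF L] is_subfield_divide[OF M] by auto
  have "veq (r * ((l / l') * (m / m'))) (1 * ((l / l') * (m / m')))" by (rule veq_mult[OF r1 veq_refl])
  moreover have "r * ((l / l') * (m / m')) = n" using lm by (simp add: r_def)
  ultimately have "veq n ((l / l') * (m / m'))" by simp
  then show thesis
    using that[OF lm _ 1(3-6) 2(3-6)] fin by (simp add: r_def s_def s'_def)
qed

text \<open>A unit \<open>n\<close> has the residue \<open>p * q * s / s'\<close>.\<close>

lemma tens_unit:
  assumes "n \<in> Domain (frac_graph (tens L M \<sigma>))" "veq n 1"
  obtains p q J u w J' u' w' where "p \<in> L" "q \<in> M" "veq p 1" "veq q 1"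
    "finite (J :: nat set)" "u ` J \<subseteq> L \<inter> V" "w ` J \<subseteq> M \<inter> V" "veq (\<Sum>i\<in>J. u i * w i) 1"
    "finite (J' :: nat set)" "u' ` J' \<subseteq> L \<inter> V" "w' ` J' \<subseteq> M \<inter> V" "veq (\<Sum>i\<in>J'. u' i * w' i) 1"
    "n * (\<Sum>i\<in>J'. u' i * w' i) - p * q * (\<Sum>i\<in>J. u i * w i) \<lless> 1"
proof -
  have "n \<noteq> 0" using assms(2) by auto
  obtain l m J u w J' u' w' where lm: "l \<in> L - {0}" "m \<in> M - {0}" "veq n (l * m)"
    and 1: "finite (J :: nat set)" "u ` J \<subseteq> L \<inter> V" "w ` J \<subseteq> M \<inter> V" "veq (\<Sum>i\<in>J. u i * w i) 1"
    and 2: "finite (J' :: nat set)" "u' ` J' \<subseteq> L \<inter> V" "w' ` J' \<subseteq> M \<inter> V" "veq (\<Sum>i\<in>J'. u' i * w' i) 1"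
    and 3: "n / (l * m) * (\<Sum>i\<in>J'. u' i * w' i) - (\<Sum>i\<in>J. u i * w i) \<lless> 1"
    by (rule tens_element[OF assms(1) \<open>n \<noteq> 0\<close>])
  have lm1: "veq (l * m) 1" using lm(3) assms(2) veq_sym veq_trans by blast
  then have "veq (l * m / m) (1 / m)" by (intro veq_divide) auto
  then have "veq l (inverse m)" using lm(2) by (simp add: inverse_eq_divide)
  moreover have "inverse m \<in> M - {0}" using lm(2) is_subfield_inverse[OF M] by auto
  \<comment> \<open>As \<open>l * m\<close> is a unit, \<open>l\<close> and \<open>inverse m\<close>
    share a value, which occurs in \<open>C\<close> by \<open>VG\<close>. Hence
    \<open>p = l / c\<close> and \<open>q = m * c\<close> are units with the same product.\<close>
  ultimately obtain c where c: "c \<in> C - {0}" "veq l c" using VG[OF lm(1)] by blast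
  have p: "l / c \<in> L" "veq (l / c) 1"
    using veq_divide[OF c(2) veq_refl[of c]] c(1) lm(1) CL by (auto intro: is_subfield_divide[OF L])
  have pq: "(l / c) * (m * c) = l * m" using c(1) by simp
  then have "veq (m * c) 1"
    using veq_divide[OF lm1 p(2)] c(1) lm(1) by simp
  moreover have "m * c \<in> M" using lm(2) c(1) CM by (auto intro: is_subfield_mult[OF M])
  moreover have "n * (\<Sum>i\<in>J'. u' i * w' i) - (l / c) * (m * c) * (\<Sum>i\<in>J. u i * w i) \<lless> 1"
  proof -
    define t where "t = n / (l * m) * (\<Sum>i\<in>J'. u' i * w' i) - (\<Sum>i\<in>J. u i * w i)"
    have "l * m * t \<lless> 1" using vle_vlt_mult[of "l * m" 1 t 1] lm1 3 by (simp add: veq_def t_def)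
    moreover have "l * m * t = n * (\<Sum>i\<in>J'. u' i * w' i) - l * m * (\<Sum>i\<in>J. u i * w i)"
      using lm(1,2) by (simp add: t_def right_diff_distrib)
    ultimately show ?thesis unfolding pq by simp
  qed
  ultimately show thesis using that[OF p(1) _ p(2) _ 1 2] by blast
qed

end

subsection \<open>Value group and residue field\<close>

lemma rta_simps [simp]:
  "carrier (ring_of_type_algebra :: 'b::field ring) = UNIV"
  "x \<otimes>\<^bsub>ring_of_type_algebra\<^esub> y = x * (y :: 'b::field)"
  "x \<oplus>\<^bsub>ring_of_type_algebra\<^esub> y = x + (y :: 'b::field)"
  "\<zero>\<^bsub>ring_of_type_algebra\<^esub> = (0 :: 'b::field)" "\<one>\<^bsub>ring_of_type_algebra\<^esub> = (1 :: 'b::field)"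
  by (simp_all add: ring_of_type_algebra_def)

lemma rta_field: "field (ring_of_type_algebra :: 'b::field ring)"
  by (rule field_from_type_algebra)

lemma rta_a_inv [simp]: "\<ominus>\<^bsub>ring_of_type_algebra\<^esub> x = - (x :: 'b::field)"
proof -
  interpret field "ring_of_type_algebra :: 'b ring" by (rule rta_field)
  show ?thesis by (rule minus_equality) auto
qed

lemma rta_inv [simp]: "x \<noteq> 0 \<Longrightarrow> inv\<^bsub>ring_of_type_algebra\<^esub> x = inverse (x :: 'b::field)"
proof -
  interpret field "ring_of_type_algebra :: 'b ring" by (rule rta_field)
  assume "x \<noteq> 0"
  then show ?thesis by (intro comm_inv_char) auto
qed

lemma subfield_rta_iff: "subfield K ring_of_type_algebra \<longleftrightarrow> is_subfield (K :: 'b::field set)"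
proof
  interpret field "ring_of_type_algebra :: 'b ring" by (rule rta_field)
  assume K: "subfield K ring_of_type_algebra"
  note S = subfieldE(1)[OF K]
  have "inverse x \<in> K" if "x \<in> K" for x
    using subfield_m_inv(1)[OF K, of x] that subringE(2)[OF S] by (cases "x = 0") auto
  then show "is_subfield K"
    using subringE(2,3)[OF S] subringE(5)[OF S] subringE(6)[OF S] subringE(7)[OF S]
    by (auto simp: is_subfield_def)
next
  interpret field "ring_of_type_algebra :: 'b ring" by (rule rta_field)
  assume K: "is_subfield K"
  show "subfield K ring_of_type_algebra"
  proof (rule subfieldI')
    show "subring K ring_of_type_algebra"
      using K by (intro subringI) (auto simp: is_subfield_def)
    show "inv\<^bsub>ring_of_type_algebra\<^esub> k \<in> K" if "k \<in> K - {\<zero>\<^bsub>ring_of_type_algebra\<^esub>}" for k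
      using that K by (auto simp: is_subfield_def)
  qed
qed

lemma convex_valuationI:
  assumes "rc_valued_field (V :: 'a::linordered_field set)"
  shows "convex_valuation V" "V \<noteq> UNIV" "real_closed_in (UNIV :: 'a set)"
proof -
  have V: "subring V RR" "V \<noteq> UNIV" and conv: "\<And>x y. x \<in> V \<Longrightarrow> y \<in> V \<Longrightarrow> {x..y} \<subseteq> V"
    and rc: "real_closed TYPE('a)"
    using assms by (auto simp: rc_valued_field_def valuation_ring_def)
  interpret field "RR :: 'a ring" by (rule rta_field)
  show "V \<noteq> UNIV" by (rule V)
  show "convex_valuation V"
  proof
    show "x + y \<in> V" "x * y \<in> V" if "x \<in> V" "y \<in> V" for x y
      using subringE(7)[OF V(1) that] subringE(6)[OF V(1) that] by simp_all
    show "- x \<in> V" if "x \<in> V" for x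
      using subringE(5)[OF V(1) that] by simp
    show "1 \<in> V" using subringE(3)[OF V(1)] by simp
    show "x \<in> V" if "0 \<le> x" "x \<le> y" "y \<in> V" for x y
      using conv[of 0 y] subringE(2)[OF V(1)] that by auto
  qed
  show "real_closed_in (UNIV :: 'a set)"
    using rc by (auto simp: real_closed_in_def real_closed_def is_subfield_def)
qed

section \<open>Values and residues in terms of \<open>\<preceq>\<close>\<close>

context convex_valuation
begin

lemma V_iff: "x \<in> V \<longleftrightarrow> x \<preceq> 1"
  by (simp add: vle_1_iff)

lemma inverse_V_iff: "x \<noteq> 0 \<Longrightarrow> inverse x \<in> V \<longleftrightarrow> 1 \<preceq> x"
  by (simp add: V_iff inverse_eq_divide vle_divide_iff)

lemma val_units_eq: "val_units RR V = {x. veq x 1}"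
proof -
  have "x \<in> val_units RR V \<longleftrightarrow> veq x 1" for x
  proof (cases "x = 0")
    case False
    then show ?thesis using inverse_V_iff[OF False] V_iff[of x] by (auto simp: val_units_def veq_def)
  qed (simp add: val_units_def)
  then show ?thesis by blast
qed

lemma val_ideal_eq: "val_ideal RR V = {x. x \<lless> 1}"
  unfolding val_ideal_def val_units_eq using vlt_imp_vle by (auto simp: V_iff veq_def vlt_def)

lemma val_eq: assumes "x \<noteq> 0" shows "val RR V x = {y. veq y x}"
proof -
  have "val RR V x = {u * x | u. veq u 1}"
    unfolding val_def r_coset_def val_units_eq by auto
  also have "\<dots> = {y. veq y x}"
  proof safe
    fix u assume "veq u 1"
    then show "veq (u * x) x" using veq_mult[of u 1 x x] by simp
  next
    fix y assume "veq y x"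
    then have "veq (y / x) 1" using veq_divide[of y x x x] assms by simp
    then show "\<exists>u. y = u * x \<and> veq u 1" using assms by (intro exI[of _ "y / x"]) simp
  qed
  finally show ?thesis .
qed

lemma val_eq_iff: "x \<noteq> 0 \<Longrightarrow> y \<noteq> 0 \<Longrightarrow> val RR V x = val RR V y \<longleftrightarrow> veq x y"
  unfolding val_eq using veq_sym veq_trans veq_refl by blast

lemma res_eq: "res RR V x = {y. y - x \<lless> 1}"
proof -
  have "res RR V x = {e + x | e. e \<lless> 1}"
    unfolding res_def a_r_coset_def r_coset_def val_ideal_eq by auto
  also have "\<dots> = {y. y - x \<lless> 1}" by (auto intro: exI[of _ "y - x" for y])
  finally show ?thesis .
qed

lemma res_eq_iff: "res RR V x = res RR V y \<longleftrightarrow> x - y \<lless> 1"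
proof
  assume "res RR V x = res RR V y"
  moreover have "x \<in> res RR V x" by (simp add: res_eq)
  ultimately show "x - y \<lless> 1" by (simp add: res_eq)
next
  assume xy: "x - y \<lless> 1"
  have "z - x \<lless> 1 \<longleftrightarrow> z - y \<lless> 1" for z
    using vlt_add[OF _ xy, of "z - x"] vlt_diff[OF _ xy, of "z - y"] by (auto simp: algebra_simps)
  then show "res RR V x = res RR V y" by (simp add: res_eq)
qed

lemma subring_V: "subring V RR"
proof -
  interpret field "RR :: 'a ring" by (rule rta_field)
  show ?thesis by (intro subringI) (auto intro: V_1 V_add V_mult V_uminus)
qed

lemma cring_V: "cring (RR\<lparr>carrier := V\<rparr>)"
proof -
  interpret field "RR :: 'a ring" by (rule rta_field)
  show ?thesis using subring_is_domain[OF subring_V] by (simp add: domain_def)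
qed

lemma val_ideal_ideal: "ideal (val_ideal RR V) (RR\<lparr>carrier := V\<rparr>)"
proof (rule idealI)
  interpret V: cring "RR\<lparr>carrier := V\<rparr>" by (rule cring_V)
  show "ring (RR\<lparr>carrier := V\<rparr>)" by (rule V.ring_axioms)
  have inv: "\<ominus>\<^bsub>RR\<lparr>carrier := V\<rparr>\<^esub> x = - x" if "x \<in> V" for x
    using that V_uminus by (intro V.minus_equality) auto
  show "subgroup (val_ideal RR V) (add_monoid (RR\<lparr>carrier := V\<rparr>))"
  proof (rule group.subgroupI[OF V.a_group])
    show "val_ideal RR V \<subseteq> carrier (add_monoid (RR\<lparr>carrier := V\<rparr>))"
      unfolding val_ideal_eq using vlt_imp_vle by (auto simp: V_iff)
    show "val_ideal RR V \<noteq> {}" unfolding val_ideal_eq by (auto intro: exI[of _ 0])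
    fix a assume a: "a \<in> val_ideal RR V"
    then have "a \<in> V" unfolding val_ideal_eq using vlt_imp_vle by (auto simp: V_iff)
    then show "inv\<^bsub>add_monoid (RR\<lparr>carrier := V\<rparr>)\<^esub> a \<in> val_ideal RR V"
      using inv[of a] a unfolding a_inv_def val_ideal_eq by simp
    fix b assume "b \<in> val_ideal RR V"
    then show "a \<otimes>\<^bsub>add_monoid (RR\<lparr>carrier := V\<rparr>)\<^esub> b \<in> val_ideal RR V"
      using a by (simp add: val_ideal_eq vlt_add)
  qed
  fix a x assume "a \<in> val_ideal RR V" "x \<in> carrier (RR\<lparr>carrier := V\<rparr>)"
  then have "a * x \<lless> 1" using vlt_vle_mult[of a 1 x 1] by (simp add: val_ideal_eq V_iff)
  then show "x \<otimes>\<^bsub>RR\<lparr>carrier := V\<rparr>\<^esub> a \<in> val_ideal RR V" "a \<otimes>\<^bsub>RR\<lparr>carrier := V\<rparr>\<^esub> x \<in> val_ideal RR V"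
    by (simp_all add: val_ideal_eq mult.commute)
qed

lemma res_hom: "res RR V \<in> ring_hom (RR\<lparr>carrier := V\<rparr>) (residue_field RR V)"
proof -
  interpret I: ideal "val_ideal RR V" "RR\<lparr>carrier := V\<rparr>" by (rule val_ideal_ideal)
  have "res RR V = (\<lambda>x. val_ideal RR V +>\<^bsub>RR\<lparr>carrier := V\<rparr>\<^esub> x)" by (simp add: res_def fun_eq_iff)
  then show ?thesis using I.rcos_ring_hom by (simp add: residue_field_def)
qed

lemma residue_carrier: "carrier (residue_field RR V) = res RR V ` V"
  unfolding residue_field_def FactRing_def A_RCOSETS_def RCOSETS_def
  by (auto simp: res_def a_r_coset_def)

lemma res_mult: "x \<in> V \<Longrightarrow> y \<in> V \<Longrightarrow> res RR V (x * y) = res RR V x \<otimes>\<^bsub>residue_field RR V\<^esub> res RR V y"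
  and res_add: "x \<in> V \<Longrightarrow> y \<in> V \<Longrightarrow> res RR V (x + y) = res RR V x \<oplus>\<^bsub>residue_field RR V\<^esub> res RR V y"
  and res_1: "res RR V 1 = \<one>\<^bsub>residue_field RR V\<^esub>"
  using ring_hom_mult[OF res_hom, of x y] ring_hom_add[OF res_hom, of x y] ring_hom_one[OF res_hom] by simp_all

lemma cring_residue: "cring (residue_field RR V)"
  unfolding residue_field_def by (rule ideal.quotient_is_cring[OF val_ideal_ideal cring_V])

lemma res_0: "res RR V 0 = \<zero>\<^bsub>residue_field RR V\<^esub>"
proof -
  interpret k: cring "residue_field RR V" by (rule cring_residue)
  interpret V: cring "RR\<lparr>carrier := V\<rparr>" by (rule cring_V)
  show ?thesis using ring_hom_zero[OF res_hom V.ring_axioms k.ring_axioms] by simp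
qed

lemma res_zero_iff: "res RR V x = \<zero>\<^bsub>residue_field RR V\<^esub> \<longleftrightarrow> x \<lless> 1"
  unfolding res_0[symmetric] res_eq_iff by simp

lemma V_inverse: "x \<in> V \<Longrightarrow> \<not> x \<lless> 1 \<Longrightarrow> inverse x \<in> V \<and> x \<noteq> 0"
  using inverse_V_iff[of x] by (cases "x = 0") (auto simp: vlt_def)

lemma field_residue: "field (residue_field RR V)"
proof -
  interpret k: cring "residue_field RR V" by (rule cring_residue)
  show ?thesis
  proof (rule k.cring_fieldI2)
    show "\<zero>\<^bsub>residue_field RR V\<^esub> \<noteq> \<one>\<^bsub>residue_field RR V\<^esub>"
      using res_zero_iff[of 1] res_1 by auto
    fix a assume "a \<in> carrier (residue_field RR V)" "a \<noteq> \<zero>\<^bsub>residue_field RR V\<^esub>"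
    then obtain x where x: "x \<in> V" "a = res RR V x" "\<not> x \<lless> 1" using res_zero_iff by (auto simp: residue_carrier)
    then have "inverse x \<in> V" "x \<noteq> 0" using V_inverse by auto
    then show "\<exists>b\<in>carrier (residue_field RR V). a \<otimes>\<^bsub>residue_field RR V\<^esub> b = \<one>\<^bsub>residue_field RR V\<^esub>"
      using x res_mult[of x "inverse x"] res_1 by (intro bexI[of _ "res RR V (inverse x)"]) (auto simp: residue_carrier)
  qed
qed

lemma res_inverse:
  assumes "x \<in> V" "\<not> x \<lless> 1"
  shows "inv\<^bsub>residue_field RR V\<^esub> (res RR V x) = res RR V (inverse x)"
proof -
  interpret k: field "residue_field RR V" by (rule field_residue)
  show ?thesis
    using V_inverse[OF assms] res_mult[of x "inverse x"] assms(1) res_1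
    by (intro k.comm_inv_char) (auto simp: residue_carrier)
qed

lemma res_uminus: "x \<in> V \<Longrightarrow> \<ominus>\<^bsub>residue_field RR V\<^esub> (res RR V x) = res RR V (- x)"
proof -
  interpret k: field "residue_field RR V" by (rule field_residue)
  assume "x \<in> V"
  then show ?thesis
    using res_add[of "- x" x] V_uminus[of x] res_0
    by (intro k.minus_equality) (auto simp: residue_carrier)
qed

lemma subfield_residue:
  assumes K: "is_subfield K"
  shows "subfield (residue_field_on RR V K) (residue_field RR V)"
proof -
  interpret k: field "residue_field RR V" by (rule field_residue)
  note KI = is_subfield_intros[OF K]
  show ?thesis
  proof (rule k.subfieldI')
    show "subring (residue_field_on RR V K) (residue_field RR V)"
    proof (rule k.subringI)
      show "residue_field_on RR V K \<subseteq> carrier (residue_field RR V)"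
        by (auto simp: residue_field_on_def residue_carrier)
      show "\<one>\<^bsub>residue_field RR V\<^esub> \<in> residue_field_on RR V K"
        unfolding residue_field_on_def res_1[symmetric] using KI(2) V_1 by blast
    next
      fix h assume "h \<in> residue_field_on RR V K"
      then obtain x where "x \<in> K" "x \<in> V" "h = res RR V x" by (auto simp: residue_field_on_def)
      then show "\<ominus>\<^bsub>residue_field RR V\<^esub> h \<in> residue_field_on RR V K"
        using res_uminus KI(5) V_uminus by (auto simp: residue_field_on_def)
    next
      fix h1 h2 assume "h1 \<in> residue_field_on RR V K" "h2 \<in> residue_field_on RR V K"
      then obtain x y where *: "x \<in> K" "x \<in> V" "h1 = res RR V x" "y \<in> K" "y \<in> V" "h2 = res RR V y"
        by (auto simp: residue_field_on_def)
      show "h1 \<otimes>\<^bsub>residue_field RR V\<^esub> h2 \<in> residue_field_on RR V K"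
        using * res_mult[of x y] KI(4)[of x y] V_mult[of x y] by (auto simp: residue_field_on_def)
      show "h1 \<oplus>\<^bsub>residue_field RR V\<^esub> h2 \<in> residue_field_on RR V K"
        using * res_add[of x y] KI(3)[of x y] V_add[of x y] by (auto simp: residue_field_on_def)
    qed
    fix h assume "h \<in> residue_field_on RR V K - {\<zero>\<^bsub>residue_field RR V\<^esub>}"
    then obtain x where x: "x \<in> K" "x \<in> V" "h = res RR V x" "\<not> x \<lless> 1"
      using res_zero_iff by (auto simp: residue_field_on_def)
    then show "inv\<^bsub>residue_field RR V\<^esub> h \<in> residue_field_on RR V K"
      using res_inverse[OF x(2,4)] V_inverse[OF x(2,4)] KI(6) by (auto simp: residue_field_on_def)
  qed
qed

lemma combine_res:
  assumes "\<And>i. i \<in> set js \<Longrightarrow> w i \<in> V" "\<And>i. i \<in> set js \<Longrightarrow> u i \<in> V"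
  shows "ring.combine (residue_field RR V) (map (\<lambda>i. res RR V (w i)) js) (map (\<lambda>i. res RR V (u i)) js)
    = res RR V (\<Sum>i\<leftarrow>js. w i * u i)"
  using assms
proof (induction js)
  interpret k: field "residue_field RR V" by (rule field_residue)
  case Nil
  show ?case by (simp add: res_0)
next
  interpret k: field "residue_field RR V" by (rule field_residue)
  case (Cons j js)
  have "(\<Sum>i\<leftarrow>js. w i * u i) \<in> V"
    using Cons.prems by (induction js) (auto intro: V_0 V_add V_mult)
  then show ?case using Cons by (simp add: res_add res_mult V_mult)
qed

text \<open>Independence is a condition on lists of residues. Choosing representatives turns
  coefficients into elements of \<open>C \<inter> V\<close> or \<open>M \<inter> V\<close>, and a
  zero combination into one in the maximal ideal.\<close>

lemma residue_linear_disjoint: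
  assumes C: "is_subfield C" and L: "is_subfield L" and M: "is_subfield M"
    and ld: "linearly_disjoint (residue_field RR V)
           (residue_field_on RR V L) (residue_field_on RR V M) (residue_field_on RR V C)"
    and J: "finite (J :: nat set)" and u: "u ` J \<subseteq> L \<inter> V" and w: "w ` J \<subseteq> M \<inter> V"
    and indep: "\<And>e. e ` J \<subseteq> C \<inter> V \<Longrightarrow> (\<Sum>i\<in>J. e i * u i) \<lless> 1 \<Longrightarrow> \<forall>i\<in>J. e i \<lless> 1"
    and sum: "(\<Sum>i\<in>J. w i * u i) \<lless> 1"
  shows "\<forall>i\<in>J. w i \<lless> 1"
proof -
  interpret k: field "residue_field RR V" by (rule field_residue)
  define js where "js = sorted_list_of_set J"
  have js: "set js = J" "distinct js" using J by (auto simp: js_def)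
  have sl: "(\<Sum>i\<leftarrow>js. f i) = (\<Sum>i\<in>J. f i)" for f :: "nat \<Rightarrow> 'a"
    using sum_list_distinct_conv_sum_set[OF js(2), of f] js(1) by simp
  define Us where "Us = map (\<lambda>i. res RR V (u i)) js"
  have UsL: "set Us \<subseteq> residue_field_on RR V L" using u js by (auto simp: Us_def residue_field_on_def)
  have Uc: "set Us \<subseteq> carrier (residue_field RR V)" using u js by (auto simp: Us_def residue_carrier)
  have uV: "u i \<in> V" "w i \<in> V" if "i \<in> set js" for i using that js u w by auto
  have "k.independent (residue_field_on RR V C) Us"
  proof (rule ccontr)
    assume dep: "\<not> k.independent (residue_field_on RR V C) Us"
    obtain Ks where Ks: "length Ks = length Us" "k.combine Ks Us = \<zero>\<^bsub>residue_field RR V\<^esub>"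
      "set Ks \<subseteq> residue_field_on RR V C" "set Ks \<noteq> {\<zero>\<^bsub>residue_field RR V\<^esub>}"
      using k.dependent_imp_non_trivial_combine[OF subfield_residue[OF C] Uc] dep by blast
    have "Us \<noteq> []" using dep k.independent.intros(1) by auto
    have "\<forall>x\<in>set Ks. \<exists>e. e \<in> C \<inter> V \<and> x = res RR V e" using Ks(3) by (auto simp: residue_field_on_def)
    then obtain g where g: "\<And>x. x \<in> set Ks \<Longrightarrow> g x \<in> C \<inter> V \<and> x = res RR V (g x)" by metis
    \<comment> \<open>\<open>g\<close> picks representatives in \<open>C \<inter> V\<close>. The
      lookup gives each index in \<open>js\<close> the coefficient at its position; the indices are
      distinct even if residues coincide.\<close>
    define e where "e = (\<lambda>i. g (the (map_of (zip js Ks) i)))"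
    have len: "length js = length Ks" using Ks(1) by (simp add: Us_def)
    have enth: "e (js ! i) = g (Ks ! i)" if "i < length js" for i
      using map_of_zip_nth[OF len js(2)] that len by (simp add: e_def)
    have Keq: "Ks = map (\<lambda>i. res RR V (e i)) js"
      using len enth g by (intro nth_equalityI) auto
    have eCV: "e i \<in> C \<inter> V" if "i \<in> J" for i
    proof -
      have "i \<in> set js" using that js(1) by simp
      then obtain p where "p < length js" "js ! p = i" unfolding in_set_conv_nth by blast
      then show ?thesis using enth[of p] g[of "Ks ! p"] len by auto
    qed
    have "res RR V (\<Sum>i\<leftarrow>js. e i * u i) = \<zero>\<^bsub>residue_field RR V\<^esub>"
      using Ks(2) combine_res[of js e u] eCV uV js(1) by (simp add: Us_def Keq)
    then have "(\<Sum>i\<in>J. e i * u i) \<lless> 1" unfolding res_zero_iff sl .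
    then have "\<forall>i\<in>J. e i \<lless> 1" using eCV by (intro indep) auto
    then have "set Ks \<subseteq> {\<zero>\<^bsub>residue_field RR V\<^esub>}" unfolding Keq using js(1) res_zero_iff by auto
    moreover have "Ks \<noteq> []" using \<open>Us \<noteq> []\<close> Ks(1) by auto
    ultimately have "set Ks = {\<zero>\<^bsub>residue_field RR V\<^esub>}" by (cases Ks) auto
    then show False using Ks(4) by simp
  qed
  then have ind: "k.independent (residue_field_on RR V M) Us"
    using ld UsL unfolding linearly_disjoint_def by blast
  define Ws where "Ws = map (\<lambda>i. res RR V (w i)) js"
  have "k.combine Ws Us = \<zero>\<^bsub>residue_field RR V\<^esub>"
    unfolding Ws_def Us_def using combine_res[of js w u] uV sum by (simp add: sl res_zero_iff)
  moreover have "set Ws \<subseteq> residue_field_on RR V M" using w js by (auto simp: Ws_def residue_field_on_def)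
  ultimately have "set (take (length Us) Ws) \<subseteq> {\<zero>\<^bsub>residue_field RR V\<^esub>}"
    using k.independent_imp_trivial_combine[OF subfield_residue[OF M] ind] by blast
  then show ?thesis using js(1) res_zero_iff by (auto simp: Us_def Ws_def)
qed

lemma value_group_disjoint:
  assumes vg: "value_group_on RR V L \<inter> value_group_on RR V M = value_group_on RR V C"
    and "l \<in> L - {0}" "m \<in> M - {0}" "veq l m"
  shows "\<exists>c\<in>C - {0}. veq l c"
proof -
  have "val RR V l \<in> value_group_on RR V L" using assms(2) by (auto simp: value_group_on_def)
  moreover have "val RR V l = val RR V m" using assms by (simp add: val_eq_iff)
  then have "val RR V l \<in> value_group_on RR V M" using assms(3) by (auto simp: value_group_on_def)
  ultimately have "val RR V l \<in> value_group_on RR V C" using vg by blast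
  then obtain c where "c \<in> C - {0}" "val RR V l = val RR V c" by (auto simp: value_group_on_def)
  then show ?thesis using assms(2) by (auto simp: val_eq_iff)
qed

lemma value_carrier: "carrier (value_group RR V) = val RR V ` (- {0})"
  unfolding value_group_def FactGroup_def RCOSETS_def val_def by auto

lemma val_mult:
  assumes "x \<noteq> 0" "y \<noteq> 0"
  shows "val RR V x \<otimes>\<^bsub>value_group RR V\<^esub> val RR V y = val RR V (x * y)"
proof -
  have "val RR V x \<otimes>\<^bsub>value_group RR V\<^esub> val RR V y = {a * b | a b. veq a x \<and> veq b y}"
    unfolding value_group_def FactGroup_def using assms by (auto simp: set_mult_def val_eq)
  also have "\<dots> = {z. veq z (x * y)}"
  proof safe
    fix z assume "veq z (x * y)"
    then have "veq (z / x) y" using veq_divide[of z "x * y" x x] assms by simp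
    then show "\<exists>a b. z = a * b \<and> veq a x \<and> veq b y"
      using assms by (intro exI[of _ x] exI[of _ "z / x"]) simp
  qed (rule veq_mult)
  finally show ?thesis using assms by (simp add: val_eq)
qed

lemma val_1: "\<one>\<^bsub>value_group RR V\<^esub> = val RR V 1"
  unfolding value_group_def FactGroup_def by (simp add: val_eq val_units_eq)

lemma val_inverse:
  assumes "x \<noteq> 0"
  shows "inv\<^bsub>value_group RR V\<^esub> (val RR V x) = val RR V (inverse x)"
  unfolding m_inv_def
proof (rule the_equality)
  show "val RR V (inverse x) \<in> carrier (value_group RR V) \<and>
    val RR V x \<otimes>\<^bsub>value_group RR V\<^esub> val RR V (inverse x) = \<one>\<^bsub>value_group RR V\<^esub> \<and>
    val RR V (inverse x) \<otimes>\<^bsub>value_group RR V\<^esub> val RR V x = \<one>\<^bsub>value_group RR V\<^esub>"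
    using assms by (simp add: val_mult val_1 value_carrier)
  fix y assume y: "y \<in> carrier (value_group RR V) \<and> val RR V x \<otimes>\<^bsub>value_group RR V\<^esub> y = \<one>\<^bsub>value_group RR V\<^esub> \<and>
    y \<otimes>\<^bsub>value_group RR V\<^esub> val RR V x = \<one>\<^bsub>value_group RR V\<^esub>"
  then obtain z where z: "z \<noteq> 0" "y = val RR V z" by (auto simp: value_carrier)
  then have "veq (z * x) 1" using y assms by (simp add: val_mult val_1 val_eq_iff)
  then have "veq (z * x / x) (1 / x)" by (rule veq_divide[OF _ veq_refl])
  then show "y = val RR V (inverse x)" using z assms by (simp add: val_eq_iff inverse_eq_divide)
qed

end

subsection \<open>Maximal valued fields\<close>

text \<open>Maximality quantifies over fields with elements in \<open>'a set\<close>. The algebraic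
  closure corresponds to pairs from an infinite type, so it embeds there by singletons.\<close>

lemma inj_alg_closure_set:
  assumes rcU: "real_closed_in (UNIV :: 'a::linordered_field set)"
  obtains h :: "'a::linordered_field alg_closure \<Rightarrow> 'a set" where "inj h"
proof -
  have "|(UNIV :: 'a set) \<times> (UNIV :: 'a set)| =o |UNIV :: 'a set|"
    by (rule card_of_Times_same_infinite) (rule infinite_UNIV_char_0)
  then have "|(UNIV :: 'a set) \<times> (UNIV :: 'a set)| \<le>o |UNIV :: 'a set|" by (rule ordIso_imp_ordLeq)
  then obtain f :: "'a \<times> 'a \<Rightarrow> 'a" where f: "inj_on f (UNIV \<times> UNIV)" unfolding card_of_ordLeq[symmetric] by blast
  define p where "p = (\<lambda>z :: 'a alg_closure. SOME xy. z = cplx (fst xy) (snd xy))"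
  have p: "z = cplx (fst (p z)) (snd (p z))" for z
  proof -
    obtain x y where "z = cplx x y" by (rule alg_closure_cplx[OF rcU])
    then have "\<exists>xy. z = cplx (fst xy) (snd xy)" by (intro exI[of _ "(x, y)"]) simp
    then show ?thesis unfolding p_def by (rule someI_ex)
  qed
  have "inj (\<lambda>z. {f (p z)})"
  proof (rule injI)
    fix z w assume "{f (p z)} = {f (p w)}"
    then have "f (p z) = f (p w)" by simp
    then have pp: "p z = p w" using inj_onD[OF f, of "p z" "p w"] by simp
    have "z = cplx (fst (p z)) (snd (p z))" by (rule p)
    also have "\<dots> = w" unfolding pp by (rule p[symmetric])
    finally show "z = w" .
  qed
  then show thesis by (rule that)
qed

section \<open>Copies of subfields of the algebraic closure, valued by the norm\<close>

context convex_valuation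
begin

lemma inverse_vle_1_iff: "x \<noteq> 0 \<Longrightarrow> inverse x \<preceq> 1 \<longleftrightarrow> 1 \<preceq> x"
  by (simp add: inverse_eq_divide vle_divide_iff)

context
  fixes F :: "'a alg_closure set" and h :: "'a alg_closure \<Rightarrow> 'a set"
  assumes rcU: "real_closed_in (UNIV :: 'a set)" and F: "is_subfield F" and h: "inj h"
begin

abbreviation "SF \<equiv> image_ring h (ring_of_type_algebra\<lparr>carrier := F\<rparr>)"
abbreviation "WF \<equiv> h ` {z \<in> F. nrm2 z \<preceq> 1}"

lemma F_field: "field (ring_of_type_algebra\<lparr>carrier := F\<rparr>)"
proof -
  interpret field "ring_of_type_algebra :: 'a alg_closure ring" by (rule rta_field)
  show ?thesis using F by (intro subfield_iff(2)) (simp add: subfield_rta_iff)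
qed

lemma SF_field: "field SF"
  by (rule field.inj_imp_image_ring_is_field[OF F_field]) (use h in \<open>auto intro: inj_on_subset\<close>)

lemma SF_carrier: "carrier SF = h ` F"
  by (simp add: image_ring_carrier)

lemma SF_hom: "h \<in> ring_hom (ring_of_type_algebra\<lparr>carrier := F\<rparr>) SF"
  using inj_imp_image_ring_iso[of h "ring_of_type_algebra\<lparr>carrier := F\<rparr>"] h
  by (auto simp: ring_iso_def intro: inj_on_subset)

lemma SF_mult: "x \<in> F \<Longrightarrow> y \<in> F \<Longrightarrow> h x \<otimes>\<^bsub>SF\<^esub> h y = h (x * y)"
  and SF_add: "x \<in> F \<Longrightarrow> y \<in> F \<Longrightarrow> h x \<oplus>\<^bsub>SF\<^esub> h y = h (x + y)"
  and SF_1: "\<one>\<^bsub>SF\<^esub> = h 1"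
  and SF_0: "\<zero>\<^bsub>SF\<^esub> = h 0"
  using ring_hom_mult[OF SF_hom, of x y] ring_hom_add[OF SF_hom, of x y] ring_hom_one[OF SF_hom]
  by (simp_all add: image_ring_zero)

lemma h_eq: "h x = h y \<longleftrightarrow> x = y"
  using h by (simp add: inj_eq)

lemma SF_inv: "x \<in> F \<Longrightarrow> x \<noteq> 0 \<Longrightarrow> inv\<^bsub>SF\<^esub> (h x) = h (inverse x)"
proof -
  interpret S: field SF by (rule SF_field)
  assume "x \<in> F" "x \<noteq> 0"
  then show ?thesis
    using is_subfield_inverse[OF F, of x] SF_mult[of x "inverse x"]
    by (intro S.comm_inv_char) (auto simp: SF_carrier SF_1)
qed

lemma SF_uminus: "x \<in> F \<Longrightarrow> \<ominus>\<^bsub>SF\<^esub> (h x) = h (- x)"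
proof -
  interpret S: field SF by (rule SF_field)
  assume "x \<in> F"
  then show ?thesis
    using is_subfield_uminus[OF F, of x] SF_add[of "- x" x]
    by (intro S.minus_equality) (auto simp: SF_carrier SF_0)
qed

lemma SF_valuation_ring: "valuation_ring SF WF"
  unfolding valuation_ring_def
proof (intro conjI ballI)
  interpret S: field SF by (rule SF_field)
  note FI = is_subfield_intros[OF F]
  show "field SF" by (rule SF_field)
  show "subring WF SF"
  proof (rule S.subringI)
    show "WF \<subseteq> carrier SF" by (auto simp: SF_carrier)
    show "\<one>\<^bsub>SF\<^esub> \<in> WF" unfolding SF_1 using FI(2) nrm2_1[OF rcU] by auto
    fix x assume "x \<in> WF"
    then show "\<ominus>\<^bsub>SF\<^esub> x \<in> WF" using FI(5) nrm2_uminus[OF rcU] SF_uminus by auto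
  next
    fix x y assume "x \<in> WF" "y \<in> WF"
    then obtain a b where *: "x = h a" "y = h b" "a \<in> F" "b \<in> F" "nrm2 a \<preceq> 1" "nrm2 b \<preceq> 1" by blast
    show "x \<otimes>\<^bsub>SF\<^esub> y \<in> WF"
      using * FI(4)[of a b] vle_mult[of "nrm2 a" 1 "nrm2 b" 1] SF_mult nrm2_mult[OF rcU] by simp
    show "x \<oplus>\<^bsub>SF\<^esub> y \<in> WF"
      using * FI(3)[of a b] nrm2_vle_add[OF rcU, of a 1 b] SF_add by simp
  qed
  fix x assume "x \<in> carrier SF - {\<zero>\<^bsub>SF\<^esub>}"
  then obtain z where z: "x = h z" "z \<in> F" "z \<noteq> 0" by (auto simp: SF_carrier SF_0)
  then have "nrm2 z \<noteq> 0" using nrm2_eq_0_iff[OF rcU] by simp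
  then have "nrm2 z \<preceq> 1 \<or> nrm2 (inverse z) \<preceq> 1"
    using vle_total[of "nrm2 z" 1] inverse_vle_1_iff[of "nrm2 z"] unfolding nrm2_inverse[OF rcU] by blast
  then show "x \<in> WF \<or> inv\<^bsub>SF\<^esub> x \<in> WF"
    using z FI(6)[of z] SF_inv[of z] by auto
qed

lemma SF_val_units: "val_units SF WF = h ` {z \<in> F. veq (nrm2 z) 1}"
proof -
  have "h z \<in> val_units SF WF \<longleftrightarrow> veq (nrm2 z) 1" if z: "z \<in> F" for z
  proof (cases "z = 0")
    case True
    have "nrm2 (0 :: 'a alg_closure) = 0" using nrm2_eq_0_iff[OF rcU] by blast
    then show ?thesis using True by (simp add: val_units_def SF_0 h_eq)
  next
    case False
    then have "nrm2 z \<noteq> 0" using nrm2_eq_0_iff[OF rcU] by simp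
    then have "nrm2 (inverse z) \<preceq> 1 \<longleftrightarrow> 1 \<preceq> nrm2 z"
      unfolding nrm2_inverse[OF rcU] by (rule inverse_vle_1_iff)
    then show ?thesis
      using False z is_subfield_inverse[OF F z] SF_inv[OF z False]
      by (auto simp: val_units_def SF_0 h_eq veq_def)
  qed
  moreover have "val_units SF WF \<subseteq> h ` F" by (auto simp: val_units_def)
  ultimately show ?thesis by blast
qed

lemma SF_val_ideal: "val_ideal SF WF = h ` {z \<in> F. nrm2 z \<lless> 1}"
proof -
  have "val_ideal SF WF = h ` {z \<in> F. nrm2 z \<preceq> 1} - h ` {z \<in> F. veq (nrm2 z) 1}"
    unfolding val_ideal_def SF_val_units ..
  also have "\<dots> = h ` ({z \<in> F. nrm2 z \<preceq> 1} - {z \<in> F. veq (nrm2 z) 1})"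
    by (rule image_set_diff[OF h, symmetric])
  also have "{z \<in> F. nrm2 z \<preceq> 1} - {z \<in> F. veq (nrm2 z) 1} = {z \<in> F. nrm2 z \<lless> 1}"
    using vlt_imp_vle by (auto simp: veq_def vlt_def)
  finally show ?thesis .
qed

lemma SF_val:
  assumes z: "z \<in> F" "z \<noteq> 0"
  shows "val SF WF (h z) = h ` {y \<in> F. veq (nrm2 y) (nrm2 z)}"
proof -
  have "val SF WF (h z) = {u \<otimes>\<^bsub>SF\<^esub> h z | u. u \<in> val_units SF WF}"
    by (auto simp: val_def r_coset_def)
  also have "\<dots> = {h (v * z) | v. v \<in> F \<and> veq (nrm2 v) 1}"
    unfolding SF_val_units using SF_mult[OF _ z(1)] by (auto intro: exI)
  also have "\<dots> = h ` {y \<in> F. veq (nrm2 y) (nrm2 z)}"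
  proof safe
    fix v assume v: "v \<in> F" "veq (nrm2 v) 1"
    have "veq (nrm2 (v * z)) (nrm2 z)"
      using veq_mult[OF v(2) veq_refl[of "nrm2 z"]] by (simp add: nrm2_mult[OF rcU])
    then show "h (v * z) \<in> h ` {y \<in> F. veq (nrm2 y) (nrm2 z)}"
      using is_subfield_mult[OF F v(1) z(1)] by blast
  next
    fix y assume y: "y \<in> F" "veq (nrm2 y) (nrm2 z)"
    have "nrm2 z \<noteq> 0" using z nrm2_eq_0_iff[OF rcU] by simp
    then have "veq (nrm2 (y / z)) 1"
      using veq_divide[OF y(2) veq_refl[of "nrm2 z"]] by (simp add: nrm2_divide[OF rcU])
    then show "\<exists>v. h y = h (v * z) \<and> v \<in> F \<and> veq (nrm2 v) 1"
      using is_subfield_divide[OF F y(1) z(1)] z(2) by (intro exI[of _ "y / z"]) simp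
  qed
  finally show ?thesis .
qed

lemma SF_res:
  assumes z: "z \<in> F"
  shows "res SF WF (h z) = h ` {y \<in> F. nrm2 (y - z) \<lless> 1}"
proof -
  have "res SF WF (h z) = {u \<oplus>\<^bsub>SF\<^esub> h z | u. u \<in> val_ideal SF WF}"
    by (auto simp: res_def a_r_coset_def r_coset_def)
  also have "\<dots> = {h (v + z) | v. v \<in> F \<and> nrm2 v \<lless> 1}"
    unfolding SF_val_ideal using SF_add[OF _ z] by (auto intro: exI)
  also have "\<dots> = h ` {y \<in> F. nrm2 (y - z) \<lless> 1}"
  proof safe
    fix v assume v: "v \<in> F" "nrm2 v \<lless> 1"
    then show "h (v + z) \<in> h ` {y \<in> F. nrm2 (y - z) \<lless> 1}"
      using is_subfield_add[OF F v(1) z] by (intro image_eqI[of _ _ "v + z"]) auto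
  next
    fix y assume y: "y \<in> F" "nrm2 (y - z) \<lless> 1"
    then show "\<exists>v. h y = h (v + z) \<and> v \<in> F \<and> nrm2 v \<lless> 1"
      using is_subfield_diff[OF F y(1) z] by (intro exI[of _ "y - z"]) simp
  qed
  finally show ?thesis .
qed

text \<open>If \<open>z\<close> is \<open>c\<close> times a 1-unit, both have the same value, and
  the same residue if they are integral; the residue zero is represented by
  \<open>0\<close>.\<close>

lemma SF_immediate:
  assumes CF: "to_ac ` C \<subseteq> F" and C: "is_subfield C"
    and imm: "\<And>z. z \<in> F - {0} \<Longrightarrow> \<exists>c\<in>C - {0}. unit1 (z / to_ac c)"
  shows "immediate_over SF WF (h ` to_ac ` C)"
  unfolding immediate_over_def
proof
  have cF: "to_ac c \<in> F" if "c \<in> C" for c using that CF by blast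
  have carr: "carrier (value_group SF WF) = val SF WF ` (h ` F - {h 0})"
    unfolding value_group_def FactGroup_def RCOSETS_def val_def by (auto simp: SF_carrier SF_0)
  have vg: "val SF WF (h z) \<in> value_group_on SF WF (h ` to_ac ` C)" if z: "z \<in> F" "z \<noteq> 0" for z
  proof -
    obtain c where c: "c \<in> C - {0}" "unit1 (z / to_ac c)" using imm[of z] z by blast
    have "nrm2 (to_ac c) \<noteq> 0" using c(1) nrm2_eq_0_iff[OF rcU] by simp
    then have "veq (nrm2 (z / to_ac c) * nrm2 (to_ac c)) (1 * nrm2 (to_ac c))"
      using unit1_veq[OF rcU c(2)] by (intro veq_mult) auto
    moreover have "nrm2 (z / to_ac c) * nrm2 (to_ac c) = nrm2 z"
      using c(1) by (simp add: nrm2_mult[OF rcU, symmetric])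
    ultimately have eq: "veq (nrm2 z) (nrm2 (to_ac c))" by simp
    have "veq y (nrm2 z) \<longleftrightarrow> veq y (nrm2 (to_ac c))" for y using eq veq_trans veq_sym by blast
    then have "val SF WF (h z) = val SF WF (h (to_ac c))"
      using z c(1) cF by (simp add: SF_val)
    then show ?thesis using c(1) by (auto simp: value_group_on_def SF_0 h_eq intro!: image_eqI[of _ _ "h (to_ac c)"])
  qed
  show "value_group_on SF WF (h ` to_ac ` C) = carrier (value_group SF WF)"
  proof
    show "value_group_on SF WF (h ` to_ac ` C) \<subseteq> carrier (value_group SF WF)"
      unfolding carr value_group_on_def using CF by (intro image_mono) (auto simp: SF_0)
    show "carrier (value_group SF WF) \<subseteq> value_group_on SF WF (h ` to_ac ` C)"
      unfolding carr using vg by (auto simp: h_eq)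
  qed
  have carr2: "carrier (residue_field SF WF) = res SF WF ` WF"
    unfolding residue_field_def FactRing_def A_RCOSETS_def RCOSETS_def
    by (auto simp: res_def a_r_coset_def)
  have rf: "res SF WF (h z) \<in> residue_field_on SF WF (h ` to_ac ` C)" if z: "z \<in> F" "nrm2 z \<preceq> 1" for z
  proof -
    have "\<exists>c\<in>C. nrm2 (to_ac c) \<preceq> 1 \<and> nrm2 (z - to_ac c) \<lless> 1"
    proof (cases "nrm2 z \<lless> 1")
      case True
      have "nrm2 (0 :: 'a alg_closure) = 0" using nrm2_eq_0_iff[OF rcU] by blast
      then show ?thesis using True is_subfield_0[OF C] by (intro bexI[of _ 0]) simp_all
    next
      case False
      have "nrm2 (0 :: 'a alg_closure) = 0" using nrm2_eq_0_iff[OF rcU] by blast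
      then have "z \<noteq> 0" using False by auto
      then obtain c where c: "c \<in> C - {0}" "unit1 (z / to_ac c)" using imm[of z] z by blast
      have c0: "nrm2 (to_ac c) \<noteq> 0" using c(1) nrm2_eq_0_iff[OF rcU] by simp
      have "1 \<preceq> nrm2 z / nrm2 (to_ac c)"
        using unit1_veq[OF rcU c(2)] by (simp add: veq_def nrm2_divide[OF rcU])
      then have "nrm2 (to_ac c) \<preceq> nrm2 z" using c0 by (simp add: vle_divide_iff')
      then have c1: "nrm2 (to_ac c) \<preceq> 1" using z(2) vle_trans by blast
      have "z - to_ac c = (z / to_ac c - 1) * to_ac c" using c(1) by (simp add: left_diff_distrib)
      then have "nrm2 (z - to_ac c) = nrm2 (z / to_ac c - 1) * nrm2 (to_ac c)" by (simp add: nrm2_mult[OF rcU])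
      also have "\<dots> \<lless> 1"
        using vlt_vle_mult[of "nrm2 (z / to_ac c - 1)" 1 "nrm2 (to_ac c)" 1] c(2) c1
        by (simp add: unit1_def[OF rcU])
      finally show ?thesis using c c1 by blast
    qed
    then obtain c where c: "c \<in> C" "nrm2 (to_ac c) \<preceq> 1" "nrm2 (z - to_ac c) \<lless> 1" by blast
    have "nrm2 (y - z) \<lless> 1 \<longleftrightarrow> nrm2 (y - to_ac c) \<lless> 1" for y
      using nrm2_vlt_add[OF rcU, of "y - z" 1 "z - to_ac c"] nrm2_vlt_add[OF rcU, of "y - to_ac c" 1 "to_ac c - z"]
        c(3) nrm2_minus_commute[OF rcU, of z "to_ac c"] by auto
    then have "res SF WF (h z) = res SF WF (h (to_ac c))" using z c(1) cF by (simp add: SF_res)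
    then show ?thesis using c cF unfolding residue_field_on_def by blast
  qed
  show "residue_field_on SF WF (h ` to_ac ` C) = carrier (residue_field SF WF)"
    unfolding carr2 using rf by (auto simp: residue_field_on_def)
qed

end

lemma maximal_in_closureI:
  assumes rcU: "real_closed_in (UNIV :: 'a set)" and C: "is_subfield C"
    and max: "maximal_valued_field (RR\<lparr>carrier := C\<rparr>) (C \<inter> V)"
  shows "maximal_in_closure C"
  unfolding maximal_in_closure_def[OF rcU]
proof (intro allI impI)
  fix F assume F: "is_subfield F" and CF: "to_ac ` C \<subseteq> F"
    and imm: "\<forall>z\<in>F - {0}. \<exists>c\<in>C - {0}. unit1 (z / to_ac c)"
  obtain h :: "'a alg_closure \<Rightarrow> 'a set" where h: "inj h" by (rule inj_alg_closure_set[OF rcU])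
  define S where "S = image_ring h (ring_of_type_algebra\<lparr>carrier := F\<rparr>)"
  define W where "W = h ` {z \<in> F. nrm2 z \<preceq> 1}"
  define e where "e = (\<lambda>x. h (to_ac x))"
  have eC: "e ` C = h ` to_ac ` C" by (auto simp: e_def)
  have vr: "valuation_ring S W" unfolding S_def W_def by (rule SF_valuation_ring[OF rcU F h])
  have cF: "to_ac c \<in> F" if "c \<in> C" for c using that CF by blast
  have hom: "e \<in> ring_hom (RR\<lparr>carrier := C\<rparr>) S"
  proof (rule ring_hom_memI)
    fix x y assume "x \<in> carrier (RR\<lparr>carrier := C\<rparr>)" "y \<in> carrier (RR\<lparr>carrier := C\<rparr>)"
    then have xy: "to_ac x \<in> F" "to_ac y \<in> F" using cF by auto
    show "e (x \<otimes>\<^bsub>RR\<lparr>carrier := C\<rparr>\<^esub> y) = e x \<otimes>\<^bsub>S\<^esub> e y"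
      using SF_mult[OF rcU F h xy] by (simp add: e_def S_def)
    show "e (x \<oplus>\<^bsub>RR\<lparr>carrier := C\<rparr>\<^esub> y) = e x \<oplus>\<^bsub>S\<^esub> e y"
      using SF_add[OF rcU F h xy] by (simp add: e_def S_def)
  next
    fix x assume "x \<in> carrier (RR\<lparr>carrier := C\<rparr>)"
    then show "e x \<in> carrier S" using cF by (simp add: e_def S_def SF_carrier[OF rcU F h])
  next
    show "e \<one>\<^bsub>RR\<lparr>carrier := C\<rparr>\<^esub> = \<one>\<^bsub>S\<^esub>" using SF_1[OF rcU F h] by (simp add: e_def S_def)
  qed
  have carr: "carrier (RR\<lparr>carrier := C\<rparr>) = C" by simp
  have nV: "nrm2 (to_ac c) \<preceq> 1 \<longleftrightarrow> c \<in> V" for c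
    using vle_square_iff[of c 1] by (simp add: nrm2_to_ac vle_1_iff)
  have tr: "e ` (C \<inter> V) = W \<inter> e ` C"
    unfolding W_def e_def using cF nV h by (auto simp: inj_eq)
  have im: "immediate_over S W (e ` C)"
    unfolding S_def W_def eC by (rule SF_immediate[OF rcU F h CF C]) (use imm in blast)
  have "e ` C = carrier S"
    using max vr hom tr im unfolding maximal_valued_field_def carr by blast
  then have "h ` to_ac ` C = h ` F" by (simp add: eC S_def SF_carrier[OF rcU F h])
  then show "F = to_ac ` C" using h by (simp add: inj_image_eq_iff)
qed

end

subsection \<open>The compositum\<close>

lemma is_subfield_generate_field: "is_subfield (generate_field (ring_of_type_algebra :: 'b::field ring) H)"
proof -
  have "inverse x \<in> generate_field ring_of_type_algebra H" if "x \<in> generate_field ring_of_type_algebra H" for x :: 'b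
    using that generate_field.m_inv[OF that] by (cases "x = 0") auto
  moreover have "(0 :: 'b) \<in> generate_field ring_of_type_algebra H"
    using generate_field.eng_add[OF generate_field.one generate_field.a_inv[OF generate_field.one],
        of "ring_of_type_algebra :: 'b ring" H] by simp
  ultimately show ?thesis
    using generate_field.one[of "ring_of_type_algebra :: 'b ring" H]
      generate_field.a_inv[of _ "ring_of_type_algebra :: 'b ring" H]
      generate_field.eng_add[of _ "ring_of_type_algebra :: 'b ring" H]
      generate_field.eng_mult[of _ "ring_of_type_algebra :: 'b ring" H]
    by (auto simp: is_subfield_def)
qed

lemma generate_field_minimal:
  assumes "is_subfield (K :: 'b::field set)" "H \<subseteq> K"
  shows "generate_field ring_of_type_algebra H \<subseteq> K"
proof
  fix x assume "x \<in> generate_field ring_of_type_algebra H"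
  then show "x \<in> K"
    by (induction rule: generate_field.induct) (use assms in \<open>auto intro: is_subfield_intros[OF assms(1)]\<close>)
qed

section \<open>Automorphisms of the ordered valued field\<close>

lemma ov_automorphism_iff:
  "ov_automorphism V g \<longleftrightarrow> (\<forall>x y. g (x + y) = g x + g y) \<and> (\<forall>x y. g (x * y) = g x * g y) \<and>
    g 1 = 1 \<and> bij g \<and> strict_mono g \<and> g ` V = (V :: 'a::linordered_field set)"
  by (auto simp: ov_automorphism_def ring_iso_def ring_hom_def)

lemma ov_automorphism_comp:
  "ov_automorphism V g \<Longrightarrow> ov_automorphism V h \<Longrightarrow> ov_automorphism V (g \<circ> h)"
  unfolding ov_automorphism_iff image_comp[symmetric] by (auto simp: strict_mono_def intro: bij_comp)

lemma ov_automorphism_inv: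
  fixes V :: "'a::linordered_field set"
  assumes "ov_automorphism V g"
  shows "ov_automorphism V (inv_into UNIV g)"
proof -
  have add: "\<And>x y. g (x + y) = g x + g y" and mult: "\<And>x y. g (x * y) = g x * g y"
    and 1: "g 1 = 1" and b: "bij g" and mono: "strict_mono g" and V: "g ` V = V"
    using assms by (simp_all add: ov_automorphism_iff)
  note i = bij_is_inj[OF b] and s = surj_f_inv_f[OF bij_is_surj[OF b]]
  show ?thesis unfolding ov_automorphism_iff
  proof (intro conjI allI)
    show "inv_into UNIV g (x + y) = inv_into UNIV g x + inv_into UNIV g y"
      and "inv_into UNIV g (x * y) = inv_into UNIV g x * inv_into UNIV g y" for x y
      by (rule injD[OF i], simp add: add mult s)+
    show "inv_into UNIV g 1 = 1" by (rule inv_f_eq[OF i 1])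
    show "bij (inv_into UNIV g)" by (rule bij_imp_bij_inv[OF b])
    show "strict_mono (inv_into UNIV g)"
    proof (rule strict_monoI)
      fix x y :: 'a assume "x < y"
      then have "g (inv_into UNIV g x) < g (inv_into UNIV g y)" by (simp only: s)
      then show "inv_into UNIV g x < inv_into UNIV g y" by (simp only: strict_mono_less[OF mono])
    qed
    have "inv_into UNIV g ` V = inv_into UNIV g ` (g ` V)" by (simp only: V)
    also have "\<dots> = V" by (simp add: image_comp i)
    finally show "inv_into UNIV g ` V = V" .
  qed
qed

lemma ov_automorphism_image_subfield:
  assumes "ov_automorphism V g" "is_subfield K"
  shows "is_subfield (g ` K)" "is_subfield (g -` K)"
proof -
  have add: "\<And>x y. g (x + y) = g x + g y" and mult: "\<And>x y. g (x * y) = g x * g y" and 1: "g 1 = 1"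
    using assms(1) by (simp_all add: ov_automorphism_iff)
  have 0: "g 0 = 0" using add[of 0 0] by simp
  have um: "g (- x) = - g x" for x using add[of x "- x"] 0 by (simp add: minus_unique)
  have inv: "g (inverse x) = inverse (g x)" for x
  proof (cases "x = 0")
    case False
    then have "g x * g (inverse x) = 1" by (simp add: mult[symmetric] 1)
    then show ?thesis using inverse_unique by metis
  qed (simp add: 0)
  note K = is_subfield_intros[OF assms(2)]
  show "is_subfield (g -` K)" unfolding is_subfield_def using K by (auto simp: add mult 0 1 um inv)
  show "is_subfield (g ` K)" unfolding is_subfield_def
  proof (intro conjI ballI)
    show "0 \<in> g ` K" using 0 K(1) by force
    show "1 \<in> g ` K" using 1 K(2) by force
    fix x assume "x \<in> g ` K"
    then obtain a where a: "x = g a" "a \<in> K" by blast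
    show "- x \<in> g ` K" unfolding a um[symmetric] by (intro imageI K a)
    show "inverse x \<in> g ` K" unfolding a inv[symmetric] by (intro imageI K a)
    fix y assume "y \<in> g ` K"
    then obtain b where b: "y = g b" "b \<in> K" by blast
    show "x + y \<in> g ` K" unfolding a b add[symmetric] by (intro imageI K a b)
    show "x * y \<in> g ` K" unfolding a b mult[symmetric] by (intro imageI K a b)
  qed
qed

text \<open>Images and preimages of subfields are subfields, so both inclusions are minimality of
  the generated field.\<close>

lemma ov_automorphism_generate_field:
  assumes "ov_automorphism V g"
  shows "g ` generate_field RR H = generate_field RR (g ` H)"
proof
  show "g ` generate_field RR H \<subseteq> generate_field RR (g ` H)"
    unfolding image_subset_iff_subset_vimage
    by (intro generate_field_minimal ov_automorphism_image_subfield[OF assms] is_subfield_generate_field)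
      (auto intro: generate_field.incl)
  show "generate_field RR (g ` H) \<subseteq> g ` generate_field RR H"
    by (intro generate_field_minimal ov_automorphism_image_subfield[OF assms] is_subfield_generate_field)
      (auto intro: generate_field.incl)
qed

section \<open>Value group and residue field of the compositum\<close>

context disjoint_pair
begin

lemma compositum_eq: "Domain (frac_graph (tens L M \<sigma>)) = generate_field RR (C \<union> L \<union> M)"
proof
  show "Domain (frac_graph (tens L M \<sigma>)) \<subseteq> generate_field RR (C \<union> L \<union> M)"
    by (rule tens_subset[OF is_subfield_generate_field]) (auto intro: generate_field.incl)
  have fg: "field_graph (frac_graph (tens L M \<sigma>))" by (rule val_graph_field[OF val_graph_tens])
  show "generate_field RR (C \<union> L \<union> M) \<subseteq> Domain (frac_graph (tens L M \<sigma>))"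
    by (rule generate_field_minimal[OF is_subfield_Domain[OF fg]])
      (use CL tens_left tens_right frac_graph_incl[OF order_graph_tens] in blast)
qed

text \<open>Every nonzero element has the value of a single product \<open>l * m\<close>, by
  \<open>tens_element\<close>.\<close>

lemma value_group_compositum:
  "value_group_on RR V (generate_field RR (C \<union> L \<union> M)) =
    generate (value_group RR V) (value_group_on RR V L \<union> value_group_on RR V M)"
    (is "value_group_on RR V ?N = generate ?G ?H")
proof
  show "value_group_on RR V ?N \<subseteq> generate ?G ?H"
  proof
    fix \<gamma> assume "\<gamma> \<in> value_group_on RR V ?N"
    then obtain n where n: "n \<in> ?N" "n \<noteq> 0" "\<gamma> = val RR V n" by (auto simp: value_group_on_def)
    then have nD: "n \<in> Domain (frac_graph (tens L M \<sigma>))" by (simp only: compositum_eq)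
    obtain l m where lm: "l \<in> L - {0}" "m \<in> M - {0}" "veq n (l * m)"
      by (rule tens_element[OF nD n(2)])
    have "\<gamma> = val RR V (l * m)" using lm n by (simp add: val_eq_iff)
    also have "\<dots> = val RR V l \<otimes>\<^bsub>?G\<^esub> val RR V m" using lm by (simp add: val_mult)
    also have "\<dots> \<in> generate ?G ?H"
      using lm by (intro generate.eng generate.incl) (auto simp: value_group_on_def)
    finally show "\<gamma> \<in> generate ?G ?H" .
  qed
  have N: "is_subfield ?N" by (rule is_subfield_generate_field)
  have HN: "\<exists>n\<in>?N - {0}. \<gamma> = val RR V n" if "\<gamma> \<in> ?H" for \<gamma>
    using that generate_field.incl[of _ "C \<union> L \<union> M" RR] by (auto simp: value_group_on_def)
  show "generate ?G ?H \<subseteq> value_group_on RR V ?N"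
  proof
    fix \<gamma> assume "\<gamma> \<in> generate ?G ?H"
    then have "\<exists>n\<in>?N - {0}. \<gamma> = val RR V n"
    proof (induction rule: generate.induct)
      case one
      then show ?case unfolding val_1 using is_subfield_1[OF N] by (intro bexI[of _ 1]) auto
    next
      case (incl h)
      then show ?case by (rule HN)
    next
      case (inv h)
      then obtain n where "n \<in> ?N - {0}" "h = val RR V n" using HN by blast
      then show ?case using is_subfield_inverse[OF N] by (intro bexI[of _ "inverse n"]) (auto simp: val_inverse)
    next
      case (eng h1 h2)
      then obtain n1 n2 where "n1 \<in> ?N - {0}" "h1 = val RR V n1" "n2 \<in> ?N - {0}" "h2 = val RR V n2" by blast
      then show ?case using is_subfield_mult[OF N] by (intro bexI[of _ "n1 * n2"]) (auto simp: val_mult)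
    qed
    then show "\<gamma> \<in> value_group_on RR V ?N" by (auto simp: value_group_on_def)
  qed
qed

text \<open>By \<open>tens_unit\<close> the residue of a unit is a rational expression in residues
  from \<open>L\<close> and \<open>M\<close>; elements of the maximal ideal have the residue
  zero.\<close>

lemma residue_field_compositum:
  "residue_field_on RR V (generate_field RR (C \<union> L \<union> M)) =
    generate_field (residue_field RR V) (residue_field_on RR V L \<union> residue_field_on RR V M)"
    (is "residue_field_on RR V ?N = generate_field ?k ?H")
proof
  interpret k: field "residue_field RR V" by (rule field_residue)
  have V1: "x \<in> V" "\<not> x \<lless> 1" if "veq x 1" for x
    using that by (auto simp: V_iff veq_def vlt_def)
  have nV: "\<exists>y\<in>V. h = res RR V y" if "h \<in> carrier ?k" for h using that by (auto simp: residue_carrier)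
  have L': "res RR V x \<in> generate_field ?k ?H" if "x \<in> L" "x \<in> V" for x
    using that by (intro generate_field.incl) (auto simp: residue_field_on_def)
  have M': "res RR V x \<in> generate_field ?k ?H" if "x \<in> M" "x \<in> V" for x
    using that by (intro generate_field.incl) (auto simp: residue_field_on_def)
  have mult': "res RR V (x * y) \<in> generate_field ?k ?H"
    if "x \<in> V" "y \<in> V" "res RR V x \<in> generate_field ?k ?H" "res RR V y \<in> generate_field ?k ?H" for x y
    using that by (simp add: res_mult generate_field.eng_mult)
  have inv': "res RR V (inverse x) \<in> generate_field ?k ?H"
    if "veq x 1" "res RR V x \<in> generate_field ?k ?H" for x
    using generate_field.m_inv[OF that(2)] V1[OF that(1)] by (simp add: res_inverse res_zero_iff)
  \<comment> \<open>Zero is not among the introduction rules of \<open>generate_field\<close>; it is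
    obtained as \<open>1 + - 1\<close>.\<close>
  have zero': "res RR V x \<in> generate_field ?k ?H" if "x \<lless> 1" for x
  proof -
    have "res RR V x = res RR V (1 + - 1)" using that by (simp add: res_eq_iff)
    also have "\<dots> = \<one>\<^bsub>?k\<^esub> \<oplus>\<^bsub>?k\<^esub> \<ominus>\<^bsub>?k\<^esub> \<one>\<^bsub>?k\<^esub>"
      unfolding res_add[OF V_1 V_uminus[OF V_1]] res_1[symmetric] res_uminus[OF V_1] ..
    also have "\<dots> \<in> generate_field ?k ?H" by (intro generate_field.intros)
    finally show ?thesis .
  qed
  have sum': "(\<Sum>i\<in>J. u i * w i) \<in> V \<and> res RR V (\<Sum>i\<in>J. u i * w i) \<in> generate_field ?k ?H"
    if "finite (J :: nat set)" "u ` J \<subseteq> L \<inter> V" "w ` J \<subseteq> M \<inter> V" for J u w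
    using that
  proof (induction J)
    case empty
    show ?case using zero'[of 0] V_0 by simp
  next
    case (insert j J)
    then have uw: "u j \<in> L" "u j \<in> V" "w j \<in> M" "w j \<in> V"
      and IH: "(\<Sum>i\<in>J. u i * w i) \<in> V" "res RR V (\<Sum>i\<in>J. u i * w i) \<in> generate_field ?k ?H" by auto
    have "res RR V (u j * w j) \<in> generate_field ?k ?H" by (intro mult' L' M' uw)
    then have "res RR V (u j * w j + (\<Sum>i\<in>J. u i * w i)) \<in> generate_field ?k ?H"
      unfolding res_add[OF V_mult[OF uw(2,4)] IH(1)] by (rule generate_field.eng_add) (rule IH(2))
    then show ?case using insert.hyps V_add[OF V_mult[OF uw(2,4)] IH(1)] by simp
  qed
  show "residue_field_on RR V ?N \<subseteq> generate_field ?k ?H"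
  proof
    fix \<alpha> assume "\<alpha> \<in> residue_field_on RR V ?N"
    then obtain n where n: "n \<in> ?N" "n \<in> V" "\<alpha> = res RR V n" by (auto simp: residue_field_on_def)
    show "\<alpha> \<in> generate_field ?k ?H"
    proof (cases "n \<lless> 1")
      case True
      then show ?thesis unfolding n(3) by (rule zero')
    next
      case False
      then have n1: "veq n 1" using n(2) by (auto simp: V_iff veq_def vlt_def)
      have nD: "n \<in> Domain (frac_graph (tens L M \<sigma>))" using n(1) by (simp only: compositum_eq)
      obtain p q J u w J' u' w' where pq: "p \<in> L" "q \<in> M" "veq p 1" "veq q 1"
        and s: "finite (J :: nat set)" "u ` J \<subseteq> L \<inter> V" "w ` J \<subseteq> M \<inter> V" "veq (\<Sum>i\<in>J. u i * w i) 1"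
        and s': "finite (J' :: nat set)" "u' ` J' \<subseteq> L \<inter> V" "w' ` J' \<subseteq> M \<inter> V" "veq (\<Sum>i\<in>J'. u' i * w' i) 1"
        and d: "n * (\<Sum>i\<in>J'. u' i * w' i) - p * q * (\<Sum>i\<in>J. u i * w i) \<lless> 1"
        by (rule tens_unit[OF nD n1])
      define S where "S = (\<Sum>i\<in>J. u i * w i)"
      define S' where "S' = (\<Sum>i\<in>J'. u' i * w' i)"
      have S: "S \<in> V" "res RR V S \<in> generate_field ?k ?H" unfolding S_def using sum'[OF s(1-3)] by auto
      have S': "res RR V S' \<in> generate_field ?k ?H" "veq S' 1" "S' \<noteq> 0"
        unfolding S'_def using sum'[OF s'(1-3)] s'(4) by auto
      have iS: "inverse S' \<in> V" using V_inverse[OF V1[OF S'(2)]] by blast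
      have "(n * S' - p * q * S) * inverse S' \<lless> 1"
        using vlt_vle_mult[of "n * S' - p * q * S" 1 "inverse S'" 1] d iS
        unfolding S_def[symmetric] S'_def[symmetric] by (simp add: V_iff)
      moreover have "(n * S' - p * q * S) * inverse S' = n - p * q * S * inverse S'"
        using S'(3) by (simp add: field_simps)
      ultimately have "res RR V n = res RR V (p * q * S * inverse S')" by (simp only: res_eq_iff)
      moreover have "res RR V (p * q * S * inverse S') \<in> generate_field ?k ?H"
        by (intro mult' inv' L' M' V_mult pq S S' iS V1(1))
      ultimately show ?thesis unfolding n(3) by (simp only:)
    qed
  qed
  have N: "is_subfield ?N" by (rule is_subfield_generate_field)
  note sub = subfield_residue[OF N]
  show "generate_field ?k ?H \<subseteq> residue_field_on RR V ?N"
    by (rule k.generate_field_min_subfield1[OF _ sub])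
      (auto simp: residue_field_on_def residue_carrier intro: generate_field.incl)
qed

end

section \<open>The simultaneous extension of \<open>\<sigma>\<close> and
  \<open>\<tau>\<close>\<close>

theorem theorem2p5:
  fixes V C L M L' M' N N' :: "'a::linordered_field set"
    and \<kappa> :: "'c rel"
    and \<sigma> \<tau> :: "'a \<Rightarrow> 'a"
  assumes "monster_rcvf V \<kappa>"
    and "subfield C RR" and "subfield L RR" and "subfield M RR"
    and "|L| <o \<kappa>" and "|M| <o \<kappa>"
    and "maximal_valued_field (RR\<lparr>carrier := C\<rparr>) (C \<inter> V)"
    and "C \<subseteq> L \<inter> M"
    and "value_group_on RR V L \<inter> value_group_on RR V M = value_group_on RR V C"
    and "linearly_disjoint (residue_field RR V)
           (residue_field_on RR V L) (residue_field_on RR V M) (residue_field_on RR V C)"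
    and "ov_automorphism V \<sigma>" and "ov_automorphism V \<tau>"
    and "\<forall>c\<in>C. \<sigma> c = c"
    and "\<forall>\<gamma>\<in>value_group_on RR V L. \<sigma> ` \<gamma> = \<gamma>"
    and "\<forall>\<alpha>\<in>residue_field_on RR V L. \<sigma> ` \<alpha> = \<alpha>"
    and "\<forall>c\<in>C. \<tau> c = c"
    and "\<forall>\<gamma>\<in>value_group_on RR V L. \<tau> ` \<gamma> = \<gamma>"
    and "\<forall>\<alpha>\<in>residue_field_on RR V L. \<tau> ` \<alpha> = \<alpha>"
    and "\<sigma> ` L = L'" and "\<tau> ` M = M'"
    and "N = generate_field RR (C \<union> L \<union> M)" and "N' = generate_field RR (C \<union> L' \<union> M')"
  shows "(\<exists>\<rho>. ov_automorphism V \<rho> \<and> \<rho> ` N = N' \<and>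
            (\<forall>x\<in>L. \<rho> x = \<sigma> x) \<and> (\<forall>x\<in>M. \<rho> x = \<tau> x)) \<and>
         value_group_on RR V N =
           generate (value_group RR V) (value_group_on RR V L \<union> value_group_on RR V M) \<and>
         residue_field_on RR V N =
           generate_field (residue_field RR V)
             (residue_field_on RR V L \<union> residue_field_on RR V M)"
proof -
  have V: "rc_valued_field V" and kappa: "Card_order \<kappa>" "natLeq <o \<kappa>"
    and satur: "saturated V \<kappa>" and homog: "strongly_homogeneous V \<kappa>"
    using assms(1) by (auto simp: monster_rcvf_def)
  interpret convex_valuation V by (rule convex_valuationI(1)[OF V])
  note nontriv = convex_valuationI(2)[OF V] and rcU = convex_valuationI(3)[OF V]
  have C: "is_subfield C" and L: "is_subfield L" and M: "is_subfield M"
    using assms(2-4) by (simp_all add: subfield_rta_iff)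
  have CL: "C \<subseteq> L" and CM: "C \<subseteq> M" using assms(8) by auto
  define \<tau>' where "\<tau>' = inv_into UNIV \<tau>"
  define s where "s = \<tau>' \<circ> \<sigma>"
  have bij: "bij \<tau>" using assms(12) by (simp add: ov_automorphism_iff)
  have \<tau>\<tau>': "\<tau> (\<tau>' x) = x" for x unfolding \<tau>'_def by (rule surj_f_inv_f[OF bij_is_surj[OF bij]])
  have \<tau>'\<tau>: "\<tau>' (\<tau> x) = x" for x unfolding \<tau>'_def by (rule inv_f_f[OF bij_is_inj[OF bij]])
  have aut: "ov_automorphism V s"
    unfolding s_def \<tau>'_def by (intro ov_automorphism_comp ov_automorphism_inv assms(11,12))
  have s_hom: "s (x + y) = s x + s y" "s (x * y) = s x * s y" and s_mono: "strict_mono s" for x y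
    using aut by (simp_all add: ov_automorphism_iff)
  have s_0: "s 0 = 0" using s_hom(1)[of 0 0] by simp
  \<comment> \<open>Values and residues are sets of field elements. Both maps send those of
    \<open>L\<close> onto themselves, hence so does \<open>s\<close>.\<close>
  have s_preserves: "s x \<in> A" if "\<sigma> ` A = A" "\<tau> ` A = A" "x \<in> A" for x A
  proof -
    have "\<sigma> x \<in> \<tau> ` A" using that by auto
    then show ?thesis unfolding s_def using \<tau>'\<tau> by auto
  qed
  have s_val: "veq (s l) l" if l: "l \<in> L" for l
  proof (cases "l = 0")
    case False
    then have vL: "val RR V l \<in> value_group_on RR V L" using l by (auto simp: value_group_on_def)
    have "l \<in> val RR V l" using False by (simp add: val_eq)
    then have "s l \<in> val RR V l" by (rule s_preserves[OF bspec[OF assms(14) vL] bspec[OF assms(17) vL]])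
    then show ?thesis using False by (simp add: val_eq)
  qed (simp add: s_0)
  have s_res: "s l - l \<lless> 1" if l: "l \<in> L" "l \<in> V" for l
  proof -
    have rL: "res RR V l \<in> residue_field_on RR V L" using l by (auto simp: residue_field_on_def)
    have "l \<in> res RR V l" by (simp add: res_eq)
    then have "s l \<in> res RR V l" by (rule s_preserves[OF bspec[OF assms(15) rL] bspec[OF assms(18) rL]])
    then show ?thesis by (simp add: res_eq)
  qed
  interpret disjoint_pair V \<kappa> C L M s
  proof unfold_locales
    show "maximal_in_closure C" by (rule maximal_in_closureI[OF rcU C assms(7)])
    show "\<exists>c\<in>C - {0}. veq l c" if "l \<in> L - {0}" "m \<in> M - {0}" "veq l m" for l m
      by (rule value_group_disjoint[OF assms(9) that])
    show "\<forall>i\<in>J. w i \<lless> 1" if "finite J" "u ` J \<subseteq> L \<inter> V" "w ` J \<subseteq> M \<inter> V"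
      "\<And>e. e ` J \<subseteq> C \<inter> V \<Longrightarrow> (\<Sum>i\<in>J. e i * u i) \<lless> 1 \<Longrightarrow> \<forall>i\<in>J. e i \<lless> 1"
      "(\<Sum>i\<in>J. w i * u i) \<lless> 1" for J :: "nat set" and u w
      by (rule residue_linear_disjoint[OF C L M assms(10) that(1-3) _ that(5)]) (rule that(4))
    show "s c = c" if "c \<in> C" for c using \<tau>'\<tau>[of c] that assms(13,16) by (simp add: s_def)
    show "0 < s x" if "0 < x" for x using strict_monoD[OF s_mono that] by (simp only: s_0)
  qed (fact rcU satur C L CL assms(5) M CM s_hom s_val s_res)+
  define G where "G = frac_graph (tens L M s)"
  define f where "f = (\<lambda>x. if x \<in> L then s x else x)"
  have tG: "tens L M s \<subseteq> G" unfolding G_def by (rule frac_graph_incl[OF order_graph_tens])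
  \<comment> \<open>A small relatively algebraically closed field above \<open>L \<union> M\<close>
    contains the domain and bounds its cardinality.\<close>
  have small_G: "|Domain G| <o \<kappa>"
  proof -
    have "|L \<union> M| <o \<kappa>" by (rule small_Un[OF kappa assms(5,6)])
    then obtain T where T: "L \<union> M \<subseteq> T" "rel_alg_closed T" "|T| <o \<kappa>"
      by (rule small_rel_alg_closed[OF kappa])
    have "Domain G \<subseteq> T" unfolding G_def
      using T by (intro tens_subset) (auto simp: rel_alg_closed_def)
    then show ?thesis by (rule small_mono[OF kappa _ T(3)])
  qed
  have fG: "(a, f a) \<in> G" if "a \<in> L \<union> M" for a
    using that tG tens_left tens_right by (auto simp: f_def)
  have vG: "val_graph G" unfolding G_def by (rule val_graph_tens)
  have "partial_elementary V (L \<union> M) f"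
    by (rule val_graph_partial_elementary[OF kappa satur rcU nontriv vG small_G fG])
  then obtain g where g: "ov_automorphism V g" "\<And>a. a \<in> L \<union> M \<Longrightarrow> g a = f a"
    using homog small_Un[OF kappa assms(5,6)] unfolding strongly_homogeneous_def by blast
  have gL: "g l = s l" if "l \<in> L" for l using g(2)[of l] that by (simp add: f_def)
  have gM: "g m = m" if m: "m \<in> M" for m
  \<comment> \<open>On \<open>L \<inter> M\<close> the two clauses of \<open>f\<close> agree: the
    graph contains both \<open>(m, s m)\<close> and \<open>(m, m)\<close>, and it is
    single-valued.\<close>
  proof (cases "m \<in> L")
    case True
    then have "s m = m"
      using order_graph_eq[OF order_graph_tens tens_left[OF True] tens_right[OF m]] by simp
    then show ?thesis using gL[OF True] by simp
  qed (use g(2)[of m] m in \<open>simp add: f_def\<close>)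
  define \<rho> where "\<rho> = \<tau> \<circ> g"
  have \<rho>: "ov_automorphism V \<rho>" unfolding \<rho>_def by (rule ov_automorphism_comp[OF assms(12) g(1)])
  have \<rho>L: "\<rho> l = \<sigma> l" if "l \<in> L" for l using gL[OF that] \<tau>\<tau>' by (simp add: \<rho>_def s_def)
  have \<rho>M: "\<rho> m = \<tau> m" if "m \<in> M" for m using gM[OF that] by (simp add: \<rho>_def)
  have "\<rho> ` C = C" using \<rho>M CM assms(16) by (auto simp: subset_iff image_iff)
  moreover have "\<rho> ` L = L'" unfolding assms(19)[symmetric] using \<rho>L by (intro image_cong) auto
  moreover have "\<rho> ` M = M'" unfolding assms(20)[symmetric] using \<rho>M by (intro image_cong) auto
  ultimately have "\<rho> ` N = N'"
    unfolding assms(21,22) ov_automorphism_generate_field[OF \<rho>] by (simp only: image_Un)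
  then have "\<exists>\<rho>. ov_automorphism V \<rho> \<and> \<rho> ` N = N' \<and> (\<forall>x\<in>L. \<rho> x = \<sigma> x) \<and> (\<forall>x\<in>M. \<rho> x = \<tau> x)"
    using \<rho> \<rho>L \<rho>M by (intro exI[of _ \<rho>]) simp
  then show ?thesis
    unfolding assms(21) by (intro conjI value_group_compositum residue_field_compositum)
qed

end
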